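(* Work in $V=\mathbb{R}^3$ with coordinates $x_1,x_2,z$. (1) Let $W$ be of type $A_2$. Then the freeness of $\mathcal{A}$ depends only on $L(\mathcal{A})$ for every arrangement $\mathcal{A}$ with $\mathrm{Shi}^k_W\subset\mathcal{A}\subset\mathrm{Cat}^k_W$ for some integer $k\ge1$, or with $\mathrm{Cat}^k_W\subset\mathcal{A}\subset\mathrm{Shi}^{k+1}_W$ for some integer $k\ge 0$. (2) Let $W$ be of type $B_2$ or $G_2$. Then the freeness of $\mathcal{A}$ depends only on $L(\mathcal{A})$ for every arrangement $\mathcal{A}$ satisfying one of: $\mathrm{Shi}^{k_1,k_2}_W\subset\mathcal{A}\subset\mathrm{Cat}^{k_1}_W\mathrm{Shi}^{k_2}_W$; $\mathrm{Shi}^{k_1,k_2}_W\subset\mathcal{A}\subset\mathrm{Shi}^{k_1}_W\mathrm{Cat}^{k_2}_W$ (for integers $k_1,k_2\ge1$); $\mathrm{Cat}^{k_1,k_2}_W\subset\mathcal{A}\subset\mathrm{Cat}^{k_1}_W\mathrm{Shi}^{k_2+1}_W$; $\mathrm{Cat}^{k_1,k_2}_W\subset\mathcal{A}\subset\mathrm{Shi}^{k_1+1}_W\mathrm{Cat}^{k_2}_W$ (for integers $k_1,k_2\ge 0$).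
   Context: Let $W$ be a Weyl group of rank two (type $A_2$, $B_2$ or $G_2$), with positive system $\Phi^+$ of linear forms in $x_1,x_2$, decomposed as $\Phi^+=\Phi^+_l\cup\Phi^+_s$ into long and short roots. Hyperplanes $\{\alpha=jz\}$ are linear hyperplanes in $\mathbb{R}^3$. Define $\mathrm{Cat}^k_W=\{\alpha=jz\mid\alpha\in\Phi^+,\,-k\le j\le k\}\cup\{z=0\}$, $\mathrm{Shi}^k_W=\{\alpha=jz\mid\alpha\in\Phi^+,\,-k+1\le j\le k\}\cup\{z=0\}$, $\mathrm{Cat}^{k_1,k_2}_W=\{\alpha=jz\mid\alpha\in\Phi^+_l,\,-k_1\le j\le k_1\}\cup\{\alpha=jz\mid\alpha\in\Phi^+_s,\,-k_2\le j\le k_2\}\cup\{z=0\}$, $\mathrm{Shi}^{k_1,k_2}_W=\{\alpha=jz\mid\alpha\in\Phi^+_l,\,-k_1+1\le j\le k_1\}\cup\{\alpha=jz\mid\alpha\in\Phi^+_s,\,-k_2+1\le j\le k_2\}\cup\{z=0\}$, $\mathrm{Cat}^{k_1}_W\mathrm{Shi}^{k_2}_W=\{\alpha=jz\mid\alpha\in\Phi^+_l,\,-k_1\le j\le k_1\}\cup\{\alpha=jz\mid\alpha\in\Phi^+_s,\,-k_2+1\le j\le k_2\}\cup\{z=0\}$, $\mathrm{Shi}^{k_1}_W\mathrm{Cat}^{k_2}_W=\{\alpha=jz\mid\alpha\in\Phi^+_l,\,-k_1+1\le j\le k_1\}\cup\{\alpha=jz\mid\alpha\in\Phi^+_s,\,-k_2\le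 j\le k_2\}\cup\{z=0\}$. An arrangement is a finite set of linear hyperplanes; with $S=\mathbb{R}[x_1,x_2,z]$, $D(\mathcal{A})=\{\theta\in\mathrm{Der}\,S\mid\theta(\alpha_H)\in S\alpha_H\ \forall H\in\mathcal{A}\}$ ($\alpha_H$ a defining linear form of $H$), and $\mathcal{A}$ is free if $D(\mathcal{A})$ is a free $S$-module. $L(\mathcal{A})=\{\bigcap_{H\in\mathcal{C}}H\mid\mathcal{C}\subset\mathcal{A}\}$ is the intersection lattice. "The freeness of $\mathcal{A}$ depends only on $L(\mathcal{A})$" means: every arrangement $\mathcal{A}'$ in $\mathbb{R}^3$ with intersection lattice isomorphic to $L(\mathcal{A})$ is free if and only if $\mathcal{A}$ is free. *)

theory Defs
  imports
    "HOL-Analysis.Analysis"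
    "HOL-Computational_Algebra.Polynomial"
    "HOL-Library.Function_Algebras"
begin

section \<open>The polynomial ring and its derivations\<close>

text \<open>The ring \<open>\<real>[x\<^sub>1][x\<^sub>2][z]\<close>; the outermost variable is \<open>z\<close>.\<close>

type_synonym S = "real poly poly poly"

definition Const :: "real \<Rightarrow> S" where
  "Const c = [:[:[:c:]:]:]"

definition X1 :: S where
  "X1 = [:[:[:0, 1:]:]:]"

definition X2 :: S where
  "X2 = [:[:0, 1:]:]"

definition Z :: S where
  "Z = [:0, 1:]"

definition linear_form :: "real^3 \<Rightarrow> S" where
  "linear_form a = Const (a $ 1) * X1 + Const (a $ 2) * X2 + Const (a $ 3) * Z"

definition derivation :: "(S \<Rightarrow> S) \<Rightarrow> bool" where
  "derivation \<theta> \<longleftrightarrow>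
     (\<forall>f g. \<theta> (f + g) = \<theta> f + \<theta> g) \<and>
     (\<forall>c f. \<theta> (Const c * f) = Const c * \<theta> f) \<and>
     (\<forall>f g. \<theta> (f * g) = \<theta> f * g + f * \<theta> g)"

text \<open>The pointwise \<open>S\<close>-module structure on maps \<open>S \<Rightarrow> S\<close>, of which the derivations and the
  modules \<open>D(\<A>)\<close> below are submodules.\<close>

global_interpretation der: module "\<lambda>(s::S) (\<theta>::S \<Rightarrow> S) f. s * \<theta> f"
  by unfold_locales (auto simp: algebra_simps fun_eq_iff)

definition free_submodule :: "(S \<Rightarrow> S) set \<Rightarrow> bool" where
  "free_submodule M \<longleftrightarrow> (\<exists>B\<subseteq>M. der.independent B \<and> der.span B = M)"


section \<open>Arrangements in \<open>\<real>\<^sup>3\<close>\<close>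

definition hyperplane :: "real^3 \<Rightarrow> (real^3) set" where
  "hyperplane a = {v. a \<bullet> v = 0}"

definition arrangement :: "(real^3) set set \<Rightarrow> bool" where
  "arrangement \<A> \<longleftrightarrow> finite \<A> \<and> (\<forall>H\<in>\<A>. \<exists>a. a \<noteq> 0 \<and> H = hyperplane a)"

text \<open>The condition is imposed for all defining linear forms of \<open>H\<close>; these differ by nonzero
  constants only.\<close>

definition log_der :: "(real^3) set set \<Rightarrow> (S \<Rightarrow> S) set" where
  "log_der \<A> = {\<theta>. derivation \<theta> \<and>
     (\<forall>H\<in>\<A>. \<forall>a. a \<noteq> 0 \<and> H = hyperplane a \<longrightarrow> linear_form a dvd \<theta> (linear_form a))}"

definition free_arrangement :: "(real^3) set set \<Rightarrow> bool" where
  "free_arrangement \<A> \<longleftrightarrow> free_submodule (log_der \<A>)"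

text \<open>\<open>\<Inter>{} = UNIV\<close>, so the ambient space belongs to the intersection lattice.\<close>

definition intersection_lattice :: "(real^3) set set \<Rightarrow> (real^3) set set" where
  "intersection_lattice \<A> = {\<Inter>\<C> | \<C>. \<C> \<subseteq> \<A>}"

definition lattice_isomorphic :: "(real^3) set set \<Rightarrow> (real^3) set set \<Rightarrow> bool" where
  "lattice_isomorphic \<A> \<B> \<longleftrightarrow>
     (\<exists>\<phi>. bij_betw \<phi> (intersection_lattice \<A>) (intersection_lattice \<B>) \<and>
       (\<forall>X\<in>intersection_lattice \<A>. \<forall>Y\<in>intersection_lattice \<A>. X \<subseteq> Y \<longleftrightarrow> \<phi> X \<subseteq> \<phi> Y))"

definition freeness_depends_only_on_lattice :: "(real^3) set set \<Rightarrow> bool" where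
  "freeness_depends_only_on_lattice \<A> \<longleftrightarrow>
     (\<forall>\<A>'. arrangement \<A>' \<and> lattice_isomorphic \<A> \<A>' \<longrightarrow>
        (free_arrangement \<A>' \<longleftrightarrow> free_arrangement \<A>))"


section \<open>Root systems of rank two\<close>

text \<open>A root is a linear form \<open>a\<^sub>1 x\<^sub>1 + a\<^sub>2 x\<^sub>2\<close>, represented by its coefficient vector.  The space of
  these forms carries an arbitrary inner product, so that no particular coordinates for the root
  systems are singled out.\<close>

definition inner_form :: "(real^2 \<Rightarrow> real^2 \<Rightarrow> real) \<Rightarrow> bool" where
  "inner_form ip \<longleftrightarrow> bilinear ip \<and> (\<forall>x y. ip x y = ip y x) \<and> (\<forall>x. x \<noteq> 0 \<longrightarrow> ip x x > 0)"

definition cartan :: "(real^2 \<Rightarrow> real^2 \<Rightarrow> real) \<Rightarrow> real^2 \<Rightarrow> real^2 \<Rightarrow> real" where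
  "cartan ip \<beta> \<alpha> = 2 * ip \<beta> \<alpha> / ip \<alpha> \<alpha>"

definition root_system :: "(real^2 \<Rightarrow> real^2 \<Rightarrow> real) \<Rightarrow> (real^2) set \<Rightarrow> bool" where
  "root_system ip \<Phi> \<longleftrightarrow>
     inner_form ip \<and> finite \<Phi> \<and> 0 \<notin> \<Phi> \<and> span \<Phi> = UNIV \<and>
     (\<forall>\<alpha>\<in>\<Phi>. \<forall>c. c *\<^sub>R \<alpha> \<in> \<Phi> \<longrightarrow> c = 1 \<or> c = -1) \<and>
     (\<forall>\<alpha>\<in>\<Phi>. \<forall>\<beta>\<in>\<Phi>. \<beta> - cartan ip \<beta> \<alpha> *\<^sub>R \<alpha> \<in> \<Phi>) \<and>
     (\<forall>\<alpha>\<in>\<Phi>. \<forall>\<beta>\<in>\<Phi>. cartan ip \<beta> \<alpha> \<in> \<int>)"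

definition root_base :: "(real^2) set \<Rightarrow> (real^2) set \<Rightarrow> bool" where
  "root_base \<Phi> \<Delta> \<longleftrightarrow> \<Delta> \<subseteq> \<Phi> \<and> independent \<Delta> \<and>
     (\<forall>\<gamma>\<in>\<Phi>. \<exists>c :: real^2 \<Rightarrow> int. \<gamma> = (\<Sum>\<delta>\<in>\<Delta>. of_int (c \<delta>) *\<^sub>R \<delta>) \<and>
        ((\<forall>\<delta>\<in>\<Delta>. c \<delta> \<ge> 0) \<or> (\<forall>\<delta>\<in>\<Delta>. c \<delta> \<le> 0)))"

definition positive_roots :: "(real^2) set \<Rightarrow> (real^2) set \<Rightarrow> (real^2) set" where
  "positive_roots \<Phi> \<Delta> = {\<gamma>\<in>\<Phi>. \<exists>c :: real^2 \<Rightarrow> nat. \<gamma> = (\<Sum>\<delta>\<in>\<Delta>. of_nat (c \<delta>) *\<^sub>R \<delta>)}"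

text \<open>The type is read off from the Cartan matrix of the base.  In \<open>B\<^sub>2\<close> and \<open>G\<^sub>2\<close> the simple root
  \<open>\<alpha>\<close> is the short one.\<close>

definition type_A2 :: "(real^2 \<Rightarrow> real^2 \<Rightarrow> real) \<Rightarrow> (real^2) set \<Rightarrow> bool" where
  "type_A2 ip \<Delta> \<longleftrightarrow>
     (\<exists>\<alpha> \<beta>. \<alpha> \<noteq> \<beta> \<and> \<Delta> = {\<alpha>, \<beta>} \<and> cartan ip \<alpha> \<beta> = -1 \<and> cartan ip \<beta> \<alpha> = -1)"

definition type_B2 :: "(real^2 \<Rightarrow> real^2 \<Rightarrow> real) \<Rightarrow> (real^2) set \<Rightarrow> bool" where
  "type_B2 ip \<Delta> \<longleftrightarrow>
     (\<exists>\<alpha> \<beta>. \<alpha> \<noteq> \<beta> \<and> \<Delta> = {\<alpha>, \<beta>} \<and> cartan ip \<alpha> \<beta> = -1 \<and> cartan ip \<beta> \<alpha> = -2)"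

definition type_G2 :: "(real^2 \<Rightarrow> real^2 \<Rightarrow> real) \<Rightarrow> (real^2) set \<Rightarrow> bool" where
  "type_G2 ip \<Delta> \<longleftrightarrow>
     (\<exists>\<alpha> \<beta>. \<alpha> \<noteq> \<beta> \<and> \<Delta> = {\<alpha>, \<beta>} \<and> cartan ip \<alpha> \<beta> = -1 \<and> cartan ip \<beta> \<alpha> = -3)"

definition long_roots :: "(real^2 \<Rightarrow> real^2 \<Rightarrow> real) \<Rightarrow> (real^2) set \<Rightarrow> (real^2) set" where
  "long_roots ip P = {\<gamma>\<in>P. \<forall>\<delta>\<in>P. ip \<delta> \<delta> \<le> ip \<gamma> \<gamma>}"

definition short_roots :: "(real^2 \<Rightarrow> real^2 \<Rightarrow> real) \<Rightarrow> (real^2) set \<Rightarrow> (real^2) set" where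
  "short_roots ip P = P - long_roots ip P"


section \<open>Deformations of Weyl arrangements\<close>

definition root_hyperplane :: "real^2 \<Rightarrow> int \<Rightarrow> (real^3) set" where
  "root_hyperplane \<alpha> j = {v. \<alpha> $ 1 * v $ 1 + \<alpha> $ 2 * v $ 2 = of_int j * v $ 3}"

definition root_hyperplanes :: "(real^2) set \<Rightarrow> int \<Rightarrow> int \<Rightarrow> (real^3) set set" where
  "root_hyperplanes P a b = {root_hyperplane \<alpha> j | \<alpha> j. \<alpha> \<in> P \<and> a \<le> j \<and> j \<le> b}"

definition H_infinity :: "(real^3) set" where
  "H_infinity = {v. v $ 3 = 0}"

definition Cat :: "(real^2) set \<Rightarrow> int \<Rightarrow> (real^3) set set" where
  "Cat P k = root_hyperplanes P (- k) k \<union> {H_infinity}"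

definition Shi :: "(real^2) set \<Rightarrow> int \<Rightarrow> (real^3) set set" where
  "Shi P k = root_hyperplanes P (- k + 1) k \<union> {H_infinity}"

text \<open>In the two-parameter versions, \<open>P\<^sub>l\<close> and \<open>P\<^sub>s\<close> are the long and the short positive roots.\<close>

definition Cat_Cat :: "(real^2) set \<Rightarrow> (real^2) set \<Rightarrow> int \<Rightarrow> int \<Rightarrow> (real^3) set set" where
  "Cat_Cat P\<^sub>l P\<^sub>s k1 k2 =
     root_hyperplanes P\<^sub>l (- k1) k1 \<union> root_hyperplanes P\<^sub>s (- k2) k2 \<union> {H_infinity}"

definition Shi_Shi :: "(real^2) set \<Rightarrow> (real^2) set \<Rightarrow> int \<Rightarrow> int \<Rightarrow> (real^3) set set" where
  "Shi_Shi P\<^sub>l P\<^sub>s k1 k2 =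
     root_hyperplanes P\<^sub>l (- k1 + 1) k1 \<union> root_hyperplanes P\<^sub>s (- k2 + 1) k2 \<union> {H_infinity}"

definition Cat_Shi :: "(real^2) set \<Rightarrow> (real^2) set \<Rightarrow> int \<Rightarrow> int \<Rightarrow> (real^3) set set" where
  "Cat_Shi P\<^sub>l P\<^sub>s k1 k2 =
     root_hyperplanes P\<^sub>l (- k1) k1 \<union> root_hyperplanes P\<^sub>s (- k2 + 1) k2 \<union> {H_infinity}"

definition Shi_Cat :: "(real^2) set \<Rightarrow> (real^2) set \<Rightarrow> int \<Rightarrow> int \<Rightarrow> (real^3) set set" where
  "Shi_Cat P\<^sub>l P\<^sub>s k1 k2 =
     root_hyperplanes P\<^sub>l (- k1 + 1) k1 \<union> root_hyperplanes P\<^sub>s (- k2) k2 \<union> {H_infinity}"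

end

theory Submission
  imports Defs "HOL-Computational_Algebra.Polynomial_Factorial"
begin

text \<open>A lattice isomorphism amounts to a bijection of the hyperplanes that preserves concurrence of
  triples. After a linear change of coordinates it fixes four lines in general position, and then
  every line joining two points that are intersections of fixed lines. In almost all of the
  deformations this fixes all lines, so that the arrangement is determined by its lattice up to a
  linear map. The few remaining cases have small parameters. Most of them have a modular point, which
  gives an explicit basis of the logarithmic derivations; those of type \<open>B\<^sub>2\<close> with two extra
  lines are square grids with their two diagonals, with an explicit basis as well; and in type
  \<open>A\<^sub>2\<close> there are two families in which the module of logarithmic derivations needs four generators.\<close>

text \<open>A linear map can carry any frame of four lines to any other, and up to scalars this uses
  up the freedom of coordinates; every further line has to be located by incidences alone. The
  obstacle is that small parameters leave too few triple points: in type A_2 one line may keep a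
  free parameter, and in a square grid only the symmetry of the list of levels survives.
  Realizations of the same lattice then need not be linearly equivalent, and freeness is decided for
  the whole family of realizations at once. In the two non-free families the excluded parameter
  values are those at which lines coincide or a new triple point appears, so they do not occur with
  the same lattice. For B_2 and G_2 the roots are written in the basis \<alpha>, \<alpha> + \<beta>
  with \<alpha> short. The short roots become (1,0), (0,1), and also (1,1) for G_2, while the long
  roots of G_2 satisfy (-1,1) + (2,1) = (1,2). So both lengths of G_2 obey the concurrence rule of
  A_2, and all incidence conditions are integer identities.\<close>

unbundle cross3_syntax

section \<open>Derivations of the polynomial ring\<close>

lemma Const_hom [simp]:
  "Const 0 = 0" "Const 1 = 1" "Const (a + b) = Const a + Const b"
  "Const (a * b) = Const a * Const b" "Const (- a) = - Const a" "Const (a - b) = Const a - Const b"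
  by (simp_all add: Const_def one_pCons)

lemma Const_eq_iff [simp]: "Const a = Const b \<longleftrightarrow> a = b"
  by (simp add: Const_def)

lemma Const_eq_0_iff [simp]: "Const a = 0 \<longleftrightarrow> a = 0"
  by (simp add: Const_def)

lemma Const_mult_Const_left [simp]: "Const a * (Const b * f) = Const (a * b) * f"
  by (simp add: mult.assoc)

text \<open>One induction per layer of the iterated polynomial ring, each peeling off its own
  variable. This is what lets derivations and algebra endomorphisms be compared on the three
  variables only.\<close>

lemma S_induct [case_names Const X1 X2 Z add mult]:
  assumes C: "\<And>c. P (Const c)" and x: "P X1" and y: "P X2" and z: "P Z"
    and add: "\<And>f g. P f \<Longrightarrow> P g \<Longrightarrow> P (f + g)"
    and mult: "\<And>f g. P f \<Longrightarrow> P g \<Longrightarrow> P (f * g)"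
  shows "P (f :: S)"
proof -
  have P0: "P 0" using C[of 0] by simp
  have 1: "P [:[:p:]:]" for p :: "real poly"
  proof (induction p)
    case 0 show ?case using P0 by simp
  next
    case (pCons a p)
    have "[:[:pCons a p:]:] = Const a + X1 * [:[:p:]:]"
      by (simp add: Const_def X1_def)
    then show ?case using pCons C x add mult by metis
  qed
  have 2: "P [:p:]" for p :: "real poly poly"
  proof (induction p)
    case 0 show ?case using P0 by simp
  next
    case (pCons a p)
    have "[:pCons a p:] = [:[:a:]:] + X2 * [:p:]"
      by (simp add: X2_def)
    then show ?case using pCons 1 y add mult by metis
  qed
  show ?thesis
  proof (induction f)
    case 0 show ?case using P0 by simp
  next
    case (pCons a p)
    have "pCons a p = [:a:] + Z * p"
      by (simp add: Z_def)
    then show ?case using pCons 2 z add mult by metis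
  qed
qed

lemma map_poly_additive:
  fixes D :: "'a::comm_monoid_add \<Rightarrow> 'b::comm_monoid_add"
  assumes "\<And>f g. D (f + g) = D f + D g" "D 0 = 0"
  shows "map_poly D (p + q) = map_poly D p + map_poly D q"
  by (rule poly_eqI) (simp add: coeff_map_poly assms)

lemma map_poly_Leibniz:
  fixes D :: "'a::comm_semiring_0 \<Rightarrow> 'a"
  assumes add: "\<And>f g. D (f + g) = D f + D g" and zero: "D 0 = 0"
    and mult: "\<And>f g. D (f * g) = D f * g + f * D g"
  shows "map_poly D (p * q) = map_poly D p * q + p * map_poly D q"
proof (rule poly_eqI)
  fix n
  have *: "D (sum f A) = (\<Sum>a\<in>A. D (f a))" for f :: "nat \<Rightarrow> 'a" and A
    by (induction A rule: infinite_finite_induct) (simp_all add: add zero)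
  show "coeff (map_poly D (p * q)) n = coeff (map_poly D p * q + p * map_poly D q) n"
    by (simp add: coeff_map_poly zero coeff_mult * mult sum.distrib)
qed

text \<open>The number of \<open>map_poly\<close> counts the layers outside the variable:
  \<open>X1\<close> is innermost, \<open>Z\<close> outermost. \<open>map_poly_Leibniz\<close> makes
  each layer a derivation again.\<close>

definition pd1 :: "S \<Rightarrow> S" where "pd1 = map_poly (map_poly pderiv)"
definition pd2 :: "S \<Rightarrow> S" where "pd2 = map_poly pderiv"
definition pd3 :: "S \<Rightarrow> S" where "pd3 = pderiv"

lemma pd_add: "pd1 (f + g) = pd1 f + pd1 g" "pd2 (f + g) = pd2 f + pd2 g" "pd3 (f + g) = pd3 f + pd3 g"
  unfolding pd1_def pd2_def pd3_def by (simp_all add: map_poly_additive pderiv_add)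

lemma pd_mult:
  "pd1 (f * g) = pd1 f * g + f * pd1 g"
  "pd2 (f * g) = pd2 f * g + f * pd2 g"
  "pd3 (f * g) = pd3 f * g + f * pd3 g"
  unfolding pd1_def pd2_def pd3_def
  by (intro map_poly_Leibniz; simp add: map_poly_additive pderiv_add map_poly_Leibniz pderiv_mult algebra_simps)
     (intro map_poly_Leibniz; simp add: map_poly_additive pderiv_add map_poly_Leibniz pderiv_mult algebra_simps |
      simp add: pderiv_mult algebra_simps)+

lemma pd_vars [simp]:
  "pd1 (Const c) = 0" "pd2 (Const c) = 0" "pd3 (Const c) = 0"
  "pd1 X1 = 1" "pd1 X2 = 0" "pd1 Z = 0"
  "pd2 X1 = 0" "pd2 X2 = 1" "pd2 Z = 0"
  "pd3 X1 = 0" "pd3 X2 = 0" "pd3 Z = 1"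
  unfolding pd1_def pd2_def pd3_def Const_def X1_def X2_def Z_def
  by (simp_all add: map_poly_pCons pderiv_pCons one_pCons)

definition mk_der :: "S \<Rightarrow> S \<Rightarrow> S \<Rightarrow> S \<Rightarrow> S" where
  "mk_der a b c = (\<lambda>f. a * pd1 f + b * pd2 f + c * pd3 f)"

lemma derivation_mk_der: "derivation (mk_der a b c)"
  unfolding derivation_def mk_der_def by (simp add: pd_add pd_mult algebra_simps)

lemma mk_der_vars [simp]: "mk_der a b c X1 = a" "mk_der a b c X2 = b" "mk_der a b c Z = c"
  by (simp_all add: mk_der_def)

lemma derivationD:
  assumes "derivation \<theta>"
  shows "\<theta> (f + g) = \<theta> f + \<theta> g" "\<theta> (Const c * f) = Const c * \<theta> f"
    "\<theta> (f * g) = \<theta> f * g + f * \<theta> g" "\<theta> (Const c) = 0"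
proof -
  show "\<theta> (f + g) = \<theta> f + \<theta> g" "\<theta> (Const c * f) = Const c * \<theta> f"
    and m: "\<theta> (f * g) = \<theta> f * g + f * \<theta> g" for f g
    using assms unfolding derivation_def by blast+
  have "\<theta> 1 = 0" using m[of 1 1] by simp
  then show "\<theta> (Const c) = 0"
    using assms[unfolded derivation_def, THEN conjunct2, THEN conjunct1, rule_format, of c 1] by simp
qed

lemma derivation_ext:
  assumes "derivation \<theta>" "derivation \<eta>" "\<theta> X1 = \<eta> X1" "\<theta> X2 = \<eta> X2" "\<theta> Z = \<eta> Z"
  shows "\<theta> = \<eta>"
proof
  fix f show "\<theta> f = \<eta> f"
    by (induction f rule: S_induct) (simp_all add: assms derivationD[OF assms(1)] derivationD[OF assms(2)])
qed

lemma derivation_0: "derivation 0"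
  by (simp add: derivation_def zero_fun_def)

lemma derivationI:
  assumes "\<And>f g. \<theta> (f + g) = \<theta> f + \<theta> g" "\<And>f g. \<theta> (f * g) = \<theta> f * g + f * \<theta> g" "\<And>c. \<theta> (Const c) = 0"
  shows "derivation \<theta>"
  unfolding derivation_def using assms by simp

lemma derivation_add:
  assumes "derivation \<theta>" "derivation \<eta>" shows "derivation (\<theta> + \<eta>)"
  by (rule derivationI)
    (simp_all add: derivationD[OF assms(1)] derivationD[OF assms(2)] ring_distribs add_ac)

lemma derivation_scale:
  assumes "derivation \<theta>" shows "derivation (\<lambda>f. s * \<theta> f)"
  by (rule derivationI) (simp_all add: derivationD[OF assms] ring_distribs mult_ac)

lemma derivation_linear_form:
  "derivation \<theta> \<Longrightarrow> \<theta> (linear_form a) = Const (a $ 1) * \<theta> X1 + Const (a $ 2) * \<theta> X2 + Const (a $ 3) * \<theta> Z"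
  by (simp add: linear_form_def derivationD(1,2))


section \<open>Linear forms\<close>

lemma linear_form_pCons: "linear_form a = [:[:[:0, a $ 1:], [:a $ 2:]:], [:[:a $ 3:]:]:]"
  by (simp add: linear_form_def Const_def X1_def X2_def Z_def)

lemma linear_form_scale: "linear_form (c *\<^sub>R a) = Const c * linear_form a"
  by (simp add: linear_form_def algebra_simps)

lemma linear_form_add: "linear_form (a + b) = linear_form a + linear_form b"
  by (simp add: linear_form_def algebra_simps)

lemma linear_form_eq_0_iff [simp]: "linear_form a = 0 \<longleftrightarrow> a = 0"
  by (simp add: linear_form_pCons vec_eq_iff forall_3)

definition ev :: "real^3 \<Rightarrow> S \<Rightarrow> real" where
  "ev v f = poly (poly (poly f [:[:v $ 3:]:]) [:v $ 2:]) (v $ 1)"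

lemma ev_simps [simp]:
  "ev v (f + g) = ev v f + ev v g" "ev v (f * g) = ev v f * ev v g" "ev v (f - g) = ev v f - ev v g"
  "ev v (- f) = - ev v f"
  "ev v 0 = 0" "ev v 1 = 1" "ev v (Const c) = c" "ev v X1 = v $ 1" "ev v X2 = v $ 2" "ev v Z = v $ 3"
  by (simp_all add: ev_def Const_def X1_def X2_def Z_def)

lemma ev_linear_form: "ev v (linear_form a) = a \<bullet> v"
  by (simp add: linear_form_def inner_vec_def sum_3)

lemma hyperplane_subset:
  assumes "a \<noteq> 0" "hyperplane a \<subseteq> hyperplane b"
  shows "\<exists>k. b = k *\<^sub>R a"
proof -
  define k where "k = (a \<bullet> b) / (a \<bullet> a)"
  \<comment> \<open>The component of b orthogonal to a: it lies in the first plane, hence in the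
    second, and is therefore orthogonal to itself.\<close>
  define w where "w = b - k *\<^sub>R a"
  have "a \<bullet> w = 0" using assms(1) by (simp add: w_def k_def inner_diff_right)
  then have "b \<bullet> w = 0" using assms(2) by (auto simp: hyperplane_def)
  then have "w \<bullet> w = 0" using \<open>a \<bullet> w = 0\<close> by (simp add: w_def inner_diff_left)
  then show ?thesis by (auto simp: w_def)
qed

lemma hyperplane_scale: "k \<noteq> 0 \<Longrightarrow> hyperplane (k *\<^sub>R a) = hyperplane a"
  by (simp add: hyperplane_def)

lemma hyperplane_eqD:
  assumes "a \<noteq> 0" "b \<noteq> 0" "hyperplane a = hyperplane b"
  obtains k where "k \<noteq> 0" "b = k *\<^sub>R a"
  using hyperplane_subset[of a b] assms by (metis order_refl scaleR_zero_left)

lemma linear_form_dvd: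
  assumes "linear_form a dvd linear_form b" "a \<noteq> 0" "b \<noteq> 0"
  shows "hyperplane a = hyperplane b"
proof -
  obtain f where f: "linear_form b = linear_form a * f" using assms(1) by (auto elim: dvdE)
  have "hyperplane a \<subseteq> hyperplane b"
  proof
    fix v assume "v \<in> hyperplane a"
    then have "ev v (linear_form b) = 0" by (simp add: f ev_linear_form hyperplane_def)
    then show "v \<in> hyperplane b" by (simp add: ev_linear_form hyperplane_def)
  qed
  then obtain k where "b = k *\<^sub>R a" using hyperplane_subset assms by blast
  then show ?thesis using assms(3) hyperplane_scale by (metis scaleR_zero_left)
qed

lemma prime_elem_linear_poly:
  fixes r :: "'a::idom"
  shows "prime_elem [:- r, 1:]"
proof (rule prime_elemI)
  show "\<not> [:- r, 1:] dvd 1"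
    by (metis poly_eq_0_iff_dvd poly_1 one_neq_zero)
qed (simp_all add: poly_eq_0_iff_dvd[symmetric])

text \<open>Passes from the monic polynomials of \<open>prime_elem_linear_poly\<close> to linear
  forms, whose leading coefficient is a nonzero constant.\<close>

lemma prime_elem_unit_mult:
  fixes p :: "'a::comm_ring_1"
  assumes uv: "u * v = 1" and p: "prime_elem p"
  shows "prime_elem (u * p)"
proof -
  have *: "u * p dvd x \<longleftrightarrow> p dvd x" for x
  proof
    assume "p dvd x"
    then obtain y where "x = p * y" unfolding dvd_def by blast
    then have "x = (u * v) * (p * y)" using uv by simp
    then have "x = (u * p) * (v * y)" by (simp only: ac_simps)
    then show "u * p dvd x" by (rule dvdI)
  qed (rule dvd_mult_right)
  have "v * (u * p) = (u * v) * p" by (simp only: ac_simps)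
  then have "v * (u * p) = p" using uv by simp
  moreover have "p \<noteq> 0" using p unfolding prime_elem_def by blast
  ultimately have "u * p \<noteq> 0" by auto
  then show ?thesis using p unfolding prime_elem_def * by blast
qed

text \<open>Take the outermost variable that occurs. Up to a nonzero constant the form is monic of
  degree one in it, hence prime in that layer, and primality survives the outer layers, in which the
  form is constant.\<close>

lemma prime_elem_linear_form:
  assumes "a \<noteq> 0"
  shows "prime_elem (linear_form a)"
proof (cases "a $ 3 = 0")
  case False
  have *: "linear_form a = [:[:[:a$3:]:]:] * [:- (- [:[:0, a$1 / a$3:], [:a$2 / a$3:]:]), 1:]"
    using False by (simp add: linear_form_pCons)
  have "[:[:[:a$3:]:]:] * [:[:[:1/a$3:]:]:] = 1"
    using False by (simp add: one_pCons)
  then show ?thesis unfolding * using prime_elem_unit_mult prime_elem_linear_poly by blast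
next
  case z: True
  show ?thesis
  proof (cases "a $ 2 = 0")
    case False
    have *: "linear_form a = [:[:[:a$2:]:] * [:- (- [:0, a$1 / a$2:]), 1:]:]"
      using False z by (simp add: linear_form_pCons)
    have "[:[:a$2:]:] * [:[:1/a$2:]:] = 1"
      using False by (simp add: one_pCons)
    then show ?thesis unfolding * using prime_elem_unit_mult prime_elem_linear_poly lift_prime_elem_poly by blast
  next
    case True
    have nz: "a $ 1 \<noteq> 0" using z True assms by (simp add: vec_eq_iff forall_3)
    have *: "linear_form a = [:[:[:a$1:] * [:- 0, 1:]:]:]"
      using True z by (simp add: linear_form_pCons)
    have "[:a$1:] * [:1/a$1:] = 1"
      using nz by (simp add: one_pCons)
    then show ?thesis unfolding * using prime_elem_unit_mult prime_elem_linear_poly lift_prime_elem_poly by metis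
  qed
qed

lemma prime_elem_power_dvd_multD:
  fixes p :: "'a::idom"
  assumes "prime_elem p" "\<not> p dvd a" "p ^ n dvd a * b"
  shows "p ^ n dvd b"
  using assms(3)
proof (induction n arbitrary: b)
  case (Suc n)
  have "p dvd p ^ Suc n" by simp
  then have "p dvd a * b" using Suc.prems by (rule dvd_trans)
  then have "p dvd b" using prime_elem_dvd_multD[OF assms(1)] assms(2) by blast
  then obtain c where c: "b = p * c" unfolding dvd_def by blast
  have "a * b = p * (a * c)" unfolding c by (rule mult.left_commute)
  then have "p * p ^ n dvd p * (a * c)" using Suc.prems by (simp only: power_Suc)
  moreover have "p \<noteq> 0" using assms(1) unfolding prime_elem_def by blast
  ultimately have "p ^ n dvd a * c" unfolding dvd_mult_cancel_left by blast
  then have "p ^ n dvd c" by (rule Suc.IH)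
  then show ?case unfolding c power_Suc by (rule mult_dvd_mono[OF dvd_refl])
qed simp

text \<open>Divide by one prime power; no other prime of the family divides it, so the remaining
  powers pass to the cofactor. Exponents above one occur in \<open>modular_interpolation\<close>,
  where several lines may meet a given one on the same line of the pencil.\<close>

lemma prod_prime_power_dvd:
  fixes p :: "'i \<Rightarrow> 'a::idom"
  assumes "finite N" "\<And>n. n \<in> N \<Longrightarrow> prime_elem (p n)"
    "\<And>m n. m \<in> N \<Longrightarrow> n \<in> N \<Longrightarrow> m \<noteq> n \<Longrightarrow> \<not> p m dvd p n"
    "\<And>n. n \<in> N \<Longrightarrow> p n ^ s n dvd e"
  shows "(\<Prod>n\<in>N. p n ^ s n) dvd e"
  using assms
proof (induction N arbitrary: e rule: finite_induct)
  case (insert m N)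
  obtain h where h: "e = p m ^ s m * h" using insert.prems(3) by (auto elim: dvdE)
  have "p n ^ s n dvd h" if "n \<in> N" for n
  proof (rule prime_elem_power_dvd_multD)
    show "prime_elem (p n)" using insert.prems that by auto
    have "\<not> p n dvd p m" using insert that by auto
    then show "\<not> p n dvd p m ^ s m" using \<open>prime_elem (p n)\<close> prime_elem_dvd_power by blast
    show "p n ^ s n dvd p m ^ s m * h" using insert.prems(3)[of n] that h by auto
  qed
  then have "(\<Prod>n\<in>N. p n ^ s n) dvd h" using insert by auto
  then show ?case using insert by (simp add: h mult_dvd_mono)
qed simp

lemma prod_prime_dvd:
  fixes p :: "'i \<Rightarrow> 'a::idom"
  assumes "finite N" "\<And>n. n \<in> N \<Longrightarrow> prime_elem (p n)"
    "\<And>m n. m \<in> N \<Longrightarrow> n \<in> N \<Longrightarrow> m \<noteq> n \<Longrightarrow> \<not> p m dvd p n"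
    "\<And>n. n \<in> N \<Longrightarrow> p n dvd e"
  shows "(\<Prod>n\<in>N. p n) dvd e"
  using prod_prime_power_dvd[of N p "\<lambda>_. 1" e] assms by simp

section \<open>Logarithmic derivations and Saito's criterion\<close>

lemma linear_form_scale_dvd:
  assumes "derivation \<theta>" "k \<noteq> 0"
  shows "linear_form (k *\<^sub>R a) dvd \<theta> (linear_form (k *\<^sub>R a)) \<longleftrightarrow> linear_form a dvd \<theta> (linear_form a)"
proof -
  have "f = Const (1 / k) * (Const k * f)" for f
    using assms(2) by simp
  then have "linear_form a dvd f \<longleftrightarrow> linear_form a dvd Const k * f" for f
    by (metis dvd_mult)
  moreover have "Const k * f dvd Const k * g \<longleftrightarrow> f dvd g" for f g
    using assms(2) by simp
  ultimately show ?thesis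
    by (simp add: linear_form_scale derivationD(2)[OF assms(1)])
qed

text \<open>\<open>log_der\<close> quantifies over all normals of a plane; as two of them differ by
  a nonzero scalar, one chosen normal per plane is enough. The explicit membership checks go through
  this form.\<close>

lemma log_der_hyperplane_image:
  assumes "0 \<notin> N"
  shows "\<theta> \<in> log_der (hyperplane ` N) \<longleftrightarrow>
    derivation \<theta> \<and> (\<forall>n\<in>N. linear_form n dvd \<theta> (linear_form n))"
proof (intro iffI conjI ballI; (elim conjE)?)
  assume *: "\<theta> \<in> log_der (hyperplane ` N)"
  then show "derivation \<theta>" by (simp add: log_der_def)
  show "linear_form n dvd \<theta> (linear_form n)" if n: "n \<in> N" for n
  proof -
    have "n \<noteq> 0" using n assms by auto
    then show ?thesis using * n unfolding log_der_def by simp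
  qed
next
  assume \<theta>: "derivation \<theta>" and *: "\<forall>n\<in>N. linear_form n dvd \<theta> (linear_form n)"
  have **: "linear_form a dvd \<theta> (linear_form a)" if n: "n \<in> N" and a: "a \<noteq> 0" "hyperplane n = hyperplane a" for n a
  proof -
    have "n \<noteq> 0" using n assms by auto
    then obtain k where "k \<noteq> 0" "a = k *\<^sub>R n" using hyperplane_eqD[OF _ a] by blast
    then show ?thesis using bspec[OF * n] linear_form_scale_dvd[OF \<theta>] by simp
  qed
  show "\<theta> \<in> log_der (hyperplane ` N)" unfolding log_der_def
  proof (intro CollectI conjI ballI allI impI)
    fix H a assume "H \<in> hyperplane ` N" and a: "a \<noteq> 0 \<and> H = hyperplane a"
    then obtain n where "n \<in> N" "H = hyperplane n" by blast
    then show "linear_form a dvd \<theta> (linear_form a)" using **[of n a] a by simp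
  qed (rule \<theta>)
qed

lemma sum_fun_apply: "(\<Sum>i\<in>I. g i) x = (\<Sum>i\<in>I. g i x)"
  for g :: "'i \<Rightarrow> 'a \<Rightarrow> 'b::comm_monoid_add"
  by (induction I rule: infinite_finite_induct) auto

lemma log_der_derivation: "\<theta> \<in> log_der \<A> \<Longrightarrow> derivation \<theta>"
  by (simp add: log_der_def)

lemma log_der_add: "\<theta> \<in> log_der \<A> \<Longrightarrow> \<eta> \<in> log_der \<A> \<Longrightarrow> (\<lambda>f. \<theta> f + \<eta> f) \<in> log_der \<A>"
  using derivation_add[of \<theta> \<eta>] by (simp add: log_der_def plus_fun_def)

lemma log_der_scale: "\<theta> \<in> log_der \<A> \<Longrightarrow> (\<lambda>f. s * \<theta> f) \<in> log_der \<A>"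
  using derivation_scale[of \<theta> s] by (simp add: log_der_def)

lemma subspace_log_der: "der.subspace (log_der \<A>)"
proof (rule der.subspaceI)
  show "0 \<in> log_der \<A>" using derivation_0 by (simp add: log_der_def)
  show "\<theta> + \<eta> \<in> log_der \<A>" if "\<theta> \<in> log_der \<A>" "\<eta> \<in> log_der \<A>" for \<theta> \<eta>
    using log_der_add[OF that] by (simp add: plus_fun_def)
qed (rule log_der_scale)

lemma log_der_mono: "\<A> \<subseteq> \<B> \<Longrightarrow> log_der \<B> \<subseteq> log_der \<A>"
  by (auto simp: log_der_def)

text \<open>The determinant of the matrix of values of the three derivations on the coordinates,
  expanded along the row of \<open>\<theta>1\<close>.\<close>

definition jac :: "(S \<Rightarrow> S) \<Rightarrow> (S \<Rightarrow> S) \<Rightarrow> (S \<Rightarrow> S) \<Rightarrow> S" where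
  "jac \<theta>1 \<theta>2 \<theta>3 =
     \<theta>1 X1 * (\<theta>2 X2 * \<theta>3 Z - \<theta>2 Z * \<theta>3 X2)
   - \<theta>1 X2 * (\<theta>2 X1 * \<theta>3 Z - \<theta>2 Z * \<theta>3 X1)
   + \<theta>1 Z * (\<theta>2 X1 * \<theta>3 X2 - \<theta>2 X2 * \<theta>3 X1)"

text \<open>Replacing one column by the combination with coefficients \<open>a\<close> multiplies
  the determinant by the corresponding entry of \<open>a\<close> and turns that column into the
  values on the linear form, all divisible by it. Some entry of \<open>a\<close> is a nonzero
  constant and can be cancelled.\<close>

lemma jac_dvd:
  assumes "derivation \<theta>1" "derivation \<theta>2" "derivation \<theta>3" "a \<noteq> 0"
    and "linear_form a dvd \<theta>1 (linear_form a)" "linear_form a dvd \<theta>2 (linear_form a)"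
      "linear_form a dvd \<theta>3 (linear_form a)"
  shows "linear_form a dvd jac \<theta>1 \<theta>2 \<theta>3"
proof -
  let ?l = "linear_form a"
  have d: "?l dvd \<theta>1 ?l * f + \<theta>2 ?l * g + \<theta>3 ?l * h" for f g h
    using assms(5-7) by simp
  have unit: "?l dvd f" if "k \<noteq> 0" "?l dvd Const k * f" for k f
  proof -
    have "f = Const (1 / k) * (Const k * f)" using that by simp
    then show ?thesis using that by (metis dvd_mult)
  qed
  note exp = derivation_linear_form[OF assms(1)] derivation_linear_form[OF assms(2)]
    derivation_linear_form[OF assms(3)]
  have 1: "Const (a $ 1) * jac \<theta>1 \<theta>2 \<theta>3 = \<theta>1 ?l * (\<theta>2 X2 * \<theta>3 Z - \<theta>2 Z * \<theta>3 X2)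
     + \<theta>2 ?l * (\<theta>1 Z * \<theta>3 X2 - \<theta>1 X2 * \<theta>3 Z) + \<theta>3 ?l * (\<theta>1 X2 * \<theta>2 Z - \<theta>1 Z * \<theta>2 X2)"
    unfolding jac_def exp by (simp add: algebra_simps)
  have 2: "Const (a $ 2) * jac \<theta>1 \<theta>2 \<theta>3 = \<theta>1 ?l * (\<theta>2 Z * \<theta>3 X1 - \<theta>2 X1 * \<theta>3 Z)
     + \<theta>2 ?l * (\<theta>1 X1 * \<theta>3 Z - \<theta>1 Z * \<theta>3 X1) + \<theta>3 ?l * (\<theta>1 Z * \<theta>2 X1 - \<theta>1 X1 * \<theta>2 Z)"
    unfolding jac_def exp by (simp add: algebra_simps)
  have 3: "Const (a $ 3) * jac \<theta>1 \<theta>2 \<theta>3 = \<theta>1 ?l * (\<theta>2 X1 * \<theta>3 X2 - \<theta>2 X2 * \<theta>3 X1)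
     + \<theta>2 ?l * (\<theta>1 X2 * \<theta>3 X1 - \<theta>1 X1 * \<theta>3 X2) + \<theta>3 ?l * (\<theta>1 X1 * \<theta>2 X2 - \<theta>1 X2 * \<theta>2 X1)"
    unfolding jac_def exp by (simp add: algebra_simps)
  have "a $ 1 \<noteq> 0 \<or> a $ 2 \<noteq> 0 \<or> a $ 3 \<noteq> 0" using assms(4) by (simp add: vec_eq_iff forall_3)
  then show ?thesis using d unit 1 2 3 by metis
qed

text \<open>Cramer's rule in a form without division.\<close>

lemma jac_cramer:
  assumes "v \<in> {X1, X2, Z}"
  shows "jac \<theta>1 \<theta>2 \<theta>3 * \<theta> v = jac \<theta> \<theta>2 \<theta>3 * \<theta>1 v + jac \<theta>1 \<theta> \<theta>3 * \<theta>2 v + jac \<theta>1 \<theta>2 \<theta> * \<theta>3 v"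
  using assms by (elim insertE) (simp_all add: jac_def algebra_simps)

definition log_basis :: "(real^3) set set \<Rightarrow> (S \<Rightarrow> S) \<Rightarrow> (S \<Rightarrow> S) \<Rightarrow> (S \<Rightarrow> S) \<Rightarrow> bool" where
  "log_basis \<A> \<theta>1 \<theta>2 \<theta>3 \<longleftrightarrow> \<theta>1 \<in> log_der \<A> \<and> \<theta>2 \<in> log_der \<A> \<and> \<theta>3 \<in> log_der \<A> \<and>
     (\<forall>\<theta>\<in>log_der \<A>. \<exists>s1 s2 s3. \<theta> = (\<lambda>f. s1 * \<theta>1 f + s2 * \<theta>2 f + s3 * \<theta>3 f)) \<and>
     (\<forall>s1 s2 s3. (\<forall>f. s1 * \<theta>1 f + s2 * \<theta>2 f + s3 * \<theta>3 f = 0) \<longrightarrow> s1 = 0 \<and> s2 = 0 \<and> s3 = 0)"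

lemma log_basis_mem:
  assumes "log_basis \<A> \<theta>1 \<theta>2 \<theta>3"
  shows "\<theta>1 \<in> log_der \<A>" "\<theta>2 \<in> log_der \<A>" "\<theta>3 \<in> log_der \<A>"
  using assms unfolding log_basis_def by simp_all

lemma log_basis_span:
  assumes "log_basis \<A> \<theta>1 \<theta>2 \<theta>3" "\<theta> \<in> log_der \<A>"
  obtains s1 s2 s3 where "\<theta> = (\<lambda>f. s1 * \<theta>1 f + s2 * \<theta>2 f + s3 * \<theta>3 f)"
  using assms unfolding log_basis_def by meson

lemma log_basis_unique:
  assumes "log_basis \<A> \<theta>1 \<theta>2 \<theta>3" "\<And>f. s1 * \<theta>1 f + s2 * \<theta>2 f + s3 * \<theta>3 f = 0"
  shows "s1 = 0 \<and> s2 = 0 \<and> s3 = 0"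
  using assms unfolding log_basis_def by metis

lemma log_basis_free:
  assumes "log_basis \<A> \<theta>1 \<theta>2 \<theta>3"
  shows "free_arrangement \<A>"
proof -
  let ?B = "{\<theta>1, \<theta>2, \<theta>3}"
  have mem: "?B \<subseteq> log_der \<A>" and
    sp: "\<And>\<theta>. \<theta> \<in> log_der \<A> \<Longrightarrow> \<exists>s1 s2 s3. \<theta> = (\<lambda>f. s1 * \<theta>1 f + s2 * \<theta>2 f + s3 * \<theta>3 f)" and
    un: "\<And>s1 s2 s3. (\<And>f. s1 * \<theta>1 f + s2 * \<theta>2 f + s3 * \<theta>3 f = 0) \<Longrightarrow> s1 = 0 \<and> s2 = 0 \<and> s3 = 0"
    using assms unfolding log_basis_def by blast+
  have ne: "\<theta>1 \<noteq> \<theta>2" "\<theta>1 \<noteq> \<theta>3" "\<theta>2 \<noteq> \<theta>3"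
    using un[of 1 "-1" 0] un[of 1 0 "-1"] un[of 0 1 "-1"] by auto
  have "der.independent ?B"
  proof
    assume "der.dependent ?B"
    then obtain u where u: "(\<Sum>v\<in>?B. (\<lambda>f. u v * v f)) = 0" "\<exists>v\<in>?B. u v \<noteq> 0"
      using der.dependent_finite[of ?B] by auto
    have "u \<theta>1 * \<theta>1 f + u \<theta>2 * \<theta>2 f + u \<theta>3 * \<theta>3 f = 0" for f
      using fun_cong[OF u(1), of f] ne by (simp add: add.assoc)
    then show False using un[of "u \<theta>1" "u \<theta>2" "u \<theta>3"] u(2) by auto
  qed
  moreover have "der.span ?B = log_der \<A>"
  proof
    show "der.span ?B \<subseteq> log_der \<A>" using mem subspace_log_der by (rule der.span_minimal)
    show "log_der \<A> \<subseteq> der.span ?B"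
    proof
      fix \<theta> assume "\<theta> \<in> log_der \<A>"
      then obtain s1 s2 s3 where "\<theta> = (\<lambda>f. s1 * \<theta>1 f + s2 * \<theta>2 f + s3 * \<theta>3 f)" using sp by blast
      then have "\<theta> = (\<lambda>f. s1 * \<theta>1 f) + (\<lambda>f. s2 * \<theta>2 f) + (\<lambda>f. s3 * \<theta>3 f)"
        by (simp add: fun_eq_iff)
      then show "\<theta> \<in> der.span ?B" by (simp add: der.span_add der.span_scale der.span_base)
    qed
  qed
  ultimately show ?thesis using mem unfolding free_arrangement_def free_submodule_def by blast
qed

text \<open>Every determinant of three logarithmic derivations is divisible by the product of the
  forms, because these are primes none of which divides another; hence it is divisible by
  \<open>jac \<theta>1 \<theta>2 \<theta>3\<close>. The numerators in Cramer's rule are such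
  determinants, so the coefficients lie in \<open>S\<close>. Independence follows from the
  determinant being nonzero.\<close>

theorem Saito_criterion:
  assumes N: "finite N" "0 \<notin> N" "inj_on hyperplane N"
    and mem: "\<theta>1 \<in> log_der (hyperplane ` N)" "\<theta>2 \<in> log_der (hyperplane ` N)" "\<theta>3 \<in> log_der (hyperplane ` N)"
    and jac: "jac \<theta>1 \<theta>2 \<theta>3 = Const c * (\<Prod>n\<in>N. linear_form n)" and c: "c \<noteq> 0"
  shows "log_basis (hyperplane ` N) \<theta>1 \<theta>2 \<theta>3"
proof -
  let ?D = "log_der (hyperplane ` N)" and ?Q = "\<Prod>n\<in>N. linear_form n"
  have nz: "?Q \<noteq> 0" using N by auto
  have Q: "\<exists>s. jac \<eta>1 \<eta>2 \<eta>3 = jac \<theta>1 \<theta>2 \<theta>3 * s" if "\<eta>1 \<in> ?D" "\<eta>2 \<in> ?D" "\<eta>3 \<in> ?D" for \<eta>1 \<eta>2 \<eta>3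
  proof -
    have "?Q dvd jac \<eta>1 \<eta>2 \<eta>3"
    proof (rule prod_prime_dvd[OF N(1)])
      show "prime_elem (linear_form n)" if "n \<in> N" for n
        using that N(2) prime_elem_linear_form by metis
      show "\<not> linear_form m dvd linear_form n" if "m \<in> N" "n \<in> N" "m \<noteq> n" for m n
        using that N(2,3) linear_form_dvd unfolding inj_on_def by metis
      show "linear_form n dvd jac \<eta>1 \<eta>2 \<eta>3" if "n \<in> N" for n
        using that \<open>\<eta>1 \<in> ?D\<close> \<open>\<eta>2 \<in> ?D\<close> \<open>\<eta>3 \<in> ?D\<close> N(2)
        unfolding log_der_hyperplane_image[OF N(2)] by (metis jac_dvd)
    qed
    then obtain s where "jac \<eta>1 \<eta>2 \<eta>3 = ?Q * s" unfolding dvd_def by blast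
    also have "\<dots> = jac \<theta>1 \<theta>2 \<theta>3 * (Const (1 / c) * s)"
      using c unfolding jac by (simp add: algebra_simps flip: Const_hom)
    finally show ?thesis by blast
  qed
  have jnz: "jac \<theta>1 \<theta>2 \<theta>3 \<noteq> 0" using nz c by (simp add: jac)
  show ?thesis unfolding log_basis_def
  proof (intro conjI ballI allI impI)
    fix \<theta> assume \<theta>: "\<theta> \<in> ?D"
    obtain s1 s2 s3 where s: "jac \<theta> \<theta>2 \<theta>3 = jac \<theta>1 \<theta>2 \<theta>3 * s1" "jac \<theta>1 \<theta> \<theta>3 = jac \<theta>1 \<theta>2 \<theta>3 * s2"
      "jac \<theta>1 \<theta>2 \<theta> = jac \<theta>1 \<theta>2 \<theta>3 * s3"
      using Q \<theta> mem by metis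
    have "\<theta> v = s1 * \<theta>1 v + s2 * \<theta>2 v + s3 * \<theta>3 v" if "v \<in> {X1, X2, Z}" for v
    proof -
      have "jac \<theta>1 \<theta>2 \<theta>3 * \<theta> v = jac \<theta>1 \<theta>2 \<theta>3 * (s1 * \<theta>1 v + s2 * \<theta>2 v + s3 * \<theta>3 v)"
        unfolding jac_cramer[OF that, of \<theta>1 \<theta>2 \<theta>3 \<theta>] s by (simp add: algebra_simps)
      then show ?thesis using jnz by simp
    qed
    moreover have "derivation (\<lambda>f. s1 * \<theta>1 f + s2 * \<theta>2 f + s3 * \<theta>3 f)"
      by (rule log_der_derivation[of _ "hyperplane ` N"]) (intro log_der_add log_der_scale mem)
    ultimately show "\<exists>s1 s2 s3. \<theta> = (\<lambda>f. s1 * \<theta>1 f + s2 * \<theta>2 f + s3 * \<theta>3 f)"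
      using derivation_ext[of \<theta> "\<lambda>f. s1 * \<theta>1 f + s2 * \<theta>2 f + s3 * \<theta>3 f"] log_der_derivation[OF \<theta>] by auto
  next
    fix s1 s2 s3 assume "\<forall>f. s1 * \<theta>1 f + s2 * \<theta>2 f + s3 * \<theta>3 f = 0"
    then have z: "s1 * \<theta>1 X1 + s2 * \<theta>2 X1 + s3 * \<theta>3 X1 = 0" "s1 * \<theta>1 X2 + s2 * \<theta>2 X2 + s3 * \<theta>3 X2 = 0"
      "s1 * \<theta>1 Z + s2 * \<theta>2 Z + s3 * \<theta>3 Z = 0" by blast+
    have "s1 * jac \<theta>1 \<theta>2 \<theta>3 = 0"
    proof -
      have "s1 * jac \<theta>1 \<theta>2 \<theta>3 = (s1 * \<theta>1 X1 + s2 * \<theta>2 X1 + s3 * \<theta>3 X1) * (\<theta>2 X2 * \<theta>3 Z - \<theta>2 Z * \<theta>3 X2)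
        - (s1 * \<theta>1 X2 + s2 * \<theta>2 X2 + s3 * \<theta>3 X2) * (\<theta>2 X1 * \<theta>3 Z - \<theta>2 Z * \<theta>3 X1)
        + (s1 * \<theta>1 Z + s2 * \<theta>2 Z + s3 * \<theta>3 Z) * (\<theta>2 X1 * \<theta>3 X2 - \<theta>2 X2 * \<theta>3 X1)"
        unfolding jac_def by (simp add: algebra_simps)
      then show ?thesis unfolding z by simp
    qed
    moreover have "s2 * jac \<theta>1 \<theta>2 \<theta>3 = 0"
    proof -
      have "s2 * jac \<theta>1 \<theta>2 \<theta>3 = (s1 * \<theta>1 X1 + s2 * \<theta>2 X1 + s3 * \<theta>3 X1) * (\<theta>1 Z * \<theta>3 X2 - \<theta>1 X2 * \<theta>3 Z)
        - (s1 * \<theta>1 X2 + s2 * \<theta>2 X2 + s3 * \<theta>3 X2) * (\<theta>1 Z * \<theta>3 X1 - \<theta>1 X1 * \<theta>3 Z)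
        + (s1 * \<theta>1 Z + s2 * \<theta>2 Z + s3 * \<theta>3 Z) * (\<theta>1 X2 * \<theta>3 X1 - \<theta>1 X1 * \<theta>3 X2)"
        unfolding jac_def by (simp add: algebra_simps)
      then show ?thesis unfolding z by simp
    qed
    moreover have "s3 * jac \<theta>1 \<theta>2 \<theta>3 = 0"
    proof -
      have "s3 * jac \<theta>1 \<theta>2 \<theta>3 = (s1 * \<theta>1 X1 + s2 * \<theta>2 X1 + s3 * \<theta>3 X1) * (\<theta>1 X2 * \<theta>2 Z - \<theta>1 Z * \<theta>2 X2)
        - (s1 * \<theta>1 X2 + s2 * \<theta>2 X2 + s3 * \<theta>3 X2) * (\<theta>1 X1 * \<theta>2 Z - \<theta>1 Z * \<theta>2 X1)
        + (s1 * \<theta>1 Z + s2 * \<theta>2 Z + s3 * \<theta>3 Z) * (\<theta>1 X1 * \<theta>2 X2 - \<theta>1 X2 * \<theta>2 X1)"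
        unfolding jac_def by (simp add: algebra_simps)
      then show ?thesis unfolding z by simp
    qed
    ultimately show "s1 = 0" "s2 = 0" "s3 = 0" using jnz by simp_all
  qed (fact mem)+
qed

section \<open>A criterion for non-freeness\<close>

text \<open>Gaussian elimination without division: equation n eliminates the pivot unknown p, and
  the solution of the smaller system is scaled by the pivot to stay in the domain. Used over
  \<open>S\<close> to bound the rank and over the reals for constant terms.\<close>

lemma homogeneous_system_solvable:
  fixes v :: "'i \<Rightarrow> nat \<Rightarrow> 'a::idom"
  assumes "finite I" "card I > n"
  shows "\<exists>u. (\<exists>i\<in>I. u i \<noteq> 0) \<and> (\<forall>k<n. (\<Sum>i\<in>I. u i * v i k) = 0)"
  using assms
proof (induction n arbitrary: I v)
  case 0
  then have "I \<noteq> {}" by auto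
  then show ?case by (intro exI[of _ "\<lambda>_. 1"]) auto
next
  case (Suc n)
  show ?case
  proof (cases "\<forall>i\<in>I. v i n = 0")
    case True
    obtain u where "\<exists>i\<in>I. u i \<noteq> 0" "\<forall>k<n. (\<Sum>i\<in>I. u i * v i k) = 0"
      using Suc.IH[of I v] Suc.prems by auto
    then show ?thesis using True by (intro exI[of _ u]) (auto simp: less_Suc_eq)
  next
    case False
    then obtain p where p: "p \<in> I" "v p n \<noteq> 0" by blast
    let ?J = "I - {p}"
    let ?w = "\<lambda>i k. v p n * v i k - v i n * v p k"
    have "card ?J > n" "finite ?J" using Suc.prems p by simp_all
    then obtain u where u: "\<exists>i\<in>?J. u i \<noteq> 0" "\<forall>k<n. (\<Sum>i\<in>?J. u i * ?w i k) = 0"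
      using Suc.IH[of ?J ?w] by blast
    define u' where "u' i = (if i = p then - (\<Sum>i\<in>?J. u i * v i n) else u i * v p n)" for i
    have "(\<Sum>i\<in>I. u' i * v i k) = (\<Sum>i\<in>?J. u i * ?w i k)" for k
    proof -
      have "(\<Sum>i\<in>I. u' i * v i k) = u' p * v p k + (\<Sum>i\<in>?J. u' i * v i k)"
        using Suc.prems p by (simp add: sum.remove)
      also have "\<dots> = (\<Sum>i\<in>?J. u i * ?w i k)"
        by (simp add: u'_def sum_distrib_left sum_distrib_right sum_subtractf algebra_simps)
      finally show ?thesis .
    qed
    moreover have "(\<Sum>i\<in>?J. u i * ?w i n) = 0" by (simp add: algebra_simps)
    ultimately have "\<forall>k<Suc n. (\<Sum>i\<in>I. u' i * v i k) = 0" using u(2) by (auto simp: less_Suc_eq)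
    moreover have "\<exists>i\<in>I. u' i \<noteq> 0" using u(1) p(2) by (auto simp: u'_def)
    ultimately show ?thesis by blast
  qed
qed

text \<open>The rank bound: more than three elements written in the basis give three equations in
  more than three unknowns, solvable nontrivially over the domain \<open>S\<close>.\<close>

lemma log_basis_independent_card:
  assumes "log_basis \<A> \<theta>1 \<theta>2 \<theta>3" "B \<subseteq> log_der \<A>" "der.independent B"
  shows "finite B \<and> card B \<le> 3"
proof (rule ccontr)
  assume "\<not> (finite B \<and> card B \<le> 3)"
  then obtain I where I: "I \<subseteq> B" "finite I" "card I > 3"
  proof (cases "finite B")
    case True
    then show thesis using that[of B] \<open>\<not> (finite B \<and> card B \<le> 3)\<close> by auto
  next
    case False
    then obtain I where "finite I" "card I = 4" "I \<subseteq> B" using infinite_arbitrarily_large by blast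
    then show thesis using that[of I] by simp
  qed
  have "\<forall>\<theta>\<in>I. \<exists>c. \<theta> = (\<lambda>f. c 0 * \<theta>1 f + c (Suc 0) * \<theta>2 f + c (2::nat) * \<theta>3 f)"
  proof
    fix \<theta> assume "\<theta> \<in> I"
    then obtain s1 s2 s3 where "\<theta> = (\<lambda>f. s1 * \<theta>1 f + s2 * \<theta>2 f + s3 * \<theta>3 f)"
      using log_basis_span[OF assms(1)] I(1) assms(2) by blast
    then show "\<exists>c. \<theta> = (\<lambda>f. c 0 * \<theta>1 f + c (Suc 0) * \<theta>2 f + c (2::nat) * \<theta>3 f)"
      by (intro exI[of _ "\<lambda>i. if i = 0 then s1 else if i = 1 then s2 else s3"]) simp
  qed
  then obtain c where c: "\<And>\<theta>. \<theta> \<in> I \<Longrightarrow> \<theta> = (\<lambda>f. c \<theta> 0 * \<theta>1 f + c \<theta> (Suc 0) * \<theta>2 f + c \<theta> (2::nat) * \<theta>3 f)"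
    using bchoice[of I "\<lambda>\<theta> c. \<theta> = (\<lambda>f. c 0 * \<theta>1 f + c (Suc 0) * \<theta>2 f + c (2::nat) * \<theta>3 f)"] by blast
  from homogeneous_system_solvable[OF I(2,3), of c]
  obtain u where u: "\<exists>\<theta>\<in>I. u \<theta> \<noteq> 0" "\<And>k. k < 3 \<Longrightarrow> (\<Sum>\<theta>\<in>I. u \<theta> * c \<theta> k) = 0"
    by (elim exE conjE) simp
  have "(\<Sum>\<theta>\<in>I. (\<lambda>f. u \<theta> * \<theta> f)) = 0"
  proof
    fix f
    have "(\<Sum>\<theta>\<in>I. (\<lambda>f. u \<theta> * \<theta> f)) f = (\<Sum>\<theta>\<in>I. u \<theta> * \<theta> f)"
      by (rule sum_fun_apply)
    also have "\<dots> = (\<Sum>\<theta>\<in>I. u \<theta> * c \<theta> 0 * \<theta>1 f + u \<theta> * c \<theta> (Suc 0) * \<theta>2 f + u \<theta> * c \<theta> 2 * \<theta>3 f)"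
    proof (rule sum.cong)
      fix \<theta> assume "\<theta> \<in> I"
      show "u \<theta> * \<theta> f = u \<theta> * c \<theta> 0 * \<theta>1 f + u \<theta> * c \<theta> (Suc 0) * \<theta>2 f + u \<theta> * c \<theta> 2 * \<theta>3 f"
        unfolding fun_cong[OF c[OF \<open>\<theta> \<in> I\<close>], of f] by (simp only: distrib_left mult.assoc)
    qed simp
    also have "\<dots> = (\<Sum>\<theta>\<in>I. u \<theta> * c \<theta> 0) * \<theta>1 f + (\<Sum>\<theta>\<in>I. u \<theta> * c \<theta> (Suc 0)) * \<theta>2 f
        + (\<Sum>\<theta>\<in>I. u \<theta> * c \<theta> 2) * \<theta>3 f"
      by (simp only: sum.distrib sum_distrib_right)
    also have "\<dots> = 0" using u(2)[of 0] u(2)[of "Suc 0"] u(2)[of 2] by simp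
    finally show "(\<Sum>\<theta>\<in>I. (\<lambda>f. u \<theta> * \<theta> f)) f = 0 f" by simp
  qed
  then have "der.dependent B" unfolding der.dependent_explicit using I(1,2) u(1) by blast
  then show False using assms(3) by simp
qed

text \<open>The gradient at the origin, that is, the homogeneous part of degree one. Together with
  \<open>ev 0\<close> it replaces the grading of \<open>S\<close> in the count of
  generators.\<close>

definition lin :: "S \<Rightarrow> real^3" where
  "lin f = vector [ev 0 (pd1 f), ev 0 (pd2 f), ev 0 (pd3 f)]"

lemma lin_add: "lin (f + g) = lin f + lin g"
  by (simp add: lin_def vec_eq_iff forall_3 vector_3 pd_add)

lemma lin_mult: "lin (f * g) = ev 0 f *\<^sub>R lin g + ev 0 g *\<^sub>R lin f"
  by (simp add: lin_def vec_eq_iff forall_3 vector_3 pd_mult)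

lemma lin_linear_form: "lin (linear_form a) = a"
  by (simp add: lin_def vec_eq_iff forall_3 vector_3 linear_form_def pd_add pd_mult)

lemma ev_0_linear_form: "ev 0 (linear_form a) = 0"
  by (simp add: ev_linear_form)

lemma lin_0: "lin 0 = 0"
  using lin_add[of 0 0] by simp

lemma lin_sum: "lin (sum f A) = (\<Sum>a\<in>A. lin (f a))"
  by (induction A rule: infinite_finite_induct) (simp_all add: lin_0 lin_add)

lemma ev_sum: "ev v (sum f A) = (\<Sum>a\<in>A. ev v (f a))"
  by (induction A rule: infinite_finite_induct) simp_all

lemma log_basis_coeff_eq:
  assumes "log_basis \<A> \<theta>1 \<theta>2 \<theta>3"
    and "\<And>x. f * \<theta>1 x + g * \<theta>2 x + h * \<theta>3 x = f' * \<theta>1 x + g' * \<theta>2 x + h' * \<theta>3 x"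
  shows "f = f' \<and> g = g' \<and> h = h'"
proof -
  have "(f - f') * \<theta>1 x + (g - g') * \<theta>2 x + (h - h') * \<theta>3 x = 0" for x
    using assms(2)[of x] by (simp add: algebra_simps)
  then show ?thesis using log_basis_unique[OF assms(1), of "f - f'" "g - g'" "h - h'"] by simp
qed

text \<open>The derivations in question are the combinations \<open>f\<theta>\<^sub>1 + g\<theta>\<^sub>2 + h\<theta>\<^sub>3\<close> with \<open>(g, h)\<close> a syzygy of
  \<open>(p\<^sub>1, p\<^sub>2)\<close> modulo the new form.  As the three forms are linearly independent, the syzygies need
  three generators, so that the module needs four, more than its rank.\<close>

theorem not_free_insert:
  assumes basis: "log_basis \<A> \<theta>1 \<theta>2 \<theta>3" and a: "a \<noteq> 0"
    and 1: "linear_form a dvd \<theta>1 (linear_form a)"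
    and 2: "\<theta>2 (linear_form a) = b * linear_form u + linear_form a * q"
    and 3: "\<theta>3 (linear_form a) = b * linear_form w + linear_form a * q'"
    and b: "\<not> linear_form a dvd b"
    and indep: "\<And>r s t. r *\<^sub>R u + s *\<^sub>R w = t *\<^sub>R a \<Longrightarrow> r = 0 \<and> s = 0 \<and> t = 0"
  shows "\<not> free_arrangement (insert (hyperplane a) \<A>)"
proof
  let ?\<B> = "insert (hyperplane a) \<A>"
  let ?l = "linear_form a"
  assume "free_arrangement ?\<B>"
  then obtain B where B: "B \<subseteq> log_der ?\<B>" "der.independent B" "der.span B = log_der ?\<B>"
    unfolding free_arrangement_def free_submodule_def by blast
  have sub: "log_der ?\<B> \<subseteq> log_der \<A>" by (rule log_der_mono) blast
  have fin: "finite B" "card B \<le> 3" using log_basis_independent_card[OF basis _ B(2)] B(1) sub by blast+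
  note mem = log_basis_mem[OF basis]
  note der = mem[THEN log_der_derivation]
  have l_dvd: "?l dvd \<theta> ?l" if "\<theta> \<in> log_der ?\<B>" for \<theta>
    using that a unfolding log_der_def by blast
  have in_D: "\<theta> \<in> log_der ?\<B>" if "\<theta> \<in> log_der \<A>" "?l dvd \<theta> ?l" for \<theta>
  proof -
    have "linear_form c dvd \<theta> (linear_form c)" if c: "c \<noteq> 0" "hyperplane a = hyperplane c" for c
    proof -
      obtain k where "k \<noteq> 0" "c = k *\<^sub>R a" using hyperplane_eqD[OF a c] by blast
      then show ?thesis
        using linear_form_scale_dvd[OF log_der_derivation[OF \<open>\<theta> \<in> log_der \<A>\<close>]] \<open>?l dvd \<theta> ?l\<close> by simp
    qed
    then show ?thesis using that(1) unfolding log_der_def by blast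
  qed
  \<comment> \<open>For a combination tangent to the new plane, g u + h w is divisible by the new
    form. Comparing linear parts gives a real relation between u, w and a, which
    \<open>indep\<close> makes trivial, so g and h have no constant term.\<close>
  have vanish: "ev 0 g = 0 \<and> ev 0 h = 0"
    if "(\<lambda>x. f * \<theta>1 x + g * \<theta>2 x + h * \<theta>3 x) \<in> log_der ?\<B>" for f g h
  proof -
    have "?l dvd f * \<theta>1 ?l + g * \<theta>2 ?l + h * \<theta>3 ?l" using l_dvd[OF that] .
    also have "f * \<theta>1 ?l + g * \<theta>2 ?l + h * \<theta>3 ?l =
      b * (g * linear_form u + h * linear_form w) + (f * \<theta>1 ?l + ?l * (g * q + h * q'))"
      unfolding 2 3 by (simp add: algebra_simps)
    finally have "?l dvd b * (g * linear_form u + h * linear_form w) + (f * \<theta>1 ?l + ?l * (g * q + h * q'))" .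
    moreover have "?l dvd f * \<theta>1 ?l + ?l * (g * q + h * q')" using 1 by simp
    ultimately have "?l dvd b * (g * linear_form u + h * linear_form w)"
      using dvd_add_left_iff by blast
    then have "?l dvd g * linear_form u + h * linear_form w"
      using b prime_elem_dvd_multD[OF prime_elem_linear_form[OF a]] by blast
    then obtain k where "g * linear_form u + h * linear_form w = ?l * k" unfolding dvd_def by blast
    then have "lin (g * linear_form u + h * linear_form w) = lin (?l * k)" by (rule arg_cong)
    then have "ev 0 g *\<^sub>R u + ev 0 h *\<^sub>R w = ev 0 k *\<^sub>R a"
      by (simp add: lin_add lin_mult lin_linear_form ev_0_linear_form)
    then show ?thesis using indep by blast
  qed
  have "\<exists>c. \<theta> = (\<lambda>x. fst c * \<theta>1 x + fst (snd c) * \<theta>2 x + snd (snd c) * \<theta>3 x)" if "\<theta> \<in> B" for \<theta>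
  proof -
    have "\<theta> \<in> log_der \<A>" using that B(1) sub by blast
    from log_basis_span[OF basis this]
    obtain f g h where "\<theta> = (\<lambda>x. f * \<theta>1 x + g * \<theta>2 x + h * \<theta>3 x)" .
    then show ?thesis by (intro exI[of _ "(f, g, h)"]) simp
  qed
  then obtain c where c: "\<And>\<theta>. \<theta> \<in> B \<Longrightarrow>
      \<theta> = (\<lambda>x. fst (c \<theta>) * \<theta>1 x + fst (snd (c \<theta>)) * \<theta>2 x + snd (snd (c \<theta>)) * \<theta>3 x)"
    using bchoice[of B "\<lambda>\<theta> c. \<theta> = (\<lambda>x. fst c * \<theta>1 x + fst (snd c) * \<theta>2 x + snd (snd c) * \<theta>3 x)"] by blast
  define f g h where "f \<theta> = fst (c \<theta>)" and "g \<theta> = fst (snd (c \<theta>))" and "h \<theta> = snd (snd (c \<theta>))" for \<theta>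
  have cB: "\<theta> x = f \<theta> * \<theta>1 x + g \<theta> * \<theta>2 x + h \<theta> * \<theta>3 x" if "\<theta> \<in> B" for \<theta> x
    using fun_cong[OF c[OF that], of x] by (simp add: f_def g_def h_def)
  have gh0: "ev 0 (g \<theta>) = 0" "ev 0 (h \<theta>) = 0" if "\<theta> \<in> B" for \<theta>
  proof -
    have "(\<lambda>x. f \<theta> * \<theta>1 x + g \<theta> * \<theta>2 x + h \<theta> * \<theta>3 x) = \<theta>" using cB[OF that] by auto
    then have "(\<lambda>x. f \<theta> * \<theta>1 x + g \<theta> * \<theta>2 x + h \<theta> * \<theta>3 x) \<in> log_der ?\<B>" using that B(1) by auto
    from vanish[OF this] show "ev 0 (g \<theta>) = 0" "ev 0 (h \<theta>) = 0" by blast+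
  qed
  \<comment> \<open>Four members of the larger module: \<open>\<theta>1\<close>, the new form times
    \<open>\<theta>2\<close>, the new form times \<open>\<theta>3\<close>, and the Koszul
    combination \<open>w \<theta>2 - u \<theta>3\<close>. No nontrivial real combination of them can
    lose all its constant coefficients over B, which is impossible if B has at most three
    elements.\<close>
  define F G H :: "nat \<Rightarrow> S" where
    "F i = (if i = 0 then 1 else 0)" and
    "G i = (if i = 1 then ?l else if i = 3 then linear_form w else 0)" and
    "H i = (if i = 2 then ?l else if i = 3 then - linear_form u else 0)" for i
  have "(\<lambda>x. F i * \<theta>1 x + G i * \<theta>2 x + H i * \<theta>3 x) \<in> log_der ?\<B>" for i
  proof (rule in_D)
    show "(\<lambda>x. F i * \<theta>1 x + G i * \<theta>2 x + H i * \<theta>3 x) \<in> log_der \<A>"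
      by (intro log_der_add log_der_scale mem)
    have "linear_form w * (b * linear_form u + ?l * q) + - linear_form u * (b * linear_form w + ?l * q')
      = ?l * (linear_form w * q - linear_form u * q')"
      by (simp add: algebra_simps)
    then have "?l dvd linear_form w * \<theta>2 ?l + - linear_form u * \<theta>3 ?l" unfolding 2 3 by simp
    then show "?l dvd F i * \<theta>1 ?l + G i * \<theta>2 ?l + H i * \<theta>3 ?l"
      using 1 by (auto simp: F_def G_def H_def)
  qed
  then have "(\<lambda>x. F i * \<theta>1 x + G i * \<theta>2 x + H i * \<theta>3 x) \<in> der.span B" for i
    using B(3) by simp
  then have "\<forall>i. \<exists>s. (\<lambda>x. F i * \<theta>1 x + G i * \<theta>2 x + H i * \<theta>3 x) = (\<Sum>\<theta>\<in>B. (\<lambda>x. s \<theta> * \<theta> x))"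
    unfolding der.span_finite[OF fin(1)] by auto
  then obtain s where s: "\<And>i. (\<lambda>x. F i * \<theta>1 x + G i * \<theta>2 x + H i * \<theta>3 x) = (\<Sum>\<theta>\<in>B. (\<lambda>x. s i \<theta> * \<theta> x))"
    using choice[of "\<lambda>i s. (\<lambda>x. F i * \<theta>1 x + G i * \<theta>2 x + H i * \<theta>3 x) = (\<Sum>\<theta>\<in>B. (\<lambda>x. s \<theta> * \<theta> x))"] by blast
  have FGH: "F i = (\<Sum>\<theta>\<in>B. s i \<theta> * f \<theta>) \<and> G i = (\<Sum>\<theta>\<in>B. s i \<theta> * g \<theta>) \<and> H i = (\<Sum>\<theta>\<in>B. s i \<theta> * h \<theta>)" for i
  proof (rule log_basis_coeff_eq[OF basis])
    fix x
    have "F i * \<theta>1 x + G i * \<theta>2 x + H i * \<theta>3 x = (\<Sum>\<theta>\<in>B. s i \<theta> * \<theta> x)"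
      using fun_cong[OF s[of i], of x] by (simp add: sum_fun_apply)
    also have "\<dots> = (\<Sum>\<theta>\<in>B. s i \<theta> * (f \<theta> * \<theta>1 x + g \<theta> * \<theta>2 x + h \<theta> * \<theta>3 x))"
      by (rule sum.cong) (simp_all only: cB)
    also have "\<dots> = (\<Sum>\<theta>\<in>B. s i \<theta> * f \<theta>) * \<theta>1 x + (\<Sum>\<theta>\<in>B. s i \<theta> * g \<theta>) * \<theta>2 x + (\<Sum>\<theta>\<in>B. s i \<theta> * h \<theta>) * \<theta>3 x"
      by (simp only: sum_distrib_right distrib_left sum.distrib mult.assoc)
    finally show "F i * \<theta>1 x + G i * \<theta>2 x + H i * \<theta>3 x = \<dots>" .
  qed
  obtain e where e: "bij_betw e {0..<card B} B" using ex_bij_betw_nat_finite[OF fin(1)] by blast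
  \<comment> \<open>Four rows of constant terms over at most three generators admit a real relation
    r. It is applied to the constant terms of F and to the linear parts of G and H, whose generators
    vanish at the origin by \<open>gh0\<close>.\<close>
  obtain r :: "nat \<Rightarrow> real" where r: "\<exists>i\<in>{..<4}. r i \<noteq> 0" "\<And>k. k < card B \<Longrightarrow> (\<Sum>i<4. r i * ev 0 (s i (e k))) = 0"
    using homogeneous_system_solvable[of "{..<4::nat}" "card B" "\<lambda>i k. ev 0 (s i (e k))"] fin(2) by auto
  have r0: "(\<Sum>i<4. r i * ev 0 (s i \<theta>)) = 0" if "\<theta> \<in> B" for \<theta>
  proof -
    have "\<theta> \<in> e ` {0..<card B}" using e that by (simp add: bij_betw_def)
    then obtain k where "k < card B" "\<theta> = e k" by auto
    then show ?thesis using r(2) by simp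
  qed
  have "(\<Sum>i<4. r i * ev 0 (F i)) = (\<Sum>\<theta>\<in>B. (\<Sum>i<4. r i * ev 0 (s i \<theta>)) * ev 0 (f \<theta>))"
  proof -
    have "(\<Sum>i<4. r i * ev 0 (F i)) = (\<Sum>i<4. \<Sum>\<theta>\<in>B. r i * ev 0 (s i \<theta>) * ev 0 (f \<theta>))"
      by (subst FGH[THEN conjunct1]) (simp add: ev_sum sum_distrib_left mult.assoc)
    also have "\<dots> = (\<Sum>\<theta>\<in>B. \<Sum>i<4. r i * ev 0 (s i \<theta>) * ev 0 (f \<theta>))" by (rule sum.swap)
    finally show ?thesis by (simp only: sum_distrib_right)
  qed
  then have F0: "(\<Sum>i<4. r i * ev 0 (F i)) = 0" by (simp add: r0)
  have lin_comb: "(\<Sum>i<4. r i *\<^sub>R lin (K i)) = 0"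
    if K: "\<And>i. K i = (\<Sum>\<theta>\<in>B. s i \<theta> * k \<theta>)" "\<And>\<theta>. \<theta> \<in> B \<Longrightarrow> ev 0 (k \<theta>) = 0" for K k
  proof -
    have "lin (K i) = (\<Sum>\<theta>\<in>B. ev 0 (s i \<theta>) *\<^sub>R lin (k \<theta>))" for i
      unfolding K(1) lin_sum by (rule sum.cong) (simp_all add: lin_mult K(2))
    then have "(\<Sum>i<4. r i *\<^sub>R lin (K i)) = (\<Sum>i<4. \<Sum>\<theta>\<in>B. (r i * ev 0 (s i \<theta>)) *\<^sub>R lin (k \<theta>))"
      by (simp add: scaleR_sum_right)
    also have "\<dots> = (\<Sum>\<theta>\<in>B. \<Sum>i<4. (r i * ev 0 (s i \<theta>)) *\<^sub>R lin (k \<theta>))" by (rule sum.swap)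
    also have "\<dots> = (\<Sum>\<theta>\<in>B. (\<Sum>i<4. r i * ev 0 (s i \<theta>)) *\<^sub>R lin (k \<theta>))" by (simp only: scaleR_sum_left)
    finally show ?thesis by (simp add: r0)
  qed
  have G0: "(\<Sum>i<4. r i *\<^sub>R lin (G i)) = 0" by (rule lin_comb[of G g]) (use FGH gh0 in blast)+
  have H0: "(\<Sum>i<4. r i *\<^sub>R lin (H i)) = 0" by (rule lin_comb[of H h]) (use FGH gh0 in blast)+
  have "r 0 = 0" using F0 by (simp add: F_def eval_nat_numeral)
  moreover have "r 1 *\<^sub>R a + r 3 *\<^sub>R w = 0"
    using G0 by (simp add: G_def eval_nat_numeral lin_0 lin_linear_form)
  then have "0 *\<^sub>R u + r 3 *\<^sub>R w = (- r 1) *\<^sub>R a" by (simp add: add_eq_0_iff2)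
  then have "r 3 = 0" "r 1 = 0" using indep[of 0 "r 3" "- r 1"] by simp_all
  moreover have "r 2 *\<^sub>R a = 0"
    using H0 \<open>r 3 = 0\<close> by (simp add: H_def eval_nat_numeral lin_0 lin_linear_form)
  then have "r 2 = 0" using a by simp
  ultimately have "r i = 0" if "i < 4" for i
    using that by (auto simp: eval_nat_numeral less_Suc_eq)
  then show False using r(1) by auto
qed

section \<open>Linear changes of coordinates\<close>

definition alg_endo :: "(S \<Rightarrow> S) \<Rightarrow> bool" where
  "alg_endo \<sigma> \<longleftrightarrow> (\<forall>f g. \<sigma> (f + g) = \<sigma> f + \<sigma> g) \<and> (\<forall>f g. \<sigma> (f * g) = \<sigma> f * \<sigma> g) \<and>
     (\<forall>c. \<sigma> (Const c) = Const c)"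

lemma alg_endoD:
  assumes "alg_endo \<sigma>"
  shows "\<sigma> (f + g) = \<sigma> f + \<sigma> g" "\<sigma> (f * g) = \<sigma> f * \<sigma> g" "\<sigma> (Const c) = Const c" "\<sigma> 0 = 0"
  using assms unfolding alg_endo_def by (blast, blast, blast, metis Const_hom(1))

lemma alg_endo_sum: "alg_endo \<sigma> \<Longrightarrow> \<sigma> (sum f A) = (\<Sum>a\<in>A. \<sigma> (f a))"
  by (induction A rule: infinite_finite_induct) (simp_all add: alg_endoD)

lemma alg_endo_id:
  assumes "alg_endo \<sigma>" "\<sigma> X1 = X1" "\<sigma> X2 = X2" "\<sigma> Z = Z"
  shows "\<sigma> f = f"
  by (induction f rule: S_induct) (simp_all add: assms alg_endoD[OF assms(1)])

text \<open>A homomorphism between different rings, so that evaluation can be iterated through the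
  layers of \<open>S\<close>; \<open>alg_endo\<close> is the version on \<open>S\<close> that fixes
  the constants.\<close>

definition rhom :: "('a::comm_ring_1 \<Rightarrow> 'b::comm_ring_1) \<Rightarrow> bool" where
  "rhom h \<longleftrightarrow> h 0 = 0 \<and> h 1 = 1 \<and> (\<forall>f g. h (f + g) = h f + h g) \<and> (\<forall>f g. h (f * g) = h f * h g)"

lemma rhom_poly_map_poly:
  assumes "rhom h"
  shows "rhom (\<lambda>f. poly (map_poly h f) w)"
proof -
  have h: "h 0 = 0" "h 1 = 1" "h (f + g) = h f + h g" "h (f * g) = h f * h g" for f g
    using assms unfolding rhom_def by blast+
  have "h (sum f A) = (\<Sum>a\<in>A. h (f a))" for f :: "nat \<Rightarrow> 'a" and A
    by (induction A rule: infinite_finite_induct) (simp_all add: h)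
  then have "map_poly h (p * q) = map_poly h p * map_poly h q" for p q
    by (intro poly_eqI) (simp add: coeff_map_poly coeff_mult h)
  then show ?thesis
    unfolding rhom_def by (simp add: map_poly_additive h)
qed

definition substitution :: "S \<Rightarrow> S \<Rightarrow> S \<Rightarrow> S \<Rightarrow> S" where
  "substitution u v w f =
     poly (map_poly (\<lambda>g. poly (map_poly (\<lambda>h. poly (map_poly Const h) u) g) v) f) w"

lemma rhom_substitution: "rhom (substitution u v w)"
proof -
  have "rhom Const" unfolding rhom_def by simp
  then show ?thesis unfolding substitution_def [abs_def] by (intro rhom_poly_map_poly)
qed

lemma substitution_vars [simp]:
  "substitution u v w (Const c) = Const c" "substitution u v w X1 = u"
  "substitution u v w X2 = v" "substitution u v w Z = w"
  by (simp_all add: substitution_def X1_def X2_def Z_def Const_def[of c] map_poly_pCons)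

lemma alg_endo_substitution: "alg_endo (substitution u v w)"
  using rhom_substitution[of u v w] unfolding rhom_def alg_endo_def by simp

text \<open>Composition of a polynomial with the map v |-> G v: the i-th variable becomes the form
  given by row i of G. On normals this is the transpose, in agreement with \<open>pull\<close>, the
  preimage of a plane under the same map.\<close>

definition coord_subst :: "real^3^3 \<Rightarrow> S \<Rightarrow> S" where
  "coord_subst G = substitution (linear_form (G $ 1)) (linear_form (G $ 2)) (linear_form (G $ 3))"

lemma alg_endo_coord_subst: "alg_endo (coord_subst G)"
  unfolding coord_subst_def by (rule alg_endo_substitution)

lemma coord_subst_linear_form: "coord_subst G (linear_form a) = linear_form (transpose G *v a)"
proof -
  have "coord_subst G (linear_form a) =
    Const (a $ 1) * linear_form (G $ 1) + Const (a $ 2) * linear_form (G $ 2) + Const (a $ 3) * linear_form (G $ 3)"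
    by (simp add: linear_form_def[of a] alg_endoD[OF alg_endo_coord_subst] coord_subst_def alg_endoD[OF alg_endo_substitution])
  also have "\<dots> = linear_form (a $ 1 *\<^sub>R G $ 1 + a $ 2 *\<^sub>R G $ 2 + a $ 3 *\<^sub>R G $ 3)"
    by (simp add: linear_form_add linear_form_scale)
  also have "a $ 1 *\<^sub>R G $ 1 + a $ 2 *\<^sub>R G $ 2 + a $ 3 *\<^sub>R G $ 3 = transpose G *v a"
    by (simp add: vec_eq_iff matrix_vector_mult_def transpose_def sum_3 mult.commute)
  finally show ?thesis .
qed

lemma transpose_cancel:
  fixes G :: "real^3^3"
  assumes "G ** G' = mat 1"
  shows "transpose G' *v (transpose G *v a) = a"
  by (simp only: matrix_vector_mul_assoc matrix_transpose_mul[symmetric] assms transpose_mat matrix_vector_mul_lid)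

lemma linear_form_axis: "linear_form (axis 1 1) = X1" "linear_form (axis 2 1) = X2" "linear_form (axis 3 1) = Z"
  by (simp_all add: linear_form_def axis_def)

lemma coord_subst_inverse:
  assumes "G ** G' = mat 1"
  shows "coord_subst G' (coord_subst G f) = f"
proof (rule alg_endo_id[where \<sigma> = "\<lambda>f. coord_subst G' (coord_subst G f)"])
  show "alg_endo (\<lambda>f. coord_subst G' (coord_subst G f))"
    unfolding alg_endo_def by (simp add: alg_endoD[OF alg_endo_coord_subst])
  have "coord_subst G' (coord_subst G (linear_form a)) = linear_form a" for a
    by (simp only: coord_subst_linear_form transpose_cancel[OF assms])
  then show "coord_subst G' (coord_subst G X1) = X1" "coord_subst G' (coord_subst G X2) = X2"
    "coord_subst G' (coord_subst G Z) = Z"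
    unfolding linear_form_axis[symmetric] by blast+
qed

definition pull :: "real^3^3 \<Rightarrow> (real^3) set \<Rightarrow> (real^3) set" where
  "pull G H = (\<lambda>v. G *v v) -` H"

lemma pull_hyperplane: "pull G (hyperplane a) = hyperplane (transpose G *v a)"
  by (simp add: pull_def hyperplane_def vimage_def dot_lmul_matrix)

lemma pull_pull: "pull G (pull G' H) = pull (G' ** G) H"
  by (simp add: pull_def vimage_def matrix_vector_mul_assoc)

lemma pull_mat_1: "pull (mat 1) H = H"
  by (simp add: pull_def vimage_def)

lemma pull_inverse: "G ** G' = mat 1 \<Longrightarrow> pull G (pull G' H) = H"
  using matrix_left_right_inverse[of G G'] by (simp add: pull_pull pull_mat_1)

lemma pull_image_inverse: "G ** G' = mat 1 \<Longrightarrow> pull G ` pull G' ` \<A> = \<A>"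
  by (simp add: image_image pull_inverse)

lemma transpose_mult_nonzero:
  fixes G :: "real^3^3"
  assumes "G ** G' = mat 1" "a \<noteq> 0"
  shows "transpose G *v a \<noteq> 0"
proof
  assume *: "transpose G *v a = 0"
  show False using transpose_cancel[OF assms(1), of a] assms(2) unfolding * by simp
qed

lemma arrangement_pull:
  assumes "G ** G' = mat 1" "arrangement \<A>"
  shows "arrangement (pull G ` \<A>)"
  using assms(2) transpose_mult_nonzero[OF assms(1)] pull_hyperplane[of G]
  unfolding arrangement_def by (metis (no_types, lifting) finite_imageI imageE)

text \<open>Conjugation by the substitution carries derivations to derivations and moves the
  tangency condition from a plane to its preimage.\<close>

lemma log_der_pull:
  assumes G: "G ** G' = mat 1" and \<theta>: "\<theta> \<in> log_der \<A>"
  shows "(\<lambda>f. coord_subst G (\<theta> (coord_subst G' f))) \<in> log_der (pull G ` \<A>)"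
proof -
  let ?\<eta> = "\<lambda>f. coord_subst G (\<theta> (coord_subst G' f))"
  have G': "G' ** G = mat 1" using G matrix_left_right_inverse by blast
  note h = alg_endoD[OF alg_endo_coord_subst]
  note d = derivationD[OF log_der_derivation[OF \<theta>]]
  have "derivation ?\<eta>"
    by (rule derivationI) (simp_all add: h d coord_subst_inverse[OF G'])
  moreover have "linear_form a dvd ?\<eta> (linear_form a)"
    if H: "H \<in> \<A>" and a: "a \<noteq> 0" "pull G H = hyperplane a" for H a
  proof -
    let ?b = "transpose G' *v a"
    have "pull G' (pull G H) = hyperplane ?b" using a pull_hyperplane by simp
    then have "H = hyperplane ?b" using pull_inverse[OF G'] by simp
    moreover have "?b \<noteq> 0" using transpose_mult_nonzero[OF G' a(1)] .
    ultimately have "linear_form ?b dvd \<theta> (linear_form ?b)" using \<theta> H unfolding log_der_def by blast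
    then obtain k where k: "\<theta> (linear_form ?b) = linear_form ?b * k" unfolding dvd_def by blast
    have "?\<eta> (linear_form a) = coord_subst G (linear_form ?b) * coord_subst G k"
      by (simp only: coord_subst_linear_form[of G'] k h)
    also have "coord_subst G (linear_form ?b) = linear_form a"
      by (simp only: coord_subst_linear_form transpose_cancel[OF G'])
    finally show ?thesis by simp
  qed
  ultimately show ?thesis unfolding log_der_def by blast
qed

text \<open>The conjugation is only semilinear, since the substitution also moves the coefficients.
  Hence independence and spanning are transported directly, with the inverse substitution applied to
  the coefficients.\<close>

lemma free_arrangement_pull_imp:
  assumes G: "G ** G' = mat 1" and free: "free_arrangement \<A>"
  shows "free_arrangement (pull G ` \<A>)"
proof -
  let ?\<sigma> = "coord_subst G" and ?\<tau> = "coord_subst G'"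
  let ?F = "\<lambda>\<theta> f. ?\<sigma> (\<theta> (?\<tau> f))"
  have G': "G' ** G = mat 1" using G matrix_left_right_inverse by blast
  have inv: "?\<tau> (?\<sigma> f) = f" "?\<sigma> (?\<tau> f) = f" for f
    using coord_subst_inverse[OF G] coord_subst_inverse[OF G'] by simp_all
  note h = alg_endoD[OF alg_endo_coord_subst] alg_endo_sum[OF alg_endo_coord_subst]
  obtain B where B: "B \<subseteq> log_der \<A>" "der.independent B" "der.span B = log_der \<A>"
    using free unfolding free_arrangement_def free_submodule_def by blast
  have injF: "inj ?F"
  proof (rule injI)
    fix \<theta> \<eta> assume *: "?F \<theta> = ?F \<eta>"
    show "\<theta> = \<eta>"
    proof
      fix f
      have "?\<tau> (?F \<theta> (?\<sigma> f)) = ?\<tau> (?F \<eta> (?\<sigma> f))" using fun_cong[OF *, of "?\<sigma> f"] by simp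
      then show "\<theta> f = \<eta> f" by (simp add: inv)
    qed
  qed
  have sub: "?F ` B \<subseteq> log_der (pull G ` \<A>)" using B(1) log_der_pull[OF G] by blast
  have "der.independent (?F ` B)"
  proof
    assume "der.dependent (?F ` B)"
    then obtain t' u where t': "finite t'" "t' \<subseteq> ?F ` B" "(\<Sum>v\<in>t'. (\<lambda>f. u v * v f)) = 0" "\<exists>v\<in>t'. u v \<noteq> 0"
      unfolding der.dependent_explicit by blast
    obtain t where t: "t \<subseteq> B" "finite t" "t' = ?F ` t" using finite_subset_image[OF t'(1,2)] by blast
    have "(\<Sum>b\<in>t. (\<lambda>f. ?\<tau> (u (?F b)) * b f)) = 0"
    proof
      fix f
      have "0 = ?\<tau> ((\<Sum>v\<in>t'. (\<lambda>f. u v * v f)) (?\<sigma> f))" using t'(3) by (simp add: h)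
      also have "\<dots> = ?\<tau> (\<Sum>v\<in>t'. u v * v (?\<sigma> f))" by (simp only: sum_fun_apply)
      also have "\<dots> = ?\<tau> (\<Sum>b\<in>t. u (?F b) * ?F b (?\<sigma> f))"
        unfolding t(3) sum.reindex[OF inj_on_subset[OF injF subset_UNIV]] by (simp only: comp_def)
      also have "\<dots> = (\<Sum>b\<in>t. ?\<tau> (u (?F b)) * b f)" by (simp add: h inv)
      finally show "(\<Sum>b\<in>t. (\<lambda>f. ?\<tau> (u (?F b)) * b f)) f = 0 f" by (simp add: sum_fun_apply)
    qed
    then have "der.dependent B" if "\<exists>b\<in>t. ?\<tau> (u (?F b)) \<noteq> 0"
      unfolding der.dependent_explicit using that t(1,2)
      by (intro exI[of _ t] exI[of _ "\<lambda>b. ?\<tau> (u (?F b))"] conjI)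
    then have "\<forall>b\<in>t. ?\<tau> (u (?F b)) = 0" using B(2) by auto
    then have "\<forall>b\<in>t. u (?F b) = 0" using inv(2) h(4) by metis
    then show False using t'(4) t(3) by blast
  qed
  moreover have "der.span (?F ` B) = log_der (pull G ` \<A>)"
  proof
    show "der.span (?F ` B) \<subseteq> log_der (pull G ` \<A>)" using sub subspace_log_der by (rule der.span_minimal)
    show "log_der (pull G ` \<A>) \<subseteq> der.span (?F ` B)"
    proof
      fix \<eta> assume "\<eta> \<in> log_der (pull G ` \<A>)"
      then have "(\<lambda>f. ?\<tau> (\<eta> (?\<sigma> f))) \<in> der.span B"
        using log_der_pull[OF G', of \<eta> "pull G ` \<A>"] pull_image_inverse[OF G'] B(3) by metis
      then obtain t r where t: "finite t" "t \<subseteq> B" "(\<lambda>f. ?\<tau> (\<eta> (?\<sigma> f))) = (\<Sum>b\<in>t. (\<lambda>f. r b * b f))"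
        unfolding der.span_explicit by blast
      have e: "?\<tau> (\<eta> (?\<sigma> g)) = (\<Sum>b\<in>t. r b * b g)" for g
        using fun_cong[OF t(3), of g] by (simp add: sum_fun_apply)
      have "\<eta> = (\<Sum>b\<in>t. (\<lambda>f. ?\<sigma> (r b) * ?F b f))"
      proof
        fix f
        have "\<eta> f = ?\<sigma> (?\<tau> (\<eta> (?\<sigma> (?\<tau> f))))" by (simp add: inv)
        also have "\<dots> = (\<Sum>b\<in>t. ?\<sigma> (r b) * ?F b f)" unfolding e by (simp add: h)
        finally show "\<eta> f = (\<Sum>b\<in>t. (\<lambda>f. ?\<sigma> (r b) * ?F b f)) f" by (simp add: sum_fun_apply)
      qed
      also have "\<dots> \<in> der.span (?F ` B)"
        by (intro der.span_sum der.span_scale der.span_base) (use t(2) in blast)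
      finally show "\<eta> \<in> der.span (?F ` B)" .
    qed
  qed
  ultimately show ?thesis using sub unfolding free_arrangement_def free_submodule_def by blast
qed

lemma free_arrangement_pull:
  assumes "G ** G' = mat 1"
  shows "free_arrangement (pull G ` \<A>) \<longleftrightarrow> free_arrangement \<A>"
  using assms free_arrangement_pull_imp[of G G'] free_arrangement_pull_imp[of G' G "pull G ` \<A>"]
    pull_image_inverse[of G' G] matrix_left_right_inverse by metis

section \<open>Incidence-preserving bijections\<close>

text \<open>What remains of the lattice in rank three: the planes, and which triples share a line.
  Frames, modularity and the propagation of fixed lines are phrased by these inclusions
  alone.\<close>

definition comb_iso :: "(real^3) set set \<Rightarrow> (real^3) set set \<Rightarrow> ((real^3) set \<Rightarrow> (real^3) set) \<Rightarrow> bool" where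
  "comb_iso \<A> \<A>' \<psi> \<longleftrightarrow> bij_betw \<psi> \<A> \<A>' \<and>
     (\<forall>H1\<in>\<A>. \<forall>H2\<in>\<A>. \<forall>H3\<in>\<A>. H1 \<inter> H2 \<subseteq> H3 \<longleftrightarrow> \<psi> H1 \<inter> \<psi> H2 \<subseteq> \<psi> H3)"

lemma comb_isoD:
  assumes "comb_iso \<A> \<A>' \<psi>" "H1 \<in> \<A>" "H2 \<in> \<A>"
  shows "\<psi> H1 \<in> \<A>'" "\<psi> H1 = \<psi> H2 \<longleftrightarrow> H1 = H2"
    "H3 \<in> \<A> \<Longrightarrow> \<psi> H1 \<inter> \<psi> H2 \<subseteq> \<psi> H3 \<longleftrightarrow> H1 \<inter> H2 \<subseteq> H3"
  using assms unfolding comb_iso_def bij_betw_def inj_on_def by auto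

lemma comb_iso_refl: "comb_iso \<A> \<A> id"
  unfolding comb_iso_def by simp

lemma hyperplane_neq_UNIV:
  assumes "a \<noteq> 0" shows "hyperplane a \<noteq> UNIV"
proof -
  have "a \<notin> hyperplane a" using assms by (simp add: hyperplane_def)
  then show ?thesis by blast
qed

lemma arrangement_subset_eq:
  assumes "arrangement \<A>" "arrangement \<B>" "H \<in> \<A>" "K \<in> \<B>" "H \<subseteq> K"
  shows "H = K"
proof -
  obtain a b where "a \<noteq> 0" "H = hyperplane a" "b \<noteq> 0" "K = hyperplane b"
    using assms(1-4) unfolding arrangement_def by metis
  then show ?thesis using assms(5) hyperplane_subset[of a b] hyperplane_scale by (metis scaleR_zero_left)
qed

lemma in_intersection_lattice: "H \<in> \<A> \<Longrightarrow> H \<in> intersection_lattice \<A>"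
  unfolding intersection_lattice_def by (rule CollectI, rule exI[of _ "{H}"]) simp

lemma UNIV_in_intersection_lattice: "UNIV \<in> intersection_lattice \<A>"
  unfolding intersection_lattice_def by (rule CollectI, rule exI[of _ "{}"]) simp

lemma in_intersection_lattice_cases:
  assumes "X \<in> intersection_lattice \<A>" "X \<noteq> UNIV"
  obtains K where "K \<in> \<A>" "X \<subseteq> K"
proof -
  obtain \<C> where C: "\<C> \<subseteq> \<A>" "X = \<Inter>\<C>" using assms(1) unfolding intersection_lattice_def by auto
  then have "\<C> \<noteq> {}" using assms(2) by auto
  then obtain K where "K \<in> \<C>" by auto
  then show thesis using that[of K] C by auto
qed

lemma arrangement_normal:
  assumes "arrangement \<A>" "H \<in> \<A>"
  obtains a where "a \<noteq> 0" "H = hyperplane a"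
  using assms unfolding arrangement_def by auto

lemma arrangement_neq_UNIV:
  assumes "arrangement \<A>" "H \<in> \<A>"
  shows "H \<noteq> UNIV"
proof -
  obtain a where "a \<noteq> 0" "H = hyperplane a" using arrangement_normal[OF assms] .
  then show ?thesis using hyperplane_neq_UNIV[of a] by simp
qed

text \<open>An order-theoretic recognition of the planes, so that any order isomorphism maps planes
  to planes.\<close>

lemma lattice_coatom_iff:
  assumes "arrangement \<A>"
  shows "X \<in> \<A> \<longleftrightarrow> X \<in> intersection_lattice \<A> \<and> X \<noteq> UNIV \<and>
    (\<forall>Y\<in>intersection_lattice \<A>. X \<subseteq> Y \<longrightarrow> Y = X \<or> Y = UNIV)" (is "?l \<longleftrightarrow> ?r")
proof
  assume X: ?l
  have "Y = X" if Y: "Y \<in> intersection_lattice \<A>" "X \<subseteq> Y" "Y \<noteq> UNIV" for Y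
  proof -
    obtain K where K: "K \<in> \<A>" "Y \<subseteq> K" using in_intersection_lattice_cases[OF Y(1,3)] .
    then have "X = K" using arrangement_subset_eq[OF assms assms X K(1)] Y(2) by auto
    then show ?thesis using K(2) Y(2) by auto
  qed
  then show ?r using in_intersection_lattice[OF X] arrangement_neq_UNIV[OF assms X] by auto
next
  assume r: ?r
  then obtain K where K: "K \<in> \<A>" "X \<subseteq> K" using in_intersection_lattice_cases[of X \<A>] by metis
  then have "K = X" using r in_intersection_lattice[OF K(1)] arrangement_neq_UNIV[OF assms K(1)] by auto
  then show ?l using K by simp
qed

lemma lattice_Int:
  assumes "X \<in> intersection_lattice \<A>" "Y \<in> intersection_lattice \<A>"
  shows "X \<inter> Y \<in> intersection_lattice \<A>"
proof -
  obtain \<C> \<D> where "\<C> \<subseteq> \<A>" "X = \<Inter>\<C>" "\<D> \<subseteq> \<A>" "Y = \<Inter>\<D>"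
    using assms unfolding intersection_lattice_def by blast
  then have "\<C> \<union> \<D> \<subseteq> \<A>" "X \<inter> Y = \<Inter>(\<C> \<union> \<D>)" by auto
  then show ?thesis unfolding intersection_lattice_def by blast
qed

text \<open>Restrict the isomorphism to the coatoms. The lattice is closed under intersection, so an
  order isomorphism commutes with it, and an inclusion H1 \<inter> H2 \<subseteq> H3 is a statement
  about the order.\<close>

lemma lattice_isomorphic_comb_iso:
  assumes A: "arrangement \<A>" and A': "arrangement \<A>'" and iso: "lattice_isomorphic \<A> \<A>'"
  obtains \<psi> where "comb_iso \<A> \<A>' \<psi>"
proof -
  let ?L = "intersection_lattice \<A>" and ?L' = "intersection_lattice \<A>'"
  from iso[unfolded lattice_isomorphic_def] obtain \<phi> where bij: "bij_betw \<phi> ?L ?L'"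
    and ord': "\<forall>X\<in>?L. \<forall>Y\<in>?L. X \<subseteq> Y \<longleftrightarrow> \<phi> X \<subseteq> \<phi> Y" by (elim exE conjE)
  have ord: "X \<subseteq> Y \<longleftrightarrow> \<phi> X \<subseteq> \<phi> Y" if "X \<in> ?L" "Y \<in> ?L" for X Y
    by (rule ord'[rule_format, OF that])
  have sur: "\<exists>X\<in>?L. Y = \<phi> X" if "Y \<in> ?L'" for Y
    using that unfolding bij_betw_imp_surj_on[OF bij, symmetric] by blast
  have mem: "\<phi> X \<in> ?L'" if "X \<in> ?L" for X
    by (rule bij_betwE[OF bij, rule_format, OF that])
  note top = UNIV_in_intersection_lattice[of \<A>] UNIV_in_intersection_lattice[of \<A>']
  have eq: "\<phi> X = \<phi> Y \<longleftrightarrow> X = Y" if "X \<in> ?L" "Y \<in> ?L" for X Y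
    by (rule inj_on_eq_iff[OF bij_betw_imp_inj_on[OF bij] that])
  have topeq: "\<phi> UNIV = UNIV"
  proof -
    obtain W where W: "W \<in> ?L" "UNIV = \<phi> W" using sur[OF top(2)] by auto
    then show ?thesis using ord[OF W(1) top(1)] by auto
  qed
  have coatom: "X \<in> \<A> \<longleftrightarrow> \<phi> X \<in> \<A>'" if X: "X \<in> ?L" for X
  proof -
    have "(\<forall>Y\<in>?L. X \<subseteq> Y \<longrightarrow> Y = X \<or> Y = UNIV) \<longleftrightarrow> (\<forall>Y\<in>\<phi> ` ?L. \<phi> X \<subseteq> Y \<longrightarrow> Y = \<phi> X \<or> Y = UNIV)"
    proof -
      have "Y = X \<or> Y = UNIV \<longleftrightarrow> \<phi> Y = \<phi> X \<or> \<phi> Y = UNIV" "X \<subseteq> Y \<longleftrightarrow> \<phi> X \<subseteq> \<phi> Y" if "Y \<in> ?L" for Y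
        using eq[OF that X] eq[OF that top(1)] ord[OF X that] topeq by simp_all
      then show ?thesis by simp
    qed
    moreover have "\<phi> ` ?L = ?L'" using bij by (simp add: bij_betw_def)
    moreover have "X \<noteq> UNIV \<longleftrightarrow> \<phi> X \<noteq> UNIV" using eq[OF X top(1)] topeq by simp
    ultimately show ?thesis unfolding lattice_coatom_iff[OF A, of X] lattice_coatom_iff[OF A', of "\<phi> X"]
      using X mem[OF X] by simp
  qed
  have AL: "\<A> \<subseteq> ?L" "\<A>' \<subseteq> ?L'" using in_intersection_lattice by auto
  have int: "\<phi> (X \<inter> Y) = \<phi> X \<inter> \<phi> Y" if X: "X \<in> ?L" and Y: "Y \<in> ?L" for X Y
  proof -
    obtain W where W: "W \<in> ?L" "\<phi> X \<inter> \<phi> Y = \<phi> W" using sur[OF lattice_Int[OF mem[OF X] mem[OF Y]]] by auto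
    have "W \<subseteq> X" "W \<subseteq> Y" using ord[OF W(1) X] ord[OF W(1) Y] W(2) by auto
    then have "\<phi> W \<subseteq> \<phi> (X \<inter> Y)" using ord[OF W(1) lattice_Int[OF X Y]] by auto
    moreover have "\<phi> (X \<inter> Y) \<subseteq> \<phi> X \<inter> \<phi> Y"
      using ord[OF lattice_Int[OF X Y] X] ord[OF lattice_Int[OF X Y] Y] by auto
    ultimately show ?thesis using W(2) by auto
  qed
  have "comb_iso \<A> \<A>' \<phi>" unfolding comb_iso_def
  proof (intro conjI ballI)
    have "\<phi> ` \<A> = \<A>'"
    proof (intro equalityI subsetI)
      fix Y assume Y: "Y \<in> \<A>'"
      then obtain W where W: "W \<in> ?L" "Y = \<phi> W" using sur AL(2) by (meson subsetD)
      then have "W \<in> \<A>" using coatom[OF W(1)] Y by simp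
      then show "Y \<in> \<phi> ` \<A>" using W(2) by simp
    qed (use coatom AL(1) in auto)
    moreover have "inj_on \<phi> \<A>" using eq AL(1) unfolding inj_on_def by auto
    ultimately show "bij_betw \<phi> \<A> \<A>'" unfolding bij_betw_def by simp
    fix H1 H2 H3 assume "H1 \<in> \<A>" "H2 \<in> \<A>" "H3 \<in> \<A>"
    then have "H1 \<in> ?L" "H2 \<in> ?L" "H3 \<in> ?L" using AL(1) by auto
    then show "H1 \<inter> H2 \<subseteq> H3 \<longleftrightarrow> \<phi> H1 \<inter> \<phi> H2 \<subseteq> \<phi> H3"
      using int[of H1 H2] ord[OF lattice_Int[of H1 \<A> H2], of H3] by simp
  qed
  then show thesis by (rule that)
qed

lemma pull_subset_iff:
  assumes "G ** G' = mat 1"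
  shows "pull G X \<subseteq> pull G Y \<longleftrightarrow> X \<subseteq> Y"
proof
  assume *: "pull G X \<subseteq> pull G Y"
  show "X \<subseteq> Y"
  proof
    fix v assume "v \<in> X"
    have "G *v (G' *v v) = v" using assms by (simp add: matrix_vector_mul_assoc)
    then have "G' *v v \<in> pull G X" using \<open>v \<in> X\<close> by (simp add: pull_def)
    then show "v \<in> Y" using * \<open>G *v (G' *v v) = v\<close> by (auto simp: pull_def)
  qed
qed (auto simp: pull_def)

lemma pull_Int: "pull G (X \<inter> Y) = pull G X \<inter> pull G Y"
  by (simp add: pull_def vimage_Int)

lemma pull_inj: "G ** G' = mat 1 \<Longrightarrow> pull G X = pull G Y \<longleftrightarrow> X = Y"
  using pull_subset_iff[of G G' X Y] pull_subset_iff[of G G' Y X] by (simp add: set_eq_subset)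

lemma comb_iso_pull:
  assumes G: "G ** G' = mat 1" and iso: "comb_iso \<A> \<A>' \<psi>"
  shows "comb_iso \<A> (pull G ` \<A>') (\<lambda>H. pull G (\<psi> H))"
proof -
  have "bij_betw \<psi> \<A> \<A>'" using iso by (simp add: comb_iso_def)
  moreover have "bij_betw (pull G) \<A>' (pull G ` \<A>')"
    by (rule inj_on_imp_bij_betw) (simp add: inj_on_def pull_inj[OF G])
  ultimately have "bij_betw (\<lambda>H. pull G (\<psi> H)) \<A> (pull G ` \<A>')"
    using bij_betw_trans[of \<psi> \<A> \<A>' "pull G"] by (simp add: comp_def)
  then show ?thesis
    using iso unfolding comb_iso_def by (simp add: pull_Int[symmetric] pull_subset_iff[OF G])
qed

lemma lattice_isomorphic_pull:
  assumes G: "G ** G' = mat 1" and iso: "lattice_isomorphic \<A> \<A>'"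
  shows "lattice_isomorphic (pull G ` \<A>) \<A>'"
proof -
  from iso[unfolded lattice_isomorphic_def] obtain \<phi>
    where bij: "bij_betw \<phi> (intersection_lattice \<A>) (intersection_lattice \<A>')"
    and ord: "\<forall>X\<in>intersection_lattice \<A>. \<forall>Y\<in>intersection_lattice \<A>. X \<subseteq> Y \<longleftrightarrow> \<phi> X \<subseteq> \<phi> Y"
    by (elim exE conjE)
  have G': "G' ** G = mat 1" using G matrix_left_right_inverse by blast
  have L: "intersection_lattice (pull G ` \<A>) = pull G ` intersection_lattice \<A>"
  proof -
    have lat: "intersection_lattice \<B> = Inter ` Pow \<B>" for \<B>
      by (auto simp: intersection_lattice_def)
    have "\<Inter>(pull G ` \<C>) = pull G (\<Inter>\<C>)" for \<C> by (auto simp: pull_def)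
    then show ?thesis unfolding lat image_Pow_surj[OF refl, symmetric] by (simp add: image_image)
  qed
  have inv: "pull G' (pull G X) = X" for X using pull_inverse[OF G'] .
  have "bij_betw (pull G') (pull G ` intersection_lattice \<A>) (intersection_lattice \<A>)"
    by (rule bij_betwI[where g = "pull G"]) (auto simp: inv)
  then have "bij_betw (\<lambda>X. \<phi> (pull G' X)) (intersection_lattice (pull G ` \<A>)) (intersection_lattice \<A>')"
    using bij_betw_trans[OF _ bij] unfolding L comp_def by blast
  moreover have "X \<subseteq> Y \<longleftrightarrow> \<phi> (pull G' X) \<subseteq> \<phi> (pull G' Y)"
    if "X \<in> intersection_lattice (pull G ` \<A>)" "Y \<in> intersection_lattice (pull G ` \<A>)" for X Y
  proof -
    obtain X' Y' where "X' \<in> intersection_lattice \<A>" "X = pull G X'" "Y' \<in> intersection_lattice \<A>" "Y = pull G Y'"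
      using \<open>X \<in> _\<close> \<open>Y \<in> _\<close> unfolding L by auto
    then show ?thesis using ord by (simp add: inv pull_subset_iff[OF G])
  qed
  ultimately show ?thesis unfolding lattice_isomorphic_def by blast
qed

lemma freeness_depends_only_pull:
  assumes G: "G ** G' = mat 1" and dep: "freeness_depends_only_on_lattice (pull G ` \<A>)"
  shows "freeness_depends_only_on_lattice \<A>"
  using assms lattice_isomorphic_pull[OF G] free_arrangement_pull[OF G]
  unfolding freeness_depends_only_on_lattice_def by blast

text \<open>For \<open>H\<^sub>1 \<noteq> H\<^sub>2\<close> the line \<open>H\<^sub>1 \<inter> H\<^sub>2\<close> is spanned by the cross product of the normals.\<close>

lemma cross_hyperplane_nonzero:
  assumes "a \<noteq> 0" "b \<noteq> 0" "hyperplane a \<noteq> hyperplane b"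
  shows "a \<times> b \<noteq> 0"
proof
  assume "a \<times> b = 0"
  then have "collinear {0, a, b}" by (simp add: cross_eq_0)
  then obtain k where "b = k *\<^sub>R a" using assms(1,2) collinear_lemma[of a b] by auto
  then show False using assms hyperplane_scale by (metis scaleR_zero_left)
qed

text \<open>Concurrence becomes the vanishing of a determinant; this turns incidences into
  polynomial identities in the normals.\<close>

lemma hyperplane_Int_subset_iff:
  assumes "a \<noteq> 0" "b \<noteq> 0" "hyperplane a \<noteq> hyperplane b"
  shows "hyperplane a \<inter> hyperplane b \<subseteq> hyperplane c \<longleftrightarrow> c \<bullet> (a \<times> b) = 0"
proof
  assume "hyperplane a \<inter> hyperplane b \<subseteq> hyperplane c"
  moreover have "a \<times> b \<in> hyperplane a \<inter> hyperplane b" by (simp add: hyperplane_def dot_cross_self)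
  ultimately show "c \<bullet> (a \<times> b) = 0" by (auto simp: hyperplane_def)
next
  assume c: "c \<bullet> (a \<times> b) = 0"
  show "hyperplane a \<inter> hyperplane b \<subseteq> hyperplane c"
  proof
    fix v assume "v \<in> hyperplane a \<inter> hyperplane b"
    then have "a \<bullet> v = 0" "b \<bullet> v = 0" by (simp_all add: hyperplane_def)
    then have "v \<times> (a \<times> b) = 0" by (simp add: Lagrange inner_commute)
    then have "collinear {0, a \<times> b, v}" using cross_skew cross_eq_0 by (metis neg_0_equal_iff_equal)
    then obtain k where "v = k *\<^sub>R (a \<times> b)"
      using cross_hyperplane_nonzero[OF assms] collinear_lemma[of "a \<times> b" v] by (metis scaleR_zero_left)
    then show "v \<in> hyperplane c" using c by (simp add: hyperplane_def)
  qed
qed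

text \<open>The normals form a frame of the projective plane.\<close>

definition generic_frame :: "(real^3) set \<Rightarrow> (real^3) set \<Rightarrow> (real^3) set \<Rightarrow> (real^3) set \<Rightarrow> bool" where
  "generic_frame H1 H2 H3 H4 \<longleftrightarrow> H1 \<noteq> H2 \<and> H1 \<noteq> H3 \<and> H2 \<noteq> H3 \<and>
     \<not> H1 \<inter> H2 \<subseteq> H3 \<and> \<not> H1 \<inter> H2 \<subseteq> H4 \<and> \<not> H1 \<inter> H3 \<subseteq> H4 \<and> \<not> H2 \<inter> H3 \<subseteq> H4"

lemma generic_frame_standardize:
  assumes a: "a1 \<noteq> 0" "a2 \<noteq> 0" "a3 \<noteq> 0"
    and gen: "generic_frame (hyperplane a1) (hyperplane a2) (hyperplane a3) (hyperplane a4)"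
  obtains G G' where "G ** G' = mat 1" "pull G (hyperplane a1) = hyperplane (axis 1 1)"
    "pull G (hyperplane a2) = hyperplane (axis 2 1)" "pull G (hyperplane a3) = hyperplane (axis 3 1)"
    "pull G (hyperplane a4) = hyperplane (vector [1, 1, 1])"
proof -
  define c where "c = a3 \<bullet> (a1 \<times> a2)"
  \<comment> \<open>Cramer's rule: y holds the coordinates of a4 in the basis a1, a2, a3. Rescaling
    the basis vectors by them makes a4 their sum, and M is the inverse of the rescaled basis, with
    rows from the dual basis.\<close>
  define y :: "real^3" where "y = vector [a4 \<bullet> (a2 \<times> a3) / c, - (a4 \<bullet> (a1 \<times> a3)) / c, a4 \<bullet> (a1 \<times> a2) / c]"
  have c: "c \<noteq> 0" unfolding c_def
    using gen hyperplane_Int_subset_iff[OF a(1,2), of a3] unfolding generic_frame_def by auto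
  have y: "y $ 1 \<noteq> 0" "y $ 2 \<noteq> 0" "y $ 3 \<noteq> 0"
    using gen c hyperplane_Int_subset_iff[OF a(1,2), of a4] hyperplane_Int_subset_iff[OF a(1,3), of a4]
      hyperplane_Int_subset_iff[OF a(2,3), of a4]
    unfolding generic_frame_def y_def by auto
  define M :: "real^3^3" where
    "M = vector [(1 / (c * y$1)) *\<^sub>R (a2 \<times> a3), (1 / (c * y$2)) *\<^sub>R (a3 \<times> a1), (1 / (c * y$3)) *\<^sub>R (a1 \<times> a2)]"
  have Mv: "M *v v = vector [(a2 \<times> a3) \<bullet> v / (c * y$1), (a3 \<times> a1) \<bullet> v / (c * y$2), (a1 \<times> a2) \<bullet> v / (c * y$3)]" for v
    by (simp add: vec_eq_iff forall_3 vector_3 matrix_mult_dot M_def)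
  have trip: "(a2 \<times> a3) \<bullet> a1 = c" "(a3 \<times> a1) \<bullet> a2 = c" "(a1 \<times> a2) \<bullet> a3 = c"
    unfolding c_def by (simp_all add: cross3_simps)
  have M1: "M *v a1 = (1 / y$1) *\<^sub>R axis 1 1" "M *v a2 = (1 / y$2) *\<^sub>R axis 2 1" "M *v a3 = (1 / y$3) *\<^sub>R axis 3 1"
    unfolding Mv using c by (simp_all add: vec_eq_iff forall_3 vector_3 axis_def trip dot_cross_self)
  have y': "(a2 \<times> a3) \<bullet> a4 = c * y$1" "(a3 \<times> a1) \<bullet> a4 = c * y$2" "(a1 \<times> a2) \<bullet> a4 = c * y$3"
    using c cross_skew[of a3 a1] by (simp_all add: y_def vector_3 inner_commute)
  have M4: "M *v a4 = vector [1, 1, 1]"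
    unfolding Mv y' using c y by simp
  define M' :: "real^3^3" where "M' = transpose (vector [y$1 *\<^sub>R a1, y$2 *\<^sub>R a2, y$3 *\<^sub>R a3])"
  have "M ** M' = mat 1"
  proof -
    have "M' *v axis i 1 = (vector [y$1 *\<^sub>R a1, y$2 *\<^sub>R a2, y$3 *\<^sub>R a3] :: real^3^3) $ i" for i
      unfolding M'_def by (simp add: matrix_vector_mult_basis row_def vec_eq_iff)
    then have "M' *v axis 1 1 = y$1 *\<^sub>R a1" "M' *v axis 2 1 = y$2 *\<^sub>R a2" "M' *v axis 3 1 = y$3 *\<^sub>R a3"
      by (simp_all only: vector_3)
    then have "M *v (M' *v axis i 1) = axis i 1" for i
      using M1 y exhaust_3[of i] by (auto simp: matrix_vector_mult_scaleR)
    then have "column i (M ** M') = column i (mat 1)" for i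
      by (simp add: matrix_vector_mul_assoc flip: matrix_vector_mult_basis)
    then show ?thesis by (simp add: vec_eq_iff column_def)
  qed
  \<comment> \<open>M acts on normals, and \<open>pull\<close> acts on normals by the transpose of
    its matrix.\<close>
  then have G: "transpose M ** transpose M' = mat 1"
    using matrix_left_right_inverse[of M M'] by (metis matrix_transpose_mul transpose_mat)
  show thesis
    by (rule that[OF G]) (use M1 M4 y in \<open>simp_all add: pull_hyperplane transpose_transpose hyperplane_scale del: transpose_matrix_vector\<close>)
qed

lemma comb_iso_generic_frame:
  assumes iso: "comb_iso \<A> \<A>' \<psi>" and H: "H1 \<in> \<A>" "H2 \<in> \<A>" "H3 \<in> \<A>" "H4 \<in> \<A>"
    and gen: "generic_frame H1 H2 H3 H4"
  shows "generic_frame (\<psi> H1) (\<psi> H2) (\<psi> H3) (\<psi> H4)"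
  using gen comb_isoD[OF iso] H unfolding generic_frame_def by simp

lemma comb_iso_normalize:
  assumes A: "arrangement \<A>" "arrangement \<A>'" and iso: "comb_iso \<A> \<A>' \<psi>"
    and H: "H1 \<in> \<A>" "H2 \<in> \<A>" "H3 \<in> \<A>" "H4 \<in> \<A>" and gen: "generic_frame H1 H2 H3 H4"
  obtains G G' where "G ** G' = mat 1" "pull G (\<psi> H1) = H1" "pull G (\<psi> H2) = H2"
    "pull G (\<psi> H3) = H3" "pull G (\<psi> H4) = H4"
proof -
  have *: "\<exists>a. a \<noteq> 0 \<and> K = hyperplane a" if "K \<in> \<A> \<union> \<A>'" for K
    using A that unfolding arrangement_def by blast
  have H': "\<psi> H1 \<in> \<A>'" "\<psi> H2 \<in> \<A>'" "\<psi> H3 \<in> \<A>'" "\<psi> H4 \<in> \<A>'"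
    using comb_isoD(1)[OF iso] H by blast+
  obtain a1 a2 a3 a4 where a: "a1 \<noteq> 0" "H1 = hyperplane a1" "a2 \<noteq> 0" "H2 = hyperplane a2"
    "a3 \<noteq> 0" "H3 = hyperplane a3" "a4 \<noteq> 0" "H4 = hyperplane a4"
    using *[of H1] *[of H2] *[of H3] *[of H4] H by blast
  obtain n1 n2 n3 n4 where n: "n1 \<noteq> 0" "\<psi> H1 = hyperplane n1" "n2 \<noteq> 0" "\<psi> H2 = hyperplane n2"
    "n3 \<noteq> 0" "\<psi> H3 = hyperplane n3" "n4 \<noteq> 0" "\<psi> H4 = hyperplane n4"
    using *[of "\<psi> H1"] *[of "\<psi> H2"] *[of "\<psi> H3"] *[of "\<psi> H4"] H' by blast
  note gen' = comb_iso_generic_frame[OF iso H gen]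
  obtain M M' where M: "M ** M' = mat 1" "pull M H1 = hyperplane (axis 1 1)"
    "pull M H2 = hyperplane (axis 2 1)" "pull M H3 = hyperplane (axis 3 1)"
    "pull M H4 = hyperplane (vector [1, 1, 1])"
    using generic_frame_standardize[OF a(1) a(3) a(5) gen[unfolded a(2) a(4) a(6) a(8)]] a by metis
  obtain N N' where N: "N ** N' = mat 1" "pull N (\<psi> H1) = hyperplane (axis 1 1)"
    "pull N (\<psi> H2) = hyperplane (axis 2 1)" "pull N (\<psi> H3) = hyperplane (axis 3 1)"
    "pull N (\<psi> H4) = hyperplane (vector [1, 1, 1])"
    using generic_frame_standardize[OF n(1) n(3) n(5) gen'[unfolded n(2) n(4) n(6) n(8)]] n by metis
  have M': "M' ** M = mat 1" using M(1) matrix_left_right_inverse by blast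
  \<comment> \<open>Both frames are brought to the standard one; the required map is the
    standardization of the image frame followed by the inverse of that of the original
    frame.\<close>
  have "(N ** M') ** (M ** N') = N ** (M' ** M) ** N'" by (simp only: matrix_mul_assoc)
  then have G: "(N ** M') ** (M ** N') = mat 1" using M' N(1) by simp
  have "pull (N ** M') (\<psi> K) = K" if "pull N (\<psi> K) = pull M K" for K
    using that pull_inverse[OF M', of K] by (simp add: pull_pull[symmetric])
  then show thesis using that[OF G] M N by simp
qed

section \<open>Arrangements with a modular point\<close>

text \<open>The part of a form without z, as a polynomial in the two inner variables. With the
  modular point at x1 = x2 = 0, the pencil has normals with \<open>n $ 3 = 0\<close>; all other
  normals are scaled to \<open>m $ 3 = 1\<close>, and their forms vanish at z =
  \<open>- lin2 m\<close>.\<close>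

definition lin2 :: "real^3 \<Rightarrow> real poly poly" where
  "lin2 n = [:[:0, n $ 1:], [:n $ 2:]:]"

abbreviation const2 :: "real \<Rightarrow> real poly poly" where
  "const2 c \<equiv> [:[:c:]:]"

lemma linear_form_lin2: "linear_form n = [:lin2 n, const2 (n $ 3):]"
  by (simp add: linear_form_pCons lin2_def)

lemma lin2_add_scale: "lin2 (m + c *\<^sub>R n) = lin2 m + const2 c * lin2 n"
  by (simp add: lin2_def)

lemma const_poly_prod: "(\<Prod>i\<in>I. [:f i:]) = [:\<Prod>i\<in>I. f i:]"
  by (induction I rule: infinite_finite_induct) (simp_all add: one_pCons mult.commute)

lemma prime_elem_lin2:
  assumes "n \<noteq> 0" "n $ 3 = 0"
  shows "prime_elem (lin2 n)"
proof -
  have "prime_elem [:lin2 n:]" using prime_elem_linear_form[OF assms(1)] assms(2) by (simp add: linear_form_lin2)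
  then show ?thesis by (simp add: prime_elem_const_poly_iff)
qed

lemma lin2_dvd:
  assumes "lin2 m dvd lin2 n" "m \<noteq> 0" "n \<noteq> 0" "m $ 3 = 0" "n $ 3 = 0"
  shows "hyperplane m = hyperplane n"
proof -
  have "linear_form m dvd linear_form n" using assms by (simp add: linear_form_lin2)
  then show ?thesis using linear_form_dvd assms by blast
qed

lemma prod_const2_scale:
  assumes "finite T" "\<And>m. m \<in> T \<Longrightarrow> c m \<noteq> (0::real)"
  shows "\<exists>k. k * (\<Prod>m\<in>T. const2 (c m) * f m) = (\<Prod>m\<in>T. f m)"
proof (intro exI)
  have "(\<Prod>m\<in>T. const2 (1 / c m)) * (\<Prod>m\<in>T. const2 (c m) * f m) = (\<Prod>m\<in>T. const2 (1 / c m) * (const2 (c m) * f m))"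
    by (simp only: prod.distrib)
  also have "\<dots> = (\<Prod>m\<in>T. f m)"
  proof (rule prod.cong)
    fix m assume "m \<in> T"
    have "const2 (1 / c m) * const2 (c m) = 1" using assms(2)[OF \<open>m \<in> T\<close>] by (simp add: one_pCons)
    then show "const2 (1 / c m) * (const2 (c m) * f m) = f m" by (simp only: mult.assoc[symmetric] mult_1)
  qed simp
  finally show "(\<Prod>m\<in>T. const2 (1 / c m)) * (\<Prod>m\<in>T. const2 (c m) * f m) = (\<Prod>m\<in>T. f m)" .
qed

lemma prod_linear_poly_dvd:
  fixes r :: "'i \<Rightarrow> 'a::idom"
  assumes "finite T" "inj_on r T" "\<And>i. i \<in> T \<Longrightarrow> poly G (r i) = 0"
  shows "(\<Prod>i\<in>T. [:- r i, 1:]) dvd G"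
proof (rule prod_prime_dvd[OF assms(1)])
  show "\<not> [:- r i, 1:] dvd [:- r j, 1:]" if "i \<in> T" "j \<in> T" "i \<noteq> j" for i j
    using that assms(2) by (auto simp: poly_eq_0_iff_dvd[symmetric] inj_on_def)
qed (use assms(3) in \<open>simp_all add: prime_elem_linear_poly poly_eq_0_iff_dvd[symmetric]\<close>)

lemma shift_mult_cancel: "- ((a + c * n) * q) + a * q + c * f = c * (f - n * q)" for a :: "'a::comm_ring_1"
  by (simp add: algebra_simps)

text \<open>The extension to one more line \<open>m\<^sub>0\<close> is governed by the lines through the pencil line \<open>n\<close>:
  restricted to the direction of \<open>n\<close>, the error is a polynomial in one variable whose zeros are the
  lines already treated.\<close>

lemma modular_interpolation:
  assumes N: "finite N" "\<And>n. n \<in> N \<Longrightarrow> n \<noteq> 0 \<and> n $ 3 = 0" "inj_on hyperplane N"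
    and M: "finite M" "\<And>m m'. m \<in> M \<Longrightarrow> m' \<in> M \<Longrightarrow> m \<noteq> m' \<Longrightarrow> \<exists>n\<in>N. \<exists>c. m - m' = c *\<^sub>R n"
    and Q: "\<And>n. n \<in> N \<Longrightarrow> lin2 n dvd const2 (n $ 2) * Q"
  shows "\<exists>g. \<forall>m\<in>M. poly g (- lin2 m) = - (const2 (m $ 2) * Q)"
  using M
proof (induction M rule: finite_induct)
  case empty
  then show ?case by simp
next
  case (insert m0 M)
  obtain g where g: "\<And>m. m \<in> M \<Longrightarrow> poly g (- lin2 m) = - (const2 (m $ 2) * Q)"
    using insert.IH insert.prems by blast
  have "\<forall>m\<in>M. \<exists>n c. n \<in> N \<and> m - m0 = c *\<^sub>R n" using insert.prems insert.hyps(2) by blast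
  then obtain f c where fc: "\<And>m. m \<in> M \<Longrightarrow> f m \<in> N" "\<And>m. m \<in> M \<Longrightarrow> m - m0 = c m *\<^sub>R f m"
    by metis
  have c0: "c m \<noteq> 0" if "m \<in> M" for m
    using fc(2)[OF that] that insert.hyps(2) by auto
  \<comment> \<open>The defect at the new node. It will be divisible by the product of all
    differences of nodes; \<open>T n\<close> collects the treated lines that meet \<open>m0\<close>
    on the pencil line n.\<close>
  define e where "e = poly g (- lin2 m0) + const2 (m0 $ 2) * Q"
  define T where "T n = {m \<in> M. f m = n}" for n
  have pow: "lin2 n ^ card (T n) dvd e" if n: "n \<in> N" for n
  proof -
    obtain F where F: "const2 (n $ 2) * Q = lin2 n * F" using Q[OF n] unfolding dvd_def by blast
    \<comment> \<open>The defect along the direction n with parameter t: at t = 0 it is e, and t =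
      \<open>const2 (c m) * lin2 n\<close> leads to the node of m, where it is already zero. The
      quotient F makes it a polynomial in t, so its roots give a factor \<open>lin2 n\<close> for
      each m in \<open>T n\<close>.\<close>
    define G where "G = pcompose g [:- lin2 m0, -1:] + [:const2 (m0 $ 2) * Q:] + [:0, F:]"
    have lm: "lin2 m = lin2 m0 + const2 (c m) * lin2 n" "m $ 2 = m0 $ 2 + c m * n $ 2" if "m \<in> T n" for m
    proof -
      have m: "m = m0 + c m *\<^sub>R n" using fc(2)[of m] that unfolding T_def by (simp add: algebra_simps)
      show "lin2 m = lin2 m0 + const2 (c m) * lin2 n" by (subst m) (rule lin2_add_scale)
      show "m $ 2 = m0 $ 2 + c m * n $ 2" by (subst m) simp
    qed
    have root: "poly G (const2 (c m) * lin2 n) = 0" if "m \<in> T n" for m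
    proof -
      have "poly G (const2 (c m) * lin2 n) = poly g (- lin2 m) + const2 (m0 $ 2) * Q + const2 (c m) * (lin2 n * F)"
        by (simp add: G_def poly_pcompose lm(1)[OF that] algebra_simps)
      also have "poly g (- lin2 m) = - (const2 (m $ 2) * Q)" using g that by (simp add: T_def)
      also have "const2 (m $ 2) = const2 (m0 $ 2) + const2 (c m) * const2 (n $ 2)" by (simp add: lm(2)[OF that])
      also have "- ((const2 (m0 $ 2) + const2 (c m) * const2 (n $ 2)) * Q) + const2 (m0 $ 2) * Q
          + const2 (c m) * (lin2 n * F) = const2 (c m) * (lin2 n * F - const2 (n $ 2) * Q)"
        by (rule shift_mult_cancel)
      finally show ?thesis by (simp only: F diff_self mult_zero_right)
    qed
    have fin: "finite (T n)" using insert.hyps(1) by (simp add: T_def)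
    have n0: "lin2 n \<noteq> 0" using N(2)[OF n] prime_elem_lin2[of n] by (auto simp: prime_elem_def)
    have "inj_on (\<lambda>m. const2 (c m) * lin2 n) (T n)"
    proof (rule inj_onI)
      fix m m' assume m: "m \<in> T n" "m' \<in> T n" and "const2 (c m) * lin2 n = const2 (c m') * lin2 n"
      then have "const2 (c m) = const2 (c m')" using n0 by (metis mult_right_cancel)
      then have "c m = c m'" by simp
      then have "m - m0 = m' - m0" using fc(2)[of m] fc(2)[of m'] m by (simp add: T_def)
      then show "m = m'" by simp
    qed
    from prod_linear_poly_dvd[OF fin this root]
    obtain K where K: "G = (\<Prod>m\<in>T n. [:- (const2 (c m) * lin2 n), 1:]) * K"
      unfolding dvd_def by blast
    have "e = poly G 0" by (simp add: G_def e_def poly_pcompose)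
    also have "\<dots> = (\<Prod>m\<in>T n. const2 (- c m) * lin2 n) * poly K 0"
    proof -
      have "poly [:- (const2 (c m) * lin2 n), 1:] 0 = const2 (- c m) * lin2 n" for m
      proof -
        have "const2 (- c m) = - const2 (c m)" by simp
        then have "const2 (- c m) * lin2 n = - (const2 (c m) * lin2 n)" by (simp only: mult_minus_left)
        then show ?thesis by simp
      qed
      then show ?thesis by (simp only: K poly_mult poly_prod)
    qed
    finally have e: "e = (\<Prod>m\<in>T n. const2 (- c m) * lin2 n) * poly K 0" .
    have "(\<Prod>m\<in>T n. const2 (- c m) * lin2 n) = (\<Prod>m\<in>T n. const2 (- c m)) * lin2 n ^ card (T n)"
      by (simp only: prod.distrib prod_constant)
    then show ?thesis unfolding e by simp
  qed
  have "(\<Prod>n\<in>N. lin2 n ^ card (T n)) dvd e"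
  proof (rule prod_prime_power_dvd[OF N(1)])
    show "\<not> lin2 n dvd lin2 n'" if "n \<in> N" "n' \<in> N" "n \<noteq> n'" for n n'
      using that N(2,3) lin2_dvd unfolding inj_on_def by metis
  qed (use N(2) prime_elem_lin2 pow in blast)+
  also have "(\<Prod>n\<in>N. lin2 n ^ card (T n)) = (\<Prod>n\<in>N. \<Prod>m\<in>T n. lin2 (f m))"
    by (rule prod.cong) (simp_all add: T_def)
  also have "\<dots> = (\<Prod>m\<in>M. lin2 (f m))"
    unfolding T_def by (rule prod.group) (use insert.hyps(1) N(1) fc(1) in auto)
  finally have "(\<Prod>m\<in>M. lin2 (f m)) dvd e" .
  moreover have "\<exists>k. k * (\<Prod>m\<in>M. const2 (c m) * lin2 (f m)) = (\<Prod>m\<in>M. lin2 (f m))"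
    by (rule prod_const2_scale[OF insert.hyps(1) c0])
  then obtain k where "k * (\<Prod>m\<in>M. const2 (c m) * lin2 (f m)) = (\<Prod>m\<in>M. lin2 (f m))" ..
  ultimately have "k * (\<Prod>m\<in>M. const2 (c m) * lin2 (f m)) dvd e" by (simp only:)
  then have "(\<Prod>m\<in>M. const2 (c m) * lin2 (f m)) dvd e" by (rule dvd_mult_right)
  moreover have "(\<Prod>m\<in>M. const2 (c m) * lin2 (f m)) = (\<Prod>m\<in>M. lin2 m - lin2 m0)"
  proof (rule prod.cong)
    fix m assume "m \<in> M"
    have "m = m0 + c m *\<^sub>R f m" using fc(2)[OF \<open>m \<in> M\<close>] by (simp add: algebra_simps)
    then have "lin2 m = lin2 (m0 + c m *\<^sub>R f m)" by (rule arg_cong)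
    then have "lin2 m = lin2 m0 + const2 (c m) * lin2 (f m)" by (simp only: lin2_add_scale)
    then show "const2 (c m) * lin2 (f m) = lin2 m - lin2 m0" by simp
  qed simp
  ultimately obtain d where d: "e = (\<Prod>m\<in>M. lin2 m - lin2 m0) * d" unfolding dvd_def by auto
  \<comment> \<open>Newton's correction: the product vanishes at all earlier nodes and at the new
    one equals the product of differences, so subtracting it times d removes exactly e.\<close>
  define g' where "g' = g - (\<Prod>m\<in>M. [:lin2 m, 1:]) * [:d:]"
  have "poly g' (- lin2 m) = - (const2 (m $ 2) * Q)" if "m \<in> M" for m
  proof -
    have "(\<Prod>m'\<in>M. lin2 m' - lin2 m) = 0"
      by (rule prod_zero) (use insert.hyps(1) that in auto)
    then show ?thesis using g[OF that] by (simp add: g'_def poly_prod)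
  qed
  moreover have "poly g' (- lin2 m0) = - (const2 (m0 $ 2) * Q)"
  proof -
    have "poly g' (- lin2 m0) = poly g (- lin2 m0) - e" by (simp add: g'_def poly_prod d)
    then show ?thesis by (simp add: e_def)
  qed
  ultimately show ?case by (intro exI[of _ g']) simp
qed

lemma Euler_in_log_der: "mk_der X1 X2 Z \<in> log_der \<A>"
proof -
  have "mk_der X1 X2 Z (linear_form a) = linear_form a" for a
    by (simp add: derivation_linear_form[OF derivation_mk_der]) (simp add: linear_form_def)
  then show ?thesis by (simp add: log_der_def derivation_mk_der)
qed

text \<open>N is the pencil, M the other lines. The basis is the Euler derivation, \<open>Q\<close>
  times the x2-derivative plus g times the z-derivative, and the product of M times the
  z-derivative. Tangency of the second to M is exactly the interpolation condition on g. The factor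
  x1 is left out of \<open>Q\<close>, since the second derivation already kills x1.\<close>

lemma modular_free_coordinates:
  assumes N: "finite N" "\<And>n. n \<in> N \<Longrightarrow> n \<noteq> 0 \<and> n $ 3 = 0" "axis 1 1 \<in> N"
    and M: "finite M" "\<And>m. m \<in> M \<Longrightarrow> m $ 3 = 1"
    and inj: "inj_on hyperplane (N \<union> M)"
    and modular: "\<And>m m'. m \<in> M \<Longrightarrow> m' \<in> M \<Longrightarrow> m \<noteq> m' \<Longrightarrow> \<exists>n\<in>N. \<exists>c. m - m' = c *\<^sub>R n"
  shows "free_arrangement (hyperplane ` (N \<union> M))"
proof -
  let ?N = "N - {axis 1 1}"
  define Q where "Q = (\<Prod>n\<in>?N. lin2 n)"
  have Q_dvd: "lin2 n dvd const2 (n $ 2) * Q" if "n \<in> N" for n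
  proof (cases "n = axis 1 1")
    case True
    then show ?thesis by (simp add: axis_def)
  next
    case False
    then have "lin2 n dvd Q" using that N(1) unfolding Q_def by (intro dvd_prodI) auto
    then show ?thesis by (rule dvd_mult)
  qed
  obtain g where g: "\<And>m. m \<in> M \<Longrightarrow> poly g (- lin2 m) = - (const2 (m $ 2) * Q)"
    using modular_interpolation[OF N(1,2) inj_on_subset[OF inj] M(1) modular Q_dvd] by blast
  have 0: "0 \<notin> N \<union> M" using N(2) M(2) by force
  have "log_basis (hyperplane ` (N \<union> M)) (mk_der X1 X2 Z) (mk_der 0 [:Q:] g) (mk_der 0 0 (\<Prod>m\<in>M. linear_form m))"
  proof (rule Saito_criterion[where c = 1])
    show "mk_der X1 X2 Z \<in> log_der (hyperplane ` (N \<union> M))" by (rule Euler_in_log_der)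
    show "mk_der 0 [:Q:] g \<in> log_der (hyperplane ` (N \<union> M))"
      unfolding log_der_hyperplane_image[OF 0]
    proof (intro conjI ballI derivation_mk_der)
      fix n assume "n \<in> N \<union> M"
      have *: "mk_der 0 [:Q:] g (linear_form n) = [:const2 (n $ 2) * Q:] + Const (n $ 3) * g"
        by (simp add: derivation_linear_form[OF derivation_mk_der] Const_def)
      show "linear_form n dvd mk_der 0 [:Q:] g (linear_form n)"
      proof (cases "n \<in> N")
        case True
        then have "linear_form n = [:lin2 n:]" using N(2) by (simp add: linear_form_lin2)
        then show ?thesis unfolding * using N(2)[OF True] Q_dvd[OF True] by simp
      next
        case False
        then have n: "n \<in> M" using \<open>n \<in> N \<union> M\<close> by blast
        then have "linear_form n = [:- (- lin2 n), 1:]" using M(2) by (simp add: linear_form_lin2 one_pCons)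
        moreover have "poly (mk_der 0 [:Q:] g (linear_form n)) (- lin2 n) = 0"
          unfolding * using g[OF n] M(2)[OF n] by simp
        ultimately show ?thesis by (simp only: poly_eq_0_iff_dvd)
      qed
    qed
    show "mk_der 0 0 (\<Prod>m\<in>M. linear_form m) \<in> log_der (hyperplane ` (N \<union> M))"
      unfolding log_der_hyperplane_image[OF 0]
    proof (intro conjI ballI derivation_mk_der)
      fix n assume n: "n \<in> N \<union> M"
      have "linear_form n dvd Const (n $ 3) * (\<Prod>m\<in>M. linear_form m)"
      proof (cases "n \<in> N")
        case True
        then show ?thesis using N(2) by simp
      next
        case False
        then have "linear_form n dvd (\<Prod>m\<in>M. linear_form m)" using n M(1) by (intro dvd_prodI) auto
        then show ?thesis by (rule dvd_mult)
      qed
      then show "linear_form n dvd mk_der 0 0 (\<Prod>m\<in>M. linear_form m) (linear_form n)"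
        by (simp add: derivation_linear_form[OF derivation_mk_der])
    qed
    have disj: "N \<inter> M = {}" using N(2) M(2) by force
    have "(\<Prod>n\<in>?N. linear_form n) = [:Q:]"
      unfolding Q_def const_poly_prod[symmetric] by (rule prod.cong) (use N(2) in \<open>auto simp: linear_form_lin2\<close>)
    then have "(\<Prod>n\<in>N. linear_form n) = X1 * [:Q:]"
      using prod.remove[OF N(1,3), of linear_form] by (simp add: linear_form_axis)
    then show "jac (mk_der X1 X2 Z) (mk_der 0 [:Q:] g) (mk_der 0 0 (\<Prod>m\<in>M. linear_form m)) =
        Const 1 * (\<Prod>n\<in>N \<union> M. linear_form n)"
      unfolding prod.union_disjoint[OF N(1) M(1) disj] by (simp add: jac_def mult.assoc)
  qed (use N(1) M(1) 0 inj in auto)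
  then show ?thesis by (rule log_basis_free)
qed

text \<open>Two lines are completed to a frame by the cross product of their normals and the sum of
  all three vectors.\<close>

lemma pencil_standardize:
  assumes a: "a1 \<noteq> 0" "a2 \<noteq> 0" and ne: "hyperplane a1 \<noteq> hyperplane a2"
  obtains G G' where "G ** G' = mat 1" "pull G (hyperplane a1) = hyperplane (axis 1 1)"
    "pull G (hyperplane a2) = hyperplane (axis 2 1)"
proof -
  define a3 where "a3 = a1 \<times> a2"
  have a3: "a3 \<noteq> 0" using cross_hyperplane_nonzero[OF a ne] by (simp add: a3_def)
  have "a3 \<in> hyperplane a1" "a3 \<in> hyperplane a2" "a3 \<notin> hyperplane a3"
    using a3 by (simp_all add: hyperplane_def a3_def dot_cross_self)
  then have ne3: "hyperplane a1 \<noteq> hyperplane a3" "hyperplane a2 \<noteq> hyperplane a3" by blast+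
  have "(a1 + a2 + a3) \<bullet> (a1 \<times> a2) = a3 \<bullet> a3" "(a1 + a2 + a3) \<bullet> (a1 \<times> a3) = - (a3 \<bullet> a3)"
    "(a1 + a2 + a3) \<bullet> (a2 \<times> a3) = a3 \<bullet> a3"
    unfolding a3_def by (simp_all add: cross3_simps)
  then have "generic_frame (hyperplane a1) (hyperplane a2) (hyperplane a3) (hyperplane (a1 + a2 + a3))"
    using a3 ne ne3 hyperplane_Int_subset_iff[OF a ne] hyperplane_Int_subset_iff[OF a(1) a3 ne3(1)]
      hyperplane_Int_subset_iff[OF a(2) a3 ne3(2)]
    unfolding generic_frame_def by (simp add: a3_def[symmetric])
  then obtain G G' where "G ** G' = mat 1" "pull G (hyperplane a1) = hyperplane (axis 1 1)"
    "pull G (hyperplane a2) = hyperplane (axis 2 1)"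
    by (rule generic_frame_standardize[OF a a3])
  then show thesis by (rule that)
qed

text \<open>Modularity, in the lattice sense, of the rank-two flat \<open>H1 \<inter> H2\<close>,
  which makes the arrangement supersolvable. It is expressed by triple incidences only, so that
  \<open>comb_iso\<close> preserves it.\<close>

definition modular_at :: "(real^3) set set \<Rightarrow> (real^3) set \<Rightarrow> (real^3) set \<Rightarrow> bool" where
  "modular_at \<A> H1 H2 \<longleftrightarrow> H1 \<in> \<A> \<and> H2 \<in> \<A> \<and> H1 \<noteq> H2 \<and>
     (\<forall>H\<in>\<A>. \<forall>H'\<in>\<A>. H \<noteq> H' \<and> \<not> H1 \<inter> H2 \<subseteq> H \<and> \<not> H1 \<inter> H2 \<subseteq> H' \<longrightarrow>
        (\<exists>K\<in>\<A>. H1 \<inter> H2 \<subseteq> K \<and> H \<inter> H' \<subseteq> K))"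

lemma modular_atD:
  assumes "modular_at \<A> H1 H2"
  shows "H1 \<in> \<A>" "H2 \<in> \<A>" "H1 \<noteq> H2"
    "H \<in> \<A> \<Longrightarrow> H' \<in> \<A> \<Longrightarrow> H \<noteq> H' \<Longrightarrow> \<not> H1 \<inter> H2 \<subseteq> H \<Longrightarrow> \<not> H1 \<inter> H2 \<subseteq> H' \<Longrightarrow>
      \<exists>K\<in>\<A>. H1 \<inter> H2 \<subseteq> K \<and> H \<inter> H' \<subseteq> K"
  using assms unfolding modular_at_def by simp_all

lemma modular_at_comb_iso:
  assumes iso: "comb_iso \<A> \<A>' \<psi>" and m: "modular_at \<A> H1 H2"
  shows "modular_at \<A>' (\<psi> H1) (\<psi> H2)"
proof -
  note H = modular_atD(1-3)[OF m]
  note inc = comb_isoD(3)[OF iso]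
  have img: "\<A>' = \<psi> ` \<A>" using iso by (simp add: comb_iso_def bij_betw_def)
  show ?thesis unfolding modular_at_def
  proof (intro conjI ballI impI; (elim conjE)?)
    show "\<psi> H1 \<in> \<A>'" "\<psi> H2 \<in> \<A>'" using H img by simp_all
    show "\<psi> H1 \<noteq> \<psi> H2" using H comb_isoD(2)[OF iso H(1,2)] by simp
    fix X X' assume X: "X \<in> \<A>'" "X' \<in> \<A>'" "X \<noteq> X'" "\<not> \<psi> H1 \<inter> \<psi> H2 \<subseteq> X" "\<not> \<psi> H1 \<inter> \<psi> H2 \<subseteq> X'"
    obtain H H' where HH: "H \<in> \<A>" "X = \<psi> H" "H' \<in> \<A>" "X' = \<psi> H'" using X(1,2) unfolding img by auto
    have "H \<noteq> H'" "\<not> H1 \<inter> H2 \<subseteq> H" "\<not> H1 \<inter> H2 \<subseteq> H'"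
      using X(3-5) inc[OF H(1,2)] HH by auto
    from modular_atD(4)[OF m HH(1,3) this]
    obtain K where K: "K \<in> \<A>" "H1 \<inter> H2 \<subseteq> K" "H \<inter> H' \<subseteq> K" by auto
    have "\<psi> K \<in> \<A>'" "\<psi> H1 \<inter> \<psi> H2 \<subseteq> \<psi> K" "X \<inter> X' \<subseteq> \<psi> K"
      using K inc[OF H(1,2) K(1)] inc[OF HH(1,3) K(1)] img HH(2,4) by simp_all
    then show "\<exists>K\<in>\<A>'. \<psi> H1 \<inter> \<psi> H2 \<subseteq> K \<and> X \<inter> X' \<subseteq> K" by (intro bexI[of _ "\<psi> K"] conjI)
  qed
qed

theorem modular_at_free:
  assumes A: "arrangement \<A>" and m: "modular_at \<A> H1 H2"
  shows "free_arrangement \<A>"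
proof -
  note H = modular_atD(1-3)[OF m]
  obtain a1 where a1: "a1 \<noteq> 0" "H1 = hyperplane a1" using arrangement_normal[OF A H(1)] .
  obtain a2 where a2: "a2 \<noteq> 0" "H2 = hyperplane a2" using arrangement_normal[OF A H(2)] .
  have "hyperplane a1 \<noteq> hyperplane a2" using H(3) a1 a2 by simp
  then obtain G G' where G: "G ** G' = mat 1" and P1: "pull G H1 = hyperplane (axis 1 1)"
    and P2: "pull G H2 = hyperplane (axis 2 1)"
    unfolding a1(2) a2(2) by (rule pencil_standardize[OF a1(1) a2(1)])
  let ?B = "pull G ` \<A>"
  have B: "arrangement ?B" using arrangement_pull[OF G A] .
  have mB: "modular_at ?B (hyperplane (axis 1 1)) (hyperplane (axis 2 1))"
    using modular_at_comb_iso[OF comb_iso_pull[OF G comb_iso_refl] m] P1 P2 by simp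
  have pencil: "hyperplane (axis 1 1) \<inter> hyperplane (axis 2 1) \<subseteq> hyperplane c \<longleftrightarrow> c $ 3 = 0" for c :: "real^3"
  proof -
    have "axis 2 1 \<in> hyperplane (axis 1 1 :: real^3)" "axis 2 1 \<notin> hyperplane (axis 2 1 :: real^3)"
      by (simp_all add: hyperplane_def inner_axis_axis)
    then have "hyperplane (axis 1 1 :: real^3) \<noteq> hyperplane (axis 2 1)" by auto
    then show ?thesis
      using hyperplane_Int_subset_iff[of "axis 1 1" "axis 2 1" c] by (simp add: cross_basis inner_axis)
  qed
  \<comment> \<open>Normals are chosen with third entry 0 or 1, and exactly \<open>axis 1 1\<close>
    for the first pencil line, as \<open>modular_free_coordinates\<close> requires.\<close>
  have "\<exists>n. n \<noteq> 0 \<and> H = hyperplane n \<and> (n $ 3 = 0 \<or> n $ 3 = 1) \<and>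
    (H = hyperplane (axis 1 1) \<longrightarrow> n = axis 1 1)" if HB: "H \<in> ?B" for H
  proof (cases "H = hyperplane (axis 1 1)")
    case True
    then show ?thesis by (intro exI[of _ "axis 1 1"]) (simp add: axis_eq_0_iff, simp add: axis_def)
  next
    case False
    obtain n where n: "n \<noteq> 0" "H = hyperplane n" using arrangement_normal[OF B HB] .
    show ?thesis
    proof (cases "n $ 3 = 0")
      case True
      then show ?thesis using n False by (intro exI[of _ n]) simp
    next
      case nz: False
      then show ?thesis using n False hyperplane_scale[of "1 / n $ 3" n]
        by (intro exI[of _ "(1 / n $ 3) *\<^sub>R n"]) auto
    qed
  qed
  then have "\<forall>H\<in>?B. \<exists>n. n \<noteq> 0 \<and> H = hyperplane n \<and> (n $ 3 = 0 \<or> n $ 3 = 1) \<and>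
    (H = hyperplane (axis 1 1) \<longrightarrow> n = axis 1 1)" by simp
  from bchoice[OF this] obtain n where n': "\<forall>H\<in>?B. n H \<noteq> 0 \<and> H = hyperplane (n H) \<and> (n H $ 3 = 0 \<or> n H $ 3 = 1) \<and>
    (H = hyperplane (axis 1 1) \<longrightarrow> n H = axis 1 1)" ..
  have n: "n H \<noteq> 0" "H = hyperplane (n H)" "n H $ 3 = 0 \<or> n H $ 3 = 1"
    "H = hyperplane (axis 1 1) \<Longrightarrow> n H = axis 1 1" if "H \<in> ?B" for H
    using bspec[OF n' that] by simp_all
  have n_hyp: "n (hyperplane v) = v" "hyperplane v \<in> ?B" if v: "v \<in> n ` ?B" for v
  proof -
    obtain H where "v = n H" "H \<in> ?B" using v by (rule imageE)
    then show "n (hyperplane v) = v" "hyperplane v \<in> ?B" using n(2)[of H] by simp_all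
  qed
  define N M where "N = {v \<in> n ` ?B. v $ 3 = 0}" and "M = {v \<in> n ` ?B. v $ 3 = 1}"
  have "v $ 3 = 0 \<or> v $ 3 = 1" if "v \<in> n ` ?B" for v
    using n(3)[OF n_hyp(2)[OF that]] n_hyp(1)[OF that] by simp
  then have NM: "N \<union> M = n ` ?B" unfolding N_def M_def by fast
  have "free_arrangement (hyperplane ` (N \<union> M))"
  proof (rule modular_free_coordinates)
    show "finite N" "finite M" using A by (simp_all add: N_def M_def arrangement_def)
    show "v \<noteq> 0 \<and> v $ 3 = 0" if "v \<in> N" for v
    proof -
      have "v \<in> n ` ?B" using \<open>v \<in> N\<close> by (simp add: N_def)
      then obtain H where "v = n H" "H \<in> ?B" by (rule imageE)
      then show ?thesis using \<open>v \<in> N\<close> n(1)[of H] by (simp add: N_def)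
    qed
    show "v $ 3 = 1" if "v \<in> M" for v using that by (simp add: M_def)
    have e1: "hyperplane (axis 1 1) \<in> ?B" using mB by (simp add: modular_at_def)
    have "axis 1 1 \<in> n ` ?B" using n(4)[OF e1 refl] imageI[OF e1, of n] by simp
    then show "axis 1 1 \<in> N" unfolding N_def by (simp add: axis_def)
    show "inj_on hyperplane (N \<union> M)" unfolding NM by (rule inj_on_inverseI[of _ n]) (rule n_hyp)
    show "\<exists>v\<in>N. \<exists>c. p - q = c *\<^sub>R v" if pq: "p \<in> M" "q \<in> M" "p \<noteq> q" for p q
    proof -
      have HB: "hyperplane p \<in> ?B" "hyperplane q \<in> ?B" "n (hyperplane p) = p" "n (hyperplane q) = q"
        using pq n_hyp by (simp_all add: M_def)
      have p3: "p $ 3 = 1" "q $ 3 = 1" using pq by (simp_all add: M_def)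
      then have nz: "p \<noteq> 0" "q \<noteq> 0" by auto
      have ne: "hyperplane p \<noteq> hyperplane q" using HB(3,4) pq(3) by auto
      have "\<not> hyperplane (axis 1 1) \<inter> hyperplane (axis 2 1) \<subseteq> hyperplane p"
        "\<not> hyperplane (axis 1 1) \<inter> hyperplane (axis 2 1) \<subseteq> hyperplane q"
        unfolding pencil using p3 by simp_all
      from modular_atD(4)[OF mB HB(1,2) ne this] obtain K where K: "K \<in> ?B" "hyperplane (axis 1 1) \<inter> hyperplane (axis 2 1) \<subseteq> K"
        "hyperplane p \<inter> hyperplane q \<subseteq> K"
        by auto
      define v where "v = n K"
      have v: "v \<noteq> 0" "K = hyperplane v" using n(1,2)[OF K(1)] by (simp_all add: v_def)
      have v3: "v $ 3 = 0" using K(2) unfolding v(2) pencil .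
      have "v \<in> N" using imageI[OF K(1), of n] v3 by (simp add: N_def v_def)
      \<comment> \<open>Third entries 0, 1 and 1 turn the determinant into proportionality of v and
        p - q.\<close>
      have "v \<bullet> (p \<times> q) = 0" using K(3) v(2) hyperplane_Int_subset_iff[OF nz ne] by simp
      then have eq: "v $ 1 * (p $ 2 - q $ 2) = v $ 2 * (p $ 1 - q $ 1)"
        using v3 p3 by (simp add: cross3_simps)
      show ?thesis
      proof (cases "v $ 1 = 0")
        case True
        then have "v $ 2 \<noteq> 0" using v(1) v3 by (simp add: vec_eq_iff forall_3)
        then have "p - q = ((p $ 2 - q $ 2) / v $ 2) *\<^sub>R v"
          using True eq v3 p3 by (simp add: vec_eq_iff forall_3)
        then show ?thesis using \<open>v \<in> N\<close> by (intro bexI[of _ v] exI)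
      next
        case False
        then have "p - q = ((p $ 1 - q $ 1) / v $ 1) *\<^sub>R v"
          using eq v3 p3 by (simp add: vec_eq_iff forall_3 field_simps)
        then show ?thesis using \<open>v \<in> N\<close> by (intro bexI[of _ v] exI)
      qed
    qed
  qed
  moreover have "hyperplane ` (N \<union> M) = (\<lambda>H. H) ` ?B"
    unfolding NM image_image[of hyperplane n] by (rule image_cong) (simp_all add: n(2)[symmetric])
  ultimately show ?thesis using free_arrangement_pull[OF G] by simp
qed

text \<open>Modularity passes to every lattice-isomorphic arrangement, so both sides of the
  equivalence are true.\<close>

lemma modular_at_freeness_depends_only:
  assumes A: "arrangement \<A>" and m: "modular_at \<A> H1 H2"
  shows "freeness_depends_only_on_lattice \<A>"
  unfolding freeness_depends_only_on_lattice_def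
proof (intro allI impI; elim conjE)
  fix \<A>' assume A': "arrangement \<A>'" and "lattice_isomorphic \<A> \<A>'"
  then obtain \<psi> where "comb_iso \<A> \<A>' \<psi>" using lattice_isomorphic_comb_iso[OF A A'] by blast
  then have "free_arrangement \<A>'" using modular_at_free[OF A'] modular_at_comb_iso m by blast
  then show "free_arrangement \<A>' \<longleftrightarrow> free_arrangement \<A>" using modular_at_free[OF A m] by blast
qed

section \<open>Lines in the affine chart \<open>z = 1\<close>\<close>

definition nv :: "real \<Rightarrow> real \<Rightarrow> real \<Rightarrow> real^3" where
  "nv a b c = vector [a, b, - c]"

text \<open>The cone over the affine line \<open>a x\<^sub>1 + b x\<^sub>2 = c\<close>; the line at infinity is \<open>plane 0 0 1\<close>.\<close>

definition plane :: "real \<Rightarrow> real \<Rightarrow> real \<Rightarrow> (real^3) set" where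
  "plane a b c = hyperplane (nv a b c)"

lemma nv_nth [simp]: "nv a b c $ 1 = a" "nv a b c $ 2 = b" "nv a b c $ 3 = - c"
  by (simp_all add: nv_def vector_3)

lemma nv_eq_iff [simp]: "nv a b c = nv a' b' c' \<longleftrightarrow> a = a' \<and> b = b' \<and> c = c'"
  by (simp add: vec_eq_iff forall_3)

lemma nv_eq_0_iff [simp]: "nv a b c = 0 \<longleftrightarrow> a = 0 \<and> b = 0 \<and> c = 0"
  by (simp add: vec_eq_iff forall_3)

lemma linear_form_nv: "linear_form (nv a b c) = Const a * X1 + Const b * X2 - Const c * Z"
  by (simp add: linear_form_def)

lemma cross_nv: "nv a b c \<times> nv a' b' c' = nv (b' * c - b * c') (a * c' - a' * c) (a' * b - a * b')"
  by (simp add: vec_eq_iff forall_3 cross3_def vector_3 algebra_simps)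

lemma inner_nv: "nv a b c \<bullet> nv a' b' c' = a * a' + b * b' + c * c'"
  by (simp add: inner_vec_def sum_3)

lemma scale_nv: "k *\<^sub>R nv a b c = nv (k * a) (k * b) (k * c)"
  by (simp add: vec_eq_iff forall_3)

lemma add_nv: "nv a b c + nv a' b' c' = nv (a + a') (b + b') (c + c')"
  by (simp add: vec_eq_iff forall_3)

lemma hyperplane_eq_cross:
  assumes "a \<noteq> 0" "b \<noteq> 0" "hyperplane a = hyperplane b"
  shows "a \<times> b = 0"
proof -
  obtain k where "b = k *\<^sub>R a" using hyperplane_eqD[OF assms] .
  then show ?thesis by (simp add: cross_mult_right)
qed

lemma inj_on_hyperplane:
  assumes "0 \<notin> N" "\<And>m n. m \<in> N \<Longrightarrow> n \<in> N \<Longrightarrow> m \<times> n = 0 \<Longrightarrow> m = n"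
  shows "inj_on hyperplane N"
proof (rule inj_onI)
  fix m n assume mn: "m \<in> N" "n \<in> N" "hyperplane m = hyperplane n"
  then have "m \<noteq> 0" "n \<noteq> 0" using assms(1) by auto
  from hyperplane_eq_cross[OF this mn(3)] show "m = n" using assms(2) mn(1,2) by simp
qed

lemma mk_der_nv: "mk_der f g h (linear_form (nv a b c)) = Const a * f + Const b * g - Const c * h"
  by (simp add: derivation_linear_form[OF derivation_mk_der])

text \<open>A polynomial takes congruent values at congruent arguments. With y = x2^2 and x = x1^2
  this gives tangency of the odd derivations to both diagonals.\<close>

lemma prod_diff_dvd:
  fixes x y :: "'a::comm_ring_1"
  assumes "finite P"
  shows "\<exists>k. (\<Prod>s\<in>P. y - c s) = (\<Prod>s\<in>P. x - c s) + (y - x) * k"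
  using assms
proof (induction P rule: finite_induct)
  case empty
  then show ?case by (intro exI[of _ 0]) simp
next
  case (insert t P)
  then obtain k where k: "(\<Prod>s\<in>P. y - c s) = (\<Prod>s\<in>P. x - c s) + (y - x) * k" by blast
  have "(\<Prod>s\<in>insert t P. y - c s) = (\<Prod>s\<in>insert t P. x - c s) + (y - x) * ((\<Prod>s\<in>P. x - c s) + (y - c t) * k)"
    using insert.hyps by (simp add: k algebra_simps)
  then show ?case by (rule exI)
qed

lemma diff_mult_split: "(q * q - s) * g - e * ((p * p - s) * f) = (q * q - s) * (g - e * f) + (q * q - p * p) * (e * f)"
  for p :: "'a::comm_ring_1"
  by (simp add: algebra_simps)

text \<open>The basis consists of the Euler derivation, of \<open>f(x\<^sub>1)\<partial>\<^sub>1 + f(x\<^sub>2)\<partial>\<^sub>2\<close> with \<open>f\<close> the product of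
  the linear factors belonging to \<open>\<plusminus>b, 0, \<plusminus>P\<close>, and of \<open>(x\<^sub>1 - bz)(x\<^sub>2 - bz)\<close> times the same
  expression without the factors for \<open>\<plusminus>b\<close>. Oddness of \<open>f\<close> gives tangency to the two diagonals.\<close>

lemma square_grid_free:
  assumes P: "finite P" "\<And>s. s \<in> P \<Longrightarrow> s > 0" and b: "b \<noteq> 0" "b \<notin> P" "- b \<notin> P"
  defines "T \<equiv> insert b (insert 0 (P \<union> uminus ` P))"
  shows "free_arrangement (hyperplane ` ((\<lambda>t. nv 1 0 t) ` T \<union> (\<lambda>t. nv 0 1 t) ` T \<union> {nv (-1) 1 0, nv 1 1 0, nv 0 0 1}))"
proof -
  let ?N = "(\<lambda>t. nv 1 0 t) ` T \<union> (\<lambda>t. nv 0 1 t) ` T \<union> {nv (-1) 1 0, nv 1 1 0, nv 0 0 1}"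
  define h :: "S \<Rightarrow> S" where "h y = (\<Prod>s\<in>P. y - Const (s * s) * (Z * Z))" for y
  define f :: "S \<Rightarrow> S" where "f x = x * h (x * x)" for x
  define w :: "S \<Rightarrow> S" where "w x = x * x - Const (b * b) * (Z * Z)" for x
  define l :: "S \<Rightarrow> S" where "l x = x - Const b * Z" for x
  have w: "w x = l x * (x + Const b * Z)" for x by (simp add: w_def l_def algebra_simps)
  have fin: "finite T" using P(1) by (simp add: T_def)
  \<comment> \<open>Of the pair b, -b only b is in T, so the product carries \<open>l\<close>, the
    half of \<open>w\<close> that vanishes at b.\<close>
  have prodT: "(\<Prod>t\<in>T. x - Const t * Z) = l x * f x" for x
  proof -
    have "P \<inter> uminus ` P = {}"
    proof (rule equals0I)
      fix s assume "s \<in> P \<inter> uminus ` P"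
      then have "s > 0" "- s > 0" using P(2) by auto
      then show False by simp
    qed
    then have "(\<Prod>t\<in>P \<union> uminus ` P. x - Const t * Z) = (\<Prod>t\<in>P. x - Const t * Z) * (\<Prod>t\<in>uminus ` P. x - Const t * Z)"
      using P(1) by (intro prod.union_disjoint) auto
    also have "(\<Prod>t\<in>uminus ` P. x - Const t * Z) = (\<Prod>t\<in>P. x + Const t * Z)"
      by (subst prod.reindex) (simp_all add: inj_on_def)
    also have "(\<Prod>t\<in>P. x - Const t * Z) * (\<Prod>t\<in>P. x + Const t * Z) = h (x * x)"
      unfolding h_def prod.distrib[symmetric] by (rule prod.cong) (simp_all add: algebra_simps)
    finally have 1: "(\<Prod>t\<in>P \<union> uminus ` P. x - Const t * Z) = h (x * x)" .
    have 0: "0 \<notin> P \<union> uminus ` P" using P(2) by force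
    have "b \<notin> insert 0 (P \<union> uminus ` P)" using b by force
    then show ?thesis using 0 P(1) by (simp add: T_def 1 f_def l_def mult.assoc)
  qed
  have lT: "(x - Const t * Z) dvd l x * f x" if "t \<in> T" for x t
    unfolding prodT[symmetric] using fin that by (rule dvd_prodI)
  define \<theta>1 \<theta>2 where "\<theta>1 = mk_der (w X1 * f X1) (w X2 * f X2) 0" and
    "\<theta>2 = mk_der (l X1 * l X2 * f X1) (l X1 * l X2 * f X2) 0"
  have N0: "0 \<notin> ?N" by auto
  \<comment> \<open>One computation for both diagonals, e = 1 and e = -1.\<close>
  have diag: "linear_form (nv (- e) 1 0) dvd w X2 * f X2 - Const e * (w X1 * f X1)"
    "linear_form (nv (- e) 1 0) dvd f X2 - Const e * f X1" if e: "e * e = 1" for e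
  proof -
    obtain k where k: "h (X2 * X2) = h (X1 * X1) + (X2 * X2 - X1 * X1) * k"
      using prod_diff_dvd[OF P(1), of "X2 * X2" "\<lambda>s. Const (s * s) * (Z * Z)" "X1 * X1"] unfolding h_def by blast
    have fk: "f X2 - Const e * f X1 = (X2 - Const e * X1) * h (X1 * X1) + X2 * ((X2 * X2 - X1 * X1) * k)"
      unfolding f_def k by (simp add: algebra_simps)
    have lf: "linear_form (nv (- e) 1 0) = X2 - Const e * X1" by (simp add: linear_form_nv)
    have "Const e * (Const e * y) = y" for y using e by simp
    then have sq: "X2 * X2 - X1 * X1 = linear_form (nv (- e) 1 0) * (X2 + Const e * X1)"
      unfolding lf by (simp add: algebra_simps)
    have "f X2 - Const e * f X1 = linear_form (nv (- e) 1 0) * h (X1 * X1)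
        + X2 * ((linear_form (nv (- e) 1 0) * (X2 + Const e * X1)) * k)"
      by (simp only: fk sq lf[symmetric])
    also have "\<dots> = linear_form (nv (- e) 1 0) * (h (X1 * X1) + X2 * ((X2 + Const e * X1) * k))"
      by (simp add: algebra_simps)
    finally have "f X2 - Const e * f X1 = \<dots>" .
    then show 1: "linear_form (nv (- e) 1 0) dvd f X2 - Const e * f X1" by (rule dvdI)
    have split: "w X2 * f X2 - Const e * (w X1 * f X1) = w X2 * (f X2 - Const e * f X1) + (X2 * X2 - X1 * X1) * (Const e * f X1)"
      unfolding w_def by (rule diff_mult_split)
    have "(X2 * X2 - X1 * X1) * (Const e * f X1) = linear_form (nv (- e) 1 0) * ((X2 + Const e * X1) * (Const e * f X1))"
      by (simp only: sq mult.assoc)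
    then have "linear_form (nv (- e) 1 0) dvd (X2 * X2 - X1 * X1) * (Const e * f X1)" by (rule dvdI)
    then show "linear_form (nv (- e) 1 0) dvd w X2 * f X2 - Const e * (w X1 * f X1)"
      unfolding split by (rule dvd_add[OF dvd_mult[OF 1]])
  qed
  have one: "1 * 1 = (1::real)" "- 1 * - 1 = (1::real)" by simp_all
  note d1 = diag[OF one(1), unfolded Const_hom mult_1_left]
    and d2 = diag[OF one(2), unfolded Const_hom mult_minus_left mult_1_left minus_minus diff_minus_eq_add]
  have "log_basis (hyperplane ` ?N) (mk_der X1 X2 Z) \<theta>1 \<theta>2"
  proof (rule Saito_criterion[where c = 1])
    show "finite ?N" using fin by simp
    show "inj_on hyperplane ?N"
      by (rule inj_on_hyperplane[OF N0]) (auto simp: cross_nv)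
    show "mk_der X1 X2 Z \<in> log_der (hyperplane ` ?N)" by (rule Euler_in_log_der)
    have x1: "X1 - Const t * Z dvd w X1 * f X1" "X1 - Const t * Z dvd l X1 * l X2 * f X1" if "t \<in> T" for t
      using dvd_mult2[OF lT[OF that, of X1], of "X1 + Const b * Z"] dvd_mult2[OF lT[OF that, of X1], of "l X2"]
      by (simp_all only: w ac_simps)
    have x2: "X2 - Const t * Z dvd w X2 * f X2" "X2 - Const t * Z dvd l X1 * l X2 * f X2" if "t \<in> T" for t
      using dvd_mult2[OF lT[OF that, of X2], of "X2 + Const b * Z"] dvd_mult2[OF lT[OF that, of X2], of "l X1"]
      by (simp_all only: w ac_simps)
    show "\<theta>1 \<in> log_der (hyperplane ` ?N)"
      unfolding log_der_hyperplane_image[OF N0] \<theta>1_def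
    proof (intro conjI ballI derivation_mk_der)
      fix n assume "n \<in> ?N"
      then consider t where "t \<in> T" "n = nv 1 0 t" | t where "t \<in> T" "n = nv 0 1 t"
        | "n = nv (-1) 1 0" | "n = nv 1 1 0" | "n = nv 0 0 1" by blast
      then show "linear_form n dvd mk_der (w X1 * f X1) (w X2 * f X2) 0 (linear_form n)"
      proof cases
        case 1 then show ?thesis using x1 by (simp add: mk_der_nv) (simp add: linear_form_nv)
      next
        case 2 then show ?thesis using x2 by (simp add: mk_der_nv) (simp add: linear_form_nv)
      qed (use d1 d2 in \<open>simp_all add: mk_der_nv add.commute\<close>)
    qed
    show "\<theta>2 \<in> log_der (hyperplane ` ?N)"
      unfolding log_der_hyperplane_image[OF N0] \<theta>2_def
    proof (intro conjI ballI derivation_mk_der)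
      fix n assume "n \<in> ?N"
      then consider t where "t \<in> T" "n = nv 1 0 t" | t where "t \<in> T" "n = nv 0 1 t"
        | "n = nv (-1) 1 0" | "n = nv 1 1 0" | "n = nv 0 0 1" by blast
      then show "linear_form n dvd mk_der (l X1 * l X2 * f X1) (l X1 * l X2 * f X2) 0 (linear_form n)"
      proof cases
        case 1 then show ?thesis using x1 by (simp add: mk_der_nv) (simp add: linear_form_nv)
      next
        case 2 then show ?thesis using x2 by (simp add: mk_der_nv) (simp add: linear_form_nv)
      next
        case 3
        have "linear_form (nv (-1) 1 0) dvd l X1 * l X2 * (f X2 - f X1)" using d1(2) by (rule dvd_mult)
        then show ?thesis unfolding 3 by (simp add: mk_der_nv algebra_simps)
      next
        case 4
        have "linear_form (nv 1 1 0) dvd l X1 * l X2 * (f X2 + f X1)" using d2(2) by (rule dvd_mult)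
        then show ?thesis unfolding 4 by (simp add: mk_der_nv algebra_simps)
      qed (simp add: mk_der_nv)
    qed
    have "(\<Prod>n\<in>?N. linear_form n) = (\<Prod>t\<in>T. linear_form (nv 1 0 t)) * (\<Prod>t\<in>T. linear_form (nv 0 1 t)) *
        (linear_form (nv (-1) 1 0) * linear_form (nv 1 1 0) * linear_form (nv 0 0 1))"
    proof -
      have "(\<Prod>n\<in>?N. linear_form n) = (\<Prod>n\<in>(\<lambda>t. nv 1 0 t) ` T \<union> (\<lambda>t. nv 0 1 t) ` T. linear_form n) *
          (\<Prod>n\<in>{nv (-1) 1 0, nv 1 1 0, nv 0 0 1}. linear_form n)"
        using fin by (intro prod.union_disjoint) auto
      also have "(\<Prod>n\<in>(\<lambda>t. nv 1 0 t) ` T \<union> (\<lambda>t. nv 0 1 t) ` T. linear_form n) =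
          (\<Prod>n\<in>(\<lambda>t. nv 1 0 t) ` T. linear_form n) * (\<Prod>n\<in>(\<lambda>t. nv 0 1 t) ` T. linear_form n)"
        using fin by (intro prod.union_disjoint) auto
      also have "(\<Prod>n\<in>(\<lambda>t. nv 1 0 t) ` T. linear_form n) = (\<Prod>t\<in>T. linear_form (nv 1 0 t))"
        by (subst prod.reindex) (simp_all add: inj_on_def)
      also have "(\<Prod>n\<in>(\<lambda>t. nv 0 1 t) ` T. linear_form n) = (\<Prod>t\<in>T. linear_form (nv 0 1 t))"
        by (subst prod.reindex) (simp_all add: inj_on_def)
      finally show ?thesis by (simp add: mult.assoc)
    qed
    also have "\<dots> = l X1 * f X1 * (l X2 * f X2) * ((X2 - X1) * (X1 + X2) * (- Z))"
      unfolding prodT[symmetric] by (simp add: linear_form_nv)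
    finally have prodN: "(\<Prod>n\<in>?N. linear_form n) = l X1 * f X1 * (l X2 * f X2) * ((X2 - X1) * (X1 + X2) * (- Z))" .
    \<comment> \<open>In \<open>w X1 - w X2\<close> the z-terms cancel; the rest is x1^2 - x2^2,
      which supplies the two diagonals.\<close>
    have "jac (mk_der X1 X2 Z) \<theta>1 \<theta>2 = Z * (l X1 * f X1 * (l X2 * f X2) * (w X1 - w X2))"
      unfolding jac_def \<theta>1_def \<theta>2_def mk_der_vars by (simp add: algebra_simps)
    also have "\<dots> = Z * (l X1 * f X1 * (l X2 * f X2) * (X1 * X1 - X2 * X2))" by (simp add: w_def)
    also have "\<dots> = Const 1 * (l X1 * f X1 * (l X2 * f X2) * ((X2 - X1) * (X1 + X2) * (- Z)))"
      by (simp add: algebra_simps)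
    finally show "jac (mk_der X1 X2 Z) \<theta>1 \<theta>2 = Const 1 * (\<Prod>n\<in>?N. linear_form n)"
      unfolding prodN .
  qed (use N0 in auto)
  then show ?thesis by (rule log_basis_free)
qed

section \<open>Two families of non-free arrangements\<close>

text \<open>The five lines other than x2 = bz are free with the given basis. Modulo x2 = bz the two
  nontrivial derivations send the new form to bz(x1 + bz) and bz(x1 - z). The forms x1 + bz, x1 - z
  and x2 - bz are independent unless they share the zero (1, -1, 1), which is the case b =
  -1.\<close>

lemma not_free_A2_two_lines:
  assumes b: "b \<noteq> 0" "b \<noteq> - 1"
  shows "\<not> free_arrangement (insert (plane 0 1 b) {plane 1 0 0, plane 0 1 0, plane 1 1 0, plane 0 0 1, plane 1 0 1})"
proof -
  let ?N = "{nv 1 0 0, nv 0 1 0, nv 1 1 0, nv 0 0 1, nv 1 0 1}"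
  have N0: "0 \<notin> ?N" by simp
  have basis: "log_basis (hyperplane ` ?N) (mk_der X1 X2 Z) (mk_der 0 (X2 * (X1 + X2)) 0) (mk_der 0 0 (Z * (Z - X1)))"
  proof (rule Saito_criterion[where c = 1])
    show "inj_on hyperplane ?N" by (rule inj_on_hyperplane[OF N0]) (auto simp: cross_nv)
    show "mk_der X1 X2 Z \<in> log_der (hyperplane ` ?N)" by (rule Euler_in_log_der)
    show "mk_der 0 (X2 * (X1 + X2)) 0 \<in> log_der (hyperplane ` ?N)"
      unfolding log_der_hyperplane_image[OF N0] by (simp add: derivation_mk_der mk_der_nv) (simp add: linear_form_nv)
    show "mk_der 0 0 (Z * (Z - X1)) \<in> log_der (hyperplane ` ?N)"
      unfolding log_der_hyperplane_image[OF N0]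
    proof (intro conjI ballI derivation_mk_der)
      fix n assume "n \<in> ?N"
      moreover have "X1 - Z dvd Z * (Z - X1)" by (rule dvdI[of _ _ "- Z"]) (simp add: algebra_simps)
      ultimately show "linear_form n dvd mk_der 0 0 (Z * (Z - X1)) (linear_form n)"
        by (elim insertE) (simp_all add: mk_der_nv, simp_all add: linear_form_nv)
    qed
    show "jac (mk_der X1 X2 Z) (mk_der 0 (X2 * (X1 + X2)) 0) (mk_der 0 0 (Z * (Z - X1))) = Const 1 * (\<Prod>n\<in>?N. linear_form n)"
      by (simp add: jac_def linear_form_nv algebra_simps)
  qed simp_all
  have "\<not> free_arrangement (insert (hyperplane (nv 0 1 b)) (hyperplane ` ?N))"
  proof (rule not_free_insert[OF basis, where b = "Const b * Z" and u = "nv 1 0 (- b)" and w = "nv 1 0 1"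
        and q = "X1 + X2 + Const b * Z" and q' = 0])
    show "nv 0 1 b \<noteq> 0" by simp
    show "linear_form (nv 0 1 b) dvd mk_der X1 X2 Z (linear_form (nv 0 1 b))"
      by (simp add: mk_der_nv) (simp add: linear_form_nv)
    show "mk_der 0 (X2 * (X1 + X2)) 0 (linear_form (nv 0 1 b)) =
      Const b * Z * linear_form (nv 1 0 (- b)) + linear_form (nv 0 1 b) * (X1 + X2 + Const b * Z)"
      by (simp add: mk_der_nv) (simp add: linear_form_nv algebra_simps)
    show "mk_der 0 0 (Z * (Z - X1)) (linear_form (nv 0 1 b)) =
      Const b * Z * linear_form (nv 1 0 1) + linear_form (nv 0 1 b) * 0"
      by (simp add: mk_der_nv) (simp add: linear_form_nv algebra_simps)
    show "\<not> linear_form (nv 0 1 b) dvd Const b * Z"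
    proof
      assume "linear_form (nv 0 1 b) dvd Const b * Z"
      then obtain k where "Const b * Z = linear_form (nv 0 1 b) * k" unfolding dvd_def by blast
      \<comment> \<open>A point of the new line at which bz does not vanish.\<close>
      then have "ev (vector [0, b, 1]) (Const b * Z) = ev (vector [0, b, 1]) (linear_form (nv 0 1 b) * k)" by simp
      then show False using b by (simp add: linear_form_nv vector_3)
    qed
    show "r = 0 \<and> s = 0 \<and> t = 0" if "r *\<^sub>R nv 1 0 (- b) + s *\<^sub>R nv 1 0 1 = t *\<^sub>R nv 0 1 b" for r s t
    proof -
      have "r + s = 0" "t = 0" "- (r * b) + s = t * b" using that by (simp_all add: scale_nv add_nv)
      then have "s = - r" "r * (b + 1) = 0" by (simp_all add: algebra_simps)
      then show ?thesis using b \<open>t = 0\<close> by auto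
    qed
  qed
  then show ?thesis by (simp add: plane_def)
qed

text \<open>The Shi arrangement with k = 1 has a basis of degrees 1, 3, 3. On x1 + x2 = cz the
  factor (x1 + x2)(x1 + x2 - z) becomes c(c - 1)z^2, and the cofactors x1 - x2 and z - x2 are
  independent of the new form unless it vanishes at (1, 1, 1), that is, c = 2.\<close>

lemma not_free_A2_Shi_insert:
  assumes c: "c \<noteq> 0" "c \<noteq> 1" "c \<noteq> 2"
  shows "\<not> free_arrangement (insert (plane 1 1 c)
    {plane 1 0 0, plane 1 0 1, plane 0 1 0, plane 0 1 1, plane 1 1 0, plane 1 1 1, plane 0 0 1})"
proof -
  let ?N = "{nv 1 0 0, nv 1 0 1, nv 0 1 0, nv 0 1 1, nv 1 1 0, nv 1 1 1, nv 0 0 1}"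
  let ?\<theta>2 = "mk_der ((X1 + X2) * (X1 * (X1 - Z))) (- ((X1 + X2) * (X2 * (X2 - Z)))) 0"
  let ?\<theta>3 = "mk_der (X1 * (X1 - Z) * (Z - X2)) (X2 * (X2 - Z) * (Z - 2 * X1 - X2)) 0"
  have N0: "0 \<notin> ?N" by simp
  have s2: "(X1 + X2) * (X1 * (X1 - Z)) + - ((X1 + X2) * (X2 * (X2 - Z))) = (X1 + X2) * ((X1 + X2 - Z) * (X1 - X2))"
    by (simp add: algebra_simps)
  have s3: "X1 * (X1 - Z) * (Z - X2) + X2 * (X2 - Z) * (Z - 2 * X1 - X2) = (X1 + X2) * ((X1 + X2 - Z) * (Z - X2))"
    by (simp add: algebra_simps)
  have basis: "log_basis (hyperplane ` ?N) (mk_der X1 X2 Z) ?\<theta>2 ?\<theta>3"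
  proof (rule Saito_criterion[where c = 2])
    show "inj_on hyperplane ?N" by (rule inj_on_hyperplane[OF N0]) (auto simp: cross_nv)
    show "mk_der X1 X2 Z \<in> log_der (hyperplane ` ?N)" by (rule Euler_in_log_der)
    show "?\<theta>2 \<in> log_der (hyperplane ` ?N)"
      unfolding log_der_hyperplane_image[OF N0]
    proof (intro conjI ballI derivation_mk_der)
      fix n assume "n \<in> ?N"
      then show "linear_form n dvd ?\<theta>2 (linear_form n)"
        unfolding insert_iff empty_iff using s2
        by (elim disjE) (simp_all only: mk_der_nv, simp_all add: linear_form_nv)
    qed
    show "?\<theta>3 \<in> log_der (hyperplane ` ?N)"
      unfolding log_der_hyperplane_image[OF N0]
    proof (intro conjI ballI derivation_mk_der)
      fix n assume "n \<in> ?N"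
      then show "linear_form n dvd ?\<theta>3 (linear_form n)"
        unfolding insert_iff empty_iff using s3
        by (elim disjE) (simp_all only: mk_der_nv, simp_all add: linear_form_nv)
    qed
    show "jac (mk_der X1 X2 Z) ?\<theta>2 ?\<theta>3 = Const 2 * (\<Prod>n\<in>?N. linear_form n)"
    proof -
      have two: "Const 2 = 2" using Const_hom(3)[of 1 1] by simp
      have "jac (mk_der X1 X2 Z) ?\<theta>2 ?\<theta>3 = Z * ((X1 + X2) * (X1 * (X1 - Z)) * (X2 * (X2 - Z)) * (2 * (Z - X1 - X2)))"
        unfolding jac_def mk_der_vars by (simp add: algebra_simps)
      also have "\<dots> = 2 * (X1 * ((X1 - Z) * (X2 * ((X2 - Z) * ((X1 + X2) * ((X1 + X2 - Z) * (- Z)))))))"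
        by (simp add: algebra_simps)
      finally show ?thesis by (simp add: linear_form_nv two)
    qed
  qed simp_all
  have t: "(X1 + X2) * (X1 + X2 - Z) = Const (c * (c - 1)) * (Z * Z) + linear_form (nv 1 1 c) * (X1 + X2 + Const (c - 1) * Z)"
    by (simp add: linear_form_nv algebra_simps)
  have "\<not> free_arrangement (insert (hyperplane (nv 1 1 c)) (hyperplane ` ?N))"
  proof (rule not_free_insert[OF basis, where b = "Const (c * (c - 1)) * (Z * Z)" and u = "nv 1 (-1) 0" and w = "nv 0 (-1) (-1)"
        and q = "(X1 + X2 + Const (c - 1) * Z) * (X1 - X2)" and q' = "(X1 + X2 + Const (c - 1) * Z) * (Z - X2)"])
    show "nv 1 1 c \<noteq> 0" by simp
    show "linear_form (nv 1 1 c) dvd mk_der X1 X2 Z (linear_form (nv 1 1 c))"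
      by (simp add: mk_der_nv) (simp add: linear_form_nv)
    have "?\<theta>2 (linear_form (nv 1 1 c)) = ((X1 + X2) * (X1 + X2 - Z)) * (X1 - X2)"
      using s2 by (simp add: mk_der_nv mult.assoc)
    then show "?\<theta>2 (linear_form (nv 1 1 c)) = Const (c * (c - 1)) * (Z * Z) * linear_form (nv 1 (-1) 0)
      + linear_form (nv 1 1 c) * ((X1 + X2 + Const (c - 1) * Z) * (X1 - X2))"
      unfolding t by (simp only: distrib_right mult.assoc linear_form_nv[of 1 "-1" 0]) simp
    have "?\<theta>3 (linear_form (nv 1 1 c)) = ((X1 + X2) * (X1 + X2 - Z)) * (Z - X2)"
      using s3 by (simp add: mk_der_nv mult.assoc)
    then show "?\<theta>3 (linear_form (nv 1 1 c)) = Const (c * (c - 1)) * (Z * Z) * linear_form (nv 0 (-1) (-1))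
      + linear_form (nv 1 1 c) * ((X1 + X2 + Const (c - 1) * Z) * (Z - X2))"
      unfolding t by (simp only: distrib_right mult.assoc linear_form_nv[of 0 "-1" "-1"]) simp
    show "\<not> linear_form (nv 1 1 c) dvd Const (c * (c - 1)) * (Z * Z)"
    proof
      assume "linear_form (nv 1 1 c) dvd Const (c * (c - 1)) * (Z * Z)"
      then obtain k where "Const (c * (c - 1)) * (Z * Z) = linear_form (nv 1 1 c) * k" unfolding dvd_def by blast
      then have "ev (vector [c, 0, 1]) (Const (c * (c - 1)) * (Z * Z)) = ev (vector [c, 0, 1]) (linear_form (nv 1 1 c) * k)" by simp
      then show False using c by (simp add: linear_form_nv vector_3)
    qed
    show "r = 0 \<and> s = 0 \<and> t = 0" if "r *\<^sub>R nv 1 (-1) 0 + s *\<^sub>R nv 0 (-1) (-1) = t *\<^sub>R nv 1 1 c" for r s t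
    proof -
      have "r = t \<and> - r - s = t \<and> - s = t * c" using that unfolding scale_nv add_nv nv_eq_iff by linarith
      then have "r = t" "- r - s = t" "- s = t * c" by blast+
      then have "t * c = 2 * t" by linarith
      moreover have "t * (c - 2) = t * c - 2 * t" by (simp add: algebra_simps)
      ultimately have "t * (c - 2) = 0" by linarith
      then show ?thesis using c \<open>r = t\<close> \<open>- r - s = t\<close> by auto
    qed
  qed
  then show ?thesis by (simp add: plane_def insert_commute)
qed

section \<open>Propagation of incidences\<close>

lemma nv_0 [simp]: "nv 0 0 0 = 0"
  by simp

lemma plane_scale: "k \<noteq> 0 \<Longrightarrow> plane (k * a) (k * b) (k * c) = plane a b c"
  unfolding plane_def using hyperplane_scale[of k "nv a b c"] by (simp add: scale_nv)

lemma hyperplane_nv: "hyperplane v = plane (v $ 1) (v $ 2) (- v $ 3)"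
proof -
  have "v = nv (v $ 1) (v $ 2) (- v $ 3)" by (simp add: vec_eq_iff forall_3)
  then show ?thesis unfolding plane_def by (rule arg_cong)
qed

lemma plane_eqD:
  assumes "plane a b c = plane a' b' c'" "a \<noteq> 0 \<or> b \<noteq> 0 \<or> c \<noteq> 0" "a' \<noteq> 0 \<or> b' \<noteq> 0 \<or> c' \<noteq> 0"
  shows "a * b' = a' * b" "a * c' = a' * c" "b * c' = b' * c"
proof -
  have "nv a b c \<times> nv a' b' c' = 0" using assms unfolding plane_def by (intro hyperplane_eq_cross) auto
  then show "a * b' = a' * b" "a * c' = a' * c" "b * c' = b' * c" by (auto simp: cross_nv)
qed

lemma plane_Int_subset_iff:
  assumes "a1 * b2 \<noteq> a2 * b1 \<or> a1 * c2 \<noteq> a2 * c1 \<or> b1 * c2 \<noteq> b2 * c1"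
  shows "plane a1 b1 c1 \<inter> plane a2 b2 c2 \<subseteq> plane a b c \<longleftrightarrow>
    a * (b2 * c1 - b1 * c2) + b * (a1 * c2 - a2 * c1) = c * (a1 * b2 - a2 * b1)"
proof -
  have nz: "nv a1 b1 c1 \<noteq> 0" "nv a2 b2 c2 \<noteq> 0" using assms by auto
  have ne: "hyperplane (nv a1 b1 c1) \<noteq> hyperplane (nv a2 b2 c2)"
  proof
    assume "hyperplane (nv a1 b1 c1) = hyperplane (nv a2 b2 c2)"
    then have "nv a1 b1 c1 \<times> nv a2 b2 c2 = 0" by (rule hyperplane_eq_cross[OF nz])
    then show False using assms by (auto simp: cross_nv)
  qed
  have "nv a b c \<bullet> (nv a1 b1 c1 \<times> nv a2 b2 c2) =
    a * (b2 * c1 - b1 * c2) + b * (a1 * c2 - a2 * c1) - c * (a1 * b2 - a2 * b1)"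
    unfolding cross_nv inner_nv by (simp add: algebra_simps)
  then show ?thesis unfolding plane_def hyperplane_Int_subset_iff[OF nz ne] by auto
qed

text \<open>Freeness and incidences are invariant under linear maps, so the isomorphism may be
  composed with one that puts the images of the four lines back in place. The premise asks for
  equivalence of freeness rather than \<open>\<A>' = \<A>\<close>, to admit cases where a parameter
  survives.\<close>

lemma rigid_frameI:
  assumes A: "arrangement \<A>" and H: "H1 \<in> \<A>" "H2 \<in> \<A>" "H3 \<in> \<A>" "H4 \<in> \<A>"
    and gen: "generic_frame H1 H2 H3 H4"
    and rigid: "\<And>\<A>' \<psi>. arrangement \<A>' \<Longrightarrow> comb_iso \<A> \<A>' \<psi> \<Longrightarrow> \<psi> H1 = H1 \<Longrightarrow> \<psi> H2 = H2 \<Longrightarrow>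
      \<psi> H3 = H3 \<Longrightarrow> \<psi> H4 = H4 \<Longrightarrow> free_arrangement \<A>' \<longleftrightarrow> free_arrangement \<A>"
  shows "freeness_depends_only_on_lattice \<A>"
  unfolding freeness_depends_only_on_lattice_def
proof (intro allI impI; elim conjE)
  fix \<A>' assume A': "arrangement \<A>'" and "lattice_isomorphic \<A> \<A>'"
  then obtain \<psi> where iso: "comb_iso \<A> \<A>' \<psi>" by (rule lattice_isomorphic_comb_iso[OF A])
  obtain G G' where G: "G ** G' = mat 1" and fx: "pull G (\<psi> H1) = H1" "pull G (\<psi> H2) = H2"
    "pull G (\<psi> H3) = H3" "pull G (\<psi> H4) = H4"
    by (rule comb_iso_normalize[OF A A' iso H gen])
  have "free_arrangement (pull G ` \<A>') \<longleftrightarrow> free_arrangement \<A>"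
    by (rule rigid[OF arrangement_pull[OF G A'] comb_iso_pull[OF G iso] fx])
  then show "free_arrangement \<A>' \<longleftrightarrow> free_arrangement \<A>"
    using free_arrangement_pull[OF G] by simp
qed

lemma generic_frame_plane:
  fixes a1 b1 c1 a2 b2 c2 a3 b3 c3 a4 b4 c4 :: real
  assumes "a3 * (b2 * c1 - b1 * c2) + b3 * (a1 * c2 - a2 * c1) \<noteq> c3 * (a1 * b2 - a2 * b1)"
    "a4 * (b2 * c1 - b1 * c2) + b4 * (a1 * c2 - a2 * c1) \<noteq> c4 * (a1 * b2 - a2 * b1)"
    "a4 * (b3 * c1 - b1 * c3) + b4 * (a1 * c3 - a3 * c1) \<noteq> c4 * (a1 * b3 - a3 * b1)"
    "a4 * (b3 * c2 - b2 * c3) + b4 * (a2 * c3 - a3 * c2) \<noteq> c4 * (a2 * b3 - a3 * b2)"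
  shows "generic_frame (plane a1 b1 c1) (plane a2 b2 c2) (plane a3 b3 c3) (plane a4 b4 c4)"
proof -
  have 1: "a1 * b2 \<noteq> a2 * b1 \<or> a1 * c2 \<noteq> a2 * c1 \<or> b1 * c2 \<noteq> b2 * c1"
    by (rule ccontr) (use assms(1) in simp)
  have 2: "a1 * b3 \<noteq> a3 * b1 \<or> a1 * c3 \<noteq> a3 * c1 \<or> b1 * c3 \<noteq> b3 * c1"
    by (rule ccontr) (use assms(3) in simp)
  have 3: "a2 * b3 \<noteq> a3 * b2 \<or> a2 * c3 \<noteq> a3 * c2 \<or> b2 * c3 \<noteq> b3 * c2"
    by (rule ccontr) (use assms(4) in simp)
  have ne: "plane a b c \<noteq> plane a' b' c'" if "a * b' \<noteq> a' * b \<or> a * c' \<noteq> a' * c \<or> b * c' \<noteq> b' * c" for a b c a' b' c'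
  proof
    assume "plane a b c = plane a' b' c'"
    moreover have "a \<noteq> 0 \<or> b \<noteq> 0 \<or> c \<noteq> 0" "a' \<noteq> 0 \<or> b' \<noteq> 0 \<or> c' \<noteq> 0" using that by auto
    ultimately show False using plane_eqD[of a b c a' b' c'] that by simp
  qed
  show ?thesis unfolding generic_frame_def plane_Int_subset_iff[OF 1] plane_Int_subset_iff[OF 2] plane_Int_subset_iff[OF 3]
    using ne[OF 1] ne[OF 2] ne[OF 3] assms by blast
qed

text \<open>A realization \<A>' of the incidences of \<A>, marked by \<psi>. The predicates
  \<open>mem\<close> and \<open>fxd\<close> take integer coefficients, which turns the side
  conditions of the propagation into integer arithmetic.\<close>

locale marked =
  fixes \<A> \<A>' :: "(real^3) set set" and \<psi> :: "(real^3) set \<Rightarrow> (real^3) set"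
  assumes A: "arrangement \<A>" and A': "arrangement \<A>'" and iso: "comb_iso \<A> \<A>' \<psi>"
begin

definition mem :: "int \<Rightarrow> int \<Rightarrow> int \<Rightarrow> bool" where
  "mem a b j \<longleftrightarrow> plane (of_int a) (of_int b) (of_int j) \<in> \<A>"

definition fxd :: "int \<Rightarrow> int \<Rightarrow> int \<Rightarrow> bool" where
  "fxd a b j \<longleftrightarrow> mem a b j \<and> \<psi> (plane (of_int a) (of_int b) (of_int j)) = plane (of_int a) (of_int b) (of_int j)"

lemma image_plane:
  assumes "H \<in> \<A>"
  obtains a b c where "\<psi> H = plane a b c" "a \<noteq> 0 \<or> b \<noteq> 0 \<or> c \<noteq> 0"
proof -
  obtain n where "n \<noteq> 0" "\<psi> H = hyperplane n" using arrangement_normal[OF A' comb_isoD(1)[OF iso assms assms]] .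
  then show thesis using that[of "n $ 1" "n $ 2" "- n $ 3"] by (simp add: hyperplane_nv vec_eq_iff forall_3)
qed

text \<open>A line through two distinct points, each the intersection of two fixed lines, is fixed.\<close>

lemma fxd_two_points:
  assumes m: "mem a b j"
    and f: "fxd a1 b1 j1" "fxd a2 b2 j2" "fxd a3 b3 j3" "fxd a4 b4 j4"
    and inc1: "a * (b2 * j1 - b1 * j2) + b * (a1 * j2 - a2 * j1) = j * (a1 * b2 - a2 * b1)"
    and inc2: "a * (b4 * j3 - b3 * j4) + b * (a3 * j4 - a4 * j3) = j * (a3 * b4 - a4 * b3)"
    and ne: "(b2 * j1 - b1 * j2) * (a3 * j4 - a4 * j3) \<noteq> (b4 * j3 - b3 * j4) * (a1 * j2 - a2 * j1) \<or>
      (b2 * j1 - b1 * j2) * (a3 * b4 - a4 * b3) \<noteq> (b4 * j3 - b3 * j4) * (a1 * b2 - a2 * b1) \<or>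
      (a1 * j2 - a2 * j1) * (a3 * b4 - a4 * b3) \<noteq> (a3 * j4 - a4 * j3) * (a1 * b2 - a2 * b1)"
  shows "fxd a b j"
proof -
  let ?t = "nv (of_int a) (of_int b) (of_int j)"
  \<comment> \<open>\<open>?P\<close> and \<open>?Q\<close> are the two points, as cross products of
    normals; \<open>ne\<close> says that they differ in the projective plane.\<close>
  let ?P = "nv (of_int (b2 * j1 - b1 * j2)) (of_int (a1 * j2 - a2 * j1)) (of_int (a2 * b1 - a1 * b2))"
  let ?Q = "nv (of_int (b4 * j3 - b3 * j4)) (of_int (a3 * j4 - a4 * j3)) (of_int (a4 * b3 - a3 * b4))"
  let ?H = "plane (of_int a) (of_int b) (of_int j)"
  obtain n1 n2 n3 where n: "\<psi> ?H = plane n1 n2 n3" and nz: "n1 \<noteq> 0 \<or> n2 \<noteq> 0 \<or> n3 \<noteq> 0"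
    using image_plane[of ?H] m unfolding mem_def by metis
  \<comment> \<open>Transport of one point: the two lines defining it do not move, so the image of
    the line passes through the same point.\<close>
  have sub: "nv n1 n2 n3 \<bullet> nv (of_int (b' * i - b * i')) (of_int (a * i' - a' * i)) (of_int (a' * b - a * b')) = 0"
    if "fxd a b i" "fxd a' b' i'"
      "?t \<bullet> nv (of_int (b' * i - b * i')) (of_int (a * i' - a' * i)) (of_int (a' * b - a * b')) = 0"
      "nv (of_int (b' * i - b * i')) (of_int (a * i' - a' * i)) (of_int (a' * b - a * b')) \<noteq> 0" for a b i a' b' i'
  proof -
    let ?u = "nv (of_int a) (of_int b) (of_int i)" and ?u' = "nv (of_int a') (of_int b') (of_int i')"
    have cr: "?u \<times> ?u' = nv (of_int (b' * i - b * i')) (of_int (a * i' - a' * i)) (of_int (a' * b - a * b'))"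
      by (simp add: cross_nv)
    have u: "?u \<noteq> 0" "?u' \<noteq> 0" using that(4) unfolding cr[symmetric] by auto
    have une: "hyperplane ?u \<noteq> hyperplane ?u'" using hyperplane_eq_cross[OF u] that(4) unfolding cr[symmetric] by auto
    have "hyperplane ?u \<inter> hyperplane ?u' \<subseteq> hyperplane ?t"
      unfolding hyperplane_Int_subset_iff[OF u une] cr by (rule that(3))
    then have "\<psi> (hyperplane ?u) \<inter> \<psi> (hyperplane ?u') \<subseteq> \<psi> (hyperplane ?t)"
      using comb_isoD(3)[OF iso] that(1,2) m unfolding fxd_def mem_def plane_def by blast
    moreover have "\<psi> (hyperplane ?u) = hyperplane ?u" "\<psi> (hyperplane ?u') = hyperplane ?u'"
      using that(1,2) unfolding fxd_def plane_def by simp_all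
    ultimately have "hyperplane ?u \<inter> hyperplane ?u' \<subseteq> hyperplane (nv n1 n2 n3)"
      using n unfolding plane_def by simp
    then show ?thesis unfolding hyperplane_Int_subset_iff[OF u une] cr .
  qed
  have PQ: "?P \<times> ?Q \<noteq> 0"
  proof
    assume "?P \<times> ?Q = 0"
    then have "nv (of_int ((a3 * j4 - a4 * j3) * (a2 * b1 - a1 * b2) - (a1 * j2 - a2 * j1) * (a4 * b3 - a3 * b4)))
       (of_int ((b2 * j1 - b1 * j2) * (a4 * b3 - a3 * b4) - (b4 * j3 - b3 * j4) * (a2 * b1 - a1 * b2)))
       (of_int ((b4 * j3 - b3 * j4) * (a1 * j2 - a2 * j1) - (b2 * j1 - b1 * j2) * (a3 * j4 - a4 * j3))) = 0"
      unfolding cross_nv by simp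
    then have "(a3 * j4 - a4 * j3) * (a2 * b1 - a1 * b2) - (a1 * j2 - a2 * j1) * (a4 * b3 - a3 * b4) = 0"
      "(b2 * j1 - b1 * j2) * (a4 * b3 - a3 * b4) - (b4 * j3 - b3 * j4) * (a2 * b1 - a1 * b2) = 0"
      "(b4 * j3 - b3 * j4) * (a1 * j2 - a2 * j1) - (b2 * j1 - b1 * j2) * (a3 * j4 - a4 * j3) = 0"
      unfolding nv_eq_0_iff of_int_eq_0_iff by blast+
    then show False using ne by (simp add: algebra_simps)
  qed
  then have P0: "?P \<noteq> 0" and Q0: "?Q \<noteq> 0" by auto
  have tP: "?t \<bullet> ?P = 0" and tQ: "?t \<bullet> ?Q = 0"
  proof -
    have "a * (b2 * j1 - b1 * j2) + b * (a1 * j2 - a2 * j1) + j * (a2 * b1 - a1 * b2) = 0"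
      "a * (b4 * j3 - b3 * j4) + b * (a3 * j4 - a4 * j3) + j * (a4 * b3 - a3 * b4) = 0"
      using inc1 inc2 by (simp_all add: algebra_simps)
    then show "?t \<bullet> ?P = 0" "?t \<bullet> ?Q = 0"
      unfolding inner_nv of_int_mult[symmetric] of_int_add[symmetric] of_int_eq_0_iff by blast+
  qed
  have nP: "nv n1 n2 n3 \<bullet> ?P = 0" and nQ: "nv n1 n2 n3 \<bullet> ?Q = 0"
    using sub[OF f(1,2) tP P0] sub[OF f(3,4) tQ Q0] by blast+
  have par: "\<exists>k. w = k *\<^sub>R (?P \<times> ?Q)" if "w \<bullet> ?P = 0" "w \<bullet> ?Q = 0" for w
  proof -
    have "w \<times> (?P \<times> ?Q) = 0" using that by (simp add: Lagrange)
    then have "collinear {0, w, ?P \<times> ?Q}" by (simp only: cross_eq_0)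
    then have "collinear {0, ?P \<times> ?Q, w}" by (simp only: insert_commute)
    then show ?thesis using PQ by (metis collinear_lemma scaleR_zero_left)
  qed
  have tnz: "?t \<noteq> 0"
  proof
    assume "?t = 0"
    moreover have "?t \<noteq> 0"
    proof -
      obtain v where "v \<noteq> 0" "hyperplane ?t = hyperplane v" using arrangement_normal[OF A] m unfolding mem_def plane_def by metis
      moreover have "hyperplane (0 :: real^3) = UNIV" by (simp add: hyperplane_def)
      ultimately show ?thesis using hyperplane_neq_UNIV by metis
    qed
    ultimately show False by simp
  qed
  obtain k where k: "?t = k *\<^sub>R (?P \<times> ?Q)" using par[OF tP tQ] ..
  obtain l where l: "nv n1 n2 n3 = l *\<^sub>R (?P \<times> ?Q)" using par[OF nP nQ] ..
  have "k \<noteq> 0" using k tnz by auto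
  moreover have "l \<noteq> 0" using l nz by auto
  ultimately have "hyperplane ?t = hyperplane (nv n1 n2 n3)" unfolding k l by (simp add: hyperplane_scale)
  then show ?thesis using m n unfolding fxd_def plane_def by simp
qed

text \<open>The point at infinity of a fixed parallel line serves as one of the two points, so a
  single affine point on the line suffices.\<close>

lemma fxd_parallel:
  assumes "mem a b j" "fxd 0 0 1" "fxd a b j0" "fxd a1 b1 j1" "fxd a2 b2 j2"
    and "a1 * b2 \<noteq> a2 * b1" "a \<noteq> 0 \<or> b \<noteq> 0"
    and "a * (b2 * j1 - b1 * j2) + b * (a1 * j2 - a2 * j1) = j * (a1 * b2 - a2 * b1)"
  shows "fxd a b j"
  by (rule fxd_two_points[OF assms(1,4,5,2,3)]) (use assms(6-8) in auto)

end

section \<open>Chains of concurrences among classes of parallel lines\<close>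

definition hyps :: "(int \<times> int) set \<Rightarrow> int \<Rightarrow> int \<Rightarrow> (real^3) set set" where
  "hyps D lo hi = {plane (of_int a) (of_int b) (of_int j) | a b j. (a, b) \<in> D \<and> lo \<le> j \<and> j \<le> hi}"

lemma hypsI: "(a, b) \<in> D \<Longrightarrow> lo \<le> j \<Longrightarrow> j \<le> hi \<Longrightarrow> plane (of_int a) (of_int b) (of_int j) \<in> hyps D lo hi"
  unfolding hyps_def by blast

lemma hypsE:
  assumes "H \<in> hyps D lo hi"
  obtains a b j where "H = plane (of_int a) (of_int b) (of_int j)" "(a, b) \<in> D" "lo \<le> j" "j \<le> hi"
  using assms unfolding hyps_def by blast

text \<open>For three directions \<open>X, Y, W = X + Y\<close>, the lines \<open>X = i\<close>, \<open>Y = j\<close> and \<open>W = i + j\<close> are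
  concurrent, so any two of them determine the third.\<close>

lemma A2_chain:
  fixes mx my mw fx fy fw :: "int \<Rightarrow> bool"
  assumes RX: "\<And>i j. mx i \<Longrightarrow> fy j \<Longrightarrow> fw (i + j) \<Longrightarrow> fx i"
    and RY: "\<And>i j. my j \<Longrightarrow> fx i \<Longrightarrow> fw (i + j) \<Longrightarrow> fy j"
    and RW: "\<And>i j. mw (i + j) \<Longrightarrow> fx i \<Longrightarrow> fy j \<Longrightarrow> fw (i + j)"
    and base: "fx 0" "fx 1" "fy 0" "fy 1" "fw 0" "fw 1"
    and mem: "\<And>j. - k + 1 \<le> j \<Longrightarrow> j \<le> k \<Longrightarrow> mx j \<and> my j \<and> mw j"
    and k: "1 \<le> k"
    and j: "- k + 1 \<le> j" "j \<le> k"
  shows "fx j \<and> fy j \<and> fw j"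
proof -
  have "n \<le> k \<longrightarrow> (\<forall>j. - n + 1 \<le> j \<and> j \<le> n \<longrightarrow> fx j \<and> fy j \<and> fw j)" if "1 \<le> n" for n
    using that
  proof (induction n rule: int_ge_induct)
    case base
    have "j = 0 \<or> j = 1" if "- 1 + 1 \<le> j \<and> j \<le> 1" for j :: int using that by linarith
    then show ?case using assms(4-9) by blast
  next
    case (step n)
    show ?case
    proof (intro impI)
      assume nk: "n + 1 \<le> k"
      then have IH: "fx j" "fy j" "fw j" if "- n + 1 \<le> j" "j \<le> n" for j using step.IH that by auto
      have n1: "- n + 1 \<le> n" "- n + 1 \<le> 0" "1 \<le> n" using step.hyps by simp_all
      have m: "mx (- n)" "my (- n)" "mw (- n)" "mx (n + 1)" "my (n + 1)" "mw (n + 1)"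
        using mem[of "- n"] mem[of "n + 1"] nk n1 by auto
      \<comment> \<open>The window [-n + 1, n] grows first to -n and then to n + 1. The order
        matters: X = -n uses Y = n with W = 0, and X = n + 1 uses the new Y = -n with W = 1.\<close>
      have xn: "fx (- n)" using RX[of "- n" n] m IH[of n] base n1 by simp
      have yn: "fy (- n)" using RY[of "- n" n] m IH[of n] base n1 by simp
      have wn: "fw (- n)" using RW[of "- n" 0] m xn base by simp
      have x: "fx (n + 1)" using RX[of "n + 1" "- n"] m yn base by simp
      have y: "fy (n + 1)" using RY[of "n + 1" "- n"] m xn base by simp
      have w: "fw (n + 1)" using RW[of n 1] m IH[of n] base n1 by simp
      show "\<forall>j. - (n + 1) + 1 \<le> j \<and> j \<le> n + 1 \<longrightarrow> fx j \<and> fy j \<and> fw j"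
      proof (intro allI impI)
        fix j assume "- (n + 1) + 1 \<le> j \<and> j \<le> n + 1"
        then consider "j = - n" | "j = n + 1" | "- n + 1 \<le> j" "j \<le> n" by linarith
        then show "fx j \<and> fy j \<and> fw j" by cases (use xn yn wn x y w IH in auto)
      qed
    qed
  qed
  then show ?thesis using k j by blast
qed

text \<open>At the lower end the lines are optional, whence the implications, and cannot support
  each other. X = -k and Y = -k use level k and W = 0, but W = -k = (-1) + (-k + 1) lies over the
  guaranteed window only if k \<ge> 2. For k = 1 this line has no guaranteed point, which is the
  reason for \<open>special\<close>.\<close>

lemma A2_chain_Cat:
  fixes mx my mw fx fy fw :: "int \<Rightarrow> bool"
  assumes RX: "\<And>i j. mx i \<Longrightarrow> fy j \<Longrightarrow> fw (i + j) \<Longrightarrow> fx i"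
    and RY: "\<And>i j. my j \<Longrightarrow> fx i \<Longrightarrow> fw (i + j) \<Longrightarrow> fy j"
    and RW: "\<And>i j. mw (i + j) \<Longrightarrow> fx i \<Longrightarrow> fy j \<Longrightarrow> fw (i + j)"
    and base: "fx 0" "fx 1" "fy 0" "fy 1" "fw 0" "fw 1"
    and mem: "\<And>j. - k + 1 \<le> j \<Longrightarrow> j \<le> k \<Longrightarrow> mx j \<and> my j \<and> mw j"
    and k: "1 \<le> k" and special: "k = 1 \<Longrightarrow> mw (- 1) \<Longrightarrow> fw (- 1)"
    and j: "- k \<le> j" "j \<le> k"
  shows "(mx j \<longrightarrow> fx j) \<and> (my j \<longrightarrow> fy j) \<and> (mw j \<longrightarrow> fw j)"
proof -
  have f: "fx j \<and> fy j \<and> fw j" if "- k + 1 \<le> j" "j \<le> k" for j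
    by (rule A2_chain[of mx fy fw fx my mw k j, OF RX RY RW base mem k that])
  show ?thesis
  proof (cases "j = - k")
    case False
    then show ?thesis using f[of j] j by simp
  next
    case True
    have "mx (- k) \<longrightarrow> fx (- k)" using RX[of "- k" k] f[of k] base k by simp
    moreover have "my (- k) \<longrightarrow> fy (- k)" using RY[of "- k" k] f[of k] base k by simp
    moreover have "mw (- k) \<longrightarrow> fw (- k)"
    proof (cases "k = 1")
      case False
      then show ?thesis using RW[of "- 1" "- k + 1"] f[of "- 1"] f[of "- k + 1"] k by simp
    qed (use special in simp)
    ultimately show ?thesis using True by simp
  qed
qed

text \<open>With the whole window [-k, k] present, W = -1 is reached from X = -1, so the exception
  at k = 1 disappears. At level k + 1, X and Y use level -k of each other with W = 1, and W uses X =
  k with Y = 1.\<close>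

lemma A2_chain_Shi:
  fixes mx my mw fx fy fw :: "int \<Rightarrow> bool"
  assumes RX: "\<And>i j. mx i \<Longrightarrow> fy j \<Longrightarrow> fw (i + j) \<Longrightarrow> fx i"
    and RY: "\<And>i j. my j \<Longrightarrow> fx i \<Longrightarrow> fw (i + j) \<Longrightarrow> fy j"
    and RW: "\<And>i j. mw (i + j) \<Longrightarrow> fx i \<Longrightarrow> fy j \<Longrightarrow> fw (i + j)"
    and base: "fx 0" "fx 1" "fy 0" "fy 1" "fw 0" "fw 1"
    and mem: "\<And>j. - k \<le> j \<Longrightarrow> j \<le> k \<Longrightarrow> mx j \<and> my j \<and> mw j"
    and k: "1 \<le> k"
    and j: "- k \<le> j" "j \<le> k + 1"
  shows "(mx j \<longrightarrow> fx j) \<and> (my j \<longrightarrow> fy j) \<and> (mw j \<longrightarrow> fw j)"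
proof -
  have mem': "mx j \<and> my j \<and> mw j" if "- k + 1 \<le> j" "j \<le> k" for j using mem[of j] that by simp
  have sp: "fw (- 1)" if "k = 1"
  proof -
    have "fx (- 1)" using RX[of "- 1" 1] mem[of "- 1"] base that by simp
    then show ?thesis using RW[of "- 1" 0] mem[of "- 1"] base that by simp
  qed
  have f: "fx j \<and> fy j \<and> fw j" if "- k \<le> j" "j \<le> k" for j
    using A2_chain_Cat[of mx fy fw fx my mw k j, OF RX RY RW base mem' k sp that] mem[OF that] by simp
  show ?thesis
  proof (cases "j = k + 1")
    case False
    then show ?thesis using f[of j] j by simp
  next
    case True
    have "mx (k + 1) \<longrightarrow> fx (k + 1)" using RX[of "k + 1" "- k"] f[of "- k"] base k by simp
    moreover have "my (k + 1) \<longrightarrow> fy (k + 1)" using RY[of "k + 1" "- k"] f[of "- k"] base k by simp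
    moreover have "mw (k + 1) \<longrightarrow> fw (k + 1)" using RW[of k 1] f[of k] base k by simp
    ultimately show ?thesis using True by simp
  qed
qed

context marked
begin

lemma A2_rules:
  assumes z: "fxd 0 0 1" and D: "a1 * b2 \<noteq> a2 * b1"
    and x0: "fxd a1 b1 0" and y0: "fxd a2 b2 0" and w0: "fxd (a1 + a2) (b1 + b2) 0"
  shows "mem a1 b1 i \<Longrightarrow> fxd a2 b2 j \<Longrightarrow> fxd (a1 + a2) (b1 + b2) (i + j) \<Longrightarrow> fxd a1 b1 i"
    and "mem a2 b2 j \<Longrightarrow> fxd a1 b1 i \<Longrightarrow> fxd (a1 + a2) (b1 + b2) (i + j) \<Longrightarrow> fxd a2 b2 j"
    and "mem (a1 + a2) (b1 + b2) (i + j) \<Longrightarrow> fxd a1 b1 i \<Longrightarrow> fxd a2 b2 j \<Longrightarrow> fxd (a1 + a2) (b1 + b2) (i + j)"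
proof -
  have nz: "a1 \<noteq> 0 \<or> b1 \<noteq> 0" "a2 \<noteq> 0 \<or> b2 \<noteq> 0" using D by auto
  have nz': "a1 + a2 \<noteq> 0 \<or> b1 + b2 \<noteq> 0"
  proof (rule ccontr)
    assume "\<not> ?thesis"
    then have "a2 = - a1" "b2 = - b1" by simp_all
    then show False using D by simp
  qed
  show "fxd a1 b1 i" if "mem a1 b1 i" "fxd a2 b2 j" "fxd (a1 + a2) (b1 + b2) (i + j)"
    by (rule fxd_parallel[OF that(1) z x0 that(2,3)]) (use D nz in \<open>auto simp: algebra_simps\<close>)
  show "fxd a2 b2 j" if "mem a2 b2 j" "fxd a1 b1 i" "fxd (a1 + a2) (b1 + b2) (i + j)"
    by (rule fxd_parallel[OF that(1) z y0 that(2,3)]) (use D nz in \<open>auto simp: algebra_simps\<close>)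
  show "fxd (a1 + a2) (b1 + b2) (i + j)" if "mem (a1 + a2) (b1 + b2) (i + j)" "fxd a1 b1 i" "fxd a2 b2 j"
    by (rule fxd_parallel[OF that(1) z w0 that(2,3)]) (use D nz' in \<open>auto simp: algebra_simps\<close>)
qed

lemma mem_hyps: "hyps D lo hi \<subseteq> \<A> \<Longrightarrow> (a, b) \<in> D \<Longrightarrow> lo \<le> j \<Longrightarrow> j \<le> hi \<Longrightarrow> mem a b j"
  unfolding mem_def using hypsI[of a b D lo j hi] by auto

lemma image_eq: "\<A>' = \<psi> ` \<A>"
  using iso by (simp add: comb_iso_def bij_betw_def)

lemma all_fixed:
  assumes "\<And>H. H \<in> \<A> \<Longrightarrow> \<psi> H = H"
  shows "\<A>' = \<A>"
  unfolding image_eq using assms by simp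

text \<open>A line without enough known points still passes through its fixed point at infinity, so
  its image keeps the direction and only the level c is unknown.\<close>

lemma parallel_image:
  assumes m: "mem a b j" and z: "fxd 0 0 1" and f: "fxd a b 0" and nz: "a \<noteq> 0 \<or> b \<noteq> 0"
  obtains c where "\<psi> (plane (of_int a) (of_int b) (of_int j)) = plane (of_int a) (of_int b) c"
proof -
  let ?H = "plane (of_int a) (of_int b) (of_int j)"
  have H: "?H \<in> \<A>" using m by (simp add: mem_def)
  obtain n1 n2 n3 where n: "\<psi> ?H = plane n1 n2 n3" "n1 \<noteq> 0 \<or> n2 \<noteq> 0 \<or> n3 \<noteq> 0" using image_plane[OF H] .
  have zA: "plane 0 0 1 \<in> \<A>" "\<psi> (plane 0 0 1) = plane 0 0 1" using z by (simp_all add: fxd_def mem_def)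
  have fA: "plane (of_int a) (of_int b) 0 \<in> \<A>" "\<psi> (plane (of_int a) (of_int b) 0) = plane (of_int a) (of_int b) 0"
    using f by (simp_all add: fxd_def mem_def)
  have cond: "of_int a * 0 \<noteq> 0 * real_of_int b \<or> of_int a * 1 \<noteq> 0 * (0::real) \<or> of_int b * 1 \<noteq> 0 * (0::real)"
    using nz by simp
  have "plane (of_int a) (of_int b) 0 \<inter> plane 0 0 1 \<subseteq> ?H"
    unfolding plane_Int_subset_iff[OF cond] by simp
  then have "\<psi> (plane (of_int a) (of_int b) 0) \<inter> \<psi> (plane 0 0 1) \<subseteq> \<psi> ?H"
    using comb_isoD(3)[OF iso fA(1) zA(1) H] by simp
  then have "plane (of_int a) (of_int b) 0 \<inter> plane 0 0 1 \<subseteq> plane n1 n2 n3" by (simp only: fA(2) zA(2) n(1))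
  then have eq: "n2 * of_int a = n1 * of_int b" unfolding plane_Int_subset_iff[OF cond] by simp
  have "?H \<noteq> plane 0 0 1"
  proof
    assume e: "?H = plane 0 0 1"
    have "real_of_int a \<noteq> 0 \<or> real_of_int b \<noteq> 0 \<or> real_of_int j \<noteq> 0" using nz by auto
    from plane_eqD(2,3)[OF e this] have "real_of_int a = 0" "real_of_int b = 0" by simp_all
    then show False using nz by simp
  qed
  then have "plane n1 n2 n3 \<noteq> plane 0 0 1" using comb_isoD(2)[OF iso H zA(1)] n(1) zA(2) by simp
  then have n12: "n1 \<noteq> 0 \<or> n2 \<noteq> 0"
    using plane_scale[of n3 0 0 1] n(2) by auto
  obtain k where k: "n1 = k * of_int a" "n2 = k * of_int b"
  proof (cases "a = 0")
    case True
    then have "n1 = 0" using eq nz by simp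
    then show thesis using that[of "n2 / of_int b"] True nz by simp
  next
    case False
    then have "n1 = n1 / of_int a * of_int a" "n2 = n1 / of_int a * of_int b"
      using eq by (simp_all add: eq_divide_eq)
    then show thesis by (rule that)
  qed
  then have "k \<noteq> 0" using n12 by auto
  then have "plane n1 n2 n3 = plane (of_int a) (of_int b) (n3 / k)"
    using plane_scale[of k "of_int a" "of_int b" "n3 / k"] k by simp
  then show thesis using that n(1) by simp
qed

end

context marked
begin

lemma A2_system_Cat:
  assumes z: "fxd 0 0 1" and D: "a1 * b2 \<noteq> a2 * b1" and ab: "a3 = a1 + a2" "b3 = b1 + b2"
    and base: "fxd a1 b1 0" "fxd a1 b1 1" "fxd a2 b2 0" "fxd a2 b2 1" "fxd a3 b3 0" "fxd a3 b3 1"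
    and m: "\<And>j. - k + 1 \<le> j \<Longrightarrow> j \<le> k \<Longrightarrow> mem a1 b1 j \<and> mem a2 b2 j \<and> mem a3 b3 j"
    and k: "1 \<le> k" and special: "k = 1 \<Longrightarrow> mem a3 b3 (- 1) \<Longrightarrow> fxd a3 b3 (- 1)"
    and j: "- k \<le> j" "j \<le> k"
  shows "(mem a1 b1 j \<longrightarrow> fxd a1 b1 j) \<and> (mem a2 b2 j \<longrightarrow> fxd a2 b2 j) \<and> (mem a3 b3 j \<longrightarrow> fxd a3 b3 j)"
proof -
  note R = A2_rules[OF z D base(1,3) base(5)[unfolded ab], folded ab]
  show ?thesis
    by (rule A2_chain_Cat[of "mem a1 b1" "fxd a2 b2" "fxd a3 b3" "fxd a1 b1" "mem a2 b2" "mem a3 b3" k j,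
        OF R base m k special j])
qed

lemma A2_system_Shi:
  assumes z: "fxd 0 0 1" and D: "a1 * b2 \<noteq> a2 * b1" and ab: "a3 = a1 + a2" "b3 = b1 + b2"
    and base: "fxd a1 b1 0" "fxd a1 b1 1" "fxd a2 b2 0" "fxd a2 b2 1" "fxd a3 b3 0" "fxd a3 b3 1"
    and m: "\<And>j. - k \<le> j \<Longrightarrow> j \<le> k \<Longrightarrow> mem a1 b1 j \<and> mem a2 b2 j \<and> mem a3 b3 j"
    and k: "1 \<le> k" and j: "- k \<le> j" "j \<le> k + 1"
  shows "(mem a1 b1 j \<longrightarrow> fxd a1 b1 j) \<and> (mem a2 b2 j \<longrightarrow> fxd a2 b2 j) \<and> (mem a3 b3 j \<longrightarrow> fxd a3 b3 j)"
proof -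
  note R = A2_rules[OF z D base(1,3) base(5)[unfolded ab], folded ab]
  show ?thesis
    by (rule A2_chain_Shi[of "mem a1 b1" "fxd a2 b2" "fxd a3 b3" "fxd a1 b1" "mem a2 b2" "mem a3 b3" k j,
        OF R base m k j])
qed

text \<open>The points (1, 0), (0, 1) and the origin, cut out by the frame, locate the remaining
  lines at levels 0 and 1.\<close>

lemma A2_frame:
  assumes f: "fxd 1 0 0" "fxd 0 1 0" "fxd 0 0 1" "fxd 1 1 1" and m: "mem 1 0 1" "mem 0 1 1" "mem 1 1 0"
  shows "fxd 1 0 1" "fxd 0 1 1" "fxd 1 1 0"
proof -
  show "fxd 1 0 1" by (rule fxd_parallel[OF m(1) f(3) f(1) f(2) f(4)]) simp_all
  show "fxd 0 1 1" by (rule fxd_parallel[OF m(2) f(3) f(2) f(1) f(4)]) simp_all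
  show "fxd 1 1 0" by (rule fxd_parallel[OF m(3) f(3) f(4) f(1) f(2)]) simp_all
qed

end

section \<open>Arrangements of type A_2\<close>

lemma hyps_memD: "hyps D lo hi \<subseteq> \<A> \<Longrightarrow> (a, b) \<in> D \<Longrightarrow> lo \<le> j \<Longrightarrow> j \<le> hi \<Longrightarrow>
    plane (of_int a) (of_int b) (of_int j) \<in> \<A>"
  using hypsI[of a b D lo j hi] by auto

lemma A2_generic_frame: "generic_frame (plane 1 0 0) (plane 0 1 0) (plane 0 0 1) (plane 1 1 1)"
  by (rule generic_frame_plane) simp_all

definition dirs_A2 :: "(int \<times> int) set" where
  "dirs_A2 = {(1, 0), (0, 1), (1, 1)}"

lemma dirs_A2_iff: "(a, b) \<in> dirs_A2 \<longleftrightarrow> a = 1 \<and> b = 0 \<or> a = 0 \<and> b = 1 \<or> a = 1 \<and> b = 1"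
  by (auto simp: dirs_A2_def)

text \<open>The only obstruction is x1 + x2 = -1 for k = 1. It is located once x1 = -1 or x2 = -1 is
  present, through (-1, 0) or (0, -1); \<open>special\<close> asks for one of them.\<close>

lemma A2_Shi_rigid:
  assumes A: "arrangement \<A>" and k: "1 \<le> k" and low: "hyps dirs_A2 (- k + 1) k \<subseteq> \<A>" and z: "plane 0 0 1 \<in> \<A>"
    and up: "\<A> \<subseteq> hyps dirs_A2 (- k) k \<union> {plane 0 0 1}"
    and special: "k = 1 \<Longrightarrow> plane 1 1 (- 1) \<in> \<A> \<Longrightarrow> plane 1 0 (- 1) \<in> \<A> \<or> plane 0 1 (- 1) \<in> \<A>"
  shows "freeness_depends_only_on_lattice \<A>"
proof -
  have H: "plane 1 0 0 \<in> \<A>" "plane 0 1 0 \<in> \<A>" "plane 1 1 1 \<in> \<A>"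
    using hyps_memD[OF low, of 1 0 0] hyps_memD[OF low, of 0 1 0] hyps_memD[OF low, of 1 1 1] k
    by (simp_all add: dirs_A2_def)
  show ?thesis
  proof (rule rigid_frameI[OF A H(1,2) z H(3) A2_generic_frame])
    fix \<A>' \<psi> assume A': "arrangement \<A>'" "comb_iso \<A> \<A>' \<psi>"
      and fx: "\<psi> (plane 1 0 0) = plane 1 0 0" "\<psi> (plane 0 1 0) = plane 0 1 0" "\<psi> (plane 0 0 1) = plane 0 0 1" "\<psi> (plane 1 1 1) = plane 1 1 1"
    interpret marked \<A> \<A>' \<psi> by unfold_locales (fact A A')+
    have m: "mem 1 0 j \<and> mem 0 1 j \<and> mem 1 1 j" if "- k + 1 \<le> j" "j \<le> k" for j
      using mem_hyps[OF low] that by (simp add: dirs_A2_def)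
    have f: "fxd 1 0 0" "fxd 0 1 0" "fxd 0 0 1" "fxd 1 1 1"
      using fx H z by (simp_all add: fxd_def mem_def)
    have f': "fxd 1 0 1" "fxd 0 1 1" "fxd 1 1 0"
      using A2_frame[OF f] m[of 0] m[of 1] k by simp_all
    have sp: "fxd 1 1 (- 1)" if k1: "k = 1" and w: "mem 1 1 (- 1)"
    proof -
      have "mem 1 0 (- 1) \<or> mem 0 1 (- 1)" using special[OF k1] w by (simp add: mem_def)
      then show ?thesis
      proof
        assume x: "mem 1 0 (- 1)"
        have "fxd 1 0 (- 1)" by (rule fxd_parallel[OF x f(3) f(1) f'(2,3)]) simp_all
        show ?thesis by (rule fxd_parallel[OF w f(3) f'(3) \<open>fxd 1 0 (- 1)\<close> f(2)]) simp_all
      next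
        assume y: "mem 0 1 (- 1)"
        have "fxd 0 1 (- 1)" by (rule fxd_parallel[OF y f(3) f(2) f'(1,3)]) simp_all
        show ?thesis by (rule fxd_parallel[OF w f(3) f'(3) \<open>fxd 0 1 (- 1)\<close> f(1)]) simp_all
      qed
    qed
    have fxj: "(mem 1 0 j \<longrightarrow> fxd 1 0 j) \<and> (mem 0 1 j \<longrightarrow> fxd 0 1 j) \<and> (mem 1 1 j \<longrightarrow> fxd 1 1 j)"
      if "- k \<le> j" "j \<le> k" for j
      by (rule A2_system_Cat[of 1 1 0 0 1 1 k j, OF f(3) _ _ _ f(1) f'(1) f(2) f'(2) f'(3) f(4) m k sp that]) simp_all
    have "\<A>' = \<A>"
    proof (rule all_fixed)
      fix H assume H: "H \<in> \<A>"
      then have "H = plane 0 0 1 \<or> H \<in> hyps dirs_A2 (- k) k" using up by auto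
      then show "\<psi> H = H"
      proof
        assume "H \<in> hyps dirs_A2 (- k) k"
        then obtain a b j where "H = plane (of_int a) (of_int b) (of_int j)" "(a, b) \<in> dirs_A2" "- k \<le> j" "j \<le> k"
          by (rule hypsE)
        then show ?thesis using fxj[of j] H unfolding fxd_def by (auto simp: dirs_A2_def mem_def)
      qed (use fx in simp)
    qed
    then show "free_arrangement \<A>' \<longleftrightarrow> free_arrangement \<A>" by simp
  qed
qed

lemma A2_Cat_rigid:
  assumes A: "arrangement \<A>" and k: "1 \<le> k" and low: "hyps dirs_A2 (- k) k \<subseteq> \<A>" and z: "plane 0 0 1 \<in> \<A>"
    and up: "\<A> \<subseteq> hyps dirs_A2 (- k) (k + 1) \<union> {plane 0 0 1}"
  shows "freeness_depends_only_on_lattice \<A>"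
proof -
  have H: "plane 1 0 0 \<in> \<A>" "plane 0 1 0 \<in> \<A>" "plane 1 1 1 \<in> \<A>"
    using hyps_memD[OF low, of 1 0 0] hyps_memD[OF low, of 0 1 0] hyps_memD[OF low, of 1 1 1] k
    by (simp_all add: dirs_A2_def)
  show ?thesis
  proof (rule rigid_frameI[OF A H(1,2) z H(3) A2_generic_frame])
    fix \<A>' \<psi> assume A': "arrangement \<A>'" "comb_iso \<A> \<A>' \<psi>"
      and fx: "\<psi> (plane 1 0 0) = plane 1 0 0" "\<psi> (plane 0 1 0) = plane 0 1 0" "\<psi> (plane 0 0 1) = plane 0 0 1" "\<psi> (plane 1 1 1) = plane 1 1 1"
    interpret marked \<A> \<A>' \<psi> by unfold_locales (fact A A')+
    have m: "mem 1 0 j \<and> mem 0 1 j \<and> mem 1 1 j" if "- k \<le> j" "j \<le> k" for j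
      using mem_hyps[OF low] that by (simp add: dirs_A2_def)
    have f: "fxd 1 0 0" "fxd 0 1 0" "fxd 0 0 1" "fxd 1 1 1"
      using fx H z by (simp_all add: fxd_def mem_def)
    have f': "fxd 1 0 1" "fxd 0 1 1" "fxd 1 1 0"
      using A2_frame[OF f] m[of 0] m[of 1] k by simp_all
    have fxj: "(mem 1 0 j \<longrightarrow> fxd 1 0 j) \<and> (mem 0 1 j \<longrightarrow> fxd 0 1 j) \<and> (mem 1 1 j \<longrightarrow> fxd 1 1 j)"
      if "- k \<le> j" "j \<le> k + 1" for j
      by (rule A2_system_Shi[of 1 1 0 0 1 1 k j, OF f(3) _ _ _ f(1) f'(1) f(2) f'(2) f'(3) f(4) m k that]) simp_all
    have "\<A>' = \<A>"
    proof (rule all_fixed)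
      fix H assume H: "H \<in> \<A>"
      then have "H = plane 0 0 1 \<or> H \<in> hyps dirs_A2 (- k) (k + 1)" using up by auto
      then show "\<psi> H = H"
      proof
        assume "H \<in> hyps dirs_A2 (- k) (k + 1)"
        then obtain a b j where "H = plane (of_int a) (of_int b) (of_int j)" "(a, b) \<in> dirs_A2" "- k \<le> j" "j \<le> k + 1"
          by (rule hypsE)
        then show ?thesis using fxj[of j] H unfolding fxd_def by (auto simp: dirs_A2_def mem_def)
      qed (use fx in simp)
    qed
    then show "free_arrangement \<A>' \<longleftrightarrow> free_arrangement \<A>" by simp
  qed
qed

text \<open>Not rigid: the image of x1 + x2 = -1 is some x1 + x2 = c. Injectivity excludes c = 0 and
  c = 1, the missing incidence with the point (1, 1) excludes c = 2, and for all other c the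
  arrangement is not free.\<close>

lemma A2_Shi_special:
  assumes A: "arrangement \<A>"
    and eq: "\<A> = insert (plane 1 1 (- 1)) {plane 1 0 0, plane 1 0 1, plane 0 1 0, plane 0 1 1, plane 1 1 0, plane 1 1 1, plane 0 0 1}"
  shows "freeness_depends_only_on_lattice \<A>"
proof -
  have H: "plane 1 0 0 \<in> \<A>" "plane 0 1 0 \<in> \<A>" "plane 0 0 1 \<in> \<A>" "plane 1 1 1 \<in> \<A>" by (simp_all add: eq)
  show ?thesis
  proof (rule rigid_frameI[OF A H A2_generic_frame])
    fix \<A>' \<psi> assume A': "arrangement \<A>'" "comb_iso \<A> \<A>' \<psi>"
      and fx: "\<psi> (plane 1 0 0) = plane 1 0 0" "\<psi> (plane 0 1 0) = plane 0 1 0" "\<psi> (plane 0 0 1) = plane 0 0 1" "\<psi> (plane 1 1 1) = plane 1 1 1"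
    interpret marked \<A> \<A>' \<psi> by unfold_locales (fact A A')+
    have f: "fxd 1 0 0" "fxd 0 1 0" "fxd 0 0 1" "fxd 1 1 1"
      using fx H by (simp_all add: fxd_def mem_def)
    have m: "mem 1 0 1" "mem 0 1 1" "mem 1 1 0" "mem 1 1 (- 1)" unfolding mem_def by (simp_all add: eq)
    have f': "fxd 1 0 1" "fxd 0 1 1" "fxd 1 1 0" using A2_frame[OF f m(1-3)] by simp_all
    obtain c where c: "\<psi> (plane 1 1 (- 1)) = plane 1 1 c"
      using parallel_image[OF m(4) f(3) f'(3)] by auto
    have img: "\<A>' = insert (plane 1 1 c) {plane 1 0 0, plane 1 0 1, plane 0 1 0, plane 0 1 1, plane 1 1 0, plane 1 1 1, plane 0 0 1}"
      unfolding image_eq eq using f f' c by (simp add: fxd_def)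
    have w: "plane 1 1 (- 1) \<in> \<A>" "plane 1 1 0 \<in> \<A>" "plane 1 0 1 \<in> \<A>" "plane 0 1 1 \<in> \<A>" by (simp_all add: eq)
    have "plane 1 1 (- 1) \<noteq> plane 1 1 0" "plane 1 1 (- 1) \<noteq> plane 1 1 1"
      using plane_eqD(2)[of 1 1 "-1" 1 1 0] plane_eqD(2)[of 1 1 "-1" 1 1 1] by auto
    then have "\<psi> (plane 1 1 (- 1)) \<noteq> \<psi> (plane 1 1 0)" "\<psi> (plane 1 1 (- 1)) \<noteq> \<psi> (plane 1 1 1)"
      using comb_isoD(2)[OF iso w(1)] w H by simp_all
    then have c01: "c \<noteq> 0" "c \<noteq> 1" using c f' f by (auto simp: fxd_def)
    have cond: "1 * 1 \<noteq> 0 * (0::real) \<or> 1 * 1 \<noteq> 0 * (1::real) \<or> 0 * 1 \<noteq> 1 * (1::real)" by simp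
    have "\<not> plane 1 0 1 \<inter> plane 0 1 1 \<subseteq> plane 1 1 (- 1)" unfolding plane_Int_subset_iff[OF cond] by simp
    then have "\<not> \<psi> (plane 1 0 1) \<inter> \<psi> (plane 0 1 1) \<subseteq> \<psi> (plane 1 1 (- 1))"
      using comb_isoD(3)[OF iso w(3,4,1)] by simp
    then have "\<not> plane 1 0 1 \<inter> plane 0 1 1 \<subseteq> plane 1 1 c" using c f' by (simp add: fxd_def)
    then have "c \<noteq> 2" unfolding plane_Int_subset_iff[OF cond] by simp
    then have "\<not> free_arrangement \<A>'" unfolding img using c01 by (intro not_free_A2_Shi_insert)
    moreover have "\<not> free_arrangement \<A>" unfolding eq by (intro not_free_A2_Shi_insert) simp_all
    ultimately show "free_arrangement \<A>' \<longleftrightarrow> free_arrangement \<A>" by simp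
  qed
qed

text \<open>The line x1 + x2 = 1 is absent, so x1 = 1 and x1 + x2 = 0 enter the frame. The image of
  x2 = 1 is some x2 = b, where injectivity excludes b = 0 and the missing incidence with the point
  (1, -1) excludes b = -1.\<close>

lemma A2_Cat0_special:
  assumes A: "arrangement \<A>"
    and eq: "\<A> = insert (plane 0 1 1) {plane 1 0 0, plane 0 1 0, plane 1 1 0, plane 0 0 1, plane 1 0 1}"
  shows "freeness_depends_only_on_lattice \<A>"
proof -
  have H: "plane 1 0 1 \<in> \<A>" "plane 0 1 0 \<in> \<A>" "plane 0 0 1 \<in> \<A>" "plane 1 1 0 \<in> \<A>" by (simp_all add: eq)
  have gen: "generic_frame (plane 1 0 1) (plane 0 1 0) (plane 0 0 1) (plane 1 1 0)" by (rule generic_frame_plane) simp_all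
  show ?thesis
  proof (rule rigid_frameI[OF A H gen])
    fix \<A>' \<psi> assume A': "arrangement \<A>'" "comb_iso \<A> \<A>' \<psi>"
      and fx: "\<psi> (plane 1 0 1) = plane 1 0 1" "\<psi> (plane 0 1 0) = plane 0 1 0" "\<psi> (plane 0 0 1) = plane 0 0 1" "\<psi> (plane 1 1 0) = plane 1 1 0"
    interpret marked \<A> \<A>' \<psi> by unfold_locales (fact A A')+
    have f: "fxd 1 0 1" "fxd 0 1 0" "fxd 0 0 1" "fxd 1 1 0"
      using fx H by (simp_all add: fxd_def mem_def)
    have m: "mem 1 0 0" "mem 0 1 1" unfolding mem_def by (simp_all add: eq)
    have x0: "fxd 1 0 0" by (rule fxd_parallel[OF m(1) f(3,1,2,4)]) simp_all
    obtain b where b: "\<psi> (plane 0 1 1) = plane 0 1 b"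
      using parallel_image[OF m(2) f(3) f(2)] by auto
    have img: "\<A>' = insert (plane 0 1 b) {plane 1 0 0, plane 0 1 0, plane 1 1 0, plane 0 0 1, plane 1 0 1}"
      unfolding image_eq eq using f x0 b by (simp add: fxd_def)
    have y1: "plane 0 1 1 \<in> \<A>" by (simp add: eq)
    have "plane 0 1 1 \<noteq> plane 0 1 0" using plane_eqD(3)[of 0 1 1 0 1 0] by auto
    then have "\<psi> (plane 0 1 1) \<noteq> \<psi> (plane 0 1 0)"
      using comb_isoD(2)[OF iso y1 H(2)] by simp
    then have b0: "b \<noteq> 0" using b fx by auto
    have cond: "1 * 1 \<noteq> 1 * (0::real) \<or> 1 * 0 \<noteq> 1 * (1::real) \<or> 0 * 0 \<noteq> 1 * (1::real)" by simp
    have "\<not> plane 1 0 1 \<inter> plane 1 1 0 \<subseteq> plane 0 1 1" unfolding plane_Int_subset_iff[OF cond] by simp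
    then have "\<not> \<psi> (plane 1 0 1) \<inter> \<psi> (plane 1 1 0) \<subseteq> \<psi> (plane 0 1 1)"
      using comb_isoD(3)[OF iso H(1,4) y1] by simp
    then have "\<not> plane 1 0 1 \<inter> plane 1 1 0 \<subseteq> plane 0 1 b" using b fx by simp
    then have "b \<noteq> - 1" unfolding plane_Int_subset_iff[OF cond] by auto
    then have "\<not> free_arrangement \<A>'" unfolding img using b0 by (intro not_free_A2_two_lines)
    moreover have "\<not> free_arrangement \<A>" unfolding eq by (intro not_free_A2_two_lines) simp_all
    ultimately show "free_arrangement \<A>' \<longleftrightarrow> free_arrangement \<A>" by simp
  qed
qed

text \<open>Two lines of level 1 meet on the level-0 line of the difference of their directions, and
  a line of level 1 meets infinity on its own level-0 parallel. So modularity of the origin reduces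
  to the presence of these level-0 lines.\<close>

lemma modular_origin:
  assumes H: "plane 1 0 0 \<in> \<A>" "plane 0 1 0 \<in> \<A>"
    and cover: "\<And>H. H \<in> \<A> \<Longrightarrow> H = plane 0 0 1 \<or> (\<exists>a b. H = plane a b 0) \<or> (\<exists>(a, b)\<in>E. H = plane a b 1)"
    and E0: "\<And>a b. (a, b) \<in> E \<Longrightarrow> plane a b 1 \<in> \<A> \<Longrightarrow> (a \<noteq> 0 \<or> b \<noteq> 0) \<and> plane a b 0 \<in> \<A>"
    and E1: "\<And>a b a' b'. (a, b) \<in> E \<Longrightarrow> (a', b') \<in> E \<Longrightarrow> plane a b 1 \<in> \<A> \<Longrightarrow> plane a' b' 1 \<in> \<A> \<Longrightarrow>
      (a, b) \<noteq> (a', b') \<Longrightarrow> plane (a - a') (b - b') 0 \<in> \<A>"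
  shows "modular_at \<A> (plane 1 0 0) (plane 0 1 0)"
proof -
  have cond0: "1 * 1 \<noteq> 0 * (0::real) \<or> 1 * 0 \<noteq> 0 * (0::real) \<or> 0 * 0 \<noteq> 1 * (0::real)" by simp
  have through: "plane 1 0 0 \<inter> plane 0 1 0 \<subseteq> plane a b c \<longleftrightarrow> c = 0" for a b c
    unfolding plane_Int_subset_iff[OF cond0] by simp
  have ne: "plane 1 0 0 \<noteq> plane 0 1 0"
  proof
    assume "plane 1 0 0 = plane 0 1 0"
    from plane_eqD(1)[OF this] show False by simp
  qed
  show ?thesis unfolding modular_at_def
  proof (intro conjI ballI impI; (elim conjE)?)
    fix X Y assume X: "X \<in> \<A>" and Y: "Y \<in> \<A>" and XY: "X \<noteq> Y"
      and nX: "\<not> plane 1 0 0 \<inter> plane 0 1 0 \<subseteq> X" and nY: "\<not> plane 1 0 0 \<inter> plane 0 1 0 \<subseteq> Y"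
    have cX: "X = plane 0 0 1 \<or> (\<exists>a b. (a, b) \<in> E \<and> X = plane a b 1)"
      using cover[OF X] nX through by auto
    have cY: "Y = plane 0 0 1 \<or> (\<exists>a b. (a, b) \<in> E \<and> Y = plane a b 1)"
      using cover[OF Y] nY through by auto
    have "\<exists>a b. plane a b 0 \<in> \<A> \<and> X \<inter> Y \<subseteq> plane a b 0"
      using cX cY
    proof (elim disjE exE conjE)
      fix a b assume ab: "X = plane 0 0 1" "(a, b) \<in> E" "Y = plane a b 1"
      then have e: "a \<noteq> 0 \<or> b \<noteq> 0" "plane a b 0 \<in> \<A>" using E0[of a b] Y by auto
      then have "0 * b \<noteq> a * (0::real) \<or> 0 * 1 \<noteq> a * 1 \<or> 0 * 1 \<noteq> b * 1" by auto
      from plane_Int_subset_iff[OF this, of a b 0] show ?thesis using e(2) ab(1,3) by auto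
    next
      fix a b assume ab: "Y = plane 0 0 1" "(a, b) \<in> E" "X = plane a b 1"
      then have e: "a \<noteq> 0 \<or> b \<noteq> 0" "plane a b 0 \<in> \<A>" using E0[of a b] X by auto
      then have "a * 0 \<noteq> 0 * b \<or> a * 1 \<noteq> 0 * 1 \<or> b * 1 \<noteq> 0 * (1::real)" by auto
      from plane_Int_subset_iff[OF this, of a b 0] show ?thesis using e(2) ab(1,3) by auto
    next
      fix a b a' b' assume ab: "(a, b) \<in> E" "X = plane a b 1" "(a', b') \<in> E" "Y = plane a' b' 1"
      have d: "(a, b) \<noteq> (a', b')" using ab XY by auto
      then have e: "plane (a - a') (b - b') 0 \<in> \<A>" using E1[OF ab(1,3)] X Y ab by simp
      have "a * b' \<noteq> a' * b \<or> a * 1 \<noteq> a' * 1 \<or> b * 1 \<noteq> b' * 1" using d by auto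
      from plane_Int_subset_iff[OF this, of "a - a'" "b - b'" 0]
      have "X \<inter> Y \<subseteq> plane (a - a') (b - b') 0" unfolding ab by (simp add: algebra_simps)
      then show ?thesis using e by auto
    qed (use XY in auto)
    then obtain a b where "plane a b 0 \<in> \<A>" "X \<inter> Y \<subseteq> plane a b 0" by auto
    then show "\<exists>K\<in>\<A>. plane 1 0 0 \<inter> plane 0 1 0 \<subseteq> K \<and> X \<inter> Y \<subseteq> K"
      using through[of a b 0] by (intro bexI[of _ "plane a b 0"]) simp_all
  qed (use H ne in auto)
qed

theorem A2_Shi:
  assumes A: "arrangement \<A>" and k: "1 \<le> k" and low: "hyps dirs_A2 (- k + 1) k \<union> {plane 0 0 1} \<subseteq> \<A>"
    and up: "\<A> \<subseteq> hyps dirs_A2 (- k) k \<union> {plane 0 0 1}"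
  shows "freeness_depends_only_on_lattice \<A>"
proof (cases "k = 1 \<and> plane 1 1 (- 1) \<in> \<A> \<and> plane 1 0 (- 1) \<notin> \<A> \<and> plane 0 1 (- 1) \<notin> \<A>")
  case False
  then show ?thesis using A2_Shi_rigid[OF A k _ _ up] low by auto
next
  case True
  have "\<A> = insert (plane 1 1 (- 1)) {plane 1 0 0, plane 1 0 1, plane 0 1 0, plane 0 1 1, plane 1 1 0, plane 1 1 1, plane 0 0 1}" (is "_ = ?B")
  proof
    show "\<A> \<subseteq> ?B"
    proof
      fix H assume H: "H \<in> \<A>"
      then have "H = plane 0 0 1 \<or> H \<in> hyps dirs_A2 (- 1) 1" using up True by auto
      then show "H \<in> ?B"
      proof
        assume "H \<in> hyps dirs_A2 (- 1) 1"
        then obtain a b j where h: "H = plane (of_int a) (of_int b) (of_int j)" "(a, b) \<in> dirs_A2" "- 1 \<le> j" "j \<le> 1"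
          by (rule hypsE)
        have "j = - 1 \<or> j = 0 \<or> j = 1" using h(3,4) by linarith
        moreover have "a = 1 \<and> b = 0 \<or> a = 0 \<and> b = 1 \<or> a = 1 \<and> b = 1" using h(2) by (simp only: dirs_A2_iff)
        ultimately show ?thesis using h(1) H True by (elim disjE conjE) simp_all
      qed simp
    qed
    have low': "hyps dirs_A2 0 1 \<subseteq> \<A>" using low True by simp
    show "?B \<subseteq> \<A>"
      using hyps_memD[OF low', of 1 0 0] hyps_memD[OF low', of 1 0 1] hyps_memD[OF low', of 0 1 0]
        hyps_memD[OF low', of 0 1 1] hyps_memD[OF low', of 1 1 0] hyps_memD[OF low', of 1 1 1] low True
      by (simp add: dirs_A2_def)
  qed
  then show ?thesis by (rule A2_Shi_special[OF A])
qed

theorem A2_Cat: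
  assumes A: "arrangement \<A>" and k: "0 \<le> k" and low: "hyps dirs_A2 (- k) k \<union> {plane 0 0 1} \<subseteq> \<A>"
    and up: "\<A> \<subseteq> hyps dirs_A2 (- k) (k + 1) \<union> {plane 0 0 1}"
  shows "freeness_depends_only_on_lattice \<A>"
proof (cases "k = 0")
  case False
  then show ?thesis using A2_Cat_rigid[OF A _ _ _ up] low k by auto
next
  case True
  have low': "hyps dirs_A2 0 0 \<subseteq> \<A>" using low True by simp
  have m: "plane 1 0 0 \<in> \<A>" "plane 0 1 0 \<in> \<A>" "plane 1 1 0 \<in> \<A>" "plane 0 0 1 \<in> \<A>"
    using hyps_memD[OF low', of 1 0 0] hyps_memD[OF low', of 0 1 0] hyps_memD[OF low', of 1 1 0] low
    by (simp_all add: dirs_A2_def)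
  have sub: "\<A> \<subseteq> {plane 1 0 0, plane 0 1 0, plane 1 1 0, plane 0 0 1, plane 1 0 1, plane 0 1 1, plane 1 1 1}"
  proof
    fix H assume "H \<in> \<A>"
    then have "H = plane 0 0 1 \<or> H \<in> hyps dirs_A2 0 1" using up True by auto
    then show "H \<in> {plane 1 0 0, plane 0 1 0, plane 1 1 0, plane 0 0 1, plane 1 0 1, plane 0 1 1, plane 1 1 1}"
    proof
      assume "H \<in> hyps dirs_A2 0 1"
      then obtain a b j where h: "H = plane (of_int a) (of_int b) (of_int j)" "(a, b) \<in> dirs_A2" "0 \<le> j" "j \<le> 1"
        by (rule hypsE)
      have "j = 0 \<or> j = 1" using h(3,4) by linarith
      moreover have "a = 1 \<and> b = 0 \<or> a = 0 \<and> b = 1 \<or> a = 1 \<and> b = 1" using h(2) by (simp only: dirs_A2_iff)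
      ultimately show ?thesis using h(1) by (elim disjE conjE) simp_all
    qed simp
  qed
  show ?thesis
  \<comment> \<open>The difference (1, -1) of (1, 0) and (0, 1) is the only one that is not a
    direction up to sign, so the origin is modular unless both lines are present. If x1 + x2 = 1 is
    present as well, the arrangement is the Shi arrangement with k = 1.\<close>
  proof (cases "plane 1 0 1 \<in> \<A> \<and> plane 0 1 1 \<in> \<A>")
    case False
    \<comment> \<open>\<open>modular_origin\<close> asks for the literal differences of directions,
      which are negative here.\<close>
    have neg: "plane (- 1) 0 0 \<in> \<A>" "plane 0 (- 1) 0 \<in> \<A>"
      using m plane_scale[of "-1" 1 0 0] plane_scale[of "-1" 0 1 0] by simp_all
    have "modular_at \<A> (plane 1 0 0) (plane 0 1 0)"
    proof (rule modular_origin[OF m(1,2), where E = "{(1, 0), (0, 1), (1, 1)}"])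
      show "H = plane 0 0 1 \<or> (\<exists>a b. H = plane a b 0) \<or> (\<exists>(a, b)\<in>{(1, 0), (0, 1), (1, 1)}. H = plane a b 1)"
        if "H \<in> \<A>" for H
      proof -
        have "H \<in> {plane 1 0 0, plane 0 1 0, plane 1 1 0, plane 0 0 1, plane 1 0 1, plane 0 1 1, plane 1 1 1}"
          using sub that by auto
        then show ?thesis unfolding insert_iff empty_iff by (elim disjE) auto
      qed
    qed (use m neg False in auto)
    then show ?thesis by (rule modular_at_freeness_depends_only[OF A])
  next
    case both: True
    show ?thesis
    proof (cases "plane 1 1 1 \<in> \<A>")
      case True
      have "hyps dirs_A2 0 1 \<subseteq> \<A>"
      proof
        fix H assume "H \<in> hyps dirs_A2 0 1"
        then obtain a b j where h: "H = plane (of_int a) (of_int b) (of_int j)" "(a, b) \<in> dirs_A2" "0 \<le> j" "j \<le> 1"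
          by (rule hypsE)
        have "j = 0 \<or> j = 1" using h(3,4) by linarith
        moreover have "a = 1 \<and> b = 0 \<or> a = 0 \<and> b = 1 \<or> a = 1 \<and> b = 1" using h(2) by (simp only: dirs_A2_iff)
        ultimately show "H \<in> \<A>" using h(1) m both True by (elim disjE conjE) simp_all
      qed
      moreover have "\<A> \<subseteq> hyps dirs_A2 (- 1) 1 \<union> {plane 0 0 1}"
      proof
        fix H assume "H \<in> \<A>"
        then have "H = plane 0 0 1 \<or> H \<in> hyps dirs_A2 0 1" using up \<open>k = 0\<close> by auto
        then show "H \<in> hyps dirs_A2 (- 1) 1 \<union> {plane 0 0 1}" unfolding hyps_def by force
      qed
      ultimately show ?thesis using A2_Shi[of \<A> 1] A m by simp
    next
      case False
      have "\<A> = insert (plane 0 1 1) {plane 1 0 0, plane 0 1 0, plane 1 1 0, plane 0 0 1, plane 1 0 1}"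
        using sub m both False by auto
      then show ?thesis by (rule A2_Cat0_special[OF A])
    qed
  qed
qed

section \<open>Linear changes of x1 and x2 that keep the line at infinity\<close>

definition blk :: "real \<Rightarrow> real \<Rightarrow> real \<Rightarrow> real \<Rightarrow> real^3^3" where
  "blk r s t u = vector [vector [r, s, 0], vector [t, u, 0], vector [0, 0, 1]]"

lemma pull_blk: "pull (blk r s t u) (plane a b c) = plane (a * r + b * t) (a * s + b * u) c"
proof -
  have "transpose (blk r s t u) *v nv a b c = nv (a * r + b * t) (a * s + b * u) c"
    by (simp add: vec_eq_iff forall_3 transpose_def matrix_vector_mult_def sum_3 blk_def vector_3 algebra_simps
        del: transpose_matrix_vector)
  then show ?thesis unfolding plane_def pull_hyperplane by simp
qed

lemma blk_inverse:
  assumes "r * u - s * t \<noteq> 0"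
  shows "blk r s t u ** blk (u / (r * u - s * t)) (- s / (r * u - s * t)) (- t / (r * u - s * t)) (r / (r * u - s * t)) = mat 1"
proof -
  let ?D = "r * u - s * t"
  have 1: "r * (u / ?D) + s * (- t / ?D) = 1" "t * (- s / ?D) + u * (r / ?D) = 1"
    "r * (- s / ?D) + s * (r / ?D) = 0" "t * (u / ?D) + u * (- t / ?D) = 0"
    using assms by (simp_all add: divide_simps)
  show ?thesis
    unfolding matrix_matrix_mult_def mat_def
    using 1 by (simp add: vec_eq_iff forall_3 sum_3 blk_def vector_3)
qed

lemma freeness_depends_only_blk:
  assumes D: "r * u - s * t \<noteq> 0" and dep: "freeness_depends_only_on_lattice (pull (blk r s t u) ` \<A>)"
  shows "freeness_depends_only_on_lattice \<A>"
  by (rule freeness_depends_only_pull[OF blk_inverse[OF D] dep])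

lemma arrangement_blk:
  assumes D: "r * u - s * t \<noteq> 0" and A: "arrangement \<A>"
  shows "arrangement (pull (blk r s t u) ` \<A>)"
  by (rule arrangement_pull[OF blk_inverse[OF D] A])

section \<open>Square grids and type B_2\<close>

definition dirs_ax :: "(int \<times> int) set" where "dirs_ax = {(1, 0), (0, 1)}"
definition dirs_diag :: "(int \<times> int) set" where "dirs_diag = {(-1, 1), (1, 1)}"

lemma dirs_ax_iff: "(a, b) \<in> dirs_ax \<longleftrightarrow> a = 1 \<and> b = 0 \<or> a = 0 \<and> b = 1"
  by (auto simp: dirs_ax_def)

lemma dirs_diag_iff: "(a, b) \<in> dirs_diag \<longleftrightarrow> a = - 1 \<and> b = 1 \<or> a = 1 \<and> b = 1"
  by (auto simp: dirs_diag_def)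

text \<open>The Catalan arrangement of type B_2 with long parameter 0 and short parameter k.
  \<open>B2_Cat_short_0\<close> brings the case of short parameter 0 to the same shape.\<close>

definition square_grid :: "int \<Rightarrow> (real^3) set set" where
  "square_grid k = hyps dirs_ax (- k) k \<union> {plane (-1) 1 0, plane 1 1 0, plane 0 0 1}"

lemma square_gridE:
  assumes "H \<in> square_grid k"
  obtains j where "- k \<le> j" "j \<le> k" "H = plane 1 0 (of_int j)" | j where "- k \<le> j" "j \<le> k" "H = plane 0 1 (of_int j)"
    | "H = plane (-1) 1 0" | "H = plane 1 1 0" | "H = plane 0 0 1"
proof -
  have "H \<in> hyps dirs_ax (- k) k \<or> H = plane (-1) 1 0 \<or> H = plane 1 1 0 \<or> H = plane 0 0 1"
    using assms unfolding square_grid_def by blast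
  then show thesis
  proof (elim disjE)
    assume "H \<in> hyps dirs_ax (- k) k"
    then obtain a b j where h: "H = plane (of_int a) (of_int b) (of_int j)" "(a, b) \<in> dirs_ax" "- k \<le> j" "j \<le> k"
      by (rule hypsE)
    from h(2) show thesis unfolding dirs_ax_iff
    proof (elim disjE conjE)
      assume "a = 1" "b = 0" then show thesis using that(1)[OF h(3,4)] h(1) by simp
    next
      assume "a = 0" "b = 1" then show thesis using that(2)[OF h(3,4)] h(1) by simp
    qed
  qed (use that in blast)+
qed

lemma square_gridD:
  "- k \<le> j \<Longrightarrow> j \<le> k \<Longrightarrow> plane 1 0 (of_int j) \<in> square_grid k"
  "- k \<le> j \<Longrightarrow> j \<le> k \<Longrightarrow> plane 0 1 (of_int j) \<in> square_grid k"
  "plane (-1) 1 0 \<in> square_grid k" "plane 1 1 0 \<in> square_grid k" "plane 0 0 1 \<in> square_grid k"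
  using hypsI[of 1 0 dirs_ax "- k" j k] hypsI[of 0 1 dirs_ax "- k" j k]
  by (simp_all add: square_grid_def dirs_ax_def)

lemma B2_generic_frame: "generic_frame (plane 1 0 1) (plane 0 1 1) (plane 0 0 1) (plane 1 1 0)"
  by (rule generic_frame_plane) simp_all

context marked
begin

lemma square_grid_mem:
  assumes "square_grid k \<subseteq> \<A>"
  shows "- k \<le> j \<Longrightarrow> j \<le> k \<Longrightarrow> mem 1 0 j" "- k \<le> j \<Longrightarrow> j \<le> k \<Longrightarrow> mem 0 1 j"
    "mem (- 1) 1 0" "mem 1 1 0" "mem 0 0 1"
  using square_gridD[where k = k] assms by (auto simp: mem_def)

text \<open>Reflection in x1 + x2 = 0 turns the frame lines of level 1 into those of level -1; the
  corners (1, 1) and (-1, -1) give the other diagonal, and the two diagonals meet in the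
  origin.\<close>

lemma square_grid_base:
  assumes f: "fxd 1 0 1" "fxd 0 1 1" "fxd 0 0 1" "fxd 1 1 0" and k: "1 \<le> k" and low: "square_grid k \<subseteq> \<A>"
  shows "fxd 1 0 (- 1)" "fxd 0 1 (- 1)" "fxd (- 1) 1 0" "fxd 1 0 0" "fxd 0 1 0"
proof -
  note m = square_grid_mem[OF low]
  have m1: "mem 1 0 (- 1)" "mem 0 1 (- 1)" "mem 1 0 0" "mem 0 1 0" using m(1,2) k by simp_all
  show p: "fxd 1 0 (- 1)" by (rule fxd_parallel[OF m1(1) f(3) f(1) f(2) f(4)]) simp_all
  show q: "fxd 0 1 (- 1)" by (rule fxd_parallel[OF m1(2) f(3) f(2) f(1) f(4)]) simp_all
  show u: "fxd (- 1) 1 0" by (rule fxd_two_points[OF m(3) f(1) f(2) p q]) simp_all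
  show "fxd 1 0 0" by (rule fxd_parallel[OF m1(3) f(3) f(1) u f(4)]) simp_all
  show "fxd 0 1 0" by (rule fxd_parallel[OF m1(4) f(3) f(2) u f(4)]) simp_all
qed

text \<open>The diagonals through the origin only permute levels up to sign. A further diagonal at
  level e reflects with an offset, and the composite is a shift by e, which propagates outwards. A
  shift by 2 still works because the levels -1, 0, 1 are known at the start.\<close>

lemma square_grid_chain:
  assumes f: "fxd 1 0 1" "fxd 0 1 1" "fxd 0 0 1" "fxd 1 1 0" and k: "1 \<le> k" and low: "square_grid k \<subseteq> \<A>"
    and e: "e = 1 \<or> e = 2" and extra: "mem (- 1) 1 e \<or> mem 1 1 e"
  shows "- k \<le> j \<Longrightarrow> j \<le> k \<Longrightarrow> fxd 1 0 j \<and> fxd 0 1 j" "mem (- 1) 1 e \<Longrightarrow> fxd (- 1) 1 e" "mem 1 1 e \<Longrightarrow> fxd 1 1 e"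
proof -
  note m = square_grid_mem[OF low]
  note f' = square_grid_base[OF f k low]
  \<comment> \<open>The extra diagonals meet x2 = 1 at x1 = 1 - e and x1 = e - 1, and e \<le> 2
    keeps both among the levels -1, 0, 1.\<close>
  have pe: "fxd 1 0 (1 - e)" "fxd 1 0 (e - 1)" using e f f' by auto
  show U: "fxd (- 1) 1 e" if "mem (- 1) 1 e"
    by (rule fxd_parallel[OF that f(3) f'(3) pe(1) f(2)]) (use e in auto)
  show V: "fxd 1 1 e" if "mem 1 1 e"
    by (rule fxd_parallel[OF that f(3) f(4) pe(2) f(2)]) (use e in auto)
  have "n \<le> k \<longrightarrow> (\<forall>j. - n \<le> j \<and> j \<le> n \<longrightarrow> fxd 1 0 j \<and> fxd 0 1 j)" if "1 \<le> n" for n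
    using that
  proof (induction n rule: int_ge_induct)
    case base
    have "j = - 1 \<or> j = 0 \<or> j = 1" if "- 1 \<le> j \<and> j \<le> 1" for j :: int using that by linarith
    then show ?case using f f' by blast
  next
    case (step n)
    show ?case
    proof (intro impI)
      assume nk: "n + 1 \<le> k"
      then have IH: "fxd 1 0 j" "fxd 0 1 j" if "- n \<le> j" "j \<le> n" for j using step.IH that by auto
      have mm: "mem 1 0 (n + 1)" "mem 0 1 (n + 1)" "mem 1 0 (- n - 1)" "mem 0 1 (- n - 1)"
        using m(1)[of "n + 1"] m(2)[of "n + 1"] m(1)[of "- n - 1"] m(2)[of "- n - 1"] nk step.hyps by auto
      have r: "fxd 1 0 (n + 1 - e)" "fxd 0 1 (n + 1 - e)" "fxd 1 0 (e - n - 1)" "fxd 0 1 (e - n - 1)"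
        using IH[of "n + 1 - e"] IH[of "e - n - 1"] e step.hyps by auto
      have "fxd 1 0 (n + 1) \<and> fxd 0 1 (n + 1)"
      proof (cases "mem (- 1) 1 e")
        case True
        have q: "fxd 0 1 (n + 1)"
          by (rule fxd_parallel[OF mm(2) f(3) f(2) r(1) U[OF True]]) simp_all
        have "fxd 1 0 (n + 1)"
          by (rule fxd_parallel[OF mm(1) f(3) f(1) q f'(3)]) simp_all
        then show ?thesis using q by simp
      next
        case False
        then have V': "fxd 1 1 e" using extra V by simp
        have "fxd 1 0 (n + 1)"
          by (rule fxd_parallel[OF mm(1) f(3) f(1) r(4) V']) simp_all
        moreover have "fxd 0 1 (n + 1)"
          by (rule fxd_parallel[OF mm(2) f(3) f(2) r(3) V']) simp_all
        ultimately show ?thesis by simp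
      qed
      then have p: "fxd 1 0 (n + 1)" and q: "fxd 0 1 (n + 1)" by simp_all
      have p': "fxd 1 0 (- n - 1)" by (rule fxd_parallel[OF mm(3) f(3) f(1) q f(4)]) simp_all
      have q': "fxd 0 1 (- n - 1)" by (rule fxd_parallel[OF mm(4) f(3) f(2) p f(4)]) simp_all
      show "\<forall>j. - (n + 1) \<le> j \<and> j \<le> n + 1 \<longrightarrow> fxd 1 0 j \<and> fxd 0 1 j"
      proof (intro allI impI)
        fix j assume "- (n + 1) \<le> j \<and> j \<le> n + 1"
        then consider "j = - n - 1" | "j = n + 1" | "- n \<le> j" "j \<le> n" by linarith
        then show "fxd 1 0 j \<and> fxd 0 1 j" by cases (use p q p' q' IH in auto)
      qed
    qed
  qed
  then show "- k \<le> j \<Longrightarrow> j \<le> k \<Longrightarrow> fxd 1 0 j \<and> fxd 0 1 j" using k by blast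
qed

text \<open>The levels are not determined here. The diagonal x1 = x2 forces both families to have
  the same levels a j, and x1 + x2 = 0 forces a to be odd on [-k, k]. The level k + 1 has no
  opposite partner and becomes the b of \<open>square_grid_free\<close>, which covers all such
  lists.\<close>

lemma square_grid_corner_free:
  assumes f: "fxd 1 0 1" "fxd 0 1 1" "fxd 0 0 1" "fxd 1 1 0" and k: "1 \<le> k"
    and eq: "\<A> = square_grid k \<union> {plane 1 0 (of_int (k + 1)), plane 0 1 (of_int (k + 1))}"
  shows "free_arrangement \<A>'"
proof -
  have low: "square_grid k \<subseteq> \<A>" unfolding eq by (rule Un_upper1)
  have corner: "plane 1 0 (of_int (k + 1)) \<in> \<A>" "plane 0 1 (of_int (k + 1)) \<in> \<A>" unfolding eq by blast+
  note m = square_grid_mem[OF low]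
  note f' = square_grid_base[OF f k low]
  let ?I = "{- k..k + 1}"
  have mP: "mem 1 0 j" and mQ: "mem 0 1 j" if "j \<in> ?I" for j
  proof -
    have "j = k + 1 \<or> - k \<le> j \<and> j \<le> k" using that by auto
    moreover have "mem 1 0 (k + 1)" "mem 0 1 (k + 1)"
      unfolding mem_def of_int_0 of_int_1 by (fact corner)+
    ultimately show "mem 1 0 j" "mem 0 1 j" using m(1,2)[of j] by blast+
  qed
  have "\<exists>c. \<psi> (plane 1 0 (of_int j)) = plane 1 0 c" if "j \<in> ?I" for j
    using parallel_image[OF mP[OF that] f(3) f'(4)] by auto
  then obtain a where aP: "\<And>j. j \<in> ?I \<Longrightarrow> \<psi> (plane 1 0 (of_int j)) = plane 1 0 (a j)"
    using bchoice[of ?I "\<lambda>j c. \<psi> (plane 1 0 (of_int j)) = plane 1 0 c"] by auto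
  have PA: "plane 1 0 (of_int j) \<in> \<A>" and QA: "plane 0 1 (of_int j) \<in> \<A>" if "j \<in> ?I" for j
    using mP[OF that] mQ[OF that] by (simp_all add: mem_def)
  have UA: "plane (- 1) 1 0 \<in> \<A>" "\<psi> (plane (- 1) 1 0) = plane (- 1) 1 0"
    and VA: "plane 1 1 0 \<in> \<A>" "\<psi> (plane 1 1 0) = plane 1 1 0"
    and zA: "plane 0 0 1 \<in> \<A>" "\<psi> (plane 0 0 1) = plane 0 0 1"
    using f f' by (simp_all add: fxd_def mem_def)
  have cond: "1 * 1 \<noteq> 0 * (0::real) \<or> 1 * c \<noteq> 0 * d \<or> 0 * c \<noteq> 1 * d" for c d :: real by simp
  have aQ: "\<psi> (plane 0 1 (of_int j)) = plane 0 1 (a j)" if j: "j \<in> ?I" for j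
  proof -
    obtain c where c: "\<psi> (plane 0 1 (of_int j)) = plane 0 1 c"
      using parallel_image[OF mQ[OF j] f(3) f'(5)] by auto
    have "plane 1 0 (of_int j) \<inter> plane 0 1 (of_int j) \<subseteq> plane (- 1) 1 0"
      unfolding plane_Int_subset_iff[OF cond] by simp
    then have "\<psi> (plane 1 0 (of_int j)) \<inter> \<psi> (plane 0 1 (of_int j)) \<subseteq> \<psi> (plane (- 1) 1 0)"
      using comb_isoD(3)[OF iso PA[OF j] QA[OF j] UA(1)] by simp
    then have "plane 1 0 (a j) \<inter> plane 0 1 c \<subseteq> plane (- 1) 1 0" by (simp only: aP[OF j] c UA(2))
    then have "c = a j" unfolding plane_Int_subset_iff[OF cond] by simp
    then show ?thesis using c by simp
  qed
  have neg: "a (- j) = - a j" if j: "- k \<le> j" "j \<le> k" for j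
  proof -
    have I: "j \<in> ?I" "- j \<in> ?I" using j by auto
    have "plane 1 0 (of_int (- j)) \<inter> plane 0 1 (of_int j) \<subseteq> plane 1 1 0"
      unfolding plane_Int_subset_iff[OF cond] by simp
    then have "\<psi> (plane 1 0 (of_int (- j))) \<inter> \<psi> (plane 0 1 (of_int j)) \<subseteq> \<psi> (plane 1 1 0)"
      using comb_isoD(3)[OF iso PA[OF I(2)] QA[OF I(1)] VA(1)] by simp
    then have "plane 1 0 (a (- j)) \<inter> plane 0 1 (a j) \<subseteq> plane 1 1 0" by (simp only: aP[OF I(2)] aQ[OF I(1)] VA(2))
    then show ?thesis unfolding plane_Int_subset_iff[OF cond] by simp
  qed
  have inj: "i = j" if "i \<in> ?I" "j \<in> ?I" "a i = a j" for i j
  proof -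
    have "\<psi> (plane 1 0 (of_int i)) = \<psi> (plane 1 0 (of_int j))" using aP that by simp
    then have "plane 1 0 (of_int i) = plane 1 0 (of_int j)"
      using comb_isoD(2)[OF iso PA[OF that(1)] PA[OF that(2)]] by simp
    from plane_eqD(2)[OF this] show ?thesis by simp
  qed
  \<comment> \<open>By oddness the levels from -k to k form a symmetric set, consisting of 0 and
    plus or minus the positive ones, as \<open>square_grid_free\<close> requires.\<close>
  define P where "P = {s \<in> a ` {- k..k}. s > 0}"
  define b where "b = a (k + 1)"
  have a0: "a 0 = 0" using neg[of 0] k by simp
  have b_notin: "b \<notin> a ` {- k..k}"
  proof
    assume "b \<in> a ` {- k..k}"
    then obtain i where "i \<in> {- k..k}" "a (k + 1) = a i" unfolding b_def by auto
    then have "k + 1 = i" using inj[of "k + 1" i] k by auto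
    then show False using \<open>i \<in> {- k..k}\<close> by auto
  qed
  have b_neg: "- b \<notin> a ` {- k..k}"
  proof
    assume "- b \<in> a ` {- k..k}"
    then obtain i where i: "- k \<le> i" "i \<le> k" "- b = a i" by auto
    then have "b = a (- i)" using neg[of i] by simp
    then show False using b_notin i by auto
  qed
  have S: "a ` {- k..k} = insert 0 (P \<union> uminus ` P)"
  proof (intro equalityI subsetI)
    fix s assume "s \<in> a ` {- k..k}"
    then obtain i where i: "- k \<le> i" "i \<le> k" "s = a i" by auto
    then have "- s \<in> a ` {- k..k}" using neg[of i] by (intro image_eqI[of _ _ "- i"]) auto
    then have "s < 0 \<Longrightarrow> - s \<in> P" by (simp add: P_def)
    moreover have "s > 0 \<Longrightarrow> s \<in> P" using i by (simp add: P_def)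
    ultimately show "s \<in> insert 0 (P \<union> uminus ` P)"
      by (cases s "0 :: real" rule: linorder_cases) (auto intro: image_eqI[of _ _ "- s"])
  next
    fix s assume "s \<in> insert 0 (P \<union> uminus ` P)"
    then consider "s = 0" | "s \<in> P" | "- s \<in> P" by auto
    then show "s \<in> a ` {- k..k}"
    proof cases
      case 1
      then show ?thesis using a0 k by (intro image_eqI[of _ _ 0]) auto
    next
      case 3
      then obtain i where i: "- k \<le> i" "i \<le> k" "- s = a i" by (auto simp: P_def)
      then have "s = a (- i)" using neg[of i] by simp
      then show ?thesis using i by auto
    qed (simp add: P_def)
  qed
  have I: "?I = insert (k + 1) {- k..k}" using k by auto
  have T: "a ` ?I = insert b (insert 0 (P \<union> uminus ` P))"
    unfolding I by (simp only: image_insert S b_def[symmetric])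
  have Aeq: "\<A> = (\<lambda>j. plane 1 0 (of_int j)) ` ?I \<union> (\<lambda>j. plane 0 1 (of_int j)) ` ?I \<union>
      {plane (- 1) 1 0, plane 1 1 0, plane 0 0 1}" (is "_ = ?R")
  proof
    show "\<A> \<subseteq> ?R"
    proof
      fix H assume "H \<in> \<A>"
      then have "H \<in> square_grid k \<or> H = plane 1 0 (of_int (k + 1)) \<or> H = plane 0 1 (of_int (k + 1))"
        unfolding eq by auto
      moreover have "H \<in> ?R" if "H \<in> square_grid k"
        using that
      proof (cases rule: square_gridE)
        case (1 j)
        then have "H \<in> (\<lambda>j. plane 1 0 (of_int j)) ` ?I" by (intro image_eqI[of _ _ j]) simp_all
        then show ?thesis by (intro UnI1)
      next
        case (2 j)
        then have "H \<in> (\<lambda>j. plane 0 1 (of_int j)) ` ?I" by (intro image_eqI[of _ _ j]) simp_all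
        then show ?thesis by (simp only: Un_iff simp_thms)
      qed blast+
      moreover have "plane 1 0 (of_int (k + 1)) \<in> (\<lambda>j. plane 1 0 (of_int j)) ` ?I"
        "plane 0 1 (of_int (k + 1)) \<in> (\<lambda>j. plane 0 1 (of_int j)) ` ?I"
        by (rule image_eqI[of _ _ "k + 1"]; use k in simp)+
      ultimately show "H \<in> ?R" by blast
    qed
    show "?R \<subseteq> \<A>" using PA QA UA(1) VA(1) zA(1) by blast
  qed
  have "\<A>' = (\<lambda>j. plane 1 0 (a j)) ` ?I \<union> (\<lambda>j. plane 0 1 (a j)) ` ?I \<union> {plane (- 1) 1 0, plane 1 1 0, plane 0 0 1}"
  proof -
    have "(\<lambda>j. \<psi> (plane 1 0 (of_int j))) ` ?I = (\<lambda>j. plane 1 0 (a j)) ` ?I"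
      "(\<lambda>j. \<psi> (plane 0 1 (of_int j))) ` ?I = (\<lambda>j. plane 0 1 (a j)) ` ?I"
      by (rule image_cong; simp only: aP aQ)+
    then show ?thesis
      unfolding image_eq Aeq image_Un image_image image_insert image_empty UA(2) VA(2) zA(2) by simp
  qed
  also have "\<dots> = hyperplane ` ((\<lambda>t. nv 1 0 t) ` (a ` ?I) \<union> (\<lambda>t. nv 0 1 t) ` (a ` ?I) \<union>
      {nv (- 1) 1 0, nv 1 1 0, nv 0 0 1})"
    unfolding plane_def image_Un image_image image_insert image_empty ..
  finally have A'eq: "\<A>' = hyperplane ` ((\<lambda>t. nv 1 0 t) ` (a ` ?I) \<union> (\<lambda>t. nv 0 1 t) ` (a ` ?I) \<union>
      {nv (- 1) 1 0, nv 1 1 0, nv 0 0 1})" .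
  have "b \<noteq> 0" using b_notin a0 k by (metis atLeastAtMost_iff image_eqI neg_le_0_iff_le order_trans zero_le_one)
  then show ?thesis unfolding A'eq T
    by (intro square_grid_free) (use b_notin b_neg in \<open>auto simp: P_def\<close>)
qed

end

text \<open>The point at infinity of the lines x1 = const is modular: x2 = j meets the diagonals at
  x1 = j and x1 = -j, the diagonals meet at x1 = 0, and the lines x2 = const meet at infinity. A
  further line x1 = k + 1 only enlarges the pencil.\<close>

lemma square_grid_modular:
  assumes k: "0 \<le> k" and low: "square_grid k \<subseteq> \<A>" and up: "\<A> \<subseteq> square_grid k \<union> {plane 1 0 (of_int (k + 1))}"
  shows "modular_at \<A> (plane 0 0 1) (plane 1 0 0)"
proof -
  have P: "plane 1 0 (of_int j) \<in> \<A>" if "- k \<le> j" "j \<le> k" for j using square_gridD(1)[OF that] low by auto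
  have H: "plane 0 0 1 \<in> \<A>" "plane 1 0 0 \<in> \<A>" using square_gridD(5)[of k] P[of 0] k low by auto
  have cond0: "0 * 0 \<noteq> 1 * (0::real) \<or> 0 * 0 \<noteq> 1 * (1::real) \<or> 0 * 0 \<noteq> 0 * (1::real)" by simp
  have through: "plane 0 0 1 \<inter> plane 1 0 0 \<subseteq> plane a b c \<longleftrightarrow> b = 0" for a b c
    unfolding plane_Int_subset_iff[OF cond0] by simp
  have ne: "plane 0 0 1 \<noteq> plane 1 0 0"
  proof
    assume "plane 0 0 1 = plane 1 0 0"
    from plane_eqD(2)[OF this] show False by simp
  qed
  have off: "(\<exists>j. - k \<le> j \<and> j \<le> k \<and> X = plane 0 1 (of_int j)) \<or> (\<exists>e. (e = 1 \<or> e = - 1) \<and> X = plane (of_int e) 1 0)"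
    if X: "X \<in> \<A>" "\<not> plane 0 0 1 \<inter> plane 1 0 0 \<subseteq> X" for X
  proof -
    have nP: "X \<noteq> plane 1 0 c" for c using X(2) through[of 1 0 c] by auto
    have nz: "X \<noteq> plane 0 0 1" using X(2) through[of 0 0 1] by auto
    have "X \<in> square_grid k" using X(1) up nP by auto
    then show ?thesis
    proof (cases rule: square_gridE)
      case 3
      then show ?thesis by (intro disjI2 exI[of _ "- 1"]) simp
    next
      case 4
      then show ?thesis by (intro disjI2 exI[of _ 1]) simp
    qed (use nP nz in auto)
  qed
  have QE: "\<exists>K\<in>\<A>. plane 0 0 1 \<inter> plane 1 0 0 \<subseteq> K \<and> plane 0 1 (of_int j) \<inter> plane (of_int e) 1 0 \<subseteq> K"
    if "- k \<le> j" "j \<le> k" "e = 1 \<or> e = - 1" for j e :: int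
  proof (rule bexI)
    have cond: "0 * 1 \<noteq> of_int e * (1::real) \<or> 0 * 0 \<noteq> of_int e * real_of_int j \<or> 1 * 0 \<noteq> 1 * real_of_int j"
      using that(3) by auto
    show "plane 0 0 1 \<inter> plane 1 0 0 \<subseteq> plane 1 0 (of_int (- e * j)) \<and>
        plane 0 1 (of_int j) \<inter> plane (of_int e) 1 0 \<subseteq> plane 1 0 (of_int (- e * j))"
      unfolding plane_Int_subset_iff[OF cond] through using that(3) by auto
    show "plane 1 0 (of_int (- e * j)) \<in> \<A>" by (rule P) (use that in auto)
  qed
  show ?thesis unfolding modular_at_def
  proof (intro conjI ballI impI; (elim conjE)?)
    fix X Y assume X: "X \<in> \<A>" and Y: "Y \<in> \<A>" and XY: "X \<noteq> Y"
      and nX: "\<not> plane 0 0 1 \<inter> plane 1 0 0 \<subseteq> X" and nY: "\<not> plane 0 0 1 \<inter> plane 1 0 0 \<subseteq> Y"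
    show "\<exists>K\<in>\<A>. plane 0 0 1 \<inter> plane 1 0 0 \<subseteq> K \<and> X \<inter> Y \<subseteq> K"
      using off[OF X nX] off[OF Y nY]
    proof (elim disjE exE conjE)
      fix i j assume ij: "X = plane 0 1 (of_int i)" "Y = plane 0 1 (of_int j)"
      then have "i \<noteq> j" using XY by auto
      then have cond: "0 * 1 \<noteq> 0 * (1::real) \<or> 0 * of_int j \<noteq> 0 * real_of_int i \<or> 1 * of_int j \<noteq> 1 * real_of_int i"
        by simp
      have "X \<inter> Y \<subseteq> plane 0 0 1" unfolding ij plane_Int_subset_iff[OF cond] by simp
      then show ?thesis using H(1) through[of 0 0 1] by (intro bexI[of _ "plane 0 0 1"]) simp_all
    next
      fix j e assume "- k \<le> j" "j \<le> k" "X = plane 0 1 (of_int j)" "e = 1" "Y = plane (of_int e) 1 0"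
      then show ?thesis using QE[of j e] by simp
    next
      fix j e assume "- k \<le> j" "j \<le> k" "X = plane 0 1 (of_int j)" "e = - 1" "Y = plane (of_int e) 1 0"
      then show ?thesis using QE[of j e] by simp
    next
      fix j e assume "- k \<le> j" "j \<le> k" "Y = plane 0 1 (of_int j)" "e = 1" "X = plane (of_int e) 1 0"
      then show ?thesis using QE[of j e] by (simp add: Int_commute)
    next
      fix j e assume "- k \<le> j" "j \<le> k" "Y = plane 0 1 (of_int j)" "e = - 1" "X = plane (of_int e) 1 0"
      then show ?thesis using QE[of j e] by (simp add: Int_commute)
    next
      fix e e' assume *: "e = 1" "X = plane (of_int e) 1 0" "e' = - 1" "Y = plane (of_int e') 1 0"
      have cond: "1 * 1 \<noteq> - 1 * (1::real) \<or> 1 * 0 \<noteq> - 1 * (0::real) \<or> 1 * 0 \<noteq> 1 * (0::real)" by simp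
      have "X \<inter> Y \<subseteq> plane 1 0 0" using plane_Int_subset_iff[OF cond, of 1 0 0] * by simp
      then show ?thesis using H(2) through[of 1 0 0] by (intro bexI[of _ "plane 1 0 0"]) simp_all
    next
      fix e e' assume *: "e = - 1" "X = plane (of_int e) 1 0" "e' = 1" "Y = plane (of_int e') 1 0"
      have cond: "- 1 * 1 \<noteq> 1 * (1::real) \<or> - 1 * 0 \<noteq> 1 * (0::real) \<or> 1 * 0 \<noteq> 1 * (0::real)" by simp
      have "X \<inter> Y \<subseteq> plane 1 0 0" using plane_Int_subset_iff[OF cond, of 1 0 0] * by simp
      then show ?thesis using H(2) through[of 1 0 0] by (intro bexI[of _ "plane 1 0 0"]) simp_all
    qed (use XY in auto)
  qed (use H ne in auto)
qed

lemma pull_swap_square_grid: "pull (blk 0 1 1 0) H \<in> square_grid k" if "H \<in> square_grid k"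
  using that
proof (cases rule: square_gridE)
  case (1 j)
  then show ?thesis using square_gridD(2)[of k j] by (simp add: pull_blk)
next
  case (2 j)
  then show ?thesis using square_gridD(1)[of k j] by (simp add: pull_blk)
next
  case 3
  then show ?thesis using square_gridD(3)[of k] plane_scale[of "-1" 1 "-1" 0] by (simp add: pull_blk)
next
  case 4
  then show ?thesis using square_gridD(4)[of k] by (simp add: pull_blk)
next
  case 5
  then show ?thesis using square_gridD(5)[of k] by (simp add: pull_blk)
qed

lemma pull_swap_swap: "pull (blk 0 1 1 0) (pull (blk 0 1 1 0) H) = H"
  using blk_inverse[of 0 0 1 1] by (simp add: pull_inverse)

lemma square_grid_one:
  assumes A: "arrangement \<A>" and k: "0 \<le> k" and low: "square_grid k \<subseteq> \<A>"
    and up: "\<A> \<subseteq> square_grid k \<union> {plane 1 0 (of_int (k + 1))}"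
  shows "freeness_depends_only_on_lattice \<A>"
  by (rule modular_at_freeness_depends_only[OF A square_grid_modular[OF k low up]])

text \<open>With at most one extra line a point at infinity is modular, after exchanging the
  coordinates if necessary. With both lines and k \<ge> 1 the levels are flexible, and freeness is
  proved for every realization.\<close>

lemma square_grid_corner:
  assumes A: "arrangement \<A>" and k: "0 \<le> k" and low: "square_grid k \<subseteq> \<A>"
    and up: "\<A> \<subseteq> square_grid k \<union> {plane 1 0 (of_int (k + 1)), plane 0 1 (of_int (k + 1))}"
  shows "freeness_depends_only_on_lattice \<A>"
proof (cases "plane 0 1 (of_int (k + 1)) \<in> \<A>")
  case False
  then have "\<A> \<subseteq> square_grid k \<union> {plane 1 0 (of_int (k + 1))}" using up by blast
  then show ?thesis by (rule square_grid_one[OF A k low])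
next
  case q: True
  show ?thesis
  proof (cases "plane 1 0 (of_int (k + 1)) \<in> \<A>")
    case False
    let ?s = "blk 0 1 1 0"
    have D: "0 * 0 - 1 * (1::real) \<noteq> 0" by simp
    have low': "square_grid k \<subseteq> pull ?s ` \<A>"
    proof
      fix H assume "H \<in> square_grid k"
      then have "pull ?s H \<in> \<A>" using pull_swap_square_grid low by blast
      then have "pull ?s (pull ?s H) \<in> pull ?s ` \<A>" by (rule imageI)
      then show "H \<in> pull ?s ` \<A>" by (simp only: pull_swap_swap)
    qed
    have up': "pull ?s ` \<A> \<subseteq> square_grid k \<union> {plane 1 0 (of_int (k + 1))}"
    proof
      fix X assume "X \<in> pull ?s ` \<A>"
      then obtain H where H: "H \<in> \<A>" "X = pull ?s H" by blast
      then have "H \<in> square_grid k \<or> H = plane 0 1 (of_int (k + 1))" using up False by blast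
      then show "X \<in> square_grid k \<union> {plane 1 0 (of_int (k + 1))}"
        using H(2) pull_swap_square_grid[of H k] by (auto simp: pull_blk)
    qed
    show ?thesis
      by (rule freeness_depends_only_blk[OF D square_grid_one[OF arrangement_blk[OF D A] k low' up']])
  next
    case p: True
    have eq: "\<A> = square_grid k \<union> {plane 1 0 (of_int (k + 1)), plane 0 1 (of_int (k + 1))}"
      using low up p q by blast
    show ?thesis
    proof (cases "k = 0")
      case False
      then have k1: "1 \<le> k" using k by simp
      have H: "plane 1 0 1 \<in> \<A>" "plane 0 1 1 \<in> \<A>" "plane 0 0 1 \<in> \<A>" "plane 1 1 0 \<in> \<A>"
        using square_gridD(1,2)[of k 1] square_gridD(3-5)[of k] k1 low by auto
      have free: "free_arrangement \<A>'" if "arrangement \<A>'" "comb_iso \<A> \<A>' \<psi>" "\<psi> (plane 1 0 1) = plane 1 0 1"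
        "\<psi> (plane 0 1 1) = plane 0 1 1" "\<psi> (plane 0 0 1) = plane 0 0 1" "\<psi> (plane 1 1 0) = plane 1 1 0" for \<A>' \<psi>
      proof -
        interpret marked \<A> \<A>' \<psi> by unfold_locales (fact A that)+
        have f: "fxd 1 0 1" "fxd 0 1 1" "fxd 0 0 1" "fxd 1 1 0"
          using that(3-6) H by (simp_all add: fxd_def mem_def)
        show ?thesis by (rule square_grid_corner_free[OF f k1 eq])
      qed
      show ?thesis
        by (rule rigid_frameI[OF A H B2_generic_frame]) (use free free[OF A comb_iso_refl] in simp)
    next
      case True
      have P: "plane 1 0 0 \<in> \<A>" "plane 0 1 0 \<in> \<A>" "plane (- 1) 1 0 \<in> \<A>"
        using square_gridD(1,2)[of k 0] square_gridD(3)[of k] True low by auto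
      have neg: "plane 1 (- 1) 0 \<in> \<A>" using P(3) plane_scale[of "-1" "-1" 1 0] by simp
      \<comment> \<open>For k = 0 the lines of level -1 are missing and
        \<open>square_grid_base\<close> does not apply. The origin is modular instead, since x1 = 1
        and x2 = 1 meet on the diagonal x1 = x2.\<close>
      have "modular_at \<A> (plane 1 0 0) (plane 0 1 0)"
      proof (rule modular_origin[OF P(1,2), where E = "{(1, 0), (0, 1)}"])
        fix H assume "H \<in> \<A>"
        then have "H \<in> square_grid 0 \<or> H = plane 1 0 1 \<or> H = plane 0 1 1" using up True by auto
        then show "H = plane 0 0 1 \<or> (\<exists>a b. H = plane a b 0) \<or> (\<exists>(a, b)\<in>{(1, 0), (0, 1)}. H = plane a b 1)"
        proof (elim disjE)
          assume "H \<in> square_grid 0"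
          then show ?thesis
          proof (cases rule: square_gridE)
            case (1 j)
            then have "j = 0" by simp
            then show ?thesis using 1(3) by auto
          next
            case (2 j)
            then have "j = 0" by simp
            then show ?thesis using 2(3) by auto
          qed auto
        qed auto
      qed (use P neg in auto)
      then show ?thesis by (rule modular_at_freeness_depends_only[OF A])
    qed
  qed
qed

text \<open>An extra diagonal starts the chain and makes the whole grid rigid; without one the grid
  itself has a modular point. The value e = 1 is the original scale, and e = 2 arises when long and
  short roots are exchanged.\<close>

lemma square_grid_diagonal:
  assumes A: "arrangement \<A>" and k: "1 \<le> k" and low: "square_grid k \<subseteq> \<A>" and e: "e = 1 \<or> e = 2"
    and up: "\<A> \<subseteq> square_grid k \<union> {plane (- 1) 1 (of_int e), plane 1 1 (of_int e)}"
  shows "freeness_depends_only_on_lattice \<A>"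
proof (cases "plane (- 1) 1 (of_int e) \<in> \<A> \<or> plane 1 1 (of_int e) \<in> \<A>")
  case False
  then have up': "\<A> \<subseteq> square_grid k \<union> {plane 1 0 (of_int (k + 1))}" using up by blast
  show ?thesis by (rule square_grid_one[OF A _ low up']) (use k in simp)
next
  case True
  have H: "plane 1 0 1 \<in> \<A>" "plane 0 1 1 \<in> \<A>" "plane 0 0 1 \<in> \<A>" "plane 1 1 0 \<in> \<A>"
    using square_gridD(1,2)[of k 1] square_gridD(3-5)[of k] k low by auto
  show ?thesis
  proof (rule rigid_frameI[OF A H B2_generic_frame])
    fix \<A>' \<psi> assume A': "arrangement \<A>'" "comb_iso \<A> \<A>' \<psi>" and fx: "\<psi> (plane 1 0 1) = plane 1 0 1"
        "\<psi> (plane 0 1 1) = plane 0 1 1" "\<psi> (plane 0 0 1) = plane 0 0 1" "\<psi> (plane 1 1 0) = plane 1 1 0"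
    interpret marked \<A> \<A>' \<psi> by unfold_locales (fact A A')+
    have f: "fxd 1 0 1" "fxd 0 1 1" "fxd 0 0 1" "fxd 1 1 0" using fx H by (simp_all add: fxd_def mem_def)
    have ex: "mem (- 1) 1 e \<or> mem 1 1 e" using True by (simp add: mem_def)
    note ch = square_grid_chain[OF f k low e ex]
    have "\<A>' = \<A>"
    proof (rule all_fixed)
      fix H assume H: "H \<in> \<A>"
      then have "H \<in> square_grid k \<or> H = plane (- 1) 1 (of_int e) \<or> H = plane 1 1 (of_int e)" using up by blast
      then show "\<psi> H = H"
      proof (elim disjE)
        assume "H \<in> square_grid k"
        then show ?thesis
        proof (cases rule: square_gridE)
          case (1 j)
          then show ?thesis using ch(1)[of j] by (simp add: fxd_def)
        next
          case (2 j)
          then show ?thesis using ch(1)[of j] by (simp add: fxd_def)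
        next
          case 3
          then show ?thesis using square_grid_base(3)[OF f k low] by (simp add: fxd_def)
        qed (use fx in simp_all)
      next
        assume "H = plane (- 1) 1 (of_int e)"
        then show ?thesis using ch(2) H by (simp add: fxd_def mem_def)
      next
        assume "H = plane 1 1 (of_int e)"
        then show ?thesis using ch(3) H by (simp add: fxd_def mem_def)
      qed
    qed
    then show "free_arrangement \<A>' \<longleftrightarrow> free_arrangement \<A>" by simp
  qed
qed

text \<open>The induction common to both lengths in B_2: from [-n + 1, n] first to -n, then to n +
  1. The steps are conditional on membership, so the same rules serve the optional lines at the
  ends; going on to k + 1 requires both lines at -k.\<close>

lemma two_chain:
  fixes mx my fx fy :: "int \<Rightarrow> bool"
  assumes SN: "\<And>n. 1 \<le> n \<Longrightarrow> (\<And>j. - n + 1 \<le> j \<Longrightarrow> j \<le> n \<Longrightarrow> fx j \<and> fy j) \<Longrightarrow>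
      (mx (- n) \<longrightarrow> fx (- n)) \<and> (my (- n) \<longrightarrow> fy (- n))"
    and SP: "\<And>n. 1 \<le> n \<Longrightarrow> (\<And>j. - n \<le> j \<Longrightarrow> j \<le> n \<Longrightarrow> fx j \<and> fy j) \<Longrightarrow>
      (mx (n + 1) \<longrightarrow> fx (n + 1)) \<and> (my (n + 1) \<longrightarrow> fy (n + 1))"
    and base: "fx 0" "fx 1" "fy 0" "fy 1"
    and mem: "\<And>j. - k + 1 \<le> j \<Longrightarrow> j \<le> k \<Longrightarrow> mx j \<and> my j"
    and k: "1 \<le> k"
  shows "- k \<le> j \<Longrightarrow> j \<le> k \<Longrightarrow> (mx j \<longrightarrow> fx j) \<and> (my j \<longrightarrow> fy j)"
    and "mx (- k) \<Longrightarrow> my (- k) \<Longrightarrow> - k \<le> j \<Longrightarrow> j \<le> k + 1 \<Longrightarrow> (mx j \<longrightarrow> fx j) \<and> (my j \<longrightarrow> fy j)"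
proof -
  have "n \<le> k \<longrightarrow> (\<forall>j. - n + 1 \<le> j \<and> j \<le> n \<longrightarrow> fx j \<and> fy j)" if "1 \<le> n" for n
    using that
  proof (induction n rule: int_ge_induct)
    case base
    have "j = 0 \<or> j = 1" if "- 1 + 1 \<le> j \<and> j \<le> 1" for j :: int using that by linarith
    then show ?case using assms(3-6) by blast
  next
    case (step n)
    show ?case
    proof (intro impI)
      assume nk: "n + 1 \<le> k"
      then have IH: "fx j \<and> fy j" if "- n + 1 \<le> j" "j \<le> n" for j using step.IH that by auto
      have m: "mx (- n)" "my (- n)" "mx (n + 1)" "my (n + 1)"
        using mem[of "- n"] mem[of "n + 1"] nk step.hyps by auto
      have n: "fx (- n) \<and> fy (- n)" using SN[OF step.hyps IH] m by simp
      have IH': "fx j \<and> fy j" if "- n \<le> j" "j \<le> n" for j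
        using IH[of j] n that by (cases "j = - n") auto
      have p: "fx (n + 1) \<and> fy (n + 1)" using SP[OF step.hyps IH'] m by simp
      show "\<forall>j. - (n + 1) + 1 \<le> j \<and> j \<le> n + 1 \<longrightarrow> fx j \<and> fy j"
      proof (intro allI impI)
        fix j assume "- (n + 1) + 1 \<le> j \<and> j \<le> n + 1"
        then have "j = n + 1 \<or> - n \<le> j \<and> j \<le> n" by linarith
        then show "fx j \<and> fy j" using p IH' by blast
      qed
    qed
  qed
  then have K: "fx j \<and> fy j" if "- k + 1 \<le> j" "j \<le> k" for j using k that by blast
  have N: "(mx (- k) \<longrightarrow> fx (- k)) \<and> (my (- k) \<longrightarrow> fy (- k))" by (rule SN[OF k K])
  show 1: "(mx j \<longrightarrow> fx j) \<and> (my j \<longrightarrow> fy j)" if "- k \<le> j" "j \<le> k" for j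
    using N K[of j] that by (cases "j = - k") auto
  show "(mx j \<longrightarrow> fx j) \<and> (my j \<longrightarrow> fy j)" if m: "mx (- k)" "my (- k)" and j: "- k \<le> j" "j \<le> k + 1"
  proof -
    have K': "fx j \<and> fy j" if "- k \<le> j" "j \<le> k" for j
      using N K[of j] that m by (cases "j = - k") auto
    show ?thesis using SP[OF k K'] 1[of j] j by (cases "j = k + 1") auto
  qed
qed

context marked
begin

lemma all_fixed_hyps:
  assumes up: "\<A> \<subseteq> hyps D1 l1 h1 \<union> hyps D2 l2 h2 \<union> {plane 0 0 1}" and z: "fxd 0 0 1"
    and 1: "\<And>a b j. (a, b) \<in> D1 \<Longrightarrow> l1 \<le> j \<Longrightarrow> j \<le> h1 \<Longrightarrow> mem a b j \<Longrightarrow> fxd a b j"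
    and 2: "\<And>a b j. (a, b) \<in> D2 \<Longrightarrow> l2 \<le> j \<Longrightarrow> j \<le> h2 \<Longrightarrow> mem a b j \<Longrightarrow> fxd a b j"
  shows "\<A>' = \<A>"
proof (rule all_fixed)
  fix H assume H: "H \<in> \<A>"
  then have "H \<in> hyps D1 l1 h1 \<or> H \<in> hyps D2 l2 h2 \<or> H = plane 0 0 1" using up by blast
  then show "\<psi> H = H"
  proof (elim disjE)
    assume "H \<in> hyps D1 l1 h1"
    then obtain a b j where h: "H = plane (of_int a) (of_int b) (of_int j)" "(a, b) \<in> D1" "l1 \<le> j" "j \<le> h1" by (rule hypsE)
    then show ?thesis using 1[OF h(2-4)] H by (simp add: fxd_def mem_def)
  next
    assume "H \<in> hyps D2 l2 h2"
    then obtain a b j where h: "H = plane (of_int a) (of_int b) (of_int j)" "(a, b) \<in> D2" "l2 \<le> j" "j \<le> h2" by (rule hypsE)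
    then show ?thesis using 2[OF h(2-4)] H by (simp add: fxd_def mem_def)
  qed (use z in \<open>simp add: fxd_def\<close>)
qed

text \<open>Each length is propagated by levels 0 and 1 of the other, which are present as both
  parameters are at least 1: short lines by means of the diagonals, diagonals by means of x2 = 0 and
  x2 = 1. So neither induction waits for the other.\<close>

lemma B2_fixed:
  assumes f: "fxd 1 0 0" "fxd 0 1 0" "fxd 0 0 1" "fxd 1 1 1"
    and k: "1 \<le> k1" "1 \<le> k2"
    and low: "hyps dirs_diag (- k1 + 1) k1 \<subseteq> \<A>" "hyps dirs_ax (- k2 + 1) k2 \<subseteq> \<A>"
  shows "- k2 \<le> j \<Longrightarrow> j \<le> k2 \<Longrightarrow> (mem 1 0 j \<longrightarrow> fxd 1 0 j) \<and> (mem 0 1 j \<longrightarrow> fxd 0 1 j)"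
    "mem 1 0 (- k2) \<Longrightarrow> mem 0 1 (- k2) \<Longrightarrow> - k2 \<le> j \<Longrightarrow> j \<le> k2 + 1 \<Longrightarrow>
      (mem 1 0 j \<longrightarrow> fxd 1 0 j) \<and> (mem 0 1 j \<longrightarrow> fxd 0 1 j)"
    "- k1 \<le> j \<Longrightarrow> j \<le> k1 \<Longrightarrow> (mem (- 1) 1 j \<longrightarrow> fxd (- 1) 1 j) \<and> (mem 1 1 j \<longrightarrow> fxd 1 1 j)"
    "mem (- 1) 1 (- k1) \<Longrightarrow> mem 1 1 (- k1) \<Longrightarrow> - k1 \<le> j \<Longrightarrow> j \<le> k1 + 1 \<Longrightarrow>
      (mem (- 1) 1 j \<longrightarrow> fxd (- 1) 1 j) \<and> (mem 1 1 j \<longrightarrow> fxd 1 1 j)"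
proof -
  have m: "mem 1 0 j \<and> mem 0 1 j" if "- k2 + 1 \<le> j" "j \<le> k2" for j
    using mem_hyps[OF low(2)] that by (simp add: dirs_ax_def)
  have md: "mem (- 1) 1 j \<and> mem 1 1 j" if "- k1 + 1 \<le> j" "j \<le> k1" for j
    using mem_hyps[OF low(1)] that by (simp add: dirs_diag_def)
  have m1: "mem 1 0 1" "mem 0 1 1" "mem (- 1) 1 0" "mem 1 1 0" "mem (- 1) 1 1" using m[of 1] md[of 0] md[of 1] k by simp_all
  have p1: "fxd 1 0 1" by (rule fxd_parallel[OF m1(1) f(3) f(1) f(2) f(4)]) simp_all
  have q1: "fxd 0 1 1" by (rule fxd_parallel[OF m1(2) f(3) f(2) f(1) f(4)]) simp_all
  have u0: "fxd (- 1) 1 0" by (rule fxd_two_points[OF m1(3) f(1) f(2) p1 q1]) simp_all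
  have v0: "fxd 1 1 0" by (rule fxd_parallel[OF m1(4) f(3) f(4) f(1) f(2)]) simp_all
  have u1: "fxd (- 1) 1 1" by (rule fxd_parallel[OF m1(5) f(3) u0 f(1) q1]) simp_all
  have SN: "(mem 1 0 (- n) \<longrightarrow> fxd 1 0 (- n)) \<and> (mem 0 1 (- n) \<longrightarrow> fxd 0 1 (- n))"
    if n: "1 \<le> n" and K: "\<And>j. - n + 1 \<le> j \<Longrightarrow> j \<le> n \<Longrightarrow> fxd 1 0 j \<and> fxd 0 1 j" for n
  proof (intro conjI impI)
    \<comment> \<open>The point (-n, 1 - n) lies on x2 - x1 = 1, the point (n, -n) on x1 + x2 =
      0.\<close>
    have q: "fxd 0 1 (1 - n)" and p: "fxd 1 0 n" using K[of "1 - n"] K[of n] n by simp_all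
    show "fxd 1 0 (- n)" if "mem 1 0 (- n)" by (rule fxd_parallel[OF that f(3) f(1) q u1]) simp_all
    show "fxd 0 1 (- n)" if "mem 0 1 (- n)" by (rule fxd_parallel[OF that f(3) f(2) p v0]) simp_all
  qed
  have SP: "(mem 1 0 (n + 1) \<longrightarrow> fxd 1 0 (n + 1)) \<and> (mem 0 1 (n + 1) \<longrightarrow> fxd 0 1 (n + 1))"
    if n: "1 \<le> n" and K: "\<And>j. - n \<le> j \<Longrightarrow> j \<le> n \<Longrightarrow> fxd 1 0 j \<and> fxd 0 1 j" for n
  proof (intro conjI impI)
    have q: "fxd 0 1 (- n)" and p: "fxd 1 0 n" using K[of "- n"] K[of n] n by simp_all
    show "fxd 1 0 (n + 1)" if "mem 1 0 (n + 1)" by (rule fxd_parallel[OF that f(3) f(1) q f(4)]) simp_all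
    show "fxd 0 1 (n + 1)" if "mem 0 1 (n + 1)" by (rule fxd_parallel[OF that f(3) f(2) p u1]) simp_all
  qed
  have SNd: "(mem (- 1) 1 (- n) \<longrightarrow> fxd (- 1) 1 (- n)) \<and> (mem 1 1 (- n) \<longrightarrow> fxd 1 1 (- n))"
    if n: "1 \<le> n" and K: "\<And>j. - n + 1 \<le> j \<Longrightarrow> j \<le> n \<Longrightarrow> fxd (- 1) 1 j \<and> fxd 1 1 j" for n
  proof (intro conjI impI)
    have u: "fxd (- 1) 1 n" and v: "fxd 1 1 n" using K[of n] n by simp_all
    show "fxd (- 1) 1 (- n)" if "mem (- 1) 1 (- n)" by (rule fxd_parallel[OF that f(3) u0 v f(2)]) simp_all
    show "fxd 1 1 (- n)" if "mem 1 1 (- n)" by (rule fxd_parallel[OF that f(3) v0 u f(2)]) simp_all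
  qed
  have SPd: "(mem (- 1) 1 (n + 1) \<longrightarrow> fxd (- 1) 1 (n + 1)) \<and> (mem 1 1 (n + 1) \<longrightarrow> fxd 1 1 (n + 1))"
    if n: "1 \<le> n" and K: "\<And>j. - n \<le> j \<Longrightarrow> j \<le> n \<Longrightarrow> fxd (- 1) 1 j \<and> fxd 1 1 j" for n
  proof (intro conjI impI)
    have u: "fxd (- 1) 1 (1 - n)" and v: "fxd 1 1 (1 - n)" using K[of "1 - n"] n by simp_all
    show "fxd (- 1) 1 (n + 1)" if "mem (- 1) 1 (n + 1)" by (rule fxd_parallel[OF that f(3) u0 v q1]) simp_all
    show "fxd 1 1 (n + 1)" if "mem 1 1 (n + 1)" by (rule fxd_parallel[OF that f(3) v0 u q1]) simp_all
  qed
  note X = two_chain[of "fxd 1 0" "fxd 0 1" "mem 1 0" "mem 0 1" k2 j, OF SN SP f(1) p1 f(2) q1 m k(2)]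
  note Y = two_chain[of "fxd (- 1) 1" "fxd 1 1" "mem (- 1) 1" "mem 1 1" k1 j, OF SNd SPd u0 u1 v0 f(4) md k(1)]
  show "- k2 \<le> j \<Longrightarrow> j \<le> k2 \<Longrightarrow> (mem 1 0 j \<longrightarrow> fxd 1 0 j) \<and> (mem 0 1 j \<longrightarrow> fxd 0 1 j)" by (rule X(1))
  show "mem 1 0 (- k2) \<Longrightarrow> mem 0 1 (- k2) \<Longrightarrow> - k2 \<le> j \<Longrightarrow> j \<le> k2 + 1 \<Longrightarrow>
      (mem 1 0 j \<longrightarrow> fxd 1 0 j) \<and> (mem 0 1 j \<longrightarrow> fxd 0 1 j)" by (rule X(2))
  show "- k1 \<le> j \<Longrightarrow> j \<le> k1 \<Longrightarrow> (mem (- 1) 1 j \<longrightarrow> fxd (- 1) 1 j) \<and> (mem 1 1 j \<longrightarrow> fxd 1 1 j)" by (rule Y(1))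
  show "mem (- 1) 1 (- k1) \<Longrightarrow> mem 1 1 (- k1) \<Longrightarrow> - k1 \<le> j \<Longrightarrow> j \<le> k1 + 1 \<Longrightarrow>
      (mem (- 1) 1 j \<longrightarrow> fxd (- 1) 1 j) \<and> (mem 1 1 j \<longrightarrow> fxd 1 1 j)" by (rule Y(2))
qed

end

lemma B2_frame_mem:
  assumes "1 \<le> k1" "1 \<le> k2" "hyps dirs_diag (- k1 + 1) k1 \<subseteq> \<A>" "hyps dirs_ax (- k2 + 1) k2 \<subseteq> \<A>"
  shows "plane 1 0 0 \<in> \<A>" "plane 0 1 0 \<in> \<A>" "plane 1 1 1 \<in> \<A>"
  using hyps_memD[OF assms(4), of 1 0 0] hyps_memD[OF assms(4), of 0 1 0] hyps_memD[OF assms(3), of 1 1 1] assms(1,2)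
  by (simp_all add: dirs_ax_def dirs_diag_def)

lemma B2_Shi:
  assumes A: "arrangement \<A>" and k: "1 \<le> k1" "1 \<le> k2"
    and low: "hyps dirs_diag (- k1 + 1) k1 \<union> hyps dirs_ax (- k2 + 1) k2 \<union> {plane 0 0 1} \<subseteq> \<A>"
    and up: "\<A> \<subseteq> hyps dirs_diag (- k1) k1 \<union> hyps dirs_ax (- k2) k2 \<union> {plane 0 0 1}"
  shows "freeness_depends_only_on_lattice \<A>"
proof -
  have low': "hyps dirs_diag (- k1 + 1) k1 \<subseteq> \<A>" "hyps dirs_ax (- k2 + 1) k2 \<subseteq> \<A>" "plane 0 0 1 \<in> \<A>"
    using low by auto
  note H = B2_frame_mem[OF k low'(1,2)]
  show ?thesis
  proof (rule rigid_frameI[OF A H(1,2) low'(3) H(3) A2_generic_frame])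
    fix \<A>' \<psi> assume A': "arrangement \<A>'" "comb_iso \<A> \<A>' \<psi>" and fx: "\<psi> (plane 1 0 0) = plane 1 0 0"
      "\<psi> (plane 0 1 0) = plane 0 1 0" "\<psi> (plane 0 0 1) = plane 0 0 1" "\<psi> (plane 1 1 1) = plane 1 1 1"
    interpret marked \<A> \<A>' \<psi> by unfold_locales (fact A A')+
    have f: "fxd 1 0 0" "fxd 0 1 0" "fxd 0 0 1" "fxd 1 1 1" using fx H low'(3) by (simp_all add: fxd_def mem_def)
    note B = B2_fixed[OF f k low'(1,2)]
    have "\<A>' = \<A>"
    proof (rule all_fixed_hyps[OF up f(3)])
      show "fxd a b j" if "(a, b) \<in> dirs_diag" "- k1 \<le> j" "j \<le> k1" "mem a b j" for a b j
        using that(1,4) B(3)[OF that(2,3)] unfolding dirs_diag_iff by blast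
      show "fxd a b j" if "(a, b) \<in> dirs_ax" "- k2 \<le> j" "j \<le> k2" "mem a b j" for a b j
        using that(1,4) B(1)[OF that(2,3)] unfolding dirs_ax_iff by blast
    qed
    then show "free_arrangement \<A>' \<longleftrightarrow> free_arrangement \<A>" by simp
  qed
qed

lemma B2_Cat_pos:
  assumes A: "arrangement \<A>" and k: "1 \<le> k1" "1 \<le> k2"
    and low: "hyps dirs_diag (- k1) k1 \<union> hyps dirs_ax (- k2) k2 \<union> {plane 0 0 1} \<subseteq> \<A>"
    and up: "\<A> \<subseteq> hyps dirs_diag (- k1) (k1 + 1) \<union> hyps dirs_ax (- k2) (k2 + 1) \<union> {plane 0 0 1}"
  shows "freeness_depends_only_on_lattice \<A>"
proof -
  have low0: "hyps dirs_diag (- k1) k1 \<subseteq> \<A>" "hyps dirs_ax (- k2) k2 \<subseteq> \<A>" using low by auto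
  have "hyps dirs_diag (- k1 + 1) k1 \<subseteq> hyps dirs_diag (- k1) k1" "hyps dirs_ax (- k2 + 1) k2 \<subseteq> hyps dirs_ax (- k2) k2"
    unfolding hyps_def by force+
  then have low': "hyps dirs_diag (- k1 + 1) k1 \<subseteq> \<A>" "hyps dirs_ax (- k2 + 1) k2 \<subseteq> \<A>" "plane 0 0 1 \<in> \<A>"
    using low by auto
  note H = B2_frame_mem[OF k low'(1,2)]
  show ?thesis
  proof (rule rigid_frameI[OF A H(1,2) low'(3) H(3) A2_generic_frame])
    fix \<A>' \<psi> assume A': "arrangement \<A>'" "comb_iso \<A> \<A>' \<psi>" and fx: "\<psi> (plane 1 0 0) = plane 1 0 0"
      "\<psi> (plane 0 1 0) = plane 0 1 0" "\<psi> (plane 0 0 1) = plane 0 0 1" "\<psi> (plane 1 1 1) = plane 1 1 1"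
    interpret marked \<A> \<A>' \<psi> by unfold_locales (fact A A')+
    have f: "fxd 1 0 0" "fxd 0 1 0" "fxd 0 0 1" "fxd 1 1 1" using fx H low'(3) by (simp_all add: fxd_def mem_def)
    note B = B2_fixed[OF f k low'(1,2)]
    have m: "mem 1 0 (- k2)" "mem 0 1 (- k2)" "mem (- 1) 1 (- k1)" "mem 1 1 (- k1)"
      using mem_hyps[OF low0(1)] mem_hyps[OF low0(2)] k by (simp_all add: dirs_ax_def dirs_diag_def)
    have "\<A>' = \<A>"
    proof (rule all_fixed_hyps[OF up f(3)])
      show "fxd a b j" if "(a, b) \<in> dirs_diag" "- k1 \<le> j" "j \<le> k1 + 1" "mem a b j" for a b j
        using that(1,4) B(4)[OF m(3,4) that(2,3)] unfolding dirs_diag_iff by blast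
      show "fxd a b j" if "(a, b) \<in> dirs_ax" "- k2 \<le> j" "j \<le> k2 + 1" "mem a b j" for a b j
        using that(1,4) B(2)[OF m(1,2) that(2,3)] unfolding dirs_ax_iff by blast
    qed
    then show "free_arrangement \<A>' \<longleftrightarrow> free_arrangement \<A>" by simp
  qed
qed

lemma hyps_mono: "l' \<le> l \<Longrightarrow> h \<le> h' \<Longrightarrow> hyps D l h \<subseteq> hyps D l' h'"
  unfolding hyps_def by force

lemma hyps_diagE:
  assumes "H \<in> hyps dirs_diag l h"
  obtains j where "l \<le> j" "j \<le> h" "H = plane (- 1) 1 (of_int j)" | j where "l \<le> j" "j \<le> h" "H = plane 1 1 (of_int j)"
proof -
  obtain a b j where h: "H = plane (of_int a) (of_int b) (of_int j)" "(a, b) \<in> dirs_diag" "l \<le> j" "j \<le> h"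
    using assms by (rule hypsE)
  from h(2) show thesis unfolding dirs_diag_iff
  proof (elim disjE conjE)
    assume "a = - 1" "b = 1" then show thesis using that(1)[OF h(3,4)] h(1) by simp
  next
    assume "a = 1" "b = 1" then show thesis using that(2)[OF h(3,4)] h(1) by simp
  qed
qed

lemma hyps_axE:
  assumes "H \<in> hyps dirs_ax l h"
  obtains j where "l \<le> j" "j \<le> h" "H = plane 1 0 (of_int j)" | j where "l \<le> j" "j \<le> h" "H = plane 0 1 (of_int j)"
proof -
  obtain a b j where h: "H = plane (of_int a) (of_int b) (of_int j)" "(a, b) \<in> dirs_ax" "l \<le> j" "j \<le> h"
    using assms by (rule hypsE)
  from h(2) show thesis unfolding dirs_ax_iff
  proof (elim disjE conjE)
    assume "a = 1" "b = 0" then show thesis using that(1)[OF h(3,4)] h(1) by simp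
  next
    assume "a = 0" "b = 1" then show thesis using that(2)[OF h(3,4)] h(1) by simp
  qed
qed

lemma hyps_diag_memD:
  assumes "hyps dirs_diag l h \<subseteq> \<A>" "l \<le> j" "j \<le> h"
  shows "plane (- 1) 1 (of_int j) \<in> \<A>" "plane 1 1 (of_int j) \<in> \<A>"
  using hyps_memD[OF assms(1), of "- 1" 1 j] hyps_memD[OF assms(1), of 1 1 j] assms(2,3)
  by (simp_all add: dirs_diag_def)

lemma hyps_ax_memD:
  assumes "hyps dirs_ax l h \<subseteq> \<A>" "l \<le> j" "j \<le> h"
  shows "plane 1 0 (of_int j) \<in> \<A>" "plane 0 1 (of_int j) \<in> \<A>"
  using hyps_memD[OF assms(1), of 1 0 j] hyps_memD[OF assms(1), of 0 1 j] assms(2,3)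
  by (simp_all add: dirs_ax_def)

text \<open>With long parameter 0 the frame line x1 + x2 = 1 is not guaranteed, and the arrangement
  is treated as a square grid with extra lines. The second alternative assumes 1 \<le> k because for
  k = 0 extra long lines are left to \<open>B2_Cat_short_0\<close>.\<close>

lemma B2_Cat_long_0:
  assumes A: "arrangement \<A>" and k: "0 \<le> k"
    and low: "hyps dirs_diag 0 0 \<union> hyps dirs_ax (- k) k \<union> {plane 0 0 1} \<subseteq> \<A>"
    and up: "\<A> \<subseteq> hyps dirs_diag 0 0 \<union> hyps dirs_ax (- k) (k + 1) \<union> {plane 0 0 1} \<or>
      1 \<le> k \<and> \<A> \<subseteq> hyps dirs_diag 0 1 \<union> hyps dirs_ax (- k) k \<union> {plane 0 0 1}"
  shows "freeness_depends_only_on_lattice \<A>"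
proof -
  have "hyps dirs_diag 0 0 \<subseteq> \<A>" using low by blast
  from hyps_diag_memD[OF this, of 0] have "plane (- 1) 1 0 \<in> \<A>" "plane 1 1 0 \<in> \<A>" by simp_all
  then have low': "square_grid k \<subseteq> \<A>" using low unfolding square_grid_def by blast
  show ?thesis using up
  proof (elim disjE conjE)
    assume up: "\<A> \<subseteq> hyps dirs_diag 0 0 \<union> hyps dirs_ax (- k) (k + 1) \<union> {plane 0 0 1}"
    have "\<A> \<subseteq> square_grid k \<union> {plane 1 0 (of_int (k + 1)), plane 0 1 (of_int (k + 1))}"
    proof
      fix H assume "H \<in> \<A>"
      then have "H \<in> hyps dirs_diag 0 0 \<or> H \<in> hyps dirs_ax (- k) (k + 1) \<or> H = plane 0 0 1" using up by blast
      then show "H \<in> square_grid k \<union> {plane 1 0 (of_int (k + 1)), plane 0 1 (of_int (k + 1))}"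
      proof (elim disjE)
        assume "H \<in> hyps dirs_diag 0 0"
        then show ?thesis
        proof (cases rule: hyps_diagE)
          case (1 j)
          then have "j = 0" by simp
          then show ?thesis using 1(3) square_gridD(3)[of k] by simp
        next
          case (2 j)
          then have "j = 0" by simp
          then show ?thesis using 2(3) square_gridD(4)[of k] by simp
        qed
      next
        assume "H \<in> hyps dirs_ax (- k) (k + 1)"
        then show ?thesis
        proof (cases rule: hyps_axE)
          case (1 j)
          then show ?thesis using square_gridD(1)[of k j] by (cases "j = k + 1") simp_all
        next
          case (2 j)
          then show ?thesis using square_gridD(2)[of k j] by (cases "j = k + 1") simp_all
        qed
      qed (use square_gridD(5)[of k] in simp)
    qed
    then show ?thesis by (rule square_grid_corner[OF A k low'])
  next
    assume k1: "1 \<le> k" and up: "\<A> \<subseteq> hyps dirs_diag 0 1 \<union> hyps dirs_ax (- k) k \<union> {plane 0 0 1}"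
    have "\<A> \<subseteq> square_grid k \<union> {plane (- 1) 1 (of_int 1), plane 1 1 (of_int 1)}"
    proof
      fix H assume "H \<in> \<A>"
      then have "H \<in> hyps dirs_diag 0 1 \<or> H \<in> square_grid k"
        using up unfolding square_grid_def by blast
      then show "H \<in> square_grid k \<union> {plane (- 1) 1 (of_int 1), plane 1 1 (of_int 1)}"
      proof
        assume "H \<in> hyps dirs_diag 0 1"
        then show ?thesis
        proof (cases rule: hyps_diagE)
          case (1 j)
          then have "j = 0 \<or> j = 1" by auto
          then show ?thesis using 1(3) square_gridD(3)[of k] by auto
        next
          case (2 j)
          then have "j = 0 \<or> j = 1" by auto
          then show ?thesis using 2(3) square_gridD(4)[of k] by auto
        qed
      qed simp
    qed
    then show ?thesis by (intro square_grid_diagonal[OF A k1 low', of 1]) simp_all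
  qed
qed

text \<open>The coordinate change \<open>(x\<^sub>2 - x\<^sub>1, x\<^sub>1 + x\<^sub>2)\<close> exchanges the long and the short roots up to a factor two.\<close>

lemma B2_Cat_short_0:
  assumes A: "arrangement \<A>" and k: "0 \<le> k"
    and low: "hyps dirs_diag (- k) k \<union> hyps dirs_ax 0 0 \<union> {plane 0 0 1} \<subseteq> \<A>"
    and up: "\<A> \<subseteq> hyps dirs_diag (- k) (k + 1) \<union> hyps dirs_ax 0 0 \<union> {plane 0 0 1} \<or>
      1 \<le> k \<and> \<A> \<subseteq> hyps dirs_diag (- k) k \<union> hyps dirs_ax 0 1 \<union> {plane 0 0 1}"
  shows "freeness_depends_only_on_lattice \<A>"
proof -
  let ?s = "blk (- 1 / 2) (1 / 2) (1 / 2) (1 / 2)"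
  have D: "- 1 / 2 * (1 / 2) - 1 / 2 * (1 / 2) \<noteq> (0 :: real)" by simp
  have s: "pull ?s (plane (- 1) 1 c) = plane 1 0 c" "pull ?s (plane 1 1 c) = plane 0 1 c"
    "pull ?s (plane 0 0 1) = plane 0 0 1" for c
    by (simp_all add: pull_blk)
  \<comment> \<open>This factor is the source of the value e = 2 in
    \<open>square_grid_diagonal\<close>.\<close>
  have s2: "pull ?s (plane 1 0 c) = plane (- 1) 1 (2 * c)" "pull ?s (plane 0 1 c) = plane 1 1 (2 * c)" for c
    using plane_scale[of "1 / 2" "- 1" 1 "2 * c"] plane_scale[of "1 / 2" 1 1 "2 * c"] by (simp_all add: pull_blk)
  let ?B = "pull ?s ` \<A>"
  have B: "arrangement ?B" by (rule arrangement_blk[OF D A])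
  have lowd: "hyps dirs_diag (- k) k \<subseteq> \<A>" and lowa: "hyps dirs_ax 0 0 \<subseteq> \<A>" and z: "plane 0 0 1 \<in> \<A>" using low by blast+
  have low': "square_grid k \<subseteq> ?B"
  proof
    fix H assume "H \<in> square_grid k"
    then show "H \<in> ?B"
    proof (cases rule: square_gridE)
      case (1 j)
      then show ?thesis using imageI[OF hyps_diag_memD(1)[OF lowd 1(1,2)], of "pull ?s"] s by simp
    next
      case (2 j)
      then show ?thesis using imageI[OF hyps_diag_memD(2)[OF lowd 2(1,2)], of "pull ?s"] s by simp
    next
      case 3
      then show ?thesis using imageI[OF hyps_ax_memD(1)[OF lowa order_refl order_refl], of "pull ?s"] s2(1)[of 0] by simp
    next
      case 4
      then show ?thesis using imageI[OF hyps_ax_memD(2)[OF lowa order_refl order_refl], of "pull ?s"] s2(2)[of 0] by simp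
    next
      case 5
      then show ?thesis using imageI[OF z, of "pull ?s"] s by simp
    qed
  qed
  have "freeness_depends_only_on_lattice ?B" using up
  proof (elim disjE conjE)
    assume up: "\<A> \<subseteq> hyps dirs_diag (- k) (k + 1) \<union> hyps dirs_ax 0 0 \<union> {plane 0 0 1}"
    have "?B \<subseteq> square_grid k \<union> {plane 1 0 (of_int (k + 1)), plane 0 1 (of_int (k + 1))}"
    proof
      fix X assume "X \<in> ?B"
      then obtain H where H: "H \<in> \<A>" "X = pull ?s H" by blast
      then have "H \<in> hyps dirs_diag (- k) (k + 1) \<or> H \<in> hyps dirs_ax 0 0 \<or> H = plane 0 0 1" using up by blast
      then show "X \<in> square_grid k \<union> {plane 1 0 (of_int (k + 1)), plane 0 1 (of_int (k + 1))}"
      proof (elim disjE)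
        assume "H \<in> hyps dirs_diag (- k) (k + 1)"
        then show ?thesis
        proof (cases rule: hyps_diagE)
          case (1 j)
          then show ?thesis using square_gridD(1)[of k j] H(2) s by (cases "j = k + 1") simp_all
        next
          case (2 j)
          then show ?thesis using square_gridD(2)[of k j] H(2) s by (cases "j = k + 1") simp_all
        qed
      next
        assume "H \<in> hyps dirs_ax 0 0"
        then show ?thesis
        proof (cases rule: hyps_axE)
          case (1 j)
          then have "H = plane 1 0 0" by simp
          then show ?thesis using H(2) square_gridD(3)[of k] s2(1)[of 0] by simp
        next
          case (2 j)
          then have "H = plane 0 1 0" by simp
          then show ?thesis using H(2) square_gridD(4)[of k] s2(2)[of 0] by simp
        qed
      qed (use H(2) s square_gridD(5)[of k] in simp)
    qed
    then show ?thesis by (rule square_grid_corner[OF B k low'])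
  next
    assume k1: "1 \<le> k" and up: "\<A> \<subseteq> hyps dirs_diag (- k) k \<union> hyps dirs_ax 0 1 \<union> {plane 0 0 1}"
    have "?B \<subseteq> square_grid k \<union> {plane (- 1) 1 (of_int 2), plane 1 1 (of_int 2)}"
    proof
      fix X assume "X \<in> ?B"
      then obtain H where H: "H \<in> \<A>" "X = pull ?s H" by blast
      then have "H \<in> hyps dirs_diag (- k) k \<or> H \<in> hyps dirs_ax 0 1 \<or> H = plane 0 0 1" using up by blast
      then show "X \<in> square_grid k \<union> {plane (- 1) 1 (of_int 2), plane 1 1 (of_int 2)}"
      proof (elim disjE)
        assume "H \<in> hyps dirs_diag (- k) k"
        then show ?thesis
        proof (cases rule: hyps_diagE)
          case (1 j)
          then show ?thesis using square_gridD(1)[of k j] H(2) s by simp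
        next
          case (2 j)
          then show ?thesis using square_gridD(2)[of k j] H(2) s by simp
        qed
      next
        assume "H \<in> hyps dirs_ax 0 1"
        then show ?thesis
        proof (cases rule: hyps_axE)
          case (1 j)
          then have "j = 0 \<or> j = 1" by auto
          then have "H = plane 1 0 0 \<or> H = plane 1 0 1" using 1(3) by auto
          then show ?thesis using H(2) square_gridD(3)[of k] s2(1)[of 0] s2(1)[of 1] by auto
        next
          case (2 j)
          then have "j = 0 \<or> j = 1" by auto
          then have "H = plane 0 1 0 \<or> H = plane 0 1 1" using 2(3) by auto
          then show ?thesis using H(2) square_gridD(4)[of k] s2(2)[of 0] s2(2)[of 1] by auto
        qed
      qed (use H(2) s square_gridD(5)[of k] in simp)
    qed
    then show ?thesis by (intro square_grid_diagonal[OF B k1 low', of 2]) simp_all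
  qed
  then show ?thesis by (rule freeness_depends_only_blk[OF D])
qed

theorem B2_Cat:
  assumes A: "arrangement \<A>" and k: "0 \<le> k1" "0 \<le> k2"
    and low: "hyps dirs_diag (- k1) k1 \<union> hyps dirs_ax (- k2) k2 \<union> {plane 0 0 1} \<subseteq> \<A>"
    and up: "\<A> \<subseteq> hyps dirs_diag (- k1) k1 \<union> hyps dirs_ax (- k2) (k2 + 1) \<union> {plane 0 0 1} \<or>
      \<A> \<subseteq> hyps dirs_diag (- k1) (k1 + 1) \<union> hyps dirs_ax (- k2) k2 \<union> {plane 0 0 1}"
  shows "freeness_depends_only_on_lattice \<A>"
proof -
  \<comment> \<open>If both parameters are 0, the length of the extra lines decides: short ones lead
    to \<open>B2_Cat_long_0\<close>, long ones to \<open>B2_Cat_short_0\<close>.\<close>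
  consider "1 \<le> k1" "1 \<le> k2" | "k1 = 0" "1 \<le> k2 \<or> \<A> \<subseteq> hyps dirs_diag (- k1) k1 \<union> hyps dirs_ax (- k2) (k2 + 1) \<union> {plane 0 0 1}"
    | "k2 = 0" "1 \<le> k1 \<or> \<A> \<subseteq> hyps dirs_diag (- k1) (k1 + 1) \<union> hyps dirs_ax (- k2) k2 \<union> {plane 0 0 1}"
    using k up by linarith
  then show ?thesis
  proof cases
    case 1
    have "\<A> \<subseteq> hyps dirs_diag (- k1) (k1 + 1) \<union> hyps dirs_ax (- k2) (k2 + 1) \<union> {plane 0 0 1}"
      using up hyps_mono[of "- k1" "- k1" k1 "k1 + 1" dirs_diag] hyps_mono[of "- k2" "- k2" k2 "k2 + 1" dirs_ax] by auto
    then show ?thesis by (rule B2_Cat_pos[OF A 1 low])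
  next
    case 2
    then show ?thesis using B2_Cat_long_0[OF A k(2)] low up by auto
  next
    case 3
    then show ?thesis using B2_Cat_short_0[OF A k(1)] low up by auto
  qed
qed

section \<open>Type G_2 as two interlocking A_2 systems\<close>

definition dirs_G2 :: "(int \<times> int) set" where "dirs_G2 = {(- 1, 1), (2, 1), (1, 2)}"

lemma dirs_G2_iff: "(a, b) \<in> dirs_G2 \<longleftrightarrow> a = - 1 \<and> b = 1 \<or> a = 2 \<and> b = 1 \<or> a = 1 \<and> b = 2"
  by (auto simp: dirs_G2_def)

context marked
begin

text \<open>Three long lines pass through two points cut out by short ones: (0,0) and (1,1), (0,1)
  and (1,-1), (1,0) and (-1,1). Their parallels then need only one point each.\<close>

lemma G2_base:
  assumes f: "fxd 1 0 0" "fxd 0 1 0" "fxd 0 0 1" "fxd 1 1 1" and f': "fxd 1 0 1" "fxd 0 1 1" "fxd 1 1 0"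
    and m: "mem (- 1) 1 0" "mem (- 1) 1 1" "mem 2 1 0" "mem 2 1 1" "mem 1 2 0" "mem 1 2 1"
  shows "fxd (- 1) 1 0" "fxd (- 1) 1 1" "fxd 2 1 0" "fxd 2 1 1" "fxd 1 2 0" "fxd 1 2 1"
proof -
  show u0: "fxd (- 1) 1 0" by (rule fxd_two_points[OF m(1) f(1,2) f'(1,2)]) simp_all
  show "fxd (- 1) 1 1" by (rule fxd_parallel[OF m(2) f(3) u0 f(1) f'(2)]) simp_all
  show v1: "fxd 2 1 1" by (rule fxd_two_points[OF m(4) f(1) f'(2) f'(1,3)]) simp_all
  show "fxd 2 1 0" by (rule fxd_parallel[OF m(3) f(3) v1 f(1,2)]) simp_all
  show w1: "fxd 1 2 1" by (rule fxd_two_points[OF m(6) f'(1) f(2) f'(2,3)]) simp_all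
  show "fxd 1 2 0" by (rule fxd_parallel[OF m(5) f(3) w1 f(1,2)]) simp_all
qed

lemma mem_A2:
  assumes "hyps dirs_A2 l h \<subseteq> \<A>" "l \<le> j" "j \<le> h"
  shows "mem 1 0 j \<and> mem 0 1 j \<and> mem 1 1 j"
  using mem_hyps[OF assms(1)] assms(2,3) by (simp add: dirs_A2_def)

lemma mem_G2:
  assumes "hyps dirs_G2 l h \<subseteq> \<A>" "l \<le> j" "j \<le> h"
  shows "mem (- 1) 1 j \<and> mem 2 1 j \<and> mem 1 2 j"
  using mem_hyps[OF assms(1)] assms(2,3) by (simp add: dirs_G2_def)

end

lemma A2_frame_mem:
  assumes "1 \<le> k" "hyps dirs_A2 (- k + 1) k \<subseteq> \<A>"
  shows "plane 1 0 0 \<in> \<A>" "plane 0 1 0 \<in> \<A>" "plane 1 1 1 \<in> \<A>"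
  using hyps_memD[OF assms(2), of 1 0 0] hyps_memD[OF assms(2), of 0 1 0] hyps_memD[OF assms(2), of 1 1 1] assms(1)
  by (simp_all add: dirs_A2_def)

text \<open>Each length is an A_2 system, with the exceptional line of the chain for parameter 1.
  The other length supplies the missing point: (-1, 0) on x2 - x1 = 1 for the short system, and (1,
  -1) on x1 = 1 and x1 + x2 = 0 for the long one. Hence no non-rigid case is left.\<close>

theorem G2_Shi:
  assumes A: "arrangement \<A>" and k: "1 \<le> k1" "1 \<le> k2"
    and low: "hyps dirs_G2 (- k1 + 1) k1 \<union> hyps dirs_A2 (- k2 + 1) k2 \<union> {plane 0 0 1} \<subseteq> \<A>"
    and up: "\<A> \<subseteq> hyps dirs_G2 (- k1) k1 \<union> hyps dirs_A2 (- k2) k2 \<union> {plane 0 0 1}"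
  shows "freeness_depends_only_on_lattice \<A>"
proof -
  have lowl: "hyps dirs_G2 (- k1 + 1) k1 \<subseteq> \<A>" and lows: "hyps dirs_A2 (- k2 + 1) k2 \<subseteq> \<A>" and z: "plane 0 0 1 \<in> \<A>"
    using low by auto
  note H = A2_frame_mem[OF k(2) lows]
  show ?thesis
  proof (rule rigid_frameI[OF A H(1,2) z H(3) A2_generic_frame])
    fix \<A>' \<psi> assume A': "arrangement \<A>'" "comb_iso \<A> \<A>' \<psi>" and fx: "\<psi> (plane 1 0 0) = plane 1 0 0"
      "\<psi> (plane 0 1 0) = plane 0 1 0" "\<psi> (plane 0 0 1) = plane 0 0 1" "\<psi> (plane 1 1 1) = plane 1 1 1"
    interpret marked \<A> \<A>' \<psi> by unfold_locales (fact A A')+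
    note ms = mem_A2[OF lows] and ml = mem_G2[OF lowl]
    have f: "fxd 1 0 0" "fxd 0 1 0" "fxd 0 0 1" "fxd 1 1 1" using fx H z by (simp_all add: fxd_def mem_def)
    have f': "fxd 1 0 1" "fxd 0 1 1" "fxd 1 1 0"
      using A2_frame[OF f] ms[of 0] ms[of 1] k by simp_all
    have g: "fxd (- 1) 1 0" "fxd (- 1) 1 1" "fxd 2 1 0" "fxd 2 1 1" "fxd 1 2 0" "fxd 1 2 1"
      using G2_base[OF f f'] ml[of 0] ml[of 1] k by simp_all
    have sps: "fxd 1 1 (- 1)" if "k2 = 1" "mem 1 1 (- 1)"
      by (rule fxd_parallel[OF that(2) f(3) f'(3) f(2) g(2)]) simp_all
    have spl: "fxd 1 2 (- 1)" if "k1 = 1" "mem 1 2 (- 1)"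
      by (rule fxd_parallel[OF that(2) f(3) g(5) f'(1,3)]) simp_all
    have S: "(mem 1 0 j \<longrightarrow> fxd 1 0 j) \<and> (mem 0 1 j \<longrightarrow> fxd 0 1 j) \<and> (mem 1 1 j \<longrightarrow> fxd 1 1 j)"
      if "- k2 \<le> j" "j \<le> k2" for j
      by (rule A2_system_Cat[of 1 1 0 0 1 1 k2 j, OF f(3) _ _ _ f(1) f'(1) f(2) f'(2) f'(3) f(4) ms k(2) sps that]) simp_all
    have L: "(mem (- 1) 1 j \<longrightarrow> fxd (- 1) 1 j) \<and> (mem 2 1 j \<longrightarrow> fxd 2 1 j) \<and> (mem 1 2 j \<longrightarrow> fxd 1 2 j)"
      if "- k1 \<le> j" "j \<le> k1" for j
      by (rule A2_system_Cat[of "- 1" 1 2 1 1 2 k1 j, OF f(3) _ _ _ g ml k(1) spl that]) simp_all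
    have "\<A>' = \<A>"
    proof (rule all_fixed_hyps[OF up f(3)])
      show "fxd a b j" if "(a, b) \<in> dirs_G2" "- k1 \<le> j" "j \<le> k1" "mem a b j" for a b j
        using that(1,4) L[OF that(2,3)] unfolding dirs_G2_iff by blast
      show "fxd a b j" if "(a, b) \<in> dirs_A2" "- k2 \<le> j" "j \<le> k2" "mem a b j" for a b j
        using that(1,4) S[OF that(2,3)] unfolding dirs_A2_iff by blast
    qed
    then show "free_arrangement \<A>' \<longleftrightarrow> free_arrangement \<A>" by simp
  qed
qed

lemma G2_Cat_pos:
  assumes A: "arrangement \<A>" and k: "1 \<le> k1" "1 \<le> k2"
    and low: "hyps dirs_G2 (- k1) k1 \<union> hyps dirs_A2 (- k2) k2 \<union> {plane 0 0 1} \<subseteq> \<A>"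
    and up: "\<A> \<subseteq> hyps dirs_G2 (- k1) (k1 + 1) \<union> hyps dirs_A2 (- k2) (k2 + 1) \<union> {plane 0 0 1}"
  shows "freeness_depends_only_on_lattice \<A>"
proof -
  have lowl: "hyps dirs_G2 (- k1) k1 \<subseteq> \<A>" and lows: "hyps dirs_A2 (- k2) k2 \<subseteq> \<A>" and z: "plane 0 0 1 \<in> \<A>"
    using low by auto
  have "hyps dirs_A2 (- k2 + 1) k2 \<subseteq> \<A>" using lows hyps_mono[of "- k2" "- k2 + 1" k2 k2 dirs_A2] by auto
  note H = A2_frame_mem[OF k(2) this]
  show ?thesis
  proof (rule rigid_frameI[OF A H(1,2) z H(3) A2_generic_frame])
    fix \<A>' \<psi> assume A': "arrangement \<A>'" "comb_iso \<A> \<A>' \<psi>" and fx: "\<psi> (plane 1 0 0) = plane 1 0 0"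
      "\<psi> (plane 0 1 0) = plane 0 1 0" "\<psi> (plane 0 0 1) = plane 0 0 1" "\<psi> (plane 1 1 1) = plane 1 1 1"
    interpret marked \<A> \<A>' \<psi> by unfold_locales (fact A A')+
    note ms = mem_A2[OF lows] and ml = mem_G2[OF lowl]
    have f: "fxd 1 0 0" "fxd 0 1 0" "fxd 0 0 1" "fxd 1 1 1" using fx H z by (simp_all add: fxd_def mem_def)
    have f': "fxd 1 0 1" "fxd 0 1 1" "fxd 1 1 0"
      using A2_frame[OF f] ms[of 0] ms[of 1] k by simp_all
    have g: "fxd (- 1) 1 0" "fxd (- 1) 1 1" "fxd 2 1 0" "fxd 2 1 1" "fxd 1 2 0" "fxd 1 2 1"
      using G2_base[OF f f'] ml[of 0] ml[of 1] k by simp_all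
    have S: "(mem 1 0 j \<longrightarrow> fxd 1 0 j) \<and> (mem 0 1 j \<longrightarrow> fxd 0 1 j) \<and> (mem 1 1 j \<longrightarrow> fxd 1 1 j)"
      if "- k2 \<le> j" "j \<le> k2 + 1" for j
      by (rule A2_system_Shi[of 1 1 0 0 1 1 k2 j, OF f(3) _ _ _ f(1) f'(1) f(2) f'(2) f'(3) f(4) ms k(2) that]) simp_all
    have L: "(mem (- 1) 1 j \<longrightarrow> fxd (- 1) 1 j) \<and> (mem 2 1 j \<longrightarrow> fxd 2 1 j) \<and> (mem 1 2 j \<longrightarrow> fxd 1 2 j)"
      if "- k1 \<le> j" "j \<le> k1 + 1" for j
      by (rule A2_system_Shi[of "- 1" 1 2 1 1 2 k1 j, OF f(3) _ _ _ g ml k(1) that]) simp_all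
    have "\<A>' = \<A>"
    proof (rule all_fixed_hyps[OF up f(3)])
      show "fxd a b j" if "(a, b) \<in> dirs_G2" "- k1 \<le> j" "j \<le> k1 + 1" "mem a b j" for a b j
        using that(1,4) L[OF that(2,3)] unfolding dirs_G2_iff by blast
      show "fxd a b j" if "(a, b) \<in> dirs_A2" "- k2 \<le> j" "j \<le> k2 + 1" "mem a b j" for a b j
        using that(1,4) S[OF that(2,3)] unfolding dirs_A2_iff by blast
    qed
    then show "free_arrangement \<A>' \<longleftrightarrow> free_arrangement \<A>" by simp
  qed
qed

text \<open>The short lines are fixed on their own as an A_2 system, including x1 + x2 = -1. With it
  the points (1, -2) and (-2, 1) fix two long lines through the origin that the short lines of
  levels 0 and 1 meet only there.\<close>

lemma G2_Cat_long_0: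
  assumes A: "arrangement \<A>" and k: "1 \<le> k2"
    and low: "hyps dirs_G2 0 0 \<union> hyps dirs_A2 (- k2) k2 \<union> {plane 0 0 1} \<subseteq> \<A>"
    and up: "\<A> \<subseteq> hyps dirs_G2 0 1 \<union> hyps dirs_A2 (- k2) (k2 + 1) \<union> {plane 0 0 1}"
  shows "freeness_depends_only_on_lattice \<A>"
proof -
  have lowl: "hyps dirs_G2 0 0 \<subseteq> \<A>" and lows: "hyps dirs_A2 (- k2) k2 \<subseteq> \<A>" and z: "plane 0 0 1 \<in> \<A>"
    using low by auto
  have "hyps dirs_A2 (- k2 + 1) k2 \<subseteq> \<A>" using lows hyps_mono[of "- k2" "- k2 + 1" k2 k2 dirs_A2] by auto
  note H = A2_frame_mem[OF k this]
  show ?thesis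
  proof (rule rigid_frameI[OF A H(1,2) z H(3) A2_generic_frame])
    fix \<A>' \<psi> assume A': "arrangement \<A>'" "comb_iso \<A> \<A>' \<psi>" and fx: "\<psi> (plane 1 0 0) = plane 1 0 0"
      "\<psi> (plane 0 1 0) = plane 0 1 0" "\<psi> (plane 0 0 1) = plane 0 0 1" "\<psi> (plane 1 1 1) = plane 1 1 1"
    interpret marked \<A> \<A>' \<psi> by unfold_locales (fact A A')+
    note ms = mem_A2[OF lows] and ml = mem_G2[OF lowl order_refl order_refl]
    have m0: "mem (- 1) 1 0" "mem 2 1 0" "mem 1 2 0" using ml by simp_all
    have f: "fxd 1 0 0" "fxd 0 1 0" "fxd 0 0 1" "fxd 1 1 1" using fx H z by (simp_all add: fxd_def mem_def)
    have f': "fxd 1 0 1" "fxd 0 1 1" "fxd 1 1 0"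
      using A2_frame[OF f] ms[of 0] ms[of 1] k by simp_all
    have S: "(mem 1 0 j \<longrightarrow> fxd 1 0 j) \<and> (mem 0 1 j \<longrightarrow> fxd 0 1 j) \<and> (mem 1 1 j \<longrightarrow> fxd 1 1 j)"
      if "- k2 \<le> j" "j \<le> k2 + 1" for j
      by (rule A2_system_Shi[of 1 1 0 0 1 1 k2 j, OF f(3) _ _ _ f(1) f'(1) f(2) f'(2) f'(3) f(4) ms k that]) simp_all
    have wm: "fxd 1 1 (- 1)" using S[of "- 1"] ms[of "- 1"] k by simp
    have u0: "fxd (- 1) 1 0" by (rule fxd_two_points[OF m0(1) f(1,2) f'(1,2)]) simp_all
    have v0: "fxd 2 1 0" by (rule fxd_two_points[OF m0(2) f(1,2) f'(1) wm]) simp_all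
    have w0: "fxd 1 2 0" by (rule fxd_two_points[OF m0(3) f(1,2) f'(2) wm]) simp_all
    have L: "fxd a b j" if ab: "(a, b) \<in> dirs_G2" and j: "0 \<le> j" "j \<le> 1" and m: "mem a b j" for a b j
    proof -
      have "j = 0 \<or> j = 1" using j by auto
      moreover have "fxd (- 1) 1 1" if "mem (- 1) 1 1" by (rule fxd_parallel[OF that f(3) u0 f(1) f'(2)]) simp_all
      moreover have "fxd 2 1 1" if "mem 2 1 1" by (rule fxd_parallel[OF that f(3) v0 f(1) f'(2)]) simp_all
      moreover have "fxd 1 2 1" if "mem 1 2 1" by (rule fxd_parallel[OF that f(3) w0 f'(1) f(2)]) simp_all
      ultimately show ?thesis using ab m u0 v0 w0 unfolding dirs_G2_iff by blast
    qed
    have "\<A>' = \<A>"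
    proof (rule all_fixed_hyps[OF up f(3)])
      show "fxd a b j" if "(a, b) \<in> dirs_A2" "- k2 \<le> j" "j \<le> k2 + 1" "mem a b j" for a b j
        using that(1,4) S[OF that(2,3)] unfolding dirs_A2_iff by blast
    qed (rule L)
    then show "free_arrangement \<A>' \<longleftrightarrow> free_arrangement \<A>" by simp
  qed
qed

text \<open>The roles of the lengths are exchanged: short lines off the origin are not guaranteed,
  so the frame is the A_2 frame of the long directions. Points such as (0, 1) on two long lines then
  fix the short ones.\<close>

lemma G2_Cat_short_0:
  assumes A: "arrangement \<A>" and k: "1 \<le> k1"
    and low: "hyps dirs_G2 (- k1) k1 \<union> hyps dirs_A2 0 0 \<union> {plane 0 0 1} \<subseteq> \<A>"
    and up: "\<A> \<subseteq> hyps dirs_G2 (- k1) (k1 + 1) \<union> hyps dirs_A2 0 1 \<union> {plane 0 0 1}"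
  shows "freeness_depends_only_on_lattice \<A>"
proof -
  have lowl: "hyps dirs_G2 (- k1) k1 \<subseteq> \<A>" and lows: "hyps dirs_A2 0 0 \<subseteq> \<A>" and z: "plane 0 0 1 \<in> \<A>"
    using low by auto
  have H: "plane (- 1) 1 0 \<in> \<A>" "plane 2 1 0 \<in> \<A>" "plane 1 2 1 \<in> \<A>"
    using hyps_memD[OF lowl, of "- 1" 1 0] hyps_memD[OF lowl, of 2 1 0] hyps_memD[OF lowl, of 1 2 1] k
    by (simp_all add: dirs_G2_def)
  have gen: "generic_frame (plane (- 1) 1 0) (plane 2 1 0) (plane 0 0 1) (plane 1 2 1)"
    by (rule generic_frame_plane) simp_all
  show ?thesis
  proof (rule rigid_frameI[OF A H(1,2) z H(3) gen])
    fix \<A>' \<psi> assume A': "arrangement \<A>'" "comb_iso \<A> \<A>' \<psi>" and fx: "\<psi> (plane (- 1) 1 0) = plane (- 1) 1 0"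
      "\<psi> (plane 2 1 0) = plane 2 1 0" "\<psi> (plane 0 0 1) = plane 0 0 1" "\<psi> (plane 1 2 1) = plane 1 2 1"
    interpret marked \<A> \<A>' \<psi> by unfold_locales (fact A A')+
    note ms = mem_A2[OF lows order_refl order_refl] and ml = mem_G2[OF lowl]
    have m0: "mem 1 0 0" "mem 0 1 0" "mem 1 1 0" using ms by simp_all
    have m1: "mem (- 1) 1 1" "mem 2 1 1" "mem 1 2 0" using ml[of 0] ml[of 1] k by simp_all
    have f: "fxd (- 1) 1 0" "fxd 2 1 0" "fxd 0 0 1" "fxd 1 2 1" using fx H z by (simp_all add: fxd_def mem_def)
    have u1: "fxd (- 1) 1 1" by (rule fxd_parallel[OF m1(1) f(3) f(1) f(2) f(4)]) simp_all
    have v1: "fxd 2 1 1" by (rule fxd_parallel[OF m1(2) f(3) f(2) f(1) f(4)]) simp_all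
    have w0: "fxd 1 2 0" by (rule fxd_parallel[OF m1(3) f(3) f(4) f(1) f(2)]) simp_all
    have L: "(mem (- 1) 1 j \<longrightarrow> fxd (- 1) 1 j) \<and> (mem 2 1 j \<longrightarrow> fxd 2 1 j) \<and> (mem 1 2 j \<longrightarrow> fxd 1 2 j)"
      if "- k1 \<le> j" "j \<le> k1 + 1" for j
      by (rule A2_system_Shi[of "- 1" 1 2 1 1 2 k1 j, OF f(3) _ _ _ f(1) u1 f(2) v1 w0 f(4) ml k that]) simp_all
    have um: "fxd (- 1) 1 (- 1)" and wm: "fxd 1 2 (- 1)" using L[of "- 1"] ml[of "- 1"] k by simp_all
    have x0: "fxd 1 0 0" by (rule fxd_two_points[OF m0(1) f(1,2) u1 v1]) simp_all
    have y0: "fxd 0 1 0" by (rule fxd_two_points[OF m0(2) f(1,2) um f(4)]) simp_all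
    have s0: "fxd 1 1 0" by (rule fxd_two_points[OF m0(3) f(1,2) v1 wm]) simp_all
    have S: "fxd a b j" if ab: "(a, b) \<in> dirs_A2" and j: "0 \<le> j" "j \<le> 1" and m: "mem a b j" for a b j
    proof -
      have "j = 0 \<or> j = 1" using j by auto
      moreover have "fxd 1 0 1" if "mem 1 0 1" by (rule fxd_parallel[OF that f(3) x0 um f(4)]) simp_all
      moreover have "fxd 0 1 1" if "mem 0 1 1" by (rule fxd_parallel[OF that f(3) y0 u1 v1]) simp_all
      moreover have "fxd 1 1 1" if "mem 1 1 1" by (rule fxd_parallel[OF that f(3) s0 um f(4)]) simp_all
      ultimately show ?thesis using ab m x0 y0 s0 unfolding dirs_A2_iff by blast
    qed
    have "\<A>' = \<A>"
    proof (rule all_fixed_hyps[OF up f(3)])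
      show "fxd a b j" if "(a, b) \<in> dirs_G2" "- k1 \<le> j" "j \<le> k1 + 1" "mem a b j" for a b j
        using that(1,4) L[OF that(2,3)] unfolding dirs_G2_iff by blast
    qed (rule S)
    then show "free_arrangement \<A>' \<longleftrightarrow> free_arrangement \<A>" by simp
  qed
qed

lemma hyps_0_1E:
  assumes "H \<in> hyps D 0 1"
  obtains a b where "(a, b) \<in> D" "H = plane (of_int a) (of_int b) 0" | a b where "(a, b) \<in> D" "H = plane (of_int a) (of_int b) 1"
proof -
  obtain a b j where h: "H = plane (of_int a) (of_int b) (of_int j)" "(a, b) \<in> D" "0 \<le> j" "j \<le> 1"
    using assms by (rule hypsE)
  have "j = 0 \<or> j = 1" using h(3,4) by auto
  then show thesis using that(1)[OF h(2)] that(2)[OF h(2)] h(1) by auto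
qed

text \<open>The difference of two positive roots of the same length is a multiple of a root: (2,1) -
  (-1,1) is three times (1,0), and (1,0) - (0,1) is a long root up to sign. Hence the origin is
  modular as long as only one length has lines of level 1.\<close>

lemma G2_Cat_0:
  assumes A: "arrangement \<A>"
    and low: "hyps dirs_G2 0 0 \<union> hyps dirs_A2 0 0 \<union> {plane 0 0 1} \<subseteq> \<A>"
    and up: "\<A> \<subseteq> hyps dirs_G2 0 0 \<union> hyps dirs_A2 0 1 \<union> {plane 0 0 1} \<or>
      \<A> \<subseteq> hyps dirs_G2 0 1 \<union> hyps dirs_A2 0 0 \<union> {plane 0 0 1}"
  shows "freeness_depends_only_on_lattice \<A>"
proof -
  have lowl: "hyps dirs_G2 0 0 \<subseteq> \<A>" and lows: "hyps dirs_A2 0 0 \<subseteq> \<A>"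
    using low by auto
  have s: "plane 1 0 0 \<in> \<A>" "plane 0 1 0 \<in> \<A>" "plane 1 1 0 \<in> \<A>"
    using hyps_memD[OF lows, of 1 0 0] hyps_memD[OF lows, of 0 1 0] hyps_memD[OF lows, of 1 1 0]
    by (simp_all add: dirs_A2_def)
  have l: "plane (- 1) 1 0 \<in> \<A>" "plane 2 1 0 \<in> \<A>" "plane 1 2 0 \<in> \<A>"
    using hyps_memD[OF lowl, of "- 1" 1 0] hyps_memD[OF lowl, of 2 1 0] hyps_memD[OF lowl, of 1 2 0]
    by (simp_all add: dirs_G2_def)
  have n: "plane (- 1) 0 0 \<in> \<A>" "plane 0 (- 1) 0 \<in> \<A>" "plane 1 (- 1) 0 \<in> \<A>"
    "plane 3 0 0 \<in> \<A>" "plane (- 3) 0 0 \<in> \<A>" "plane (- 2) (- 1) 0 \<in> \<A>"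
    using s l plane_scale[of "- 1" 1 0 0] plane_scale[of "- 1" 0 1 0] plane_scale[of "- 1" "- 1" 1 0]
      plane_scale[of 3 1 0 0] plane_scale[of "- 3" 1 0 0] plane_scale[of "- 1" 2 1 0] by simp_all
  have mod: "modular_at \<A> (plane 1 0 0) (plane 0 1 0)"
    if D: "\<A> \<subseteq> hyps D' 0 0 \<union> hyps D 0 1 \<union> {plane 0 0 1}" and E: "D = dirs_A2 \<or> D = dirs_G2" for D D'
  proof (rule modular_origin[OF s(1,2), where E = "(\<lambda>(a, b). (of_int a, of_int b)) ` D"])
    fix H assume "H \<in> \<A>"
    then have "H \<in> hyps D' 0 0 \<or> H \<in> hyps D 0 1 \<or> H = plane 0 0 1" using D by blast
    then show "H = plane 0 0 1 \<or> (\<exists>a b. H = plane a b 0) \<or>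
      (\<exists>(a, b)\<in>(\<lambda>(a, b). (of_int a, of_int b)) ` D. H = plane a b 1)"
    proof (elim disjE)
      assume "H \<in> hyps D' 0 0"
      then obtain a b j where "H = plane (of_int a) (of_int b) (of_int j)" "0 \<le> j" "j \<le> 0" by (rule hypsE)
      then have "H = plane (of_int a) (of_int b) 0" by simp
      then show ?thesis by blast
    next
      assume "H \<in> hyps D 0 1"
      then show ?thesis
      proof (cases rule: hyps_0_1E)
        case (2 a b)
        then have "(of_int a, of_int b) \<in> (\<lambda>(a, b). (of_int a, of_int b)) ` D" by (intro image_eqI[of _ _ "(a, b)"]) simp_all
        then show ?thesis using 2(2) by blast
      qed blast
    qed simp
  qed (use E s l n in \<open>auto simp: dirs_A2_def dirs_G2_def\<close>)
  then have "modular_at \<A> (plane 1 0 0) (plane 0 1 0)" using up by blast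
  then show ?thesis by (rule modular_at_freeness_depends_only[OF A])
qed

theorem G2_Cat:
  assumes A: "arrangement \<A>" and k: "0 \<le> k1" "0 \<le> k2"
    and low: "hyps dirs_G2 (- k1) k1 \<union> hyps dirs_A2 (- k2) k2 \<union> {plane 0 0 1} \<subseteq> \<A>"
    and up: "\<A> \<subseteq> hyps dirs_G2 (- k1) k1 \<union> hyps dirs_A2 (- k2) (k2 + 1) \<union> {plane 0 0 1} \<or>
      \<A> \<subseteq> hyps dirs_G2 (- k1) (k1 + 1) \<union> hyps dirs_A2 (- k2) k2 \<union> {plane 0 0 1}"
  shows "freeness_depends_only_on_lattice \<A>"
proof -
  have up': "\<A> \<subseteq> hyps dirs_G2 (- k1) (k1 + 1) \<union> hyps dirs_A2 (- k2) (k2 + 1) \<union> {plane 0 0 1}"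
    using up hyps_mono[of "- k1" "- k1" k1 "k1 + 1" dirs_G2] hyps_mono[of "- k2" "- k2" k2 "k2 + 1" dirs_A2] by auto
  consider "1 \<le> k1" "1 \<le> k2" | "k1 = 0" "1 \<le> k2" | "1 \<le> k1" "k2 = 0" | "k1 = 0" "k2 = 0"
    using k by linarith
  then show ?thesis
  proof cases
    case 1
    then show ?thesis by (rule G2_Cat_pos[OF A _ _ low up'])
  next
    case 2
    then show ?thesis using G2_Cat_long_0[OF A] low up' by simp
  next
    case 3
    then show ?thesis using G2_Cat_short_0[OF A] low up' by simp
  next
    case 4
    then show ?thesis using G2_Cat_0[OF A] low up by simp
  qed
qed

section \<open>Root systems of rank two in coordinates\<close>

text \<open>\<open>R m n\<close> stands for m \<alpha> + n \<beta> being a root, \<open>RA\<close>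
  and \<open>RB\<close> for the simple reflections. Reflections must not produce coefficients of
  mixed sign, which bounds m and n by each other; reducedness settles the extreme cases.\<close>

lemma A2_root_coefficients:
  fixes R :: "int \<Rightarrow> int \<Rightarrow> bool"
  assumes RA: "\<And>m n. R m n \<Longrightarrow> R (n - m) n" and RB: "\<And>m n. R m n \<Longrightarrow> R m (m - n)"
    and sign: "\<And>m n. R m n \<Longrightarrow> (0 \<le> m \<and> 0 \<le> n) \<or> (m \<le> 0 \<and> n \<le> 0)"
    and red: "\<And>m. R m 0 \<Longrightarrow> 0 \<le> m \<Longrightarrow> m = 1" "\<And>n. R 0 n \<Longrightarrow> 0 \<le> n \<Longrightarrow> n = 1"
    and R: "R m n" "0 \<le> m" "0 \<le> n"
  shows "(m, n) \<in> {(1, 0), (0, 1), (1, 1)}"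
proof -
  consider "m = 0" | "n = 0" | "0 < m" "0 < n" using R by linarith
  then show ?thesis
  proof cases
    case 1 then show ?thesis using red(2) R by simp
  next
    case 2 then show ?thesis using red(1) R by simp
  next
    case 3
    have "m \<le> n" using sign[OF RA[OF R(1)]] 3 by linarith
    moreover have "n \<le> m" using sign[OF RB[OF R(1)]] 3 by linarith
    ultimately have mn: "m = n" by simp
    then have "n = 1" using red(2) RA[OF R(1)] R(3) by simp
    then show ?thesis using mn by simp
  qed
qed

lemma B2_root_coefficients:
  fixes R :: "int \<Rightarrow> int \<Rightarrow> bool"
  assumes RA: "\<And>m n. R m n \<Longrightarrow> R (2 * n - m) n" and RB: "\<And>m n. R m n \<Longrightarrow> R m (m - n)"
    and sign: "\<And>m n. R m n \<Longrightarrow> (0 \<le> m \<and> 0 \<le> n) \<or> (m \<le> 0 \<and> n \<le> 0)"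
    and red: "\<And>m. R m 0 \<Longrightarrow> 0 \<le> m \<Longrightarrow> m = 1" "\<And>n. R 0 n \<Longrightarrow> 0 \<le> n \<Longrightarrow> n = 1"
    and R: "R m n" "0 \<le> m" "0 \<le> n"
  shows "(m, n) \<in> {(1, 0), (0, 1), (1, 1), (2, 1)}"
proof -
  consider "m = 0" | "n = 0" | "0 < m" "0 < n" "m = 2 * n" | "0 < m" "0 < n" "m \<noteq> 2 * n" using R by linarith
  then show ?thesis
  proof cases
    case 1 then show ?thesis using red(2) R by simp
  next
    case 2 then show ?thesis using red(1) R by simp
  next
    case 3
    then have "n = 1" using red(2) RA[OF R(1)] R(3) by simp
    then show ?thesis using 3 by simp
  next
    case 4
    have "m \<le> 2 * n" using sign[OF RA[OF R(1)]] 4 by linarith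
    moreover have "n \<le> m" using sign[OF RB[OF R(1)]] 4 by linarith
    moreover have "m \<le> n" using sign[OF RB[OF RA[OF R(1)]]] 4 \<open>m \<le> 2 * n\<close> by linarith
    ultimately have mn: "m = n" by simp
    then have "m = 1" using red(1) RB[OF R(1)] R(2) by simp
    then show ?thesis using mn by simp
  qed
qed

lemma G2_root_coefficients:
  fixes R :: "int \<Rightarrow> int \<Rightarrow> bool"
  assumes RA: "\<And>m n. R m n \<Longrightarrow> R (3 * n - m) n" and RB: "\<And>m n. R m n \<Longrightarrow> R m (m - n)"
    and sign: "\<And>m n. R m n \<Longrightarrow> (0 \<le> m \<and> 0 \<le> n) \<or> (m \<le> 0 \<and> n \<le> 0)"
    and red: "\<And>m. R m 0 \<Longrightarrow> 0 \<le> m \<Longrightarrow> m = 1" "\<And>n. R 0 n \<Longrightarrow> 0 \<le> n \<Longrightarrow> n = 1"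
    and R: "R m n" "0 \<le> m" "0 \<le> n"
  shows "(m, n) \<in> {(1, 0), (0, 1), (1, 1), (2, 1), (3, 1), (3, 2)}"
proof -
  consider "m = 0" | "n = 0" | "0 < m" "0 < n" "m = 3 * n" | "0 < m" "0 < n" "m = n"
    | "0 < m" "0 < n" "m \<noteq> n" "m \<noteq> 3 * n" using R by linarith
  then show ?thesis
  proof cases
    case 1 then show ?thesis using red(2) R by simp
  next
    case 2 then show ?thesis using red(1) R by simp
  next
    case 3
    then have "n = 1" using red(2) RA[OF R(1)] R(3) by simp
    then show ?thesis using 3 by simp
  next
    case 4
    then have "m = 1" using red(1) RB[OF R(1)] R(2) by simp
    then show ?thesis using 4 by simp
  next
    case 5
    \<comment> \<open>Single reflections give 1 < m/n < 3, double ones 3/2 \<le> m/n \<le> 2, and a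
      third reflection rules out the open interval between 3/2 and 2.\<close>
    have a: "m < 3 * n" using sign[OF RA[OF R(1)]] 5 by linarith
    have b: "n < m" using sign[OF RB[OF R(1)]] 5 by linarith
    have c: "m \<le> 2 * n" using sign[OF RB[OF RA[OF R(1)]]] a 5 by linarith
    have r: "R (3 * (m - n) - m) (m - n)" using RA[OF RB[OF R(1)]] .
    have d: "3 * n \<le> 2 * m" using sign[OF r] b by presburger
    consider "m = 2 * n" | "2 * m = 3 * n" | "m < 2 * n" "3 * n < 2 * m" using c d by linarith
    then show ?thesis
    proof cases
      case 1
      have "R n n" using RA[OF R(1)] 1 by simp
      from RB[OF this] have "n = 1" using red(1)[of n] R(3) by simp
      then show ?thesis using 1 by simp
    next
      case 2
      then have "3 * (m - n) - m = 0" by simp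
      then have "m - n = 1" using r red(2)[of "m - n"] b by simp
      then show ?thesis using 2 by simp
    next
      case 3
      have False using sign[OF RB[OF r]] 3 by presburger
      then show ?thesis ..
    qed
  qed
qed

text \<open>The three types differ only in c, which is 1, 2 or 3 for A_2, B_2 and G_2. For c > 1 the
  root \<alpha> is the short simple root.\<close>

locale rank_two_base =
  fixes ip :: "real^2 \<Rightarrow> real^2 \<Rightarrow> real" and \<Phi> :: "(real^2) set" and \<alpha> \<beta> :: "real^2" and c :: int
  assumes rs: "root_system ip \<Phi>" and base: "root_base \<Phi> {\<alpha>, \<beta>}" and ne: "\<alpha> \<noteq> \<beta>"
    and cab: "cartan ip \<alpha> \<beta> = - 1" and cba: "cartan ip \<beta> \<alpha> = - of_int c"
begin

definition root :: "int \<Rightarrow> int \<Rightarrow> real^2" where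
  "root m n = of_int m *\<^sub>R \<alpha> + of_int n *\<^sub>R \<beta>"

lemma ip: "ip (x + y) z = ip x z + ip y z" "ip z (x + y) = ip z x + ip z y"
  "ip (r *\<^sub>R x) y = r * ip x y" "ip x (r *\<^sub>R y) = r * ip x y" "ip x y = ip y x" "x \<noteq> 0 \<Longrightarrow> ip x x > 0"
proof -
  have "inner_form ip" using rs by (simp add: root_system_def)
  then have b: "bilinear ip" and s: "\<forall>x y. ip x y = ip y x" and p: "\<forall>x. x \<noteq> 0 \<longrightarrow> ip x x > 0"
    unfolding inner_form_def by blast+
  show "ip (x + y) z = ip x z + ip y z" "ip z (x + y) = ip z x + ip z y"
    "ip (r *\<^sub>R x) y = r * ip x y" "ip x (r *\<^sub>R y) = r * ip x y"
    using bilinear_ladd[OF b] bilinear_radd[OF b] bilinear_lmul[OF b] bilinear_rmul[OF b] by simp_all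
  show "ip x y = ip y x" using s by blast
  show "x \<noteq> 0 \<Longrightarrow> ip x x > 0" using p by blast
qed

lemma simple: "\<alpha> \<in> \<Phi>" "\<beta> \<in> \<Phi>" "\<alpha> \<noteq> 0" "\<beta> \<noteq> 0"
  using base rs unfolding root_base_def root_system_def by auto

lemma coeff_unique:
  assumes "a *\<^sub>R \<alpha> + b *\<^sub>R \<beta> = a' *\<^sub>R \<alpha> + b' *\<^sub>R \<beta>"
  shows "a = a' \<and> b = b'"
proof -
  have ind: "independent {\<alpha>, \<beta>}" using base by (simp add: root_base_def)
  let ?u = "\<lambda>v. if v = \<alpha> then a - a' else b - b'"
  have "(\<Sum>v\<in>{\<alpha>, \<beta>}. ?u v *\<^sub>R v) = (a - a') *\<^sub>R \<alpha> + (b - b') *\<^sub>R \<beta>" using ne by simp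
  also have "\<dots> = 0" using assms by (simp add: algebra_simps)
  finally have s: "(\<Sum>v\<in>{\<alpha>, \<beta>}. ?u v *\<^sub>R v) = 0" .
  have "?u \<alpha> = 0" "?u \<beta> = 0"
    using independentD[OF ind _ _ s, of \<alpha>] independentD[OF ind _ _ s, of \<beta>] by simp_all
  then show ?thesis using ne by auto
qed

lemma det_nonzero: "\<alpha> $ 1 * \<beta> $ 2 - \<alpha> $ 2 * \<beta> $ 1 \<noteq> 0"
proof
  assume D: "\<alpha> $ 1 * \<beta> $ 2 - \<alpha> $ 2 * \<beta> $ 1 = 0"
  have "\<beta> $ 1 *\<^sub>R \<alpha> + (- \<alpha> $ 1) *\<^sub>R \<beta> = 0 *\<^sub>R \<alpha> + 0 *\<^sub>R \<beta>"
    "\<beta> $ 2 *\<^sub>R \<alpha> + (- \<alpha> $ 2) *\<^sub>R \<beta> = 0 *\<^sub>R \<alpha> + 0 *\<^sub>R \<beta>"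
    using D by (simp_all add: vec_eq_iff forall_2 algebra_simps)
  then have "\<alpha> $ 1 = 0" "\<alpha> $ 2 = 0" using coeff_unique by (metis neg_equal_0_iff_equal)+
  then show False using simple(3) by (simp add: vec_eq_iff forall_2)
qed

lemma ip_ab: "2 * ip \<alpha> \<beta> = - ip \<beta> \<beta>" "ip \<beta> \<beta> = of_int c * ip \<alpha> \<alpha>"
proof -
  have "ip \<alpha> \<alpha> > 0" "ip \<beta> \<beta> > 0" using ip(6) simple by blast+
  then have 1: "2 * ip \<alpha> \<beta> = - ip \<beta> \<beta>" and 2: "2 * ip \<beta> \<alpha> = - of_int c * ip \<alpha> \<alpha>"
    using cab cba unfolding cartan_def by (simp_all add: divide_eq_eq)
  then show "2 * ip \<alpha> \<beta> = - ip \<beta> \<beta>" "ip \<beta> \<beta> = of_int c * ip \<alpha> \<alpha>" using ip(5)[of \<alpha> \<beta>] by simp_all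
qed

text \<open>The squared length in units of that of \<alpha>; the integral form takes the value 1 on
  short and c on long roots.\<close>

lemma ip_root: "ip (root m n) (root m n) = of_int (m * m - c * m * n + c * n * n) * ip \<alpha> \<alpha>"
proof -
  have "ip (root m n) (root m n) = of_int m * of_int m * ip \<alpha> \<alpha> + of_int m * of_int n * (2 * ip \<alpha> \<beta>) + of_int n * of_int n * ip \<beta> \<beta>"
    unfolding root_def ip(1-4) using ip(5)[of \<alpha> \<beta>] by (simp add: algebra_simps)
  then show ?thesis unfolding ip_ab by (simp add: algebra_simps)
qed

lemma cartan_root: "cartan ip (root m n) \<alpha> = of_int (2 * m - c * n)" "cartan ip (root m n) \<beta> = of_int (2 * n - m)"
proof -
  have "ip \<alpha> \<alpha> \<noteq> 0" "ip \<beta> \<beta> \<noteq> 0" using ip(6)[OF simple(3)] ip(6)[OF simple(4)] by simp_all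
  then have a: "cartan ip \<alpha> \<alpha> = 2" "cartan ip \<beta> \<beta> = 2" by (simp_all add: cartan_def)
  have "cartan ip (root m n) \<gamma> = of_int m * cartan ip \<alpha> \<gamma> + of_int n * cartan ip \<beta> \<gamma>" for \<gamma>
    unfolding root_def cartan_def ip(1,3) by (simp add: add_divide_distrib algebra_simps)
  then show "cartan ip (root m n) \<alpha> = of_int (2 * m - c * n)" "cartan ip (root m n) \<beta> = of_int (2 * n - m)"
    using a cab cba by simp_all
qed

lemma reflect:
  assumes "root m n \<in> \<Phi>"
  shows "root (c * n - m) n \<in> \<Phi>" "root m (m - n) \<in> \<Phi>"
proof -
  have r: "\<gamma> - cartan ip \<gamma> \<delta> *\<^sub>R \<delta> \<in> \<Phi>" if "\<gamma> \<in> \<Phi>" "\<delta> \<in> \<Phi>" for \<gamma> \<delta>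
    using rs that unfolding root_system_def by blast
  have "root m n - cartan ip (root m n) \<alpha> *\<^sub>R \<alpha> = root (c * n - m) n"
    "root m n - cartan ip (root m n) \<beta> *\<^sub>R \<beta> = root m (m - n)"
    unfolding cartan_root by (simp_all add: root_def vec_eq_iff algebra_simps)
  then show "root (c * n - m) n \<in> \<Phi>" "root m (m - n) \<in> \<Phi>" using r[OF assms simple(1)] r[OF assms simple(2)] by simp_all
qed

lemma root_sign:
  assumes "root m n \<in> \<Phi>"
  shows "(0 \<le> m \<and> 0 \<le> n) \<or> (m \<le> 0 \<and> n \<le> 0)"
proof -
  obtain f :: "real^2 \<Rightarrow> int" where f: "root m n = (\<Sum>\<delta>\<in>{\<alpha>, \<beta>}. of_int (f \<delta>) *\<^sub>R \<delta>)"
    "(\<forall>\<delta>\<in>{\<alpha>, \<beta>}. f \<delta> \<ge> 0) \<or> (\<forall>\<delta>\<in>{\<alpha>, \<beta>}. f \<delta> \<le> 0)"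
    using base assms unfolding root_base_def by blast
  have "of_int m *\<^sub>R \<alpha> + of_int n *\<^sub>R \<beta> = of_int (f \<alpha>) *\<^sub>R \<alpha> + of_int (f \<beta>) *\<^sub>R \<beta>"
    using f(1) ne by (simp add: root_def)
  from coeff_unique[OF this] have "m = f \<alpha>" "n = f \<beta>" by simp_all
  then show ?thesis using f(2) by auto
qed

lemma root_reduced:
  shows "root m 0 \<in> \<Phi> \<Longrightarrow> 0 \<le> m \<Longrightarrow> m = 1" "root 0 n \<in> \<Phi> \<Longrightarrow> 0 \<le> n \<Longrightarrow> n = 1"
proof -
  have r: "k = 1 \<or> k = - 1" if "\<gamma> \<in> \<Phi>" "k *\<^sub>R \<gamma> \<in> \<Phi>" for k \<gamma>
    using rs that unfolding root_system_def by blast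
  show "m = 1" if "root m 0 \<in> \<Phi>" "0 \<le> m" using r[OF simple(1), of "of_int m"] that by (simp add: root_def)
  show "n = 1" if "root 0 n \<in> \<Phi>" "0 \<le> n" using r[OF simple(2), of "of_int n"] that by (simp add: root_def)
qed

lemma simple_root: "root 1 0 \<in> \<Phi>" "root 0 1 \<in> \<Phi>"
  using simple by (simp_all add: root_def)

lemma positive_roots_eq: "positive_roots \<Phi> {\<alpha>, \<beta>} = {root m n | m n. 0 \<le> m \<and> 0 \<le> n \<and> root m n \<in> \<Phi>}"
proof (intro equalityI subsetI)
  fix \<gamma> assume "\<gamma> \<in> positive_roots \<Phi> {\<alpha>, \<beta>}"
  then obtain f :: "real^2 \<Rightarrow> nat" where f: "\<gamma> \<in> \<Phi>" "\<gamma> = (\<Sum>\<delta>\<in>{\<alpha>, \<beta>}. of_nat (f \<delta>) *\<^sub>R \<delta>)"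
    unfolding positive_roots_def by blast
  then have "\<gamma> = root (int (f \<alpha>)) (int (f \<beta>))" using ne by (simp add: root_def)
  then show "\<gamma> \<in> {root m n | m n. 0 \<le> m \<and> 0 \<le> n \<and> root m n \<in> \<Phi>}" using f(1) by force
next
  fix \<gamma> assume "\<gamma> \<in> {root m n | m n. 0 \<le> m \<and> 0 \<le> n \<and> root m n \<in> \<Phi>}"
  then obtain m n where g: "\<gamma> = root m n" "0 \<le> m" "0 \<le> n" "\<gamma> \<in> \<Phi>" by blast
  have "\<gamma> = (\<Sum>\<delta>\<in>{\<alpha>, \<beta>}. of_nat (if \<delta> = \<alpha> then nat m else nat n) *\<^sub>R \<delta>)"
    using g ne by (simp add: root_def)
  then show "\<gamma> \<in> positive_roots \<Phi> {\<alpha>, \<beta>}"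
    unfolding positive_roots_def using g(4) by (intro CollectI conjI exI[of _ "\<lambda>\<delta>. if \<delta> = \<alpha> then nat m else nat n"])
qed

lemma positive_roots_image:
  assumes "\<And>m n. root m n \<in> \<Phi> \<Longrightarrow> 0 \<le> m \<Longrightarrow> 0 \<le> n \<Longrightarrow> (m, n) \<in> C"
    and "\<And>m n. (m, n) \<in> C \<Longrightarrow> root m n \<in> \<Phi> \<and> 0 \<le> m \<and> 0 \<le> n"
  shows "positive_roots \<Phi> {\<alpha>, \<beta>} = (\<lambda>(m, n). root m n) ` C"
  unfolding positive_roots_eq using assms by (auto simp: image_iff) blast+

text \<open>\<open>Cl\<close> has to be nonempty because \<open>long_roots\<close> is defined by
  maximal length within P: otherwise the short roots would be the longest.\<close>

lemma long_short_image:
  assumes P: "P = (\<lambda>(m, n). root m n) ` (Cl \<union> Cs)" and Cl: "Cl \<noteq> {}" and c: "1 < c"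
    and l: "\<And>m n. (m, n) \<in> Cl \<Longrightarrow> m * m - c * m * n + c * n * n = c"
    and s: "\<And>m n. (m, n) \<in> Cs \<Longrightarrow> m * m - c * m * n + c * n * n = 1"
  shows "long_roots ip P = (\<lambda>(m, n). root m n) ` Cl" "short_roots ip P = (\<lambda>(m, n). root m n) ` Cs"
proof -
  let ?r = "\<lambda>(m, n). root m n"
  let ?a = "ip \<alpha> \<alpha>"
  have a: "?a > 0" using ip(6)[OF simple(3)] .
  have ca: "?a < of_int c * ?a" using a c by simp
  have il: "ip \<gamma> \<gamma> = of_int c * ?a" if "\<gamma> \<in> ?r ` Cl" for \<gamma> using that l by (auto simp: ip_root)
  have iss: "ip \<gamma> \<gamma> = ?a" if g: "\<gamma> \<in> ?r ` Cs" for \<gamma>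
  proof -
    obtain m n where "(m, n) \<in> Cs" "\<gamma> = root m n" using g by auto
    then show ?thesis using s[of m n] by (simp add: ip_root)
  qed
  have P': "P = ?r ` Cl \<union> ?r ` Cs" using P by (simp add: image_Un)
  obtain \<gamma>0 where g0: "\<gamma>0 \<in> ?r ` Cl" using Cl by auto
  show L: "long_roots ip P = ?r ` Cl"
  proof (intro equalityI subsetI)
    fix \<gamma> assume g: "\<gamma> \<in> long_roots ip P"
    then have "\<gamma> \<in> P" "ip \<gamma>0 \<gamma>0 \<le> ip \<gamma> \<gamma>" using g0 P' by (auto simp: long_roots_def)
    then show "\<gamma> \<in> ?r ` Cl" using iss[of \<gamma>] il[OF g0] ca P' by auto
  next
    fix \<gamma> assume g: "\<gamma> \<in> ?r ` Cl"
    have "ip \<delta> \<delta> \<le> ip \<gamma> \<gamma>" if d: "\<delta> \<in> P" for \<delta>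
    proof -
      have "\<delta> \<in> ?r ` Cl \<or> \<delta> \<in> ?r ` Cs" using d unfolding P' by (rule UnE) simp_all
      then show ?thesis
      proof
        assume "\<delta> \<in> ?r ` Cl"
        then show ?thesis by (simp only: il[OF g] il order_refl)
      next
        assume "\<delta> \<in> ?r ` Cs"
        then show ?thesis using ca by (simp only: il[OF g] iss less_imp_le)
      qed
    qed
    then show "\<gamma> \<in> long_roots ip P" using g P' by (simp add: long_roots_def)
  qed
  have "?r ` Cl \<inter> ?r ` Cs = {}"
  proof (rule equals0I)
    fix \<gamma> assume "\<gamma> \<in> ?r ` Cl \<inter> ?r ` Cs"
    then have "ip \<gamma> \<gamma> = of_int c * ?a" "ip \<gamma> \<gamma> = ?a" using il[of \<gamma>] iss[of \<gamma>] by blast+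
    then show False using ca by linarith
  qed
  then have "?r ` Cl \<union> ?r ` Cs - ?r ` Cl = ?r ` Cs" by (simp add: Un_Diff Diff_triv Int_commute)
  then show "short_roots ip P = ?r ` Cs" unfolding short_roots_def L unfolding P' .
qed

end

section \<open>Transfer to the standard coordinates\<close>

text \<open>Roots given by integer coordinates in a basis X, Y. \<open>blk_of\<close> substitutes
  these two forms for x1 and x2, so that the lines in standard coordinates pull back to root
  hyperplanes.\<close>

definition combos :: "real^2 \<Rightarrow> real^2 \<Rightarrow> (int \<times> int) set \<Rightarrow> (real^2) set" where
  "combos X Y D = (\<lambda>(a, b). of_int a *\<^sub>R X + of_int b *\<^sub>R Y) ` D"

definition blk_of :: "real^2 \<Rightarrow> real^2 \<Rightarrow> real^3^3" where
  "blk_of X Y = blk (X $ 1) (X $ 2) (Y $ 1) (Y $ 2)"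

lemma root_hyperplane_plane: "root_hyperplane \<gamma> j = plane (\<gamma> $ 1) (\<gamma> $ 2) (of_int j)"
  by (auto simp: root_hyperplane_def plane_def hyperplane_def inner_vec_def sum_3)

lemma root_hyperplane_pull:
  "root_hyperplane (of_int a *\<^sub>R X + of_int b *\<^sub>R Y) j = pull (blk_of X Y) (plane (of_int a) (of_int b) (of_int j))"
  unfolding root_hyperplane_plane blk_of_def pull_blk by simp

lemma H_infinity_pull: "H_infinity = pull (blk_of X Y) (plane 0 0 1)"
  unfolding blk_of_def pull_blk by (auto simp: H_infinity_def plane_def hyperplane_def inner_vec_def sum_3)

lemma root_hyperplanes_pull: "root_hyperplanes (combos X Y D) l h = pull (blk_of X Y) ` hyps D l h"
proof (intro equalityI subsetI)
  fix H assume "H \<in> root_hyperplanes (combos X Y D) l h"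
  then obtain a b j where H: "H = root_hyperplane (of_int a *\<^sub>R X + of_int b *\<^sub>R Y) j" "(a, b) \<in> D" "l \<le> j" "j \<le> h"
    unfolding root_hyperplanes_def combos_def by auto
  then show "H \<in> pull (blk_of X Y) ` hyps D l h" unfolding root_hyperplane_pull using imageI[OF hypsI[OF H(2-4)]] by simp
next
  fix H assume "H \<in> pull (blk_of X Y) ` hyps D l h"
  then obtain K where K: "K \<in> hyps D l h" "H = pull (blk_of X Y) K" by blast
  from K(1) obtain a b j where k: "K = plane (of_int a) (of_int b) (of_int j)" "(a, b) \<in> D" "l \<le> j" "j \<le> h"
    by (rule hypsE)
  have "H = root_hyperplane (of_int a *\<^sub>R X + of_int b *\<^sub>R Y) j" unfolding root_hyperplane_pull K(2) k(1) ..
  moreover have "of_int a *\<^sub>R X + of_int b *\<^sub>R Y \<in> combos X Y D" unfolding combos_def using k(2) by force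
  ultimately show "H \<in> root_hyperplanes (combos X Y D) l h" unfolding root_hyperplanes_def using k(3,4) by blast
qed

lemma freeness_depends_only_transfer:
  assumes D: "X $ 1 * Y $ 2 - X $ 2 * Y $ 1 \<noteq> 0" and A: "arrangement \<A>"
    and low: "pull (blk_of X Y) ` L \<subseteq> \<A>" and up: "\<A> \<subseteq> pull (blk_of X Y) ` U"
    and std: "\<And>\<B>. arrangement \<B> \<Longrightarrow> L \<subseteq> \<B> \<Longrightarrow> \<B> \<subseteq> U \<Longrightarrow> freeness_depends_only_on_lattice \<B>"
  shows "freeness_depends_only_on_lattice \<A>"
proof -
  obtain G' where G: "blk_of X Y ** G' = mat 1" using blk_inverse[OF D] unfolding blk_of_def by blast
  then have G': "G' ** blk_of X Y = mat 1" using matrix_left_right_inverse by blast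
  have "freeness_depends_only_on_lattice (pull G' ` \<A>)"
  proof (rule std)
    show "arrangement (pull G' ` \<A>)" by (rule arrangement_pull[OF G' A])
    have "pull G' ` pull (blk_of X Y) ` L \<subseteq> pull G' ` \<A>" using low by (rule image_mono)
    then show "L \<subseteq> pull G' ` \<A>" by (simp only: pull_image_inverse[OF G'])
    have "pull G' ` \<A> \<subseteq> pull G' ` pull (blk_of X Y) ` U" using up by (rule image_mono)
    then show "pull G' ` \<A> \<subseteq> U" by (simp only: pull_image_inverse[OF G'])
  qed
  then show ?thesis by (rule freeness_depends_only_pull[OF G'])
qed

text \<open>Common to B_2 and G_2. The hypothesis \<open>Shi\<close> allows extra lines of both
  lengths, so it covers both Shi cases; \<open>Cat\<close> keeps the two alternatives apart, since
  for parameter 0 the arguments depend on the length of the extra lines.\<close>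

lemma two_lengths:
  fixes X Y :: "real^2" and Dl Ds :: "(int \<times> int) set"
  assumes D: "X $ 1 * Y $ 2 - X $ 2 * Y $ 1 \<noteq> 0" and P: "Pl = combos X Y Dl" "Ps = combos X Y Ds"
    and Shi: "\<And>\<B> k1 k2. arrangement \<B> \<Longrightarrow> 1 \<le> k1 \<Longrightarrow> 1 \<le> k2 \<Longrightarrow>
      hyps Dl (- k1 + 1) k1 \<union> hyps Ds (- k2 + 1) k2 \<union> {plane 0 0 1} \<subseteq> \<B> \<Longrightarrow>
      \<B> \<subseteq> hyps Dl (- k1) k1 \<union> hyps Ds (- k2) k2 \<union> {plane 0 0 1} \<Longrightarrow> freeness_depends_only_on_lattice \<B>"
    and Cat: "\<And>\<B> k1 k2. arrangement \<B> \<Longrightarrow> 0 \<le> k1 \<Longrightarrow> 0 \<le> k2 \<Longrightarrow>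
      hyps Dl (- k1) k1 \<union> hyps Ds (- k2) k2 \<union> {plane 0 0 1} \<subseteq> \<B> \<Longrightarrow>
      \<B> \<subseteq> hyps Dl (- k1) k1 \<union> hyps Ds (- k2) (k2 + 1) \<union> {plane 0 0 1} \<or>
      \<B> \<subseteq> hyps Dl (- k1) (k1 + 1) \<union> hyps Ds (- k2) k2 \<union> {plane 0 0 1} \<Longrightarrow> freeness_depends_only_on_lattice \<B>"
    and A: "arrangement \<A>"
    and cases: "(\<exists>k1\<ge>1. \<exists>k2\<ge>1. Shi_Shi Pl Ps k1 k2 \<subseteq> \<A> \<and> \<A> \<subseteq> Cat_Shi Pl Ps k1 k2) \<or>
         (\<exists>k1\<ge>1. \<exists>k2\<ge>1. Shi_Shi Pl Ps k1 k2 \<subseteq> \<A> \<and> \<A> \<subseteq> Shi_Cat Pl Ps k1 k2) \<or>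
         (\<exists>k1\<ge>0. \<exists>k2\<ge>0. Cat_Cat Pl Ps k1 k2 \<subseteq> \<A> \<and> \<A> \<subseteq> Cat_Shi Pl Ps k1 (k2 + 1)) \<or>
         (\<exists>k1\<ge>0. \<exists>k2\<ge>0. Cat_Cat Pl Ps k1 k2 \<subseteq> \<A> \<and> \<A> \<subseteq> Shi_Cat Pl Ps (k1 + 1) k2)"
  shows "freeness_depends_only_on_lattice \<A>"
proof -
  have img: "root_hyperplanes Pl l1 h1 \<union> root_hyperplanes Ps l2 h2 \<union> {H_infinity} =
    pull (blk_of X Y) ` (hyps Dl l1 h1 \<union> hyps Ds l2 h2 \<union> {plane 0 0 1})" for l1 h1 l2 h2
    unfolding P root_hyperplanes_pull H_infinity_pull[of X Y] image_Un by simp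
  note tr = freeness_depends_only_transfer[OF D A]
  have mono: "hyps Dl l1 h1 \<union> hyps Ds l2 h2 \<union> {plane 0 0 1} \<subseteq> hyps Dl l1' h1' \<union> hyps Ds l2' h2' \<union> {plane 0 0 1}"
    if "l1' \<le> l1" "h1 \<le> h1'" "l2' \<le> l2" "h2 \<le> h2'" for l1 h1 l2 h2 l1' h1' l2' h2'
    using hyps_mono[OF that(1,2), of Dl] hyps_mono[OF that(3,4), of Ds] by blast
  from cases show ?thesis
  proof (elim disjE exE conjE)
    fix k1 k2 assume k: "(1::int) \<le> k1" "(1::int) \<le> k2" and low: "Shi_Shi Pl Ps k1 k2 \<subseteq> \<A>" and up: "\<A> \<subseteq> Cat_Shi Pl Ps k1 k2"
    show ?thesis
    proof (rule tr[OF low[unfolded Shi_Shi_def img] up[unfolded Cat_Shi_def img]])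
      fix \<B> assume B: "arrangement \<B>" "hyps Dl (- k1 + 1) k1 \<union> hyps Ds (- k2 + 1) k2 \<union> {plane 0 0 1} \<subseteq> \<B>"
        "\<B> \<subseteq> hyps Dl (- k1) k1 \<union> hyps Ds (- k2 + 1) k2 \<union> {plane 0 0 1}"
      have "\<B> \<subseteq> hyps Dl (- k1) k1 \<union> hyps Ds (- k2) k2 \<union> {plane 0 0 1}"
        by (rule order_trans[OF B(3) mono]) simp_all
      then show "freeness_depends_only_on_lattice \<B>" by (rule Shi[OF B(1) k B(2)])
    qed
  next
    fix k1 k2 assume k: "(1::int) \<le> k1" "(1::int) \<le> k2" and low: "Shi_Shi Pl Ps k1 k2 \<subseteq> \<A>" and up: "\<A> \<subseteq> Shi_Cat Pl Ps k1 k2"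
    show ?thesis
    proof (rule tr[OF low[unfolded Shi_Shi_def img] up[unfolded Shi_Cat_def img]])
      fix \<B> assume B: "arrangement \<B>" "hyps Dl (- k1 + 1) k1 \<union> hyps Ds (- k2 + 1) k2 \<union> {plane 0 0 1} \<subseteq> \<B>"
        "\<B> \<subseteq> hyps Dl (- k1 + 1) k1 \<union> hyps Ds (- k2) k2 \<union> {plane 0 0 1}"
      have "\<B> \<subseteq> hyps Dl (- k1) k1 \<union> hyps Ds (- k2) k2 \<union> {plane 0 0 1}"
        by (rule order_trans[OF B(3) mono]) simp_all
      then show "freeness_depends_only_on_lattice \<B>" by (rule Shi[OF B(1) k B(2)])
    qed
  next
    fix k1 k2 assume k: "(0::int) \<le> k1" "(0::int) \<le> k2" and low: "Cat_Cat Pl Ps k1 k2 \<subseteq> \<A>" and up: "\<A> \<subseteq> Cat_Shi Pl Ps k1 (k2 + 1)"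
    show ?thesis
    proof (rule tr[OF low[unfolded Cat_Cat_def img] up[unfolded Cat_Shi_def img]])
      fix \<B> assume B: "arrangement \<B>" "hyps Dl (- k1) k1 \<union> hyps Ds (- k2) k2 \<union> {plane 0 0 1} \<subseteq> \<B>"
        "\<B> \<subseteq> hyps Dl (- k1) k1 \<union> hyps Ds (- (k2 + 1) + 1) (k2 + 1) \<union> {plane 0 0 1}"
      \<comment> \<open>Here - (k2 + 1) + 1 = - k2: the Shi range with parameter k2 + 1 starts at
        the same level as the Catalan range with parameter k2.\<close>
      then show "freeness_depends_only_on_lattice \<B>" using Cat[OF B(1) k B(2)] by simp
    qed
  next
    fix k1 k2 assume k: "(0::int) \<le> k1" "(0::int) \<le> k2" and low: "Cat_Cat Pl Ps k1 k2 \<subseteq> \<A>" and up: "\<A> \<subseteq> Shi_Cat Pl Ps (k1 + 1) k2"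
    show ?thesis
    proof (rule tr[OF low[unfolded Cat_Cat_def img] up[unfolded Shi_Cat_def img]])
      fix \<B> assume B: "arrangement \<B>" "hyps Dl (- k1) k1 \<union> hyps Ds (- k2) k2 \<union> {plane 0 0 1} \<subseteq> \<B>"
        "\<B> \<subseteq> hyps Dl (- (k1 + 1) + 1) (k1 + 1) \<union> hyps Ds (- k2) k2 \<union> {plane 0 0 1}"
      then show "freeness_depends_only_on_lattice \<B>" using Cat[OF B(1) k B(2)] by simp
    qed
  qed
qed

lemma one_length:
  fixes X Y :: "real^2"
  assumes D: "X $ 1 * Y $ 2 - X $ 2 * Y $ 1 \<noteq> 0" and P: "P = combos X Y dirs_A2" and A: "arrangement \<A>"
    and cases: "(\<exists>k\<ge>1. Shi P k \<subseteq> \<A> \<and> \<A> \<subseteq> Cat P k) \<or> (\<exists>k\<ge>0. Cat P k \<subseteq> \<A> \<and> \<A> \<subseteq> Shi P (k + 1))"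
  shows "freeness_depends_only_on_lattice \<A>"
proof -
  have img: "root_hyperplanes P l h \<union> {H_infinity} = pull (blk_of X Y) ` (hyps dirs_A2 l h \<union> {plane 0 0 1})" for l h
    unfolding P root_hyperplanes_pull H_infinity_pull[of X Y] image_Un by simp
  note tr = freeness_depends_only_transfer[OF D A]
  from cases show ?thesis
  proof (elim disjE exE conjE)
    fix k assume k: "(1::int) \<le> k" and low: "Shi P k \<subseteq> \<A>" and up: "\<A> \<subseteq> Cat P k"
    show ?thesis
      by (rule tr[OF low[unfolded Shi_def img] up[unfolded Cat_def img]]) (rule A2_Shi[OF _ k])
  next
    fix k assume k: "(0::int) \<le> k" and low: "Cat P k \<subseteq> \<A>" and up: "\<A> \<subseteq> Shi P (k + 1)"
    have "- (k + 1) + 1 = - k" by simp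
    note up' = up[unfolded Shi_def img this]
    show ?thesis
      by (rule tr[OF low[unfolded Cat_def img] up']) (rule A2_Cat[OF _ k])
  qed
qed

context rank_two_base
begin

lemma A2_case:
  assumes c: "c = 1" and A: "arrangement \<A>"
    and cases: "(\<exists>k\<ge>1. Shi (positive_roots \<Phi> {\<alpha>, \<beta>}) k \<subseteq> \<A> \<and> \<A> \<subseteq> Cat (positive_roots \<Phi> {\<alpha>, \<beta>}) k) \<or>
      (\<exists>k\<ge>0. Cat (positive_roots \<Phi> {\<alpha>, \<beta>}) k \<subseteq> \<A> \<and> \<A> \<subseteq> Shi (positive_roots \<Phi> {\<alpha>, \<beta>}) (k + 1))"
  shows "freeness_depends_only_on_lattice \<A>"
proof (rule one_length[OF det_nonzero _ A cases])
  have "positive_roots \<Phi> {\<alpha>, \<beta>} = (\<lambda>(m, n). root m n) ` {(1, 0), (0, 1), (1, 1)}"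
  proof (rule positive_roots_image)
    show "(m, n) \<in> {(1, 0), (0, 1), (1, 1)}" if "root m n \<in> \<Phi>" "0 \<le> m" "0 \<le> n" for m n
      by (rule A2_root_coefficients[of "\<lambda>m n. root m n \<in> \<Phi>", OF _ reflect(2) root_sign root_reduced that])
        (use reflect(1) c in auto)
    have "root 1 1 \<in> \<Phi>" using reflect(2)[OF simple_root(1)] by simp
    then show "root m n \<in> \<Phi> \<and> 0 \<le> m \<and> 0 \<le> n" if "(m, n) \<in> {(1, 0), (0, 1), (1, 1)}" for m n
      using that simple_root by auto
  qed
  then show "positive_roots \<Phi> {\<alpha>, \<beta>} = combos \<alpha> \<beta> dirs_A2"
    by (simp add: combos_def dirs_A2_def root_def)
qed

text \<open>The basis \<alpha>, \<alpha> + \<beta> consists of two short roots, orthogonal in B_2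
  and simple roots of the short A_2 subsystem in G_2. It is the origin of \<open>dirs_ax\<close>,
  \<open>dirs_diag\<close> and \<open>dirs_G2\<close>.\<close>

lemma det_nonzero': "\<alpha> $ 1 * (\<alpha> + \<beta>) $ 2 - \<alpha> $ 2 * (\<alpha> + \<beta>) $ 1 \<noteq> 0"
  using det_nonzero by (simp add: algebra_simps)

lemma combos_root: "combos \<alpha> (\<alpha> + \<beta>) D = (\<lambda>(m, n). root m n) ` (\<lambda>(a, b). (a + b, b)) ` D"
  unfolding combos_def image_image
  by (rule image_cong) (auto simp: root_def algebra_simps)

lemma B2_roots:
  assumes c: "c = 2" and P: "P = positive_roots \<Phi> {\<alpha>, \<beta>}"
  shows "long_roots ip P = combos \<alpha> (\<alpha> + \<beta>) dirs_diag" "short_roots ip P = combos \<alpha> (\<alpha> + \<beta>) dirs_ax"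
proof -
  have "P = (\<lambda>(m, n). root m n) ` ({(0, 1), (2, 1)} \<union> {(1, 0), (1, 1)})" unfolding P
  proof (rule positive_roots_image)
    have "(m, n) \<in> {(1, 0), (0, 1), (1, 1), (2, 1)}" if "root m n \<in> \<Phi>" "0 \<le> m" "0 \<le> n" for m n
      by (rule B2_root_coefficients[of "\<lambda>m n. root m n \<in> \<Phi>", OF _ reflect(2) root_sign root_reduced that])
        (use reflect(1) c in auto)
    then show "(m, n) \<in> {(0, 1), (2, 1)} \<union> {(1, 0), (1, 1)}" if "root m n \<in> \<Phi>" "0 \<le> m" "0 \<le> n" for m n
      using that by blast
    have "root 1 1 \<in> \<Phi>" "root 2 1 \<in> \<Phi>" using reflect(2)[OF simple_root(1)] reflect(1)[OF simple_root(2)] c by simp_all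
    then show "root m n \<in> \<Phi> \<and> 0 \<le> m \<and> 0 \<le> n" if "(m, n) \<in> {(0, 1), (2, 1)} \<union> {(1, 0), (1, 1)}" for m n
      using that simple_root by auto
  qed
  note L = long_short_image[OF this]
  have "long_roots ip P = (\<lambda>(m, n). root m n) ` {(0, 1), (2, 1)}" by (rule L(1)) (use c in auto)
  then show "long_roots ip P = combos \<alpha> (\<alpha> + \<beta>) dirs_diag" unfolding combos_root by (simp add: dirs_diag_def)
  have "short_roots ip P = (\<lambda>(m, n). root m n) ` {(1, 0), (1, 1)}" by (rule L(2)) (use c in auto)
  then show "short_roots ip P = combos \<alpha> (\<alpha> + \<beta>) dirs_ax" unfolding combos_root by (simp add: dirs_ax_def)
qed

lemma G2_roots:
  assumes c: "c = 3" and P: "P = positive_roots \<Phi> {\<alpha>, \<beta>}"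
  shows "long_roots ip P = combos \<alpha> (\<alpha> + \<beta>) dirs_G2" "short_roots ip P = combos \<alpha> (\<alpha> + \<beta>) dirs_A2"
proof -
  have "P = (\<lambda>(m, n). root m n) ` ({(0, 1), (3, 1), (3, 2)} \<union> {(1, 0), (1, 1), (2, 1)})" unfolding P
  proof (rule positive_roots_image)
    have "(m, n) \<in> {(1, 0), (0, 1), (1, 1), (2, 1), (3, 1), (3, 2)}" if "root m n \<in> \<Phi>" "0 \<le> m" "0 \<le> n" for m n
      by (rule G2_root_coefficients[of "\<lambda>m n. root m n \<in> \<Phi>", OF _ reflect(2) root_sign root_reduced that])
        (use reflect(1) c in auto)
    then show "(m, n) \<in> {(0, 1), (3, 1), (3, 2)} \<union> {(1, 0), (1, 1), (2, 1)}" if "root m n \<in> \<Phi>" "0 \<le> m" "0 \<le> n" for m n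
      using that by blast
    have r: "root 1 1 \<in> \<Phi>" "root 3 1 \<in> \<Phi>" using reflect(2)[OF simple_root(1)] reflect(1)[OF simple_root(2)] c by simp_all
    then have "root 2 1 \<in> \<Phi>" "root 3 2 \<in> \<Phi>" using reflect(1)[OF r(1)] reflect(2)[OF r(2)] c by simp_all
    then show "root m n \<in> \<Phi> \<and> 0 \<le> m \<and> 0 \<le> n" if "(m, n) \<in> {(0, 1), (3, 1), (3, 2)} \<union> {(1, 0), (1, 1), (2, 1)}" for m n
      using that simple_root r by auto
  qed
  note L = long_short_image[OF this]
  have "long_roots ip P = (\<lambda>(m, n). root m n) ` {(0, 1), (3, 1), (3, 2)}" by (rule L(1)) (use c in auto)
  then show "long_roots ip P = combos \<alpha> (\<alpha> + \<beta>) dirs_G2" unfolding combos_root by (simp add: dirs_G2_def)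
  have "short_roots ip P = (\<lambda>(m, n). root m n) ` {(1, 0), (1, 1), (2, 1)}" by (rule L(2)) (use c in auto)
  then show "short_roots ip P = combos \<alpha> (\<alpha> + \<beta>) dirs_A2" unfolding combos_root by (simp add: dirs_A2_def)
qed

end

theorem theorem3p3:
  fixes ip :: "real^2 \<Rightarrow> real^2 \<Rightarrow> real"
    and \<Phi> \<Delta> P P\<^sub>l P\<^sub>s :: "(real^2) set"
  assumes "root_system ip \<Phi>"
    and "root_base \<Phi> \<Delta>"
    and "P = positive_roots \<Phi> \<Delta>"
    and "P\<^sub>l = long_roots ip P"
    and "P\<^sub>s = short_roots ip P"
  shows "(type_A2 ip \<Delta> \<longrightarrow>
      (\<forall>\<A>. arrangement \<A> \<and>
        ((\<exists>k\<ge>1. Shi P k \<subseteq> \<A> \<and> \<A> \<subseteq> Cat P k) \<or>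
         (\<exists>k\<ge>0. Cat P k \<subseteq> \<A> \<and> \<A> \<subseteq> Shi P (k + 1)))
        \<longrightarrow> freeness_depends_only_on_lattice \<A>)) \<and>
    (type_B2 ip \<Delta> \<or> type_G2 ip \<Delta> \<longrightarrow>
      (\<forall>\<A>. arrangement \<A> \<and>
        ((\<exists>k1\<ge>1. \<exists>k2\<ge>1. Shi_Shi P\<^sub>l P\<^sub>s k1 k2 \<subseteq> \<A> \<and> \<A> \<subseteq> Cat_Shi P\<^sub>l P\<^sub>s k1 k2) \<or>
         (\<exists>k1\<ge>1. \<exists>k2\<ge>1. Shi_Shi P\<^sub>l P\<^sub>s k1 k2 \<subseteq> \<A> \<and> \<A> \<subseteq> Shi_Cat P\<^sub>l P\<^sub>s k1 k2) \<or>
         (\<exists>k1\<ge>0. \<exists>k2\<ge>0. Cat_Cat P\<^sub>l P\<^sub>s k1 k2 \<subseteq> \<A> \<and> \<A> \<subseteq> Cat_Shi P\<^sub>l P\<^sub>s k1 (k2 + 1)) \<or>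
         (\<exists>k1\<ge>0. \<exists>k2\<ge>0. Cat_Cat P\<^sub>l P\<^sub>s k1 k2 \<subseteq> \<A> \<and> \<A> \<subseteq> Shi_Cat P\<^sub>l P\<^sub>s (k1 + 1) k2))
        \<longrightarrow> freeness_depends_only_on_lattice \<A>))"
proof (intro conjI impI allI)
  fix \<A> assume "type_A2 ip \<Delta>" and A: "arrangement \<A> \<and>
    ((\<exists>k\<ge>1. Shi P k \<subseteq> \<A> \<and> \<A> \<subseteq> Cat P k) \<or> (\<exists>k\<ge>0. Cat P k \<subseteq> \<A> \<and> \<A> \<subseteq> Shi P (k + 1)))"
  then obtain \<alpha> \<beta> where ab: "\<alpha> \<noteq> \<beta>" "\<Delta> = {\<alpha>, \<beta>}" "cartan ip \<alpha> \<beta> = - 1" "cartan ip \<beta> \<alpha> = - 1"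
    unfolding type_A2_def by blast
  interpret rank_two_base ip \<Phi> \<alpha> \<beta> 1
    by unfold_locales (use assms(1,2) ab in simp_all)
  show "freeness_depends_only_on_lattice \<A>"
    by (rule A2_case[OF refl conjunct1[OF A] conjunct2[OF A, unfolded assms(3) ab(2)]])
next
  fix \<A> assume type: "type_B2 ip \<Delta> \<or> type_G2 ip \<Delta>" and A: "arrangement \<A> \<and>
        ((\<exists>k1\<ge>1. \<exists>k2\<ge>1. Shi_Shi P\<^sub>l P\<^sub>s k1 k2 \<subseteq> \<A> \<and> \<A> \<subseteq> Cat_Shi P\<^sub>l P\<^sub>s k1 k2) \<or>
         (\<exists>k1\<ge>1. \<exists>k2\<ge>1. Shi_Shi P\<^sub>l P\<^sub>s k1 k2 \<subseteq> \<A> \<and> \<A> \<subseteq> Shi_Cat P\<^sub>l P\<^sub>s k1 k2) \<or>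
         (\<exists>k1\<ge>0. \<exists>k2\<ge>0. Cat_Cat P\<^sub>l P\<^sub>s k1 k2 \<subseteq> \<A> \<and> \<A> \<subseteq> Cat_Shi P\<^sub>l P\<^sub>s k1 (k2 + 1)) \<or>
         (\<exists>k1\<ge>0. \<exists>k2\<ge>0. Cat_Cat P\<^sub>l P\<^sub>s k1 k2 \<subseteq> \<A> \<and> \<A> \<subseteq> Shi_Cat P\<^sub>l P\<^sub>s (k1 + 1) k2))"
  from type show "freeness_depends_only_on_lattice \<A>"
  proof
    assume "type_B2 ip \<Delta>"
    then obtain \<alpha> \<beta> where ab: "\<alpha> \<noteq> \<beta>" "\<Delta> = {\<alpha>, \<beta>}" "cartan ip \<alpha> \<beta> = - 1" "cartan ip \<beta> \<alpha> = - 2"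
      unfolding type_B2_def by blast
    interpret rank_two_base ip \<Phi> \<alpha> \<beta> 2
      by unfold_locales (use assms(1,2) ab in simp_all)
    note P = B2_roots[OF refl assms(3)[unfolded ab(2)], folded assms(4,5)]
    show ?thesis
      by (rule two_lengths[OF det_nonzero' P B2_Shi B2_Cat conjunct1[OF A] conjunct2[OF A]])
  next
    assume "type_G2 ip \<Delta>"
    then obtain \<alpha> \<beta> where ab: "\<alpha> \<noteq> \<beta>" "\<Delta> = {\<alpha>, \<beta>}" "cartan ip \<alpha> \<beta> = - 1" "cartan ip \<beta> \<alpha> = - 3"
      unfolding type_G2_def by blast
    interpret rank_two_base ip \<Phi> \<alpha> \<beta> 3
      by unfold_locales (use assms(1,2) ab in simp_all)
    note P = G2_roots[OF refl assms(3)[unfolded ab(2)], folded assms(4,5)]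
    show ?thesis
      by (rule two_lengths[OF det_nonzero' P G2_Shi G2_Cat conjunct1[OF A] conjunct2[OF A]])
  qed
qed

end
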